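(* Let $M$ be a simply connected Riemann surface with local complex coordinate $z$. Let a map $G:M\to\mathbb C\cup\{\infty\}$ and a nonconstant conformal map $g:M\to(\mathbb C\cup\{\infty\})\setminus\{|z|=1\}$ be given. (1) When the map $g$ is holomorphic and satisfies $|g|>1$ and $$\frac{G_z}{g_z}>0,\qquad |g|^2|G_{\bar z}|>|G_z|,\qquad G_{z\bar z}+\frac{\bar g_{\bar z}}{(|g|^4-1)\bar g}G_z-\frac{|g|^2\bar g\,g_z}{|g|^4-1}G_{\bar z}=0,\qquad(\ast)$$ put $$x_1=\mathrm{Re}\left\{G-\frac{1+|g|^2}{\bar g g_z}G_z\right\},\quad x_2=\mathrm{Im}\left\{G-\frac{1+|g|^2}{\bar g g_z}G_z\right\},\quad x_3=\frac{1+|g|^2}{|g|^2g_z}G_z.\qquad(\ast\ast)$$ Then $x=(x_1,x_2,x_3):M\to S_1^3$ is a space-like surface with de Sitter Gauss map $G$, holomorphic normal Gauss map $g$, and Gauss curvature $K$ satisfying $\sqrt{1-K}=\frac{1+|g|^2}{|g|^2-1}$; and the conformal structure on $M$ is induced by the negative definite second fundamental form. Conversely, any space-like surface $x:M\to S_1^3$ with $\sqrt{1-K}=\frac{1+|g|^2}{|g|^2-1}\ (=\eta_3)$ can be given by $(\ast\ast)$, and its de Sitter Gauss map $G$ and normal Gauss map $g$ must satisfy $(\ast)$, where the conformal structure on $M$ is induced by the negative definite second fundamental form. (2) When the map $g$ is antiholomorphic without holomorphic points and satisfies $|g|<1$ and $$\frac{G_{\bar z}}{|g|^2g_{\bar z}}>0,\qquad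 \frac{|g|^2|G_z|}{|G_{\bar z}|}<1,\qquad G_{z\bar z}+\frac{\bar g_{z}}{(|g|^4-1)\bar g}G_{\bar z}-\frac{|g|^2\bar g\,g_{\bar z}}{|g|^4-1}G_{z}=0,\qquad(\dagger)$$ put $$x_1=\mathrm{Re}\left\{G-\frac{1+|g|^2}{\bar g g_{\bar z}}G_{\bar z}\right\},\quad x_2=\mathrm{Im}\left\{G-\frac{1+|g|^2}{\bar g g_{\bar z}}G_{\bar z}\right\},\quad x_3=\frac{1+|g|^2}{|g|^2g_{\bar z}}G_{\bar z}.\qquad(\dagger\dagger)$$ Then $x=(x_1,x_2,x_3):M\to S_1^3$ is a space-like surface with de Sitter Gauss map $G$, antiholomorphic normal Gauss map $g$, and Gauss curvature $K$ satisfying $\sqrt{1-K}=\frac{1+|g|^2}{1-|g|^2}$; and the conformal structure on $M$ is induced by the negative definite second fundamental form. Conversely, any space-like surface $x:M\to S_1^3$ with $\sqrt{1-K}=\frac{1+|g|^2}{1-|g|^2}\ (=-\eta_3)$ can be given by $(\dagger\dagger)$, and its de Sitter Gauss map $G$ and normal Gauss map $g$ must satisfy $(\dagger)$, where the conformal structure on $M$ is induced by the negative definite second fundamental form.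
   Context: $S_1^3$ is the upper half-space model of de Sitter 3-space: $\{(x_1,x_2,x_3):x_3>0\}$ with the Lorentz metric $\frac1{x_3^2}(dx_1^2+dx_2^2-dx_3^2)$. All maps are smooth. Subscripts $z,\bar z$ denote the Wirtinger derivatives; $\bar g_{\bar z}$ and $\bar g_z$ are the derivatives of $\bar g$. "Without holomorphic points" for an antiholomorphic $g$ means $g_{\bar z}\ne0$ everywhere. Inequalities such as $\frac{G_z}{g_z}>0$ mean that the quantity is real and positive. For a space-like immersed surface $x:M\to S_1^3$, write the time-like unit normal as $N=\sum_{A=1}^3x_3\eta_A\frac{\partial}{\partial x_A}$ with $\eta_1^2+\eta_2^2-\eta_3^2=-1$. The second fundamental form $\mathrm{II}$ is defined by $D_XY=\nabla_XY+\mathrm{II}(X,Y)N$ ($D$ ambient, $\nabla$ induced Levi-Civita connection); when it is definite it induces a conformal structure on $M$. $K$ is the Gauss curvature of the induced metric. Normal Gauss map: $g=\frac{\eta_1+i\eta_2}{1-\eta_3}:M\to(\mathbb C\cup\{\infty\})\setminus\{|z|=1\}$, i.e. the composition of $(\eta_1,\eta_2,\eta_3):M\to H^2(-1)=\{\eta_1^2+\eta_2^2-\eta_3^2=-1\}$ with stereographic projection from $(0,0,1)$; equivalently $(\eta_1,\eta_2,\eta_3)=\left(-\frac{g+\bar g}{|g|^2-1},\frac{i(g-\bar g)}{|g|^2-1},\frac{1+|g|^2}{|g|^2-1}\right)$. De Sitter Gauss map: it assigns to a point of the surface the final point, in $\{(x_1,x_2,0)\}\cup\{\infty\}\cong\mathbb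 C\cup\{\infty\}$ (with $(x_1,x_2,0)\leftrightarrow x_1+ix_2$), of the oriented time-like geodesic of $S_1^3$ through that point with tangent vector $N$; it is given by $G=x_1+ix_2+x_3g$. In the converse parts, $g$, $G$, $\eta_3$ and $K$ are the normal Gauss map, the de Sitter Gauss map, the third normal component and the Gauss curvature of the given surface.
   Formalization: Where the formulas are undefined (poles of g, zeros of g_z; in (2) zeros of g), the positive quotient, the inequality (as |G_z̄|>|G_z|/|g|² at poles) and x are read by smooth or continuous extension; M is oriented so that (x_u,x_v,N) is positive. *)

theory Defs
  imports "HOL-Analysis.Analysis"
begin

section \<open>Smoothness and Wirtinger derivatives\<close>

definition dderiv :: "'a::real_normed_vector \<Rightarrow> ('a \<Rightarrow> 'b::real_normed_vector) \<Rightarrow> 'a \<Rightarrow> 'b" where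
  "dderiv v f p = frechet_derivative f (at p) v"

text \<open>For open \<open>S\<close>, \<open>Ck_on k S f\<close> says that \<open>f\<close> is \<open>k\<close> times continuously differentiable on \<open>S\<close>.\<close>

primrec Ck_on :: "nat \<Rightarrow> 'a::euclidean_space set \<Rightarrow> ('a \<Rightarrow> 'b::real_normed_vector) \<Rightarrow> bool" where
  "Ck_on 0 S f \<longleftrightarrow> continuous_on S f"
| "Ck_on (Suc k) S f \<longleftrightarrow>
     (\<forall>p\<in>S. f differentiable (at p)) \<and> (\<forall>v. Ck_on k S (dderiv v f))"

definition smooth_on :: "'a::euclidean_space set \<Rightarrow> ('a \<Rightarrow> 'b::real_normed_vector) \<Rightarrow> bool" where
  "smooth_on S f \<longleftrightarrow> (\<forall>k. Ck_on k S f)"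

definition dz :: "(complex \<Rightarrow> complex) \<Rightarrow> complex \<Rightarrow> complex" where
  "dz f w = (dderiv 1 f w - \<i> * dderiv \<i> f w) / 2"

definition dzbar :: "(complex \<Rightarrow> complex) \<Rightarrow> complex \<Rightarrow> complex" where
  "dzbar f w = (dderiv 1 f w + \<i> * dderiv \<i> f w) / 2"

section \<open>Riemann surfaces and maps into the Riemann sphere\<close>

text \<open>A chart is a pair of its domain and its coordinate function. Second countability is not
  required: it is automatic for connected Riemann surfaces (Rado).\<close>

type_synonym 'a chart = "'a set \<times> ('a \<Rightarrow> complex)"

definition chart_image :: "'a chart \<Rightarrow> complex set" where
  "chart_image c = snd c ` fst c"

definition chart_inv :: "'a chart \<Rightarrow> complex \<Rightarrow> 'a" where
  "chart_inv c = inv_into (fst c) (snd c)"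

definition in_chart :: "'a chart \<Rightarrow> ('a \<Rightarrow> 'b) \<Rightarrow> complex \<Rightarrow> 'b" where
  "in_chart c f = f \<circ> chart_inv c"

definition riemann_surface :: "'a::t2_space set \<Rightarrow> 'a chart set \<Rightarrow> bool" where
  "riemann_surface M A \<longleftrightarrow>
     M \<noteq> {} \<and> connected M \<and> (\<Union>c\<in>A. fst c) = M \<and>
     (\<forall>c\<in>A. openin (top_of_set M) (fst c) \<and> open (chart_image c) \<and>
        homeomorphism (fst c) (chart_image c) (snd c) (chart_inv c)) \<and>
     (\<forall>c\<in>A. \<forall>d\<in>A. (snd d \<circ> chart_inv c) holomorphic_on snd c ` (fst c \<inter> fst d))"

definition smooth_map :: "'a chart set \<Rightarrow> ('a \<Rightarrow> 'b::real_normed_vector) \<Rightarrow> bool" where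
  "smooth_map A f \<longleftrightarrow> (\<forall>c\<in>A. smooth_on (chart_image c) (in_chart c f))"

text \<open>Points of the Riemann sphere are elements of \<^typ>\<open>complex option\<close>, with \<^term>\<open>None\<close> as the
  point at infinity and with the topology of the one-point compactification. The two standard
  charts of the sphere are \<open>finite_val\<close>, away from infinity, and \<open>recip_val\<close>, away from 0.\<close>

definition finite_val :: "complex option \<Rightarrow> complex" where
  "finite_val w = (case w of None \<Rightarrow> 0 | Some c \<Rightarrow> c)"

definition recip_val :: "complex option \<Rightarrow> complex" where
  "recip_val w = (case w of None \<Rightarrow> 0 | Some c \<Rightarrow> inverse c)"

definition continuous_sphere_map :: "'a::t2_space set \<Rightarrow> ('a \<Rightarrow> complex option) \<Rightarrow> bool" where
  "continuous_sphere_map M f \<longleftrightarrow>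
     continuous_map (top_of_set M) (Alexandroff_compactification euclidean) f"

definition smooth_sphere_map :: "'a::t2_space set \<Rightarrow> 'a chart set \<Rightarrow> ('a \<Rightarrow> complex option) \<Rightarrow> bool" where
  "smooth_sphere_map M A f \<longleftrightarrow> continuous_sphere_map M f \<and>
     (\<forall>c\<in>A. smooth_on {w \<in> chart_image c. in_chart c f w \<noteq> None} (finite_val \<circ> in_chart c f) \<and>
            smooth_on {w \<in> chart_image c. in_chart c f w \<noteq> Some 0} (recip_val \<circ> in_chart c f))"

definition holomorphic_sphere_map :: "'a::t2_space set \<Rightarrow> 'a chart set \<Rightarrow> ('a \<Rightarrow> complex option) \<Rightarrow> bool" where
  "holomorphic_sphere_map M A f \<longleftrightarrow> continuous_sphere_map M f \<and>
     (\<forall>c\<in>A. (finite_val \<circ> in_chart c f) holomorphic_on {w \<in> chart_image c. in_chart c f w \<noteq> None} \<and>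
            (recip_val \<circ> in_chart c f) holomorphic_on {w \<in> chart_image c. in_chart c f w \<noteq> Some 0})"

definition antiholomorphic_sphere_map :: "'a::t2_space set \<Rightarrow> 'a chart set \<Rightarrow> ('a \<Rightarrow> complex option) \<Rightarrow> bool" where
  "antiholomorphic_sphere_map M A f \<longleftrightarrow> holomorphic_sphere_map M A (map_option cnj \<circ> f)"

section \<open>Metrics, Levi-Civita connection, curvature\<close>

text \<open>A (pseudo-)metric on an open subset of a Euclidean space is a function \<open>h\<close> giving a bilinear
  form \<open>h p\<close> at each point \<open>p\<close>. For constant vector fields \<open>X\<close>, \<open>Y\<close>, the covariant derivative of
  \<open>Y\<close> along \<open>X\<close> is determined by the Koszul formula (all Lie brackets vanish).\<close>

definition christoffel ::
    "('a::euclidean_space \<Rightarrow> 'a \<Rightarrow> 'a \<Rightarrow> real) \<Rightarrow> 'a \<Rightarrow> 'a \<Rightarrow> 'a \<Rightarrow> 'a" where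
  "christoffel h p X Y = (THE V. \<forall>Z. h p V Z =
     (dderiv X (\<lambda>q. h q Y Z) p + dderiv Y (\<lambda>q. h q X Z) p - dderiv Z (\<lambda>q. h q X Y) p) / 2)"

definition curvature_tensor ::
    "('a::euclidean_space \<Rightarrow> 'a \<Rightarrow> 'a \<Rightarrow> real) \<Rightarrow> 'a \<Rightarrow> 'a \<Rightarrow> 'a \<Rightarrow> 'a \<Rightarrow> 'a" where
  "curvature_tensor h p X Y Z =
     dderiv X (\<lambda>q. christoffel h q Y Z) p + christoffel h p X (christoffel h p Y Z)
   - dderiv Y (\<lambda>q. christoffel h q X Z) p - christoffel h p Y (christoffel h p X Z)"

definition gauss_curvature :: "(complex \<Rightarrow> complex \<Rightarrow> complex \<Rightarrow> real) \<Rightarrow> complex \<Rightarrow> real" where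
  "gauss_curvature h p =
     h p (curvature_tensor h p 1 \<i> \<i>) 1 / (h p 1 1 * h p \<i> \<i> - (h p 1 \<i>)\<^sup>2)"

section \<open>Surfaces in the upper half-space model of de Sitter 3-space\<close>

definition dS_metric :: "real^3 \<Rightarrow> real^3 \<Rightarrow> real^3 \<Rightarrow> real" where
  "dS_metric p X Y = (X$1 * Y$1 + X$2 * Y$2 - X$3 * Y$3) / (p$3)\<^sup>2"

text \<open>The next definitions concern a parametrised surface \<open>x\<close>, i.e. a surface read in a chart,
  at the parameter \<open>w\<close>; \<open>Y\<close> and \<open>N\<close> are vector fields along \<open>x\<close>.\<close>

definition induced_metric :: "(complex \<Rightarrow> real^3) \<Rightarrow> complex \<Rightarrow> complex \<Rightarrow> complex \<Rightarrow> real" where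
  "induced_metric x w X Y = dS_metric (x w) (dderiv X x w) (dderiv Y x w)"

definition ambient_covderiv ::
    "(complex \<Rightarrow> real^3) \<Rightarrow> complex \<Rightarrow> complex \<Rightarrow> (complex \<Rightarrow> real^3) \<Rightarrow> real^3" where
  "ambient_covderiv x w X Y = dderiv X Y w + christoffel dS_metric (x w) (dderiv X x w) (Y w)"

text \<open>\<open>D\<^sub>X Y = \<nabla>\<^sub>X Y + II(X,Y) N\<close> for the coordinate fields with constant components \<open>X\<close>, \<open>Y\<close>.\<close>

definition second_form ::
    "(complex \<Rightarrow> real^3) \<Rightarrow> (complex \<Rightarrow> real^3) \<Rightarrow> complex \<Rightarrow> complex \<Rightarrow> complex \<Rightarrow> real" where
  "second_form x N w X Y = (THE r. ambient_covderiv x w X (dderiv Y x) =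
     dderiv (christoffel (induced_metric x) w X Y) x w + r *\<^sub>R N w)"

definition spacelike_surface :: "'a set \<Rightarrow> 'a chart set \<Rightarrow> ('a \<Rightarrow> real^3) \<Rightarrow> bool" where
  "spacelike_surface M A x \<longleftrightarrow> smooth_map A x \<and> (\<forall>p\<in>M. x p $ 3 > 0) \<and>
     (\<forall>c\<in>A. \<forall>w\<in>chart_image c. \<forall>v. v \<noteq> 0 \<longrightarrow> induced_metric (in_chart c x) w v v > 0)"

text \<open>\<open>\<eta>\<close> are the components of the normal in the frame \<open>x\<^sub>3 \<partial>/\<partial>x\<^sub>A\<close>.\<close>

definition normal_field :: "('a \<Rightarrow> real^3) \<Rightarrow> ('a \<Rightarrow> real^3) \<Rightarrow> 'a \<Rightarrow> real^3" where
  "normal_field x \<eta> p = (x p $ 3) *\<^sub>R \<eta> p"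

definition timelike_unit_normal ::
    "'a set \<Rightarrow> 'a chart set \<Rightarrow> ('a \<Rightarrow> real^3) \<Rightarrow> ('a \<Rightarrow> real^3) \<Rightarrow> bool" where
  "timelike_unit_normal M A x \<eta> \<longleftrightarrow> smooth_map A \<eta> \<and>
     (\<forall>p\<in>M. (\<eta> p $ 1)\<^sup>2 + (\<eta> p $ 2)\<^sup>2 - (\<eta> p $ 3)\<^sup>2 = -1) \<and>
     (\<forall>c\<in>A. \<forall>w\<in>chart_image c. \<forall>v.
        dS_metric (in_chart c x w) (dderiv v (in_chart c x) w) (in_chart c (normal_field x \<eta>) w) = 0)"

text \<open>The complex structure of the atlas is the one induced by the negative definite form II:
  charts are isothermal for II, and the orientation is the one for which
  \<open>(x\<^sub>u, x\<^sub>v, N)\<close> is positively oriented (\<open>u + iv\<close> the coordinate). A conformal class alone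
  determines a complex structure only up to conjugation.\<close>

definition structure_induced_by_neg_II ::
    "'a chart set \<Rightarrow> ('a \<Rightarrow> real^3) \<Rightarrow> ('a \<Rightarrow> real^3) \<Rightarrow> bool" where
  "structure_induced_by_neg_II A x \<eta> \<longleftrightarrow>
     (\<forall>c\<in>A. \<forall>w\<in>chart_image c.
        let X = in_chart c x; N = in_chart c (normal_field x \<eta>); II = second_form X N w in
          (\<forall>v. v \<noteq> 0 \<longrightarrow> II v v < 0) \<and>
          II 1 1 = II \<i> \<i> \<and> II 1 \<i> = 0 \<and> II \<i> 1 = 0 \<and>
          det (vector [dderiv 1 X w, dderiv \<i> X w, N w] :: real^3^3) > 0)"

subsection \<open>The two Gauss maps\<close>

definition stereographic :: "real^3 \<Rightarrow> complex option" where
  "stereographic e = (if e$3 = 1 then None else Some (Complex (e$1) (e$2) / of_real (1 - e$3)))"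

text \<open>The third component of the inverse of the stereographic projection.\<close>

definition stereographic_height :: "complex option \<Rightarrow> real" where
  "stereographic_height w =
     (case w of None \<Rightarrow> 1 | Some c \<Rightarrow> (1 + (cmod c)\<^sup>2) / ((cmod c)\<^sup>2 - 1))"

text \<open>A time-like geodesic starting upwards leaves the half-space through \<open>x\<^sub>3 = \<infinity>\<close> in finite
  proper time, and its final point is only reached in the other half of de Sitter space. Geodesics
  are therefore taken in the full de Sitter space, the hyperquadric \<open>\<langle>X,X\<rangle> = 1\<close> of Minkowski
  4-space with time coordinate \<open>X\<^sub>4\<close>; the half-space is isometric to its part
  \<open>X\<^sub>3 + X\<^sub>4 > 0\<close> by \<open>dS_embed\<close>. The half-space coordinates \<open>half_space_coords\<close> extend to
  \<open>X\<^sub>3 + X\<^sub>4 \<noteq> 0\<close>.\<close>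

definition minkowski4 :: "real^4 \<Rightarrow> real^4 \<Rightarrow> real" where
  "minkowski4 X Y = X$1 * Y$1 + X$2 * Y$2 + X$3 * Y$3 - X$4 * Y$4"

definition dS_embed :: "real^3 \<Rightarrow> real^4" where
  "dS_embed p = (let q = (p$1)\<^sup>2 + (p$2)\<^sup>2 - (p$3)\<^sup>2 in
     vector [p$1 / p$3, p$2 / p$3, (1 - q) / (2 * p$3), (1 + q) / (2 * p$3)])"

definition half_space_coords :: "real^4 \<Rightarrow> real^3" where
  "half_space_coords X = vector [X$1 / (X$3 + X$4), X$2 / (X$3 + X$4), 1 / (X$3 + X$4)]"

text \<open>A curve in the hyperquadric is a geodesic iff its acceleration is normal to the hyperquadric,
  i.e. a multiple of the position vector.\<close>

definition dS_geodesic :: "(real \<Rightarrow> real^4) \<Rightarrow> (real \<Rightarrow> real^4) \<Rightarrow> bool" where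
  "dS_geodesic \<gamma> \<beta> \<longleftrightarrow> (\<forall>t. minkowski4 (\<gamma> t) (\<gamma> t) = 1 \<and>
     (\<gamma> has_vector_derivative \<beta> t) (at t) \<and>
     (\<exists>k. (\<beta> has_vector_derivative k *\<^sub>R \<gamma> t) (at t)))"

text \<open>The ideal boundary is \<open>{(x\<^sub>1,x\<^sub>2,0)} \<union> {\<infinity>}\<close>, inside the one-point compactification
  of \<open>\<real>\<^sup>3\<close>.\<close>

definition is_final_point :: "real^3 \<Rightarrow> real^3 \<Rightarrow> complex option \<Rightarrow> bool" where
  "is_final_point p N P \<longleftrightarrow> (\<exists>\<gamma> \<beta>. dS_geodesic \<gamma> \<beta> \<and>
     \<gamma> 0 = dS_embed p \<and> \<beta> 0 = dderiv N dS_embed p \<and>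
     limitin (Alexandroff_compactification euclidean) (\<lambda>t. Some (half_space_coords (\<gamma> t)))
       (map_option (\<lambda>c. vector [Re c, Im c, 0]) P) at_top)"

definition final_point :: "real^3 \<Rightarrow> real^3 \<Rightarrow> complex option" where
  "final_point p N = (THE P. is_final_point p N P)"

definition normal_gauss_map :: "('a \<Rightarrow> real^3) \<Rightarrow> 'a \<Rightarrow> complex option" where
  "normal_gauss_map \<eta> p = stereographic (\<eta> p)"

definition dS_gauss_map :: "('a \<Rightarrow> real^3) \<Rightarrow> ('a \<Rightarrow> real^3) \<Rightarrow> 'a \<Rightarrow> complex option" where
  "dS_gauss_map x \<eta> p = final_point (x p) (normal_field x \<eta> p)"

text \<open>The lemmas up to \<open>final_point_formula\<close> establish
  \<open>G = x\<^sub>1 + i x\<^sub>2 + x\<^sub>3 g\<close> (with \<open>G = \<infinity>\<close> where \<open>g = \<infinity>\<close>).\<close>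

lemma minkowski4_has_derivative:
  assumes "(f has_vector_derivative f') (at t)" "(g has_vector_derivative g') (at t)"
  shows "((\<lambda>t. minkowski4 (f t) (g t)) has_real_derivative minkowski4 f' (g t) + minkowski4 (f t) g') (at t)"
proof -
  have nth: "((\<lambda>t. h t $ i) has_real_derivative h' $ i) (at t)" if "(h has_vector_derivative h') (at t)" for h::"real\<Rightarrow>real^4" and h' i
    using bounded_linear.has_vector_derivative[OF bounded_linear_vec_nth that] 
    by (simp add: has_real_derivative_iff_has_vector_derivative)
  note [derivative_intros] = nth[OF assms(1)] nth[OF assms(2)]
  show ?thesis unfolding minkowski4_def
    by (auto intro!: derivative_eq_intros simp: algebra_simps)
qed

lemma dS_geodesic_eq:
  assumes "dS_geodesic \<gamma> \<beta>" "minkowski4 (\<beta> 0) (\<beta> 0) = -1"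
  shows "\<gamma> t = cosh t *\<^sub>R \<gamma> 0 + sinh t *\<^sub>R \<beta> 0"
proof -
  from assms(1) obtain k where g: "\<And>t. minkowski4 (\<gamma> t) (\<gamma> t) = 1"
    "\<And>t. (\<gamma> has_vector_derivative \<beta> t) (at t)"
    "\<And>t. (\<beta> has_vector_derivative k t *\<^sub>R \<gamma> t) (at t)"
    unfolding dS_geodesic_def by metis
  have sym: "minkowski4 X Y = minkowski4 Y X" for X Y by (simp add: minkowski4_def)
  have sc: "minkowski4 (r *\<^sub>R X) Y = r * minkowski4 X Y" for r X Y by (simp add: minkowski4_def algebra_simps)
  have gb: "minkowski4 (\<gamma> t) (\<beta> t) = 0" for t
  proof -
    have "((\<lambda>t. minkowski4 (\<gamma> t) (\<gamma> t)) has_real_derivative minkowski4 (\<beta> t) (\<gamma> t) + minkowski4 (\<gamma> t) (\<beta> t)) (at t)"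
      by (intro minkowski4_has_derivative g)
    moreover have "((\<lambda>t. minkowski4 (\<gamma> t) (\<gamma> t)) has_real_derivative 0) (at t)"
      unfolding g(1) by simp
    ultimately show ?thesis using DERIV_unique sym by (metis add_cancel_right_right double_zero)
  qed
  have k: "k t = - minkowski4 (\<beta> t) (\<beta> t)" for t
  proof -
    have "((\<lambda>t. minkowski4 (\<gamma> t) (\<beta> t)) has_real_derivative minkowski4 (\<beta> t) (\<beta> t) + minkowski4 (\<gamma> t) (k t *\<^sub>R \<gamma> t)) (at t)"
      by (intro minkowski4_has_derivative g)
    moreover have "((\<lambda>t. minkowski4 (\<gamma> t) (\<beta> t)) has_real_derivative 0) (at t)"
      unfolding gb by simp
    ultimately have "minkowski4 (\<beta> t) (\<beta> t) + minkowski4 (\<gamma> t) (k t *\<^sub>R \<gamma> t) = 0" using DERIV_unique by blast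
    then show ?thesis using sc[of "k t" "\<gamma> t" "\<gamma> t"] g(1)[of t] sym[of "\<gamma> t" "k t *\<^sub>R \<gamma> t"] by simp
  qed
  have "((\<lambda>t. minkowski4 (\<beta> t) (\<beta> t)) has_real_derivative 0) (at t)" for t
  proof -
    have "((\<lambda>t. minkowski4 (\<beta> t) (\<beta> t)) has_real_derivative minkowski4 (k t *\<^sub>R \<gamma> t) (\<beta> t) + minkowski4 (\<beta> t) (k t *\<^sub>R \<gamma> t)) (at t)"
      by (intro minkowski4_has_derivative g)
    then show ?thesis using sc gb sym by simp
  qed
  then have "minkowski4 (\<beta> t) (\<beta> t) = minkowski4 (\<beta> 0) (\<beta> 0)" for t
    using DERIV_isconst_all[of "\<lambda>t. minkowski4 (\<beta> t) (\<beta> t)"] by blast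
  then have b: "(\<beta> has_vector_derivative \<gamma> t) (at t)" for t
    using g(3)[of t] k[of t] assms(2) by simp
  have cc: "exp (- (s * t)) *\<^sub>R (\<gamma> t + s *\<^sub>R \<beta> t) = \<gamma> 0 + s *\<^sub>R \<beta> 0" if "s * s = 1" for s t :: real
  proof -
    have "((\<lambda>t. exp (- (s * t)) *\<^sub>R (\<gamma> t + s *\<^sub>R \<beta> t)) has_vector_derivative 0) (at t)" for t
      using that by (auto intro!: derivative_eq_intros g(2) b simp: algebra_simps)
    then obtain C where "\<And>t. exp (- (s * t)) *\<^sub>R (\<gamma> t + s *\<^sub>R \<beta> t) = C"
      using has_vector_derivative_zero_constant[of UNIV "\<lambda>t. exp (- (s * t)) *\<^sub>R (\<gamma> t + s *\<^sub>R \<beta> t)"] by auto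
    from this[of t] this[of 0] show ?thesis by simp
  qed
  have 1: "\<gamma> t + \<beta> t = exp t *\<^sub>R (\<gamma> 0 + \<beta> 0)"
    using cc[of 1 t, symmetric] by (simp flip: scaleR_add_right add: exp_minus)
  have 2: "\<gamma> t - \<beta> t = exp (-t) *\<^sub>R (\<gamma> 0 - \<beta> 0)"
    using cc[of "-1" t, symmetric] by (simp flip: scaleR_diff_right add: exp_minus)
  have "2 *\<^sub>R \<gamma> t = (\<gamma> t + \<beta> t) + (\<gamma> t - \<beta> t)" by (simp add: scaleR_2)
  also have "\<dots> = 2 *\<^sub>R (cosh t *\<^sub>R \<gamma> 0 + sinh t *\<^sub>R \<beta> 0)"
  proof -
    have "2 * cosh t = exp t + exp (-t)" "2 * sinh t = exp t - exp (-t)"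
      by (simp_all add: cosh_def sinh_def)
    then show ?thesis unfolding 1 2 scaleR_add_right scaleR_diff_right scaleR_scaleR
      by (simp only:) (simp only: scaleR_add_left scaleR_diff_left, simp)
  qed
  finally show ?thesis by simp
qed

lemma vector_4_nth: "(vector [a,b,c,d] :: real^4)$1 = a" "(vector [a,b,c,d] :: real^4)$2 = b"
  "(vector [a,b,c,d] :: real^4)$3 = c" "(vector [a,b,c,d] :: real^4)$4 = d"
  by (simp_all add: vector_def)

lemma dS_embed_derivative:
  assumes "p$3 \<noteq> 0"
  shows "dderiv h dS_embed p = vector [h$1/p$3 - p$1*h$3/(p$3)^2, h$2/p$3 - p$2*h$3/(p$3)^2,
   - (1 - ((p$1)^2+(p$2)^2-(p$3)^2)) * h$3/(2*(p$3)^2) - (p$1*h$1+p$2*h$2-p$3*h$3)/p$3,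
   - (1 + ((p$1)^2+(p$2)^2-(p$3)^2)) * h$3/(2*(p$3)^2) + (p$1*h$1+p$2*h$2-p$3*h$3)/p$3]"
proof -
  have nth: "((\<lambda>x. x $ i) has_derivative (\<lambda>h. h $ i)) F" for i::3 and F :: "(real^3) filter"
    by (rule bounded_linear_imp_has_derivative) (rule bounded_linear_vec_nth)
  have a2: "2 * p$3 \<noteq> 0" using assms by simp
  note di = has_derivative_divide has_derivative_add has_derivative_diff has_derivative_power
    has_derivative_const has_derivative_mult nth assms a2
  let ?D = "\<lambda>h. vector [h$1/p$3 - p$1*h$3/(p$3)^2, h$2/p$3 - p$2*h$3/(p$3)^2,
   - (1 - ((p$1)^2+(p$2)^2-(p$3)^2)) * h$3/(2*(p$3)^2) - (p$1*h$1+p$2*h$2-p$3*h$3)/p$3,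
   - (1 + ((p$1)^2+(p$2)^2-(p$3)^2)) * h$3/(2*(p$3)^2) + (p$1*h$1+p$2*h$2-p$3*h$3)/p$3] :: real^4"
  have c12: "((\<lambda>x. x$i / x$3) has_derivative (\<lambda>h. h$i/p$3 - p$i*h$3/(p$3)^2)) (at p)" for i
    by (rule has_derivative_eq_rhs, (rule di)+)
       (use assms in \<open>simp add: fun_eq_iff field_simps power2_eq_square\<close>)
  have c3: "((\<lambda>x. (1 - ((x$1)\<^sup>2 + (x$2)\<^sup>2 - (x$3)\<^sup>2)) / (2 * x$3)) has_derivative
     (\<lambda>h. - (1 - ((p$1)^2+(p$2)^2-(p$3)^2)) * h$3/(2*(p$3)^2) - (p$1*h$1+p$2*h$2-p$3*h$3)/p$3)) (at p)"
    by (rule has_derivative_eq_rhs, (rule di)+)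
       (use assms in \<open>simp add: fun_eq_iff field_simps power2_eq_square\<close>)
  have c4: "((\<lambda>x. (1 + ((x$1)\<^sup>2 + (x$2)\<^sup>2 - (x$3)\<^sup>2)) / (2 * x$3)) has_derivative
     (\<lambda>h. - (1 + ((p$1)^2+(p$2)^2-(p$3)^2)) * h$3/(2*(p$3)^2) + (p$1*h$1+p$2*h$2-p$3*h$3)/p$3)) (at p)"
    by (rule has_derivative_eq_rhs, (rule di)+)
       (use assms in \<open>simp add: fun_eq_iff field_simps power2_eq_square\<close>)
  have "((\<lambda>x. dS_embed x $ i) has_derivative (\<lambda>h. ?D h $ i)) (at p)" for i
    using exhaust_4[of i] c12[of 1] c12[of 2] c3 c4
    by (elim disjE) (simp_all only: dS_embed_def Let_def vector_4_nth)
  then have "(dS_embed has_derivative ?D) (at p)"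
    unfolding has_derivative_componentwise_within[of dS_embed] Basis_vec_def
    by (auto simp: inner_axis)
  then show ?thesis by (simp add: dderiv_def frechet_derivative_at[symmetric])
qed

lemma is_final_point_formula:
  fixes p e :: "real^3"
  assumes p: "p$3 > 0" and e: "(e$1)\<^sup>2 + (e$2)\<^sup>2 - (e$3)\<^sup>2 = -1"
  defines "Q \<equiv> map_option (\<lambda>g. Complex (p$1) (p$2) + of_real (p$3) * g) (stereographic e)"
  shows "is_final_point p (p$3 *\<^sub>R e) R \<longleftrightarrow> R = Q"
proof -
  define P where "P = dS_embed p"
  define V where "V = dderiv (p$3 *\<^sub>R e) dS_embed p"
  define c where "c t = cosh t *\<^sub>R P + sinh t *\<^sub>R V" for t :: real
  define b where "b t = sinh t *\<^sub>R P + cosh t *\<^sub>R V" for t :: real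
  let ?A = "Alexandroff_compactification (euclidean :: (real^3) topology)"
  let ?emb = "map_option (\<lambda>c. vector [Re c, Im c, 0] :: real^3)"
  have V: "V = vector [e$1 - p$1*e$3/p$3, e$2 - p$2*e$3/p$3,
     - (1 - ((p$1)^2+(p$2)^2-(p$3)^2)) * e$3/(2*p$3) - (p$1*e$1+p$2*e$2-p$3*e$3),
     - (1 + ((p$1)^2+(p$2)^2-(p$3)^2)) * e$3/(2*p$3) + (p$1*e$1+p$2*e$2-p$3*e$3)]"
    unfolding V_def using p
    by (subst dS_embed_derivative) (auto simp: vec_eq_iff forall_4 vector_4_nth field_simps power2_eq_square)
  have PP: "minkowski4 P P = 1"
    using p unfolding minkowski4_def P_def dS_embed_def Let_def vector_4_nth
    by (simp add: field_simps power2_eq_square)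
  have PV: "minkowski4 P V = 0"
    using p unfolding minkowski4_def P_def V dS_embed_def Let_def vector_4_nth
    by (simp add: field_simps power2_eq_square)
  have e3: "(e$3)\<^sup>2 = (e$1)\<^sup>2 + (e$2)\<^sup>2 + 1" using e by simp
  have VV: "minkowski4 V V = -1"
  proof -
    have "minkowski4 V V = (e$1)\<^sup>2 + (e$2)\<^sup>2 - (e$3)\<^sup>2"
      using p unfolding minkowski4_def V vector_4_nth
      by (simp add: field_simps power2_eq_square)
    then show ?thesis using e by simp
  qed
  have bil: "minkowski4 (r *\<^sub>R X + s *\<^sub>R Y) (r *\<^sub>R X + s *\<^sub>R Y) =
      r\<^sup>2 * minkowski4 X X + 2 * r * s * minkowski4 X Y + s\<^sup>2 * minkowski4 Y Y" for r s X Y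
    by (simp add: minkowski4_def algebra_simps power2_eq_square)
  have geo: "dS_geodesic c b"
    unfolding dS_geodesic_def
  proof (intro allI conjI)
    fix t
    show "minkowski4 (c t) (c t) = 1"
      unfolding c_def bil PP PV VV using cosh_square_eq[of t] by simp
    show "(c has_vector_derivative b t) (at t)"
      unfolding c_def b_def by (auto intro!: derivative_eq_intros simp: has_real_derivative_iff_has_vector_derivative[symmetric])
    have "(b has_vector_derivative 1 *\<^sub>R c t) (at t)"
      unfolding c_def b_def by (auto intro!: derivative_eq_intros simp: has_real_derivative_iff_has_vector_derivative[symmetric])
    then show "\<exists>k. (b has_vector_derivative k *\<^sub>R c t) (at t)" by blast
  qed
  have lim: "limitin ?A (\<lambda>t. Some (half_space_coords (c t))) (?emb Q) at_top"
  proof -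
    have l: "c t $ 3 + c t $ 4 = (cosh t - e$3 * sinh t) / p$3" for t
      using p unfolding c_def P_def V dS_embed_def Let_def
      by (simp add: vector_4_nth field_simps power2_eq_square)
    have c1: "c t $ 1 = (cosh t * p$1 + sinh t * (p$3 * e$1 - p$1 * e$3)) / p$3" for t
      using p unfolding c_def P_def V dS_embed_def Let_def
      by (simp add: vector_4_nth field_simps)
    have c2: "c t $ 2 = (cosh t * p$2 + sinh t * (p$3 * e$2 - p$2 * e$3)) / p$3" for t
      using p unfolding c_def P_def V dS_embed_def Let_def
      by (simp add: vector_4_nth field_simps)
    have H: "half_space_coords (c t) = vector [
       (cosh t * p$1 + sinh t * (p$3 * e$1 - p$1 * e$3)) / (cosh t - e$3 * sinh t),
       (cosh t * p$2 + sinh t * (p$3 * e$2 - p$2 * e$3)) / (cosh t - e$3 * sinh t),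
       p$3 / (cosh t - e$3 * sinh t)]" for t
      using p unfolding half_space_coords_def l c1 c2 by simp
    show ?thesis
    proof (cases "e$3 = 1")
      case True
      then have Q: "?emb Q = None" by (simp add: Q_def stereographic_def)
      have "filterlim (\<lambda>t. p$3 * exp t) at_top at_top"
        using p by (intro filterlim_tendsto_pos_mult_at_top[OF tendsto_const] exp_at_top)
      have ev: "eventually (\<lambda>t. half_space_coords (c t) \<notin> K) at_top" if cK: "compact K" for K
      proof -
        obtain B where B: "\<And>y. y \<in> K \<Longrightarrow> norm y \<le> B"
          using compact_imp_bounded[OF cK] by (auto simp: bounded_iff)
        have "eventually (\<lambda>t. p$3 * exp t > B) at_top"
          using \<open>filterlim (\<lambda>t. p$3 * exp t) at_top at_top\<close> by (simp add: filterlim_at_top_dense)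
        then show ?thesis
        proof eventually_elim
          case (elim t)
          have "half_space_coords (c t) $ 3 = p$3 * exp t"
            unfolding H using True by (simp add: cosh_minus_sinh exp_minus field_simps)
          then have "norm (half_space_coords (c t)) > B"
            using elim component_le_norm_cart[of "half_space_coords (c t)" 3] by linarith
          then show ?case using B by force
        qed
      qed
      show ?thesis unfolding Q limitin_def
      proof (intro conjI allI impI)
        show "None \<in> topspace ?A" by simp
        fix U assume "openin ?A U \<and> None \<in> U"
        then obtain K where "compact K" "U = insert None (Some ` (UNIV - K))"
          by (auto simp: openin_Alexandroff_compactification)
        then show "eventually (\<lambda>t. Some (half_space_coords (c t)) \<in> U) at_top"
          using ev[of K] by (auto elim: eventually_mono)
      qed
    next
      case False
      define L where "L = (vector [p$1 + p$3 * e$1 / (1 - e$3), p$2 + p$3 * e$2 / (1 - e$3), 0] :: real^3)"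
      have Q: "?emb Q = Some L"
        using False by (simp add: Q_def stereographic_def L_def)
      have q: "((\<lambda>t. (cosh t * a + sinh t * (p$3 * d - a * e$3)) / (cosh t - e$3 * sinh t))
          \<longlongrightarrow> a + p$3 * d / (1 - e$3)) at_top" for a d
      proof -
        have "((\<lambda>t. (a + tanh t * (p$3 * d - a * e$3)) / (1 - e$3 * tanh t))
          \<longlongrightarrow> (a + 1 * (p$3 * d - a * e$3)) / (1 - e$3 * 1)) at_top"
          using False by (intro tendsto_intros tanh_real_at_top) auto
        moreover have "(a + tanh t * (p$3 * d - a * e$3)) / (1 - e$3 * tanh t) =
           (cosh t * a + sinh t * (p$3 * d - a * e$3)) / (cosh t - e$3 * sinh t)" for t
        proof -
          have "cosh t \<noteq> 0" by simp
          then have 1: "a + tanh t * (p$3 * d - a * e$3) = (cosh t * a + sinh t * (p$3 * d - a * e$3)) / cosh t"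
            "1 - e$3 * tanh t = (cosh t - e$3 * sinh t) / cosh t"
            by (simp_all add: tanh_def add_divide_distrib diff_divide_distrib)
          show ?thesis unfolding 1 by simp
        qed
        moreover have "(a + 1 * (p$3 * d - a * e$3)) / (1 - e$3 * 1) = a + p$3 * d / (1 - e$3)"
          using False by (simp add: field_simps)
        ultimately show ?thesis by simp
      qed
      have q3: "((\<lambda>t. p$3 / (cosh t - e$3 * sinh t)) \<longlongrightarrow> 0) at_top"
      proof -
        have "((\<lambda>t. inverse (cosh t) * (p$3 / (1 - e$3 * tanh t))) \<longlongrightarrow> 0 * (p$3 / (1 - e$3 * 1))) at_top"
          using False by (intro tendsto_intros tanh_real_at_top tendsto_inverse_0_at_top cosh_real_at_top) auto
        moreover have "inverse (cosh t) * (p$3 / (1 - e$3 * tanh t)) = p$3 / (cosh t - e$3 * sinh t)" for t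
        proof -
          have "1 - e$3 * tanh t = (cosh t - e$3 * sinh t) / cosh t"
            by (simp add: tanh_def diff_divide_distrib)
          then show ?thesis by (simp add: field_simps)
        qed
        ultimately show ?thesis by simp
      qed
      have "((\<lambda>t. half_space_coords (c t)) \<longlongrightarrow> L) at_top"
        unfolding H L_def
      proof (rule vec_tendstoI)
        fix i :: 3
        show "((\<lambda>t. (vector [
       (cosh t * p$1 + sinh t * (p$3 * e$1 - p$1 * e$3)) / (cosh t - e$3 * sinh t),
       (cosh t * p$2 + sinh t * (p$3 * e$2 - p$2 * e$3)) / (cosh t - e$3 * sinh t),
       p$3 / (cosh t - e$3 * sinh t)] :: real^3) $ i) \<longlongrightarrow>
         (vector [p$1 + p$3 * e$1 / (1 - e$3), p$2 + p$3 * e$2 / (1 - e$3), 0] :: real^3) $ i) at_top"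
          using exhaust_3[of i] q[of "p$1" "e$1"] q[of "p$2" "e$2"] q3 by auto
      qed
      then show ?thesis unfolding Q
        using continuous_map_limit[OF continuous_map_Some, of euclidean "\<lambda>t. half_space_coords (c t)" L at_top]
        by (simp add: comp_def)
    qed
  qed
  have haus: "Hausdorff_space ?A"
    by (simp add: Hausdorff_space_Alexandroff_compactification locally_compact_space_euclidean)
  have inj: "?emb R = ?emb Q \<Longrightarrow> R = Q"
    by (cases R; cases Q) (auto simp: vec_eq_iff forall_3 complex_eq_iff)
  show ?thesis
  proof
    assume "R = Q"
    then show "is_final_point p (p$3 *\<^sub>R e) R"
      unfolding is_final_point_def using geo lim
      by (intro exI[of _ c] exI[of _ b]) (auto simp: c_def b_def P_def V_def)
  next
    assume "is_final_point p (p$3 *\<^sub>R e) R"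
    then obtain \<gamma> \<beta> where g: "dS_geodesic \<gamma> \<beta>" "\<gamma> 0 = P" "\<beta> 0 = V"
      "limitin ?A (\<lambda>t. Some (half_space_coords (\<gamma> t))) (?emb R) at_top"
      unfolding is_final_point_def P_def V_def by blast
    have "\<gamma> = c"
      using dS_geodesic_eq[OF g(1)] g(2,3) VV by (auto simp: c_def fun_eq_iff)
    then have "?emb R = ?emb Q"
      using limitin_Hausdorff_unique[OF g(4) _ _ haus] lim by auto
    then show "R = Q" by (rule inj)
  qed
qed

lemma final_point_formula:
  fixes p e :: "real^3"
  assumes "p$3 > 0" "(e$1)\<^sup>2 + (e$2)\<^sup>2 - (e$3)\<^sup>2 = -1"
  shows "final_point p (p$3 *\<^sub>R e) =
    map_option (\<lambda>g. Complex (p$1) (p$2) + of_real (p$3) * g) (stereographic e)"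
  unfolding final_point_def is_final_point_formula[OF assms] by simp

section \<open>The representation formulas\<close>

text \<open>Some expressions below are not defined at isolated points: at poles of \<open>g\<close> and zeros of
  \<open>g\<^sub>z\<close> for holomorphic \<open>g\<close>, at zeros of \<open>g\<close> for antiholomorphic \<open>g\<close>. These
  points do occur on the surfaces in question (umbilic points, points with vertical normal); the
  formulas are understood there by extension: the positive quotient has a positive smooth
  extension, the strict inequality between the continuously extended sides persists, and the
  surface \<open>x\<close> is the smooth extension of the formula. At a pole of \<open>g\<close> the inequality is
  extended in the divided form |G_zbar| > |G_z| / |g|^2, both of whose sides have limits there.\<close>

definition holo_conditions ::
    "'a set \<Rightarrow> 'a chart set \<Rightarrow> ('a \<Rightarrow> complex option) \<Rightarrow> ('a \<Rightarrow> complex option) \<Rightarrow> bool" where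
  "holo_conditions M A g G \<longleftrightarrow>
     (\<exists>l :: 'a \<Rightarrow> real. smooth_map A l \<and> (\<forall>p\<in>M. l p > 0) \<and>
        (\<forall>c\<in>A. \<forall>w\<in>chart_image c.
           let g' = finite_val \<circ> in_chart c g; G' = finite_val \<circ> in_chart c G in
             in_chart c g w \<noteq> None \<and> dz g' w \<noteq> 0 \<longrightarrow>
               dz G' w / dz g' w = complex_of_real (in_chart c l w))) \<and>
     (\<forall>c\<in>A. \<forall>w\<in>chart_image c.
        let g' = finite_val \<circ> in_chart c g; G' = finite_val \<circ> in_chart c G in
          (in_chart c g w \<noteq> None \<longrightarrow>
             in_chart c G w \<noteq> None \<and>
             (cmod (g' w))\<^sup>2 * cmod (dzbar G' w) > cmod (dz G' w) \<and>
             dzbar (dz G') w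
               + dzbar (\<lambda>q. cnj (g' q)) w / (((cmod (g' w)) ^ 4 - 1) * cnj (g' w)) * dz G' w
               - (cmod (g' w))\<^sup>2 * cnj (g' w) * dz g' w / ((cmod (g' w)) ^ 4 - 1) * dzbar G' w = 0) \<and>
          (in_chart c g w = None \<longrightarrow>
             (\<exists>a b. ((\<lambda>q. cmod (dzbar G' q)) \<longlongrightarrow> a) (at w) \<and>
                    ((\<lambda>q. cmod (dz G' q) / (cmod (g' q))\<^sup>2) \<longlongrightarrow> b) (at w) \<and> a > b)))"

definition holo_representation ::
    "'a chart set \<Rightarrow> ('a \<Rightarrow> complex option) \<Rightarrow> ('a \<Rightarrow> complex option) \<Rightarrow> ('a \<Rightarrow> real^3) \<Rightarrow> bool" where
  "holo_representation A g G x \<longleftrightarrow>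
     (\<forall>c\<in>A. \<forall>w\<in>chart_image c.
        let g' = finite_val \<circ> in_chart c g; G' = finite_val \<circ> in_chart c G; X = in_chart c x w in
          in_chart c g w \<noteq> None \<and> dz g' w \<noteq> 0 \<longrightarrow>
            X$1 = Re (G' w - (1 + (cmod (g' w))\<^sup>2) / (cnj (g' w) * dz g' w) * dz G' w) \<and>
            X$2 = Im (G' w - (1 + (cmod (g' w))\<^sup>2) / (cnj (g' w) * dz g' w) * dz G' w) \<and>
            complex_of_real (X$3) = (1 + (cmod (g' w))\<^sup>2) / ((cmod (g' w))\<^sup>2 * dz g' w) * dz G' w)"

definition without_holomorphic_points :: "'a chart set \<Rightarrow> ('a \<Rightarrow> complex option) \<Rightarrow> bool" where
  "without_holomorphic_points A g \<longleftrightarrow>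
     (\<forall>c\<in>A. \<forall>w\<in>chart_image c. dzbar (finite_val \<circ> in_chart c g) w \<noteq> 0)"

definition antiholo_conditions ::
    "'a set \<Rightarrow> 'a chart set \<Rightarrow> ('a \<Rightarrow> complex option) \<Rightarrow> ('a \<Rightarrow> complex option) \<Rightarrow> bool" where
  "antiholo_conditions M A g G \<longleftrightarrow>
     (\<forall>p\<in>M. G p \<noteq> None) \<and>
     (\<exists>l :: 'a \<Rightarrow> real. smooth_map A l \<and> (\<forall>p\<in>M. l p > 0) \<and>
        (\<forall>c\<in>A. \<forall>w\<in>chart_image c.
           let g' = finite_val \<circ> in_chart c g; G' = finite_val \<circ> in_chart c G in
             g' w \<noteq> 0 \<longrightarrow>
               dzbar G' w / ((cmod (g' w))\<^sup>2 * dzbar g' w) = complex_of_real (in_chart c l w))) \<and>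
     (\<forall>c\<in>A. \<forall>w\<in>chart_image c.
        let g' = finite_val \<circ> in_chart c g; G' = finite_val \<circ> in_chart c G in
          (g' w \<noteq> 0 \<longrightarrow>
             (cmod (g' w))\<^sup>2 * cmod (dz G' w) / cmod (dzbar G' w) < 1 \<and>
             dzbar (dz G') w
               + dz (\<lambda>q. cnj (g' q)) w / (((cmod (g' w)) ^ 4 - 1) * cnj (g' w)) * dzbar G' w
               - (cmod (g' w))\<^sup>2 * cnj (g' w) * dzbar g' w / ((cmod (g' w)) ^ 4 - 1) * dz G' w = 0) \<and>
          (g' w = 0 \<longrightarrow>
             (\<exists>a. ((\<lambda>q. (cmod (g' q))\<^sup>2 * cmod (dz G' q) / cmod (dzbar G' q)) \<longlongrightarrow> a) (at w) \<and> a < 1)))"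

definition antiholo_representation ::
    "'a chart set \<Rightarrow> ('a \<Rightarrow> complex option) \<Rightarrow> ('a \<Rightarrow> complex option) \<Rightarrow> ('a \<Rightarrow> real^3) \<Rightarrow> bool" where
  "antiholo_representation A g G x \<longleftrightarrow>
     (\<forall>c\<in>A. \<forall>w\<in>chart_image c.
        let g' = finite_val \<circ> in_chart c g; G' = finite_val \<circ> in_chart c G; X = in_chart c x w in
          g' w \<noteq> 0 \<longrightarrow>
            X$1 = Re (G' w - (1 + (cmod (g' w))\<^sup>2) / (cnj (g' w) * dzbar g' w) * dzbar G' w) \<and>
            X$2 = Im (G' w - (1 + (cmod (g' w))\<^sup>2) / (cnj (g' w) * dzbar g' w) * dzbar G' w) \<and>
            complex_of_real (X$3) =
              (1 + (cmod (g' w))\<^sup>2) / ((cmod (g' w))\<^sup>2 * dzbar g' w) * dzbar G' w)"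

text \<open>\<open>K \<le> 1\<close> is stated because \<^const>\<open>sqrt\<close> is an odd function on all reals.\<close>

definition sqrt_one_minus_curvature :: "'a chart set \<Rightarrow> ('a \<Rightarrow> real^3) \<Rightarrow> ('a \<Rightarrow> real) \<Rightarrow> bool" where
  "sqrt_one_minus_curvature A x f \<longleftrightarrow>
     (\<forall>c\<in>A. \<forall>w\<in>chart_image c.
        let K = gauss_curvature (induced_metric (in_chart c x)) w in
          K \<le> 1 \<and> sqrt (1 - K) = in_chart c f w)"

end

theory Submission
  imports Defs "HOL-Complex_Analysis.Conformal_Mappings"
begin

text \<open>
  Put \<open>m = 1/g\<close> and \<open>\<epsilon> = 1\<close> in the holomorphic case, \<open>m = cnj g\<close> and \<open>\<epsilon> = -1\<close> in the
  antiholomorphic one. Then \<open>|m| < 1\<close>, the normal is \<open>\<epsilon>\<close> times the Poincare disc parametrisation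
  of the hyperboloid at \<open>m\<close>, and poles of \<open>g\<close> become zeros of \<open>m\<close>. With \<open>P = x\<^sub>1 + i x\<^sub>2\<close>
  and \<open>x\<^sub>3 = (1 + |m|\<^sup>2) l\<close>, both the second order equation for \<open>G\<close> with the condition that the
  quotient of first derivatives is the positive function \<open>l\<close>, and the conformality of II with
  \<open>1 - K = \<eta>\<^sub>3\<^sup>2\<close>, are equivalent to holomorphy of \<open>m\<close> and the first order system
  \<open>m P\<^sub>z = -(1 + |m|\<^sup>2) l\<^sub>z\<close>, \<open>dzbar P = -(1 + |m|\<^sup>2) dzbar (cnj m l)\<close>. The differential of the surface
  is \<open>b dz + cnj c dzbar\<close> in a frame orthogonal to the normal; the induced metric is the squared
  modulus of this form divided by \<open>x\<^sub>3\<^sup>2\<close>, II is a positive multiple of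
  \<open>\<epsilon> (|c|\<^sup>2 - |b|\<^sup>2) |dz|\<^sup>2\<close>, and the curvature follows from the Gauss equation
  \<open>K = 1 - det II / det I\<close>. The strict inequality on \<open>G\<close> is \<open>|b| > |c|\<close>, respectively
  \<open>|b| < |c|\<close>. At a pole of \<open>g\<close> it bounds \<open>l\<^sub>z / m\<close>, which makes \<open>P\<close> extend smoothly.
\<close>

section \<open>Smooth functions and Wirtinger calculus\<close>

lemma dderiv_eqI: "(f has_derivative F) (at w) \<Longrightarrow> dderiv v f w = F v"
  unfolding dderiv_def by (simp add: frechet_derivative_at[symmetric])

lemma has_derivative_dderiv:
  "f differentiable (at w) \<Longrightarrow> (f has_derivative (\<lambda>v. dderiv v f w)) (at w)"
  unfolding dderiv_def by (simp add: frechet_derivative_works eta_contract_eq)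

lemma linear_dderiv: "f differentiable (at w) \<Longrightarrow> linear (\<lambda>v. dderiv v f w)"
  by (rule has_derivative_linear[OF has_derivative_dderiv])

lemma dderiv_basis:
  fixes f :: "complex \<Rightarrow> 'b::real_normed_vector"
  assumes "f differentiable (at w)"
  shows "dderiv v f w = Re v *\<^sub>R dderiv 1 f w + Im v *\<^sub>R dderiv \<i> f w"
proof -
  interpret linear "\<lambda>v. dderiv v f w" by (rule linear_dderiv[OF assms])
  have "v = Re v *\<^sub>R 1 + Im v *\<^sub>R \<i>" by (simp add: complex_eq_iff)
  then show ?thesis by (metis add scale)
qed

lemma dderiv_cong_open:
  assumes "open S" "w \<in> S" "\<And>x. x \<in> S \<Longrightarrow> f x = g x"
  shows "dderiv v f w = dderiv v g w"
proof -
  have "(f has_derivative F) (at w) \<longleftrightarrow> (g has_derivative F) (at w)" for F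
    using has_derivative_transform_within_open[of f F w UNIV S g] 
      has_derivative_transform_within_open[of g F w UNIV S f] assms by auto
  then show ?thesis unfolding dderiv_def frechet_derivative_def by presburger
qed

lemma differentiable_cong_open:
  assumes "open S" "w \<in> S" "\<And>x. x \<in> S \<Longrightarrow> f x = g x" "f differentiable (at w)"
  shows "g differentiable (at w)"
  using has_derivative_transform_within_open[of f _ w UNIV S g] assms
  unfolding differentiable_def by auto

lemma Ck_on_cong:
  assumes "open S" "\<And>x. x \<in> S \<Longrightarrow> f x = g x" "Ck_on k S f"
  shows "Ck_on k S g"
  using assms(2,3)
proof (induction k arbitrary: f g)
  case 0 then show ?case using continuous_on_cong by (metis Ck_on.simps(1))
next
  case (Suc k)
  have "dderiv v f x = dderiv v g x" if "x \<in> S" for v x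
    using dderiv_cong_open[OF assms(1) that] Suc.prems(1) by blast
  then have "Ck_on k S (dderiv v g)" for v
    using Suc.IH[of "dderiv v f" "dderiv v g"] Suc.prems by simp
  moreover have "g differentiable (at x)" if "x \<in> S" for x
    using differentiable_cong_open[OF assms(1) that] Suc.prems that by auto
  ultimately show ?case by simp
qed

lemma Ck_on_subset: "Ck_on k S f \<Longrightarrow> T \<subseteq> S \<Longrightarrow> Ck_on k T f"
  by (induction k arbitrary: f) (auto intro: continuous_on_subset)

lemma Ck_on_SucD: "Ck_on (Suc k) S f \<Longrightarrow> Ck_on k S f"
proof (induction k arbitrary: f)
  case 0 then show ?case
    by (auto intro!: continuous_at_imp_continuous_on differentiable_imp_continuous_within)
next
  case (Suc k) then show ?case by (metis Ck_on.simps(2))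
qed

lemma Ck_on_local:
  assumes "\<And>x. x \<in> S \<Longrightarrow> \<exists>T. open T \<and> x \<in> T \<and> Ck_on k T f"
  shows "Ck_on k S f"
  using assms
proof (induction k arbitrary: f)
  case 0 then show ?case
    by (metis Ck_on.simps(1) continuous_at_imp_continuous_on continuous_on_eq_continuous_at)
next
  case (Suc k) then show ?case by (metis Ck_on.simps(2))
qed

lemma Ck_on_const [simp]: "Ck_on k S (\<lambda>x. c)"
proof (induction k arbitrary: c)
  case (Suc k)
  have "dderiv v (\<lambda>x::'a. c) = (\<lambda>x. 0)" for v
    by (auto simp: fun_eq_iff intro: dderiv_eqI[of _ "\<lambda>_. 0", THEN trans])
  then show ?case using Suc by (simp add: differentiable_const)
qed simp

lemma Ck_on_add:
  assumes "open S" "Ck_on k S f" "Ck_on k S g"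
  shows "Ck_on k S (\<lambda>x. f x + g x)"
  using assms(2,3)
proof (induction k arbitrary: f g)
  case 0 then show ?case by (simp add: continuous_on_add)
next
  case (Suc k)
  have "dderiv v f x + dderiv v g x = dderiv v (\<lambda>x. f x + g x) x" if "x \<in> S" for v x
    using Suc.prems that
    by (intro dderiv_eqI[THEN sym] has_derivative_add has_derivative_dderiv) auto
  then have "Ck_on k S (dderiv v (\<lambda>x. f x + g x))" for v
    using Ck_on_cong[OF assms(1) _ Suc.IH[of "dderiv v f" "dderiv v g"]] Suc.prems by simp
  then show ?case using Suc.prems by auto
qed

lemma Ck_on_bilinear:
  assumes "bounded_bilinear B" "open S" "Ck_on k S f" "Ck_on k S g"
  shows "Ck_on k S (\<lambda>x. B (f x) (g x))"
  using assms(3,4)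
proof (induction k arbitrary: f g)
  case 0 then show ?case using bounded_bilinear.continuous_on[OF assms(1)] by auto
next
  case (Suc k)
  have D: "((\<lambda>x. B (f x) (g x)) has_derivative (\<lambda>v. B (f x) (dderiv v g x) + B (dderiv v f x) (g x))) (at x)"
    if "x \<in> S" for x
    using Suc.prems that
    by (intro bounded_bilinear.FDERIV[OF assms(1)] has_derivative_dderiv) auto
  then have "B (f x) (dderiv v g x) + B (dderiv v f x) (g x) = dderiv v (\<lambda>x. B (f x) (g x)) x"
    if "x \<in> S" for v x
    using that by (metis (mono_tags, lifting) dderiv_eqI)
  moreover have "Ck_on k S (\<lambda>x. B (f x) (dderiv v g x) + B (dderiv v f x) (g x))" for v
    using Suc.prems by (intro Ck_on_add assms(2) Suc.IH) (auto dest: Ck_on_SucD simp del: Ck_on.simps simp: Ck_on.simps(2)[THEN iffD1])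
  ultimately have "Ck_on k S (dderiv v (\<lambda>x. B (f x) (g x)))" for v
    using Ck_on_cong[OF assms(2)] by (metis (no_types, lifting))
  then show ?case using D by (auto simp: differentiable_def)
qed

lemma Ck_on_linear:
  assumes "bounded_linear L" "open S" "Ck_on k S f"
  shows "Ck_on k S (\<lambda>x. L (f x))"
  using assms(3)
proof (induction k arbitrary: f)
  case 0 then show ?case using linear_continuous_on_compose assms(1)
    by (simp add: bounded_linear.continuous_on)
next
  case (Suc k)
  have D: "((\<lambda>x. L (f x)) has_derivative (\<lambda>v. L (dderiv v f x))) (at x)"
    if "x \<in> S" for x
    using Suc.prems that
    by (intro bounded_linear.has_derivative[OF assms(1)] has_derivative_dderiv) auto
  then have "L (dderiv v f x) = dderiv v (\<lambda>x. L (f x)) x" if "x \<in> S" for v x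
    using that by (metis (mono_tags, lifting) dderiv_eqI)
  then have "Ck_on k S (dderiv v (\<lambda>x. L (f x)))" for v
    using Ck_on_cong[OF assms(2) _ Suc.IH[of "dderiv v f"]] Suc.prems by simp
  then show ?case using D by (auto simp: differentiable_def)
qed

lemma Ck_on_ident: "Ck_on k S (\<lambda>x. x)"
proof (cases k)
  case (Suc k)
  have "dderiv v (\<lambda>x::'a. x) = (\<lambda>x. v)" for v
    by (auto simp: fun_eq_iff intro: dderiv_eqI[of _ "\<lambda>v. v", THEN trans])
  then show ?thesis using Suc by simp
qed simp

lemma Ck_on_inverse:
  fixes f :: "'a::euclidean_space \<Rightarrow> 'b::real_normed_field"
  assumes "open S" "Ck_on k S f" "\<And>x. x \<in> S \<Longrightarrow> f x \<noteq> 0"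
  shows "Ck_on k S (\<lambda>x. inverse (f x))"
  using assms(2)
proof (induction k)
  case 0 then show ?case using assms(3) by (simp add: continuous_on_inverse)
next
  case (Suc k)
  have D: "((\<lambda>x. inverse (f x)) has_derivative (\<lambda>v. - (inverse (f x) * dderiv v f x * inverse (f x)))) (at x)"
    if "x \<in> S" for x
    using Suc.prems that assms(3)
    by (intro Deriv.has_derivative_inverse has_derivative_dderiv) auto
  then have "- inverse (f x) * (dderiv v f x * inverse (f x)) = dderiv v (\<lambda>x. inverse (f x)) x" if "x \<in> S" for v x
    using dderiv_eqI[OF D[OF that], of v] by (simp add: mult.assoc)
  moreover have "Ck_on k S (\<lambda>x. - inverse (f x) * (dderiv v f x * inverse (f x)))" for v
    using Suc.IH[OF Ck_on_SucD[OF Suc.prems]] Suc.prems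
    by (intro Ck_on_bilinear[OF bounded_bilinear_mult] assms(1)
      Ck_on_linear[OF bounded_linear_minus[OF bounded_linear_ident]]) auto
  ultimately have "Ck_on k S (dderiv v (\<lambda>x. inverse (f x)))" for v
    using Ck_on_cong[OF assms(1)] by (metis (no_types, lifting))
  then show ?case using D by (auto simp: differentiable_def)
qed

lemma Ck_on_holomorphic:
  assumes "open S" "f holomorphic_on S"
  shows "Ck_on k S f"
  using assms(2)
proof (induction k arbitrary: f)
  case 0 then show ?case by (simp add: holomorphic_on_imp_continuous_on)
next
  case (Suc k)
  have D: "(f has_derivative (\<lambda>v. deriv f x * v)) (at x)" if "x \<in> S" for x
    using holomorphic_derivI[OF Suc.prems assms(1) that] by (simp add: has_field_derivative_def)
  have "deriv f x * v = dderiv v f x" if "x \<in> S" for x v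
    using dderiv_eqI[OF D[OF that], of v] by simp
  moreover have "Ck_on k S (\<lambda>x. deriv f x * v)" for v
    using Suc.IH[of "deriv f"] Suc.prems assms(1) holomorphic_deriv
    by (intro Ck_on_bilinear[OF bounded_bilinear_mult]) auto
  ultimately have "Ck_on k S (dderiv v f)" for v
    using Ck_on_cong[OF assms(1)] by (metis (no_types, lifting))
  then show ?case using D by (auto simp: differentiable_def)
qed

lemma smooth_on_dderiv: "smooth_on S f \<Longrightarrow> smooth_on S (dderiv v f)"
  unfolding smooth_on_def by (metis Ck_on.simps(2))

lemma smooth_on_imp_differentiable: "smooth_on S f \<Longrightarrow> w \<in> S \<Longrightarrow> f differentiable (at w)"
  unfolding smooth_on_def by (metis Ck_on.simps(2))

lemma smooth_on_imp_continuous_on: "smooth_on S f \<Longrightarrow> continuous_on S f"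
  unfolding smooth_on_def by (metis Ck_on.simps(1))

lemma smooth_on_cong: "open S \<Longrightarrow> (\<And>x. x \<in> S \<Longrightarrow> f x = g x) \<Longrightarrow> smooth_on S f \<Longrightarrow> smooth_on S g"
  unfolding smooth_on_def using Ck_on_cong by metis

lemma smooth_on_subset: "smooth_on S f \<Longrightarrow> T \<subseteq> S \<Longrightarrow> smooth_on T f"
  unfolding smooth_on_def using Ck_on_subset by metis

lemma smooth_on_local:
  assumes "\<And>x. x \<in> S \<Longrightarrow> \<exists>T. open T \<and> x \<in> T \<and> smooth_on T f"
  shows "smooth_on S f"
  unfolding smooth_on_def
proof
  fix k show "Ck_on k S f" by (rule Ck_on_local) (meson assms smooth_on_def)
qed

named_theorems smooth_intros

lemma smooth_on_const [smooth_intros]: "smooth_on S (\<lambda>x. c)"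
  by (simp add: smooth_on_def)

lemma smooth_on_ident [smooth_intros]: "smooth_on S (\<lambda>x. x)"
  by (simp add: smooth_on_def Ck_on_ident)

lemma smooth_on_add [smooth_intros]:
  "open S \<Longrightarrow> smooth_on S f \<Longrightarrow> smooth_on S g \<Longrightarrow> smooth_on S (\<lambda>x. f x + g x)"
  by (simp add: smooth_on_def Ck_on_add)

lemma smooth_on_linear:
  "bounded_linear L \<Longrightarrow> open S \<Longrightarrow> smooth_on S f \<Longrightarrow> smooth_on S (\<lambda>x. L (f x))"
  by (simp add: smooth_on_def Ck_on_linear)

lemma smooth_on_bilinear:
  "bounded_bilinear B \<Longrightarrow> open S \<Longrightarrow> smooth_on S f \<Longrightarrow> smooth_on S g \<Longrightarrow> smooth_on S (\<lambda>x. B (f x) (g x))"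
  by (simp add: smooth_on_def Ck_on_bilinear)

lemmas smooth_on_minus [smooth_intros] = smooth_on_linear[OF bounded_linear_minus[OF bounded_linear_ident]]
lemmas smooth_on_cnj [smooth_intros] = smooth_on_linear[OF bounded_linear_cnj]
lemmas smooth_on_Re [smooth_intros] = smooth_on_linear[OF bounded_linear_Re]
lemmas smooth_on_Im [smooth_intros] = smooth_on_linear[OF bounded_linear_Im]
lemmas smooth_on_of_real [smooth_intros] = smooth_on_linear[OF bounded_linear_of_real]
lemmas smooth_on_vec_nth [smooth_intros] = smooth_on_linear[OF bounded_linear_vec_nth]
lemmas smooth_on_mult [smooth_intros] = smooth_on_bilinear[OF bounded_bilinear_mult]
lemmas smooth_on_scaleR [smooth_intros] = smooth_on_bilinear[OF bounded_bilinear_scaleR]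

lemma smooth_on_diff [smooth_intros]:
  "open S \<Longrightarrow> smooth_on S f \<Longrightarrow> smooth_on S g \<Longrightarrow> smooth_on S (\<lambda>x. f x - g x)"
  using smooth_on_add[OF _ _ smooth_on_minus] by (metis (no_types, lifting) ext uminus_add_conv_diff add.commute)

lemma smooth_on_inverse [smooth_intros]:
  fixes f :: "'a::euclidean_space \<Rightarrow> 'b::real_normed_field"
  shows "open S \<Longrightarrow> smooth_on S f \<Longrightarrow> (\<And>x. x \<in> S \<Longrightarrow> f x \<noteq> 0) \<Longrightarrow> smooth_on S (\<lambda>x. inverse (f x))"
  by (simp add: smooth_on_def Ck_on_inverse)

lemma smooth_on_divide [smooth_intros]:
  fixes f :: "'a::euclidean_space \<Rightarrow> 'b::real_normed_field"
  shows "open S \<Longrightarrow> smooth_on S f \<Longrightarrow> smooth_on S g \<Longrightarrow> (\<And>x. x \<in> S \<Longrightarrow> g x \<noteq> 0) \<Longrightarrow> smooth_on S (\<lambda>x. f x / g x)"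
  by (simp add: divide_inverse smooth_intros)

lemma smooth_on_power [smooth_intros]:
  fixes f :: "'a::euclidean_space \<Rightarrow> 'b::real_normed_field"
  shows "open S \<Longrightarrow> smooth_on S f \<Longrightarrow> smooth_on S (\<lambda>x. f x ^ n)"
  by (induction n) (auto intro: smooth_intros)

lemma smooth_on_holomorphic: "open S \<Longrightarrow> f holomorphic_on S \<Longrightarrow> smooth_on S f"
  by (simp add: smooth_on_def Ck_on_holomorphic)

lemma smooth_on_cmod_squared [smooth_intros]:
  "open S \<Longrightarrow> smooth_on S f \<Longrightarrow> smooth_on S (\<lambda>x. (cmod (f x))\<^sup>2)"
  unfolding cmod_power2 by (intro smooth_intros)

lemma smooth_on_vector3 [smooth_intros]:
  fixes f g h :: "'a::euclidean_space \<Rightarrow> real"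
  assumes "open S" "smooth_on S f" "smooth_on S g" "smooth_on S h"
  shows "smooth_on S (\<lambda>x. vector [f x, g x, h x] :: real^3)"
proof -
  have "(\<lambda>x. vector [f x, g x, h x] :: real^3) =
     (\<lambda>x. f x *\<^sub>R axis 1 1 + g x *\<^sub>R axis 2 1 + h x *\<^sub>R axis 3 1)"
    by (auto simp: fun_eq_iff vec_eq_iff forall_3 axis_def)
  then show ?thesis using assms by (auto intro!: smooth_intros)
qed

lemma smooth_on_dz [smooth_intros]: "open S \<Longrightarrow> smooth_on S f \<Longrightarrow> smooth_on S (dz f)"
  and smooth_on_dzbar [smooth_intros]: "open S \<Longrightarrow> smooth_on S f \<Longrightarrow> smooth_on S (dzbar f)"
  unfolding dz_def[abs_def] dzbar_def[abs_def]
  by (auto intro!: smooth_intros smooth_on_dderiv)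

lemma dderiv_commute_real:
  fixes f :: "'a::euclidean_space \<Rightarrow> real"
  assumes "open S" "Ck_on 2 S f" "p \<in> S"
  shows "dderiv u (dderiv v f) p = dderiv v (dderiv u f) p"
proof -
  have C: "\<And>q. q \<in> S \<Longrightarrow> f differentiable (at q)"
    "\<And>q v. q \<in> S \<Longrightarrow> dderiv v f differentiable (at q)"
    "\<And>u v. continuous_on S (dderiv u (dderiv v f))"
    using assms(2) by (auto simp: numeral_2_eq_2)
  obtain e where e: "e > 0" "ball p e \<subseteq> S" using assms open_contains_ball by blast
  define d where "d = e / (norm u + norm v + 1)"
  have "d > 0" using e by (simp add: d_def add_nonneg_pos)
  have inS: "p + s *\<^sub>R u + t *\<^sub>R v \<in> S" if "\<bar>s\<bar> < d" "\<bar>t\<bar> < d" for s t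
  proof -
    have "norm (s *\<^sub>R u + t *\<^sub>R v) \<le> \<bar>s\<bar> * norm u + \<bar>t\<bar> * norm v"
      by (metis norm_scaleR norm_triangle_ineq)
    also have "\<dots> \<le> d * norm u + d * norm v" using that by (intro add_mono mult_right_mono) auto
    also have "\<dots> < d * (norm u + norm v + 1)" using \<open>d > 0\<close> by (simp add: algebra_simps)
    also have "\<dots> = e" unfolding d_def by (simp add: add_nonneg_pos less_imp_neq[symmetric])
    finally have "p + (s *\<^sub>R u + t *\<^sub>R v) \<in> ball p e"
      by (metis add_diff_cancel_left' dist_commute dist_norm mem_ball)
    then show ?thesis using e(2) by (auto simp: add.assoc)
  qed
  have key: "\<exists>s t. 0 < s \<and> s < h \<and> 0 < t \<and> t < h \<and>
     f (p + h *\<^sub>R u + h *\<^sub>R v) - f (p + h *\<^sub>R u) - f (p + h *\<^sub>R v) + f p =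
      h * h * dderiv v (dderiv u f) (p + s *\<^sub>R u + t *\<^sub>R v)"
    if inS: "\<And>s t. \<bar>s\<bar> < d \<Longrightarrow> \<bar>t\<bar> < d \<Longrightarrow> p + s *\<^sub>R u + t *\<^sub>R v \<in> S"
      and h: "0 < h" "h < d" for u v h
  proof -
    have D: "((\<lambda>s. f (p + s *\<^sub>R u + t *\<^sub>R v)) has_real_derivative dderiv u f (p + s *\<^sub>R u + t *\<^sub>R v)) (at s)"
      if "\<bar>s\<bar> < d" "\<bar>t\<bar> < d" for s t
    proof -
      have "(f has_derivative (\<lambda>h. dderiv h f (p + s *\<^sub>R u + t *\<^sub>R v))) (at (p + s *\<^sub>R u + t *\<^sub>R v))"
        by (rule has_derivative_dderiv[OF C(1)[OF inS[OF that]]])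
      moreover have "((\<lambda>s. p + s *\<^sub>R u + t *\<^sub>R v) has_derivative (\<lambda>h. h *\<^sub>R u)) (at s)"
        by (auto intro!: derivative_eq_intros)
      ultimately have "((\<lambda>s. f (p + s *\<^sub>R u + t *\<^sub>R v)) has_derivative
          (\<lambda>h. dderiv (h *\<^sub>R u) f (p + s *\<^sub>R u + t *\<^sub>R v))) (at s)"
        using has_derivative_compose by fastforce
      moreover have "dderiv (h *\<^sub>R u) f q = dderiv u f q * h" if "q \<in> S" for h q
        using linear_scale[OF linear_dderiv[OF C(1)[OF that]]] by simp
      ultimately show ?thesis using inS that by (simp add: has_field_derivative_def)
    qed
    have D2: "((\<lambda>t. dderiv u f (p + s *\<^sub>R u + t *\<^sub>R v)) has_real_derivative dderiv v (dderiv u f) (p + s *\<^sub>R u + t *\<^sub>R v)) (at t)"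
      if "\<bar>s\<bar> < d" "\<bar>t\<bar> < d" for s t
    proof -
      have "(dderiv u f has_derivative (\<lambda>h. dderiv h (dderiv u f) (p + s *\<^sub>R u + t *\<^sub>R v))) (at (p + s *\<^sub>R u + t *\<^sub>R v))"
        by (intro has_derivative_dderiv C(2) inS that)
      moreover have "((\<lambda>t. p + s *\<^sub>R u + t *\<^sub>R v) has_derivative (\<lambda>h. h *\<^sub>R v)) (at t)"
        by (auto intro!: derivative_eq_intros)
      ultimately have "((\<lambda>t. dderiv u f (p + s *\<^sub>R u + t *\<^sub>R v)) has_derivative
          (\<lambda>h. dderiv (h *\<^sub>R v) (dderiv u f) (p + s *\<^sub>R u + t *\<^sub>R v))) (at t)"
        using has_derivative_compose by fastforce
      moreover have "dderiv (h *\<^sub>R v) (dderiv u f) q = dderiv v (dderiv u f) q * h" if "q \<in> S" for h q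
        using linear_scale[OF linear_dderiv[OF C(2)[OF that]]] by simp
      ultimately show ?thesis using inS that by (simp add: has_field_derivative_def)
    qed
    define g where "g s = f (p + s *\<^sub>R u + h *\<^sub>R v) - f (p + s *\<^sub>R u + 0 *\<^sub>R v)" for s
    have "\<exists>s. 0 < s \<and> s < h \<and> g h - g 0 = (h - 0) *
      (dderiv u f (p + s *\<^sub>R u + h *\<^sub>R v) - dderiv u f (p + s *\<^sub>R u + 0 *\<^sub>R v))"
      unfolding g_def using h by (intro MVT2 DERIV_diff D) auto
    then obtain s where s: "0 < s" "s < h" "g h - g 0 = h *
      (dderiv u f (p + s *\<^sub>R u + h *\<^sub>R v) - dderiv u f (p + s *\<^sub>R u + 0 *\<^sub>R v))" by auto
    have "\<exists>t. 0 < t \<and> t < h \<and> dderiv u f (p + s *\<^sub>R u + h *\<^sub>R v) - dderiv u f (p + s *\<^sub>R u + 0 *\<^sub>R v)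
       = (h - 0) * dderiv v (dderiv u f) (p + s *\<^sub>R u + t *\<^sub>R v)"
      using h s by (intro MVT2 D2) auto
    then obtain t where t: "0 < t" "t < h" "dderiv u f (p + s *\<^sub>R u + h *\<^sub>R v) - dderiv u f (p + s *\<^sub>R u + 0 *\<^sub>R v)
       = h * dderiv v (dderiv u f) (p + s *\<^sub>R u + t *\<^sub>R v)" by auto
    show ?thesis
      using s t by (intro exI[of _ s] exI[of _ t]) (simp add: g_def algebra_simps)
  qed
  have "\<exists>q q'. dist q p \<le> h * (norm u + norm v) \<and> dist q' p \<le> h * (norm u + norm v) \<and>
     dderiv v (dderiv u f) q = dderiv u (dderiv v f) q'" if h: "0 < h" "h < d" for h
  proof -
    obtain s t where 1: "0 < s" "s < h" "0 < t" "t < h" "f (p + h *\<^sub>R u + h *\<^sub>R v) - f (p + h *\<^sub>R u) - f (p + h *\<^sub>R v) + f p =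
      h * h * dderiv v (dderiv u f) (p + s *\<^sub>R u + t *\<^sub>R v)"
      using key[OF inS h] by auto
    have inS': "p + s *\<^sub>R v + t *\<^sub>R u \<in> S" if "\<bar>s\<bar> < d" "\<bar>t\<bar> < d" for s t
      using inS[OF that(2,1)] by (simp add: algebra_simps)
    obtain s' t' where 2: "0 < s'" "s' < h" "0 < t'" "t' < h" "f (p + h *\<^sub>R v + h *\<^sub>R u) - f (p + h *\<^sub>R v) - f (p + h *\<^sub>R u) + f p =
      h * h * dderiv u (dderiv v f) (p + s' *\<^sub>R v + t' *\<^sub>R u)"
      using key[OF inS' h] by auto
    have *: "dist (p + s *\<^sub>R u + t *\<^sub>R v) p \<le> h * (norm u + norm v)" if "0 < s" "s < h" "0 < t" "t < h" for s t u v
    proof -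
      have "norm (s *\<^sub>R u + t *\<^sub>R v) \<le> \<bar>s\<bar> * norm u + \<bar>t\<bar> * norm v"
        by (metis norm_scaleR norm_triangle_ineq)
      also have "\<dots> \<le> h * norm u + h * norm v" using that by (intro add_mono mult_right_mono) auto
      finally show ?thesis by (simp add: dist_norm algebra_simps)
    qed
    have "f (p + h *\<^sub>R v + h *\<^sub>R u) = f (p + h *\<^sub>R u + h *\<^sub>R v)" by (simp add: algebra_simps)
    then have "h * h * dderiv v (dderiv u f) (p + s *\<^sub>R u + t *\<^sub>R v) = h * h * dderiv u (dderiv v f) (p + s' *\<^sub>R v + t' *\<^sub>R u)"
      using 1(5) 2(5) by linarith
    then have "dderiv v (dderiv u f) (p + s *\<^sub>R u + t *\<^sub>R v) = dderiv u (dderiv v f) (p + s' *\<^sub>R v + t' *\<^sub>R u)"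
      using h by simp
    then show ?thesis using *[OF 1(1-4), of u v] *[OF 2(1-4), of v u] by (metis add.commute)
  qed
  then obtain q q' where q: "\<And>h. 0 < h \<Longrightarrow> h < d \<Longrightarrow> dist (q h) p \<le> h * (norm u + norm v)"
    "\<And>h. 0 < h \<Longrightarrow> h < d \<Longrightarrow> dist (q' h) p \<le> h * (norm u + norm v)"
    "\<And>h. 0 < h \<Longrightarrow> h < d \<Longrightarrow> dderiv v (dderiv u f) (q h) = dderiv u (dderiv v f) (q' h)"
    by metis
  have ev: "eventually (\<lambda>h. 0 < h \<and> h < d) (at_right (0::real))"
    using \<open>d > 0\<close> by (auto simp: eventually_at_right_field)
  have lim0: "((\<lambda>h. h * (norm u + norm v)) \<longlongrightarrow> 0) (at_right 0)"
    by (auto intro!: tendsto_eq_intros)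
  have "(q \<longlongrightarrow> p) (at_right 0)" "(q' \<longlongrightarrow> p) (at_right 0)"
    using q(1,2) eventually_mono[OF ev]
    by (auto intro!: metric_tendsto_imp_tendsto[OF lim0] eventually_mono[OF ev] simp: dist_real_def
        intro: order_trans[OF _ abs_ge_self])
  moreover have "isCont (dderiv a (dderiv b f)) p" for a b
    using C(3) assms by (simp add: continuous_on_eq_continuous_at)
  ultimately have 1: "((\<lambda>h. dderiv v (dderiv u f) (q h)) \<longlongrightarrow> dderiv v (dderiv u f) p) (at_right 0)"
    and 2: "((\<lambda>h. dderiv u (dderiv v f) (q' h)) \<longlongrightarrow> dderiv u (dderiv v f) p) (at_right 0)"
    by (auto intro: isCont_tendsto_compose)
  have "((\<lambda>h. dderiv v (dderiv u f) (q h)) \<longlongrightarrow> dderiv u (dderiv v f) p) (at_right 0)"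
    by (rule Lim_transform_eventually[OF 2]) (use ev q(3) in \<open>auto elim: eventually_mono\<close>)
  then show ?thesis using tendsto_unique[OF _ 1] by (simp add: trivial_limit_at_right_real)
qed

lemma dderiv_linear:
  assumes "bounded_linear L" "f differentiable (at p)"
  shows "dderiv v (\<lambda>x. L (f x)) p = L (dderiv v f p)"
  using bounded_linear.has_derivative[OF assms(1) has_derivative_dderiv[OF assms(2)]] by (rule dderiv_eqI)

lemma dderiv_commute:
  fixes f :: "'a::euclidean_space \<Rightarrow> 'b::euclidean_space"
  assumes "open S" "smooth_on S f" "p \<in> S"
  shows "dderiv u (dderiv v f) p = dderiv v (dderiv u f) p"
proof (rule euclidean_eqI)
  fix b :: 'b
  have L: "bounded_linear (\<lambda>x. x \<bullet> b)" by (rule bounded_linear_inner_left)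
  have *: "dderiv u (dderiv v f) p \<bullet> b = dderiv u (dderiv v (\<lambda>x. f x \<bullet> b)) p" for u v
  proof -
    have "dderiv u (dderiv v f) p \<bullet> b = dderiv u (\<lambda>x. dderiv v f x \<bullet> b) p"
      by (rule dderiv_linear[OF L, symmetric])
        (rule smooth_on_imp_differentiable[OF smooth_on_dderiv[OF assms(2)] assms(3)])
    also have "\<dots> = dderiv u (dderiv v (\<lambda>x. f x \<bullet> b)) p"
      by (rule dderiv_cong_open[OF assms(1,3)])
        (rule dderiv_linear[OF L smooth_on_imp_differentiable[OF assms(2)], symmetric])
    finally show ?thesis .
  qed
  have "Ck_on 2 S (\<lambda>x. f x \<bullet> b)"
    using smooth_on_linear[OF L assms(1,2)] by (simp add: smooth_on_def)
  then show "dderiv u (dderiv v f) p \<bullet> b = dderiv v (dderiv u f) p \<bullet> b"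
    unfolding * by (rule dderiv_commute_real[OF assms(1) _ assms(3)])
qed

definition has_wirtinger :: "(complex \<Rightarrow> complex) \<Rightarrow> complex \<Rightarrow> complex \<Rightarrow> complex \<Rightarrow> bool" where
  "has_wirtinger f w \<alpha> \<beta> \<longleftrightarrow> (f has_derivative (\<lambda>v. \<alpha> * v + \<beta> * cnj v)) (at w)"

lemma has_wirtinger_dz: "has_wirtinger f w \<alpha> \<beta> \<Longrightarrow> dz f w = \<alpha>"
  and has_wirtinger_dzbar: "has_wirtinger f w \<alpha> \<beta> \<Longrightarrow> dzbar f w = \<beta>"
  and has_wirtinger_dderiv: "has_wirtinger f w \<alpha> \<beta> \<Longrightarrow> dderiv v f w = \<alpha> * v + \<beta> * cnj v"
  unfolding has_wirtinger_def dz_def dzbar_def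
  by (simp_all add: dderiv_eqI algebra_simps)

lemma has_wirtinger_self:
  assumes "f differentiable (at w)"
  shows "has_wirtinger f w (dz f w) (dzbar f w)"
proof -
  have "dderiv v f w = dz f w * v + dzbar f w * cnj v" for v
    unfolding dderiv_basis[OF assms, of v] dz_def dzbar_def
    by (simp add: complex_eq_iff field_simps)
  then show ?thesis
    using has_derivative_dderiv[OF assms] by (simp add: has_wirtinger_def)
qed

lemma has_wirtinger_eq: "has_wirtinger f w \<alpha> \<beta> \<Longrightarrow> \<alpha> = \<alpha>' \<Longrightarrow> \<beta> = \<beta>' \<Longrightarrow> has_wirtinger f w \<alpha>' \<beta>'"
  by simp

lemma has_wirtinger_cong:
  "open S \<Longrightarrow> w \<in> S \<Longrightarrow> (\<And>x. x \<in> S \<Longrightarrow> f x = g x) \<Longrightarrow> has_wirtinger f w \<alpha> \<beta> \<Longrightarrow> has_wirtinger g w \<alpha> \<beta>"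
  unfolding has_wirtinger_def using has_derivative_transform_within_open by blast

lemma has_wirtinger_const: "has_wirtinger (\<lambda>x. c) w 0 0"
  by (simp add: has_wirtinger_def)

lemma has_wirtinger_add:
  "has_wirtinger f w \<alpha> \<beta> \<Longrightarrow> has_wirtinger g w \<gamma> \<delta> \<Longrightarrow> has_wirtinger (\<lambda>x. f x + g x) w (\<alpha> + \<gamma>) (\<beta> + \<delta>)"
  unfolding has_wirtinger_def
  by (rule has_derivative_eq_rhs[OF has_derivative_add], assumption+) (auto simp: algebra_simps)

lemma has_wirtinger_minus:
  "has_wirtinger f w \<alpha> \<beta> \<Longrightarrow> has_wirtinger (\<lambda>x. - f x) w (- \<alpha>) (- \<beta>)"
  unfolding has_wirtinger_def
  by (rule has_derivative_eq_rhs[OF has_derivative_minus]) (auto simp: algebra_simps)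

lemma has_wirtinger_diff:
  "has_wirtinger f w \<alpha> \<beta> \<Longrightarrow> has_wirtinger g w \<gamma> \<delta> \<Longrightarrow> has_wirtinger (\<lambda>x. f x - g x) w (\<alpha> - \<gamma>) (\<beta> - \<delta>)"
  unfolding has_wirtinger_def
  by (rule has_derivative_eq_rhs[OF has_derivative_diff]) (auto simp: algebra_simps)

lemma has_wirtinger_mult:
  "has_wirtinger f w \<alpha> \<beta> \<Longrightarrow> has_wirtinger g w \<gamma> \<delta> \<Longrightarrow>
    has_wirtinger (\<lambda>x. f x * g x) w (f w * \<gamma> + \<alpha> * g w) (f w * \<delta> + \<beta> * g w)"
  unfolding has_wirtinger_def
  by (rule has_derivative_eq_rhs[OF has_derivative_mult]) (auto simp: algebra_simps)

lemma has_wirtinger_cnj: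
  "has_wirtinger f w \<alpha> \<beta> \<Longrightarrow> has_wirtinger (\<lambda>x. cnj (f x)) w (cnj \<beta>) (cnj \<alpha>)"
  unfolding has_wirtinger_def
  by (rule has_derivative_eq_rhs[OF has_derivative_cnj]) (auto simp: algebra_simps)

lemma has_wirtinger_inverse:
  "has_wirtinger f w \<alpha> \<beta> \<Longrightarrow> f w \<noteq> 0 \<Longrightarrow>
    has_wirtinger (\<lambda>x. inverse (f x)) w (- \<alpha> / (f w)\<^sup>2) (- \<beta> / (f w)\<^sup>2)"
  unfolding has_wirtinger_def
  by (rule has_derivative_eq_rhs[OF Deriv.has_derivative_inverse])
    (auto simp: field_simps power2_eq_square)

lemma has_wirtinger_divide:
  "has_wirtinger f w \<alpha> \<beta> \<Longrightarrow> has_wirtinger g w \<gamma> \<delta> \<Longrightarrow> g w \<noteq> 0 \<Longrightarrow>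
    has_wirtinger (\<lambda>x. f x / g x) w ((\<alpha> * g w - f w * \<gamma>) / (g w)\<^sup>2) ((\<beta> * g w - f w * \<delta>) / (g w)\<^sup>2)"
  unfolding divide_inverse[of "f _"]
  by (rule has_wirtinger_eq[OF has_wirtinger_mult[OF _ has_wirtinger_inverse]])
    (auto simp: field_simps power2_eq_square)

lemma has_wirtinger_field:
  "(f has_field_derivative d) (at w) \<Longrightarrow> has_wirtinger f w d 0"
  by (simp add: has_field_derivative_def has_wirtinger_def)

lemma has_wirtinger_holomorphic:
  "f holomorphic_on S \<Longrightarrow> open S \<Longrightarrow> w \<in> S \<Longrightarrow> has_wirtinger f w (deriv f w) 0"
  by (intro has_wirtinger_field holomorphic_derivI)

lemma holomorphic_on_if_dzbar_zero:
  assumes "open S" "\<And>w. w \<in> S \<Longrightarrow> f differentiable (at w)" "\<And>w. w \<in> S \<Longrightarrow> dzbar f w = 0"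
  shows "f holomorphic_on S"
proof -
  have "(f has_field_derivative dz f w) (at w)" if "w \<in> S" for w
    using has_wirtinger_self[OF assms(2)[OF that]] assms(3)[OF that]
    by (simp add: has_wirtinger_def has_field_derivative_def)
  then show ?thesis using assms(1) holomorphic_on_open by blast
qed

lemma dzbar_cnj: "f differentiable (at w) \<Longrightarrow> dzbar (\<lambda>x. cnj (f x)) w = cnj (dz f w)"
  using has_wirtinger_dzbar has_wirtinger_cnj has_wirtinger_self by blast

lemma dzbar_of_real:
  assumes "(\<lambda>x. complex_of_real (l x)) differentiable (at w)"
  shows "dzbar (\<lambda>x. complex_of_real (l x)) w = cnj (dz (\<lambda>x. complex_of_real (l x)) w)"
  using dzbar_cnj[OF assms] by simp

lemma dderiv_of_real:
  assumes "l differentiable (at w)"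
  shows "dderiv v (\<lambda>x. complex_of_real (l x)) w = complex_of_real (dderiv v l w)"
  by (rule dderiv_linear[OF bounded_linear_of_real assms])

lemma dzbar_dz_commute:
  assumes "open S" "smooth_on S f" "w \<in> S"
  shows "dzbar (dz f) w = dz (dzbar f) w"
proof -
  note s = smooth_on_dderiv[OF assms(2)]
  note d = smooth_on_imp_differentiable[OF s assms(3)]
  have 1: "((\<lambda>x. (dderiv 1 f x - \<i> * dderiv \<i> f x) / 2) has_derivative
      (\<lambda>v. (dderiv v (dderiv 1 f) w - \<i> * dderiv v (dderiv \<i> f) w) / 2)) (at w)"
    by (auto intro!: derivative_eq_intros has_derivative_dderiv[OF d])
  have 2: "((\<lambda>x. (dderiv 1 f x + \<i> * dderiv \<i> f x) / 2) has_derivative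
      (\<lambda>v. (dderiv v (dderiv 1 f) w + \<i> * dderiv v (dderiv \<i> f) w) / 2)) (at w)"
    by (auto intro!: derivative_eq_intros has_derivative_dderiv[OF d])
  have 3: "dz f = (\<lambda>x. (dderiv 1 f x - \<i> * dderiv \<i> f x) / 2)"
    "dzbar f = (\<lambda>x. (dderiv 1 f x + \<i> * dderiv \<i> f x) / 2)"
    by (auto simp: dz_def dzbar_def fun_eq_iff)
  show ?thesis
    unfolding dzbar_def[of "dz f"] dz_def[of "dzbar f"]
    unfolding 3 dderiv_eqI[OF 1] dderiv_eqI[OF 2] dderiv_commute[OF assms, of \<i> 1]
    by (simp add: field_simps)
qed

section \<open>Surfaces in the half-space model and the Gauss equation\<close>

definition lorentz :: "real^3 \<Rightarrow> real^3 \<Rightarrow> real" where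
  "lorentz X Y = X$1 * Y$1 + X$2 * Y$2 - X$3 * Y$3"

definition hs_conn :: "real^3 \<Rightarrow> real^3 \<Rightarrow> real^3" where
  "hs_conn X Y = (X$3) *\<^sub>R Y + (Y$3) *\<^sub>R X + lorentz X Y *\<^sub>R axis 3 1"

lemma dS_metric_lorentz: "dS_metric p X Y = lorentz X Y / (p$3)\<^sup>2"
  by (simp add: dS_metric_def lorentz_def)

lemma axis3_nth: "axis (3::3) (1::real) $ 1 = 0" "axis (3::3) (1::real) $ 2 = 0" "axis (3::3) (1::real) $ 3 = 1"
  by (simp_all add: axis_def)

lemma bounded_bilinear_lorentz: "bounded_bilinear lorentz"
  unfolding bilinear_conv_bounded_bilinear[symmetric] bilinear_def lorentz_def
  by (auto intro!: linearI simp: algebra_simps)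

lemma bounded_bilinear_hs_conn: "bounded_bilinear hs_conn"
  unfolding bilinear_conv_bounded_bilinear[symmetric] bilinear_def hs_conn_def lorentz_def
  by (auto intro!: linearI simp: algebra_simps vec_eq_iff forall_3)

lemmas lorentz_simps =
  bounded_bilinear.add_left[OF bounded_bilinear_lorentz]
  bounded_bilinear.add_right[OF bounded_bilinear_lorentz]
  bounded_bilinear.diff_left[OF bounded_bilinear_lorentz]
  bounded_bilinear.diff_right[OF bounded_bilinear_lorentz]
  bounded_bilinear.scaleR_left[OF bounded_bilinear_lorentz]
  bounded_bilinear.scaleR_right[OF bounded_bilinear_lorentz]
  bounded_bilinear.minus_left[OF bounded_bilinear_lorentz]
  bounded_bilinear.minus_right[OF bounded_bilinear_lorentz]

lemma lorentz_commute: "lorentz X Y = lorentz Y X"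
  by (simp add: lorentz_def mult.commute)

lemma lorentz_nondegenerate:
  assumes "\<And>Z. lorentz V Z = lorentz V' Z" shows "V = V'"
  using assms[of "axis 1 1"] assms[of "axis 2 1"] assms[of "axis 3 1"]
  by (simp add: lorentz_def axis_def vec_eq_iff forall_3)

lemma has_derivative_dS_metric:
  assumes "(X has_derivative X') (at w)" "(Y has_derivative Y') (at w)" "(Z has_derivative Z') (at w)"
    and "X w $ 3 \<noteq> 0"
  shows "((\<lambda>q. dS_metric (X q) (Y q) (Z q)) has_derivative
    (\<lambda>v. (lorentz (Y' v) (Z w) + lorentz (Y w) (Z' v)) / (X w $ 3)\<^sup>2
       - 2 * X' v $ 3 * lorentz (Y w) (Z w) / (X w $ 3)^3)) (at w)"
proof -
  have 1: "((\<lambda>q. X q $ 3) has_derivative (\<lambda>v. X' v $ 3)) (at w)"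
    by (rule bounded_linear.has_derivative[OF bounded_linear_vec_nth assms(1)])
  have 2: "((\<lambda>q. lorentz (Y q) (Z q)) has_derivative (\<lambda>v. lorentz (Y w) (Z' v) + lorentz (Y' v) (Z w))) (at w)"
    by (rule bounded_bilinear.FDERIV[OF bounded_bilinear_lorentz assms(2,3)])
  have 3: "(X w $ 3)\<^sup>2 \<noteq> 0" using assms(4) by simp
  show ?thesis unfolding dS_metric_lorentz
    by (rule has_derivative_eq_rhs[OF has_derivative_divide[OF 2 has_derivative_power[OF 1] 3]])
       (use assms(4) in \<open>simp add: fun_eq_iff field_simps power2_eq_square power3_eq_cube\<close>)
qed

lemma christoffel_dS:
  assumes "p $ 3 \<noteq> 0"
  shows "christoffel dS_metric p X Y = - (1 / p$3) *\<^sub>R hs_conn X Y"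
proof -
  have D: "dderiv X (\<lambda>q. dS_metric q Y Z) p = - 2 * X$3 * lorentz Y Z / (p$3)^3" for X Y Z
    using dderiv_eqI[OF has_derivative_dS_metric[OF has_derivative_ident has_derivative_const has_derivative_const assms], of X Y Z]
    by (simp add: lorentz_def)
  show ?thesis unfolding christoffel_def
  proof (rule the_equality)
    show "\<forall>Z. dS_metric p (- (1 / p $ 3) *\<^sub>R hs_conn X Y) Z =
        (dderiv X (\<lambda>q. dS_metric q Y Z) p + dderiv Y (\<lambda>q. dS_metric q X Z) p -
         dderiv Z (\<lambda>q. dS_metric q X Y) p) / 2"
      unfolding D unfolding dS_metric_def using assms
      by (simp add: hs_conn_def lorentz_def axis3_nth field_simps power2_eq_square power3_eq_cube)
    then have eq: "dS_metric p V Z = dS_metric p (- (1 / p $ 3) *\<^sub>R hs_conn X Y) Z" if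
      "\<forall>Z. dS_metric p V Z = (dderiv X (\<lambda>q. dS_metric q Y Z) p + dderiv Y (\<lambda>q. dS_metric q X Z) p -
         dderiv Z (\<lambda>q. dS_metric q X Y) p) / 2" for V Z
      using that by metis
    show "V = - (1 / p $ 3) *\<^sub>R hs_conn X Y" if
      "\<forall>Z. dS_metric p V Z = (dderiv X (\<lambda>q. dS_metric q Y Z) p + dderiv Y (\<lambda>q. dS_metric q X Z) p -
         dderiv Z (\<lambda>q. dS_metric q X Y) p) / 2" for V
    proof (rule lorentz_nondegenerate)
      show "lorentz V Z = lorentz (- (1 / p $ 3) *\<^sub>R hs_conn X Y) Z" for Z
        using eq[OF that, of Z] assms unfolding dS_metric_lorentz by simp
    qed
  qed
qed

lemma det_squared_lorentz_gram:
  fixes a b c :: "real^3"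
  shows "(det (vector [a, b, c] :: real^3^3))\<^sup>2 =
    - (lorentz a a * (lorentz b b * lorentz c c - (lorentz b c)\<^sup>2)
      - lorentz a b * (lorentz a b * lorentz c c - lorentz b c * lorentz a c)
      + lorentz a c * (lorentz a b * lorentz b c - lorentz b b * lorentz a c))"
  unfolding det_3 vector_3 lorentz_def by algebra

lemma lorentz_cramer:
  fixes a b c y :: "real^3"
  assumes "det (vector [a, b, c] :: real^3^3) \<noteq> 0"
    "lorentz y a = 0" "lorentz y b = 0" "lorentz y c = 0"
  shows "y = 0"
proof -
  let ?d = "det (vector [a, b, c] :: real^3^3)"
  have "?d * y$1 = lorentz y a * (b$2*c$3 - b$3*c$2) + lorentz y b * (c$2*a$3 - c$3*a$2) + lorentz y c * (a$2*b$3 - a$3*b$2)"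
    "?d * y$2 = lorentz y a * (b$3*c$1 - b$1*c$3) + lorentz y b * (c$3*a$1 - c$1*a$3) + lorentz y c * (a$3*b$1 - a$1*b$3)"
    "- (?d * y$3) = lorentz y a * (b$1*c$2 - b$2*c$1) + lorentz y b * (c$1*a$2 - c$2*a$1) + lorentz y c * (a$1*b$2 - a$2*b$1)"
    unfolding det_3 vector_3 lorentz_def by algebra+
  then show ?thesis using assms by (simp add: vec_eq_iff forall_3)
qed

locale half_space_surface =
  fixes U :: "complex set" and x \<eta> :: "complex \<Rightarrow> real^3"
  assumes open_U: "open U"
    and smooth_x: "smooth_on U x" and smooth_eta: "smooth_on U \<eta>"
    and pos: "w \<in> U \<Longrightarrow> x w $ 3 > 0"
    and unit: "w \<in> U \<Longrightarrow> (\<eta> w $ 1)\<^sup>2 + (\<eta> w $ 2)\<^sup>2 - (\<eta> w $ 3)\<^sup>2 = -1"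
    and orth: "w \<in> U \<Longrightarrow> lorentz (dderiv v x w) (\<eta> w) = 0"
    and spacelike: "w \<in> U \<Longrightarrow> v \<noteq> 0 \<Longrightarrow> lorentz (dderiv v x w) (dderiv v x w) > 0"
begin

abbreviation "N w \<equiv> (x w $ 3) *\<^sub>R \<eta> w"

abbreviation "cov w u Y \<equiv> ambient_covderiv x w u Y"

definition hess :: "complex \<Rightarrow> complex \<Rightarrow> complex \<Rightarrow> real^3" where
  "hess u v w = cov w u (dderiv v x)"

definition beta :: "complex \<Rightarrow> complex \<Rightarrow> complex \<Rightarrow> real" where
  "beta u v w = - dS_metric (x w) (hess u v w) (N w)"

lemma cov_eq:
  "w \<in> U \<Longrightarrow> cov w u Y = dderiv u Y w - (1 / x w $ 3) *\<^sub>R hs_conn (dderiv u x w) (Y w)"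
  unfolding ambient_covderiv_def using pos[of w] by (simp add: christoffel_dS)

lemma dx: "w \<in> U \<Longrightarrow> (x has_derivative (\<lambda>v. dderiv v x w)) (at w)"
  and ddx: "w \<in> U \<Longrightarrow> (dderiv u x has_derivative (\<lambda>v. dderiv v (dderiv u x) w)) (at w)"
  and dddx: "w \<in> U \<Longrightarrow> (dderiv u (dderiv u' x) has_derivative (\<lambda>v. dderiv v (dderiv u (dderiv u' x)) w)) (at w)"
  and deta: "w \<in> U \<Longrightarrow> (\<eta> has_derivative (\<lambda>v. dderiv v \<eta> w)) (at w)"
  by (intro has_derivative_dderiv smooth_on_imp_differentiable[of U] smooth_on_dderiv smooth_x smooth_eta; assumption)+

lemma dderiv_dS_metric:
  assumes "w \<in> U" "Y differentiable (at w)" "Z differentiable (at w)"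
  shows "dderiv u (\<lambda>q. dS_metric (x q) (Y q) (Z q)) w =
    dS_metric (x w) (cov w u Y) (Z w) + dS_metric (x w) (Y w) (cov w u Z)"
proof -
  have 0: "x w $ 3 \<noteq> 0" using pos[OF assms(1)] by simp
  show ?thesis
    unfolding dderiv_eqI[OF has_derivative_dS_metric[OF dx[OF assms(1)] has_derivative_dderiv[OF assms(2)]
      has_derivative_dderiv[OF assms(3)] 0]]
    unfolding cov_eq[OF assms(1)] dS_metric_lorentz lorentz_simps
    using 0
    by (simp add: hs_conn_def lorentz_simps)
       (simp add: lorentz_def axis3_nth field_simps power2_eq_square power3_eq_cube)
qed

lemma hs_conn_commute: "hs_conn X Y = hs_conn Y X"
  by (simp add: hs_conn_def lorentz_commute)

lemma hess_commute: "w \<in> U \<Longrightarrow> hess u v w = hess v u w"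
  unfolding hess_def cov_eq using dderiv_commute[OF open_U smooth_x, of w u v] hs_conn_commute by metis

lemma beta_commute: "w \<in> U \<Longrightarrow> beta u v w = beta v u w"
  unfolding beta_def using hess_commute by metis

lemma x_differentiable: "w \<in> U \<Longrightarrow> x differentiable (at w)"
  and dx_differentiable: "w \<in> U \<Longrightarrow> dderiv v x differentiable (at w)"
  using dx ddx unfolding differentiable_def by blast+

lemma N_differentiable: "w \<in> U \<Longrightarrow> (\<lambda>w. N w) differentiable (at w)"
  by (rule smooth_on_imp_differentiable[of U]) (auto intro!: smooth_intros open_U smooth_x smooth_eta)

lemma cov_N: 
  assumes "w \<in> U" 
  shows "cov w u (\<lambda>w. N w) = (x w $ 3) *\<^sub>R dderiv u \<eta> w - (\<eta> w $ 3) *\<^sub>R dderiv u x w"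
proof -
  have "((\<lambda>w. N w) has_derivative (\<lambda>v. (x w $ 3) *\<^sub>R dderiv v \<eta> w + (dderiv v x w $ 3) *\<^sub>R \<eta> w)) (at w)"
    by (rule bounded_bilinear.FDERIV[OF bounded_bilinear_scaleR])
      (auto intro!: deta assms bounded_linear.has_derivative[OF bounded_linear_vec_nth] dx)
  then have 1: "dderiv u (\<lambda>w. N w) w = (x w $ 3) *\<^sub>R dderiv u \<eta> w + (dderiv u x w $ 3) *\<^sub>R \<eta> w"
    by (rule dderiv_eqI)
  show ?thesis unfolding cov_eq[OF assms] 1 hs_conn_def lorentz_simps orth[OF assms]
    using pos[OF assms] by (simp add: algebra_simps)
qed

lemma dS_metric_dx_N: "w \<in> U \<Longrightarrow> dS_metric (x w) (dderiv v x w) (N w) = 0"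
  by (simp add: dS_metric_lorentz lorentz_simps orth)

lemma dS_metric_N_N: "w \<in> U \<Longrightarrow> dS_metric (x w) (N w) (N w) = -1"
  using unit[of w] pos[of w]
  by (simp add: dS_metric_lorentz lorentz_simps) (simp add: lorentz_def power2_eq_square)

lemma beta_cov_N:
  assumes "w \<in> U"
  shows "beta u v w = dS_metric (x w) (cov w u (\<lambda>w. N w)) (dderiv v x w)"
proof -
  have "dderiv u (\<lambda>q. dS_metric (x q) (dderiv v x q) (N q)) w = dderiv u (\<lambda>q. 0::real) w"
    by (rule dderiv_cong_open[OF open_U assms]) (simp add: dS_metric_dx_N)
  also have "\<dots> = 0" by (rule dderiv_eqI[OF has_derivative_const])
  finally show ?thesis
    unfolding dderiv_dS_metric[OF assms dx_differentiable[OF assms] N_differentiable[OF assms]] beta_def hess_def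
    by (simp add: dS_metric_lorentz lorentz_commute) 
qed

lemma beta_eq:
  assumes "w \<in> U"
  shows "beta u v w = lorentz (dderiv u \<eta> w) (dderiv v x w) / x w $ 3
    - \<eta> w $ 3 * lorentz (dderiv u x w) (dderiv v x w) / (x w $ 3)\<^sup>2"
  unfolding beta_cov_N[OF assms] cov_N[OF assms] dS_metric_lorentz lorentz_simps
  using pos[OF assms] by (simp add: field_simps power2_eq_square)

abbreviation "h \<equiv> induced_metric x"

lemma dderiv_x_linear: "w \<in> U \<Longrightarrow> linear (\<lambda>v. dderiv v x w)"
  by (rule has_derivative_linear[OF dx])

lemmas dderiv_x_simps = linear_add[OF dderiv_x_linear] linear_diff[OF dderiv_x_linear] linear_scale[OF dderiv_x_linear]

lemma h_pos: "w \<in> U \<Longrightarrow> v \<noteq> 0 \<Longrightarrow> h w v v > 0"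
  unfolding induced_metric_def dS_metric_lorentz using spacelike[of w v] pos[of w] by simp

lemma dx_basis: "w \<in> U \<Longrightarrow> dderiv v x w = Re v *\<^sub>R dderiv 1 x w + Im v *\<^sub>R dderiv \<i> x w"
  by (rule dderiv_basis[OF x_differentiable])

lemma gram_pos:
  assumes "w \<in> U"
  shows "h w 1 1 * h w \<i> \<i> - (h w 1 \<i>)\<^sup>2 > 0"
proof -
  let ?E = "h w 1 1" and ?F = "h w 1 \<i>" and ?G = "h w \<i> \<i>"
  have E: "?E > 0" using h_pos[OF assms, of 1] by simp
  have "h w (Complex (- ?F) ?E) (Complex (- ?F) ?E) > 0"
    using E by (intro h_pos[OF assms]) (auto simp: complex_eq_iff)
  moreover have "h w (Complex a b) (Complex a b) = a\<^sup>2 * ?E + 2 * a * b * ?F + b\<^sup>2 * ?G" for a b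
    unfolding induced_metric_def dx_basis[OF assms, of "Complex a b"] dS_metric_lorentz lorentz_simps
    using pos[OF assms]
    by (simp add: lorentz_commute[of "dderiv \<i> x w" "dderiv 1 x w"] field_simps power2_eq_square)
  ultimately have "?E * (?E * ?G - ?F\<^sup>2) > 0" by (simp add: algebra_simps power2_eq_square)
  then show ?thesis using E zero_less_mult_pos by blast
qed

lemma det_frame:
  assumes "w \<in> U"
  shows "det (vector [dderiv 1 x w, dderiv \<i> x w, N w] :: real^3^3) \<noteq> 0"
proof -
  have g: "lorentz (dderiv 1 x w) (dderiv 1 x w) * lorentz (dderiv \<i> x w) (dderiv \<i> x w)
     - (lorentz (dderiv 1 x w) (dderiv \<i> x w))\<^sup>2 > 0"
  proof -
    have "h w 1 1 * h w \<i> \<i> - (h w 1 \<i>)\<^sup>2 = (lorentz (dderiv 1 x w) (dderiv 1 x w) * lorentz (dderiv \<i> x w) (dderiv \<i> x w)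
     - (lorentz (dderiv 1 x w) (dderiv \<i> x w))\<^sup>2) / (x w $ 3)^4"
      unfolding induced_metric_def dS_metric_lorentz
      by (simp add: diff_divide_distrib power2_eq_square power4_eq_xxxx)
    then show ?thesis using gram_pos[OF assms] pos[OF assms] by (simp add: zero_less_divide_iff)
  qed
  have n: "lorentz (N w) (N w) = - (x w $ 3)\<^sup>2"
    using unit[OF assms] by (simp add: lorentz_simps) (simp add: lorentz_def power2_eq_square)
  have "(det (vector [dderiv 1 x w, dderiv \<i> x w, N w] :: real^3^3))\<^sup>2 = 
    (x w $ 3)\<^sup>2 * (lorentz (dderiv 1 x w) (dderiv 1 x w) * lorentz (dderiv \<i> x w) (dderiv \<i> x w)
     - (lorentz (dderiv 1 x w) (dderiv \<i> x w))\<^sup>2)"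
    unfolding det_squared_lorentz_gram n
    by (simp add: lorentz_simps orth[OF assms] algebra_simps power2_eq_square)
  then show ?thesis using g pos[OF assms] 
    by (metis less_numeral_extra(3) mult_pos_pos zero_less_power zero_power2)
qed

lemma frame_zero:
  assumes "w \<in> U" "\<And>v. dS_metric (x w) y (dderiv v x w) = 0" "dS_metric (x w) y (N w) = 0"
  shows "y = 0"
  using lorentz_cramer[OF det_frame[OF assms(1)], of y] assms(2)[of 1] assms(2)[of \<i>] assms(3) pos[OF assms(1)]
  by (simp add: dS_metric_lorentz)

lemma koszul:
  assumes "w \<in> U"
  shows "(dderiv u (\<lambda>q. h q v z) w + dderiv v (\<lambda>q. h q u z) w - dderiv z (\<lambda>q. h q u v) w) / 2
     = dS_metric (x w) (hess u v w) (dderiv z x w)"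
proof -
  have "dderiv u (\<lambda>q. h q v z) w = dS_metric (x w) (hess u v w) (dderiv z x w) + dS_metric (x w) (hess u z w) (dderiv v x w)" for u v z
    unfolding induced_metric_def dderiv_dS_metric[OF assms dx_differentiable[OF assms] dx_differentiable[OF assms]]
    by (simp add: hess_def dS_metric_lorentz lorentz_commute)
  then show ?thesis using hess_commute[OF assms] by (simp add: field_simps)
qed

definition cram :: "complex \<Rightarrow> complex \<Rightarrow> complex \<Rightarrow> complex" where
  "cram u v w = (let k = dS_metric (x w) (hess u v w) (dderiv 1 x w); l = dS_metric (x w) (hess u v w) (dderiv \<i> x w);
      d = h w 1 1 * h w \<i> \<i> - (h w 1 \<i>)\<^sup>2 in
    of_real ((k * h w \<i> \<i> - l * h w 1 \<i>) / d) + of_real ((l * h w 1 1 - k * h w 1 \<i>) / d) * \<i>)"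

lemma h_cram:
  assumes "w \<in> U"
  shows "h w (cram u v w) z = dS_metric (x w) (hess u v w) (dderiv z x w)"
proof -
  let ?k = "dS_metric (x w) (hess u v w) (dderiv 1 x w)" and ?l = "dS_metric (x w) (hess u v w) (dderiv \<i> x w)"
  let ?E = "h w 1 1" and ?F = "h w 1 \<i>" and ?G = "h w \<i> \<i>"
  let ?d = "?E * ?G - ?F\<^sup>2"
  have d: "?d \<noteq> 0" using gram_pos[OF assms] by simp
  have 1: "h w c z = Re c * (Re z * ?E + Im z * ?F) + Im c * (Re z * ?F + Im z * ?G)" for c
    unfolding induced_metric_def dx_basis[OF assms, of c] dx_basis[OF assms, of z] dS_metric_lorentz lorentz_simps
    by (simp add: lorentz_commute[of "dderiv \<i> x w" "dderiv 1 x w"] algebra_simps add_divide_distrib)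
  have 2: "dS_metric (x w) (hess u v w) (dderiv z x w) = Re z * ?k + Im z * ?l"
    unfolding dx_basis[OF assms, of z] dS_metric_lorentz lorentz_simps
    by (simp add: add_divide_distrib)
  have 3: "Re (cram u v w) = (?k * ?G - ?l * ?F) / ?d" "Im (cram u v w) = (?l * ?E - ?k * ?F) / ?d"
    by (simp_all add: cram_def Let_def)
  have e: "(?k * ?G - ?l * ?F) * ?E + (?l * ?E - ?k * ?F) * ?F = ?k * ?d"
    "(?k * ?G - ?l * ?F) * ?F + (?l * ?E - ?k * ?F) * ?G = ?l * ?d" by algebra+
  have e1: "(?k * ?G - ?l * ?F) / ?d * ?E + (?l * ?E - ?k * ?F) / ?d * ?F = ?k"
    using e(1) d by (simp add: add_divide_distrib[symmetric] divide_eq_eq)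
  have e2: "(?k * ?G - ?l * ?F) / ?d * ?F + (?l * ?E - ?k * ?F) / ?d * ?G = ?l"
    using e(2) d by (simp add: add_divide_distrib[symmetric] divide_eq_eq)
  have "h w (cram u v w) z = Re z * ((?k * ?G - ?l * ?F) / ?d * ?E + (?l * ?E - ?k * ?F) / ?d * ?F) +
     Im z * ((?k * ?G - ?l * ?F) / ?d * ?F + (?l * ?E - ?k * ?F) / ?d * ?G)"
    unfolding 1 3 by (simp only: distrib_left mult.assoc mult.left_commute[of _ "Re z"] mult.left_commute[of _ "Im z"] add_ac)
  then show ?thesis unfolding e1 e2 2 .
qed

lemma christoffel_induced: 
  assumes "w \<in> U"
  shows "christoffel h w u v = cram u v w"
  unfolding christoffel_def koszul[OF assms]
proof (rule the_equality)
  show "\<forall>Z. h w (cram u v w) Z = dS_metric (x w) (hess u v w) (dderiv Z x w)"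
    by (simp add: h_cram[OF assms])
  fix V assume V: "\<forall>Z. h w V Z = dS_metric (x w) (hess u v w) (dderiv Z x w)"
  have "h w (V - cram u v w) (V - cram u v w) = h w V (V - cram u v w) - h w (cram u v w) (V - cram u v w)"
    by (simp add: induced_metric_def dderiv_x_simps assms dS_metric_lorentz lorentz_simps diff_divide_distrib)
  then have "h w (V - cram u v w) (V - cram u v w) = 0" using V h_cram[OF assms] by simp
  then show "V = cram u v w" using h_pos[OF assms, of "V - cram u v w"] by (metis less_irrefl right_minus_eq)
qed

lemma h_christoffel: "w \<in> U \<Longrightarrow> h w (christoffel h w u v) z = dS_metric (x w) (hess u v w) (dderiv z x w)"
  by (simp add: christoffel_induced h_cram)

lemma hess_decomposition:
  assumes "w \<in> U"
  shows "hess u v w = dderiv (christoffel h w u v) x w + beta u v w *\<^sub>R N w"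
proof -
  define V where "V = christoffel h w u v"
  define b where "b = beta u v w"
  have V: "dS_metric (x w) (dderiv V x w) (dderiv z x w) = dS_metric (x w) (hess u v w) (dderiv z x w)" for z
    using h_christoffel[OF assms] by (simp add: induced_metric_def V_def)
  have *: "dS_metric p (a - b - c *\<^sub>R d) e = dS_metric p a e - dS_metric p b e - c * dS_metric p d e" for p a b c d e
    by (simp add: dS_metric_lorentz lorentz_simps diff_divide_distrib)
  have "hess u v w - dderiv V x w - b *\<^sub>R N w = 0"
  proof (rule frame_zero[OF assms])
    show "dS_metric (x w) (hess u v w - dderiv V x w - b *\<^sub>R N w) (dderiv z x w) = 0" for z
      unfolding * V using dS_metric_dx_N[OF assms, of z] 
      by (simp add: dS_metric_lorentz lorentz_commute)
    show "dS_metric (x w) (hess u v w - dderiv V x w - b *\<^sub>R N w) (N w) = 0"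
      unfolding * dS_metric_dx_N[OF assms] dS_metric_N_N[OF assms] by (simp add: b_def beta_def)
  qed
  then show ?thesis by (simp add: V_def b_def algebra_simps)
qed

lemma N_nonzero: "w \<in> U \<Longrightarrow> N w \<noteq> 0"
  using dS_metric_N_N[of w] by (auto simp: dS_metric_def)

lemma second_form_eq:
  assumes "w \<in> U"
  shows "second_form x (\<lambda>w. N w) w u v = beta u v w"
  unfolding second_form_def
proof (rule the_equality)
  show "cov w u (dderiv v x) = dderiv (christoffel h w u v) x w + beta u v w *\<^sub>R N w"
    using hess_decomposition[OF assms] by (simp add: hess_def)
  then show "r = beta u v w" if "cov w u (dderiv v x) = dderiv (christoffel h w u v) x w + r *\<^sub>R N w" for r
    using that N_nonzero[OF assms] by simp
qed

lemma smooth_lorentz: "smooth_on U Y \<Longrightarrow> smooth_on U Z \<Longrightarrow> smooth_on U (\<lambda>q. lorentz (Y q) (Z q))"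
  by (rule smooth_on_bilinear[OF bounded_bilinear_lorentz open_U])

lemma smooth_dS_metric: "smooth_on U Y \<Longrightarrow> smooth_on U Z \<Longrightarrow> smooth_on U (\<lambda>q. dS_metric (x q) (Y q) (Z q))"
  unfolding dS_metric_lorentz using pos
  by (auto intro!: smooth_intros open_U smooth_lorentz smooth_x simp: less_imp_neq[symmetric])

lemma smooth_h: "smooth_on U (\<lambda>q. h q u v)"
  unfolding induced_metric_def by (intro smooth_dS_metric smooth_on_dderiv smooth_x)

lemma hess_eq: "w \<in> U \<Longrightarrow> hess u v w = dderiv u (dderiv v x) w - (1 / x w $ 3) *\<^sub>R hs_conn (dderiv u x w) (dderiv v x w)"
  unfolding hess_def by (rule cov_eq)

lemma smooth_hess: "smooth_on U (hess u v)"
proof (rule smooth_on_cong[OF open_U hess_eq[symmetric]])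
  show "smooth_on U (\<lambda>w. dderiv u (dderiv v x) w - (1 / x w $ 3) *\<^sub>R hs_conn (dderiv u x w) (dderiv v x w))"
    using pos by (auto intro!: smooth_intros open_U smooth_on_dderiv smooth_x 
        smooth_on_bilinear[OF bounded_bilinear_hs_conn] simp: less_imp_neq[symmetric])
qed

lemma smooth_cram: "smooth_on U (cram u v)"
proof -
  have "h q 1 1 * h q \<i> \<i> - (h q 1 \<i>)\<^sup>2 \<noteq> 0" if "q \<in> U" for q using gram_pos[OF that] by simp
  then show ?thesis
    unfolding cram_def[abs_def] Let_def
    by (intro smooth_intros open_U smooth_dS_metric smooth_h smooth_hess smooth_on_dderiv smooth_x)
qed

lemma smooth_christoffel: "smooth_on U (\<lambda>q. christoffel h q u v)"
  by (rule smooth_on_cong[OF open_U _ smooth_cram]) (simp add: christoffel_induced)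

lemma smooth_beta: "smooth_on U (beta u v)"
  unfolding beta_def[abs_def]
  by (intro smooth_intros open_U smooth_dS_metric smooth_hess smooth_x smooth_eta)

lemma cov_hess_tangent:
  assumes w: "w \<in> U"
  shows "dS_metric (x w) (cov w c (hess a b)) (dderiv z x w) =
    h w (dderiv c (\<lambda>q. christoffel h q a b) w + christoffel h w c (christoffel h w a b)) z
    + beta a b w * beta c z w"
proof -
  define V where "V q = christoffel h q a b" for q
  have dV: "(V has_derivative (\<lambda>v. dderiv v V w)) (at w)"
    unfolding V_def[abs_def] by (rule has_derivative_dderiv[OF smooth_on_imp_differentiable[OF smooth_christoffel w]])
  have db: "(beta a b has_derivative (\<lambda>v. dderiv v (beta a b) w)) (at w)"
    by (rule has_derivative_dderiv[OF smooth_on_imp_differentiable[OF smooth_beta w]])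
  let ?F = "\<lambda>q. Re (V q) *\<^sub>R dderiv 1 x q + Im (V q) *\<^sub>R dderiv \<i> x q + beta a b q *\<^sub>R N q"
  have F: "hess a b q = ?F q" if "q \<in> U" for q
    unfolding hess_decomposition[OF that] dx_basis[OF that, of "christoffel _ _ _ _"] V_def ..
  have dF: "(?F has_derivative (\<lambda>v. Re (V w) *\<^sub>R dderiv v (dderiv 1 x) w + Re (dderiv v V w) *\<^sub>R dderiv 1 x w
      + (Im (V w) *\<^sub>R dderiv v (dderiv \<i> x) w + Im (dderiv v V w) *\<^sub>R dderiv \<i> x w)
      + (beta a b w *\<^sub>R dderiv v (\<lambda>q. N q) w + dderiv v (beta a b) w *\<^sub>R N w))) (at w)"
    by (intro has_derivative_add has_derivative_scaleR bounded_linear.has_derivative[OF bounded_linear_Re dV]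
      bounded_linear.has_derivative[OF bounded_linear_Im dV] ddx[OF w] db has_derivative_dderiv[OF N_differentiable[OF w]])
  have "dderiv c (hess a b) w = dderiv c ?F w"
    by (rule dderiv_cong_open[OF open_U w F])
  note 1 = this[unfolded dderiv_eqI[OF dF]]
  note B = bounded_bilinear.add_right[OF bounded_bilinear_hs_conn] bounded_bilinear.scaleR_right[OF bounded_bilinear_hs_conn]
  have 2: "cov w c (hess a b) = dderiv (dderiv c V w) x w + 
     (Re (V w) *\<^sub>R hess c 1 w + Im (V w) *\<^sub>R hess c \<i> w)
     + dderiv c (beta a b) w *\<^sub>R N w + beta a b w *\<^sub>R cov w c (\<lambda>q. N q)"
    unfolding cov_eq[OF w] 1 F[OF w] unfolding hess_eq[OF w] dx_basis[OF w, of "dderiv c V w"] B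
    by (simp add: algebra_simps)
  have "(dderiv (V w) x has_derivative (\<lambda>v. Re (V w) *\<^sub>R dderiv v (dderiv 1 x) w + Im (V w) *\<^sub>R dderiv v (dderiv \<i> x) w)) (at w)"
    by (rule has_derivative_transform_within_open[OF _ open_U w dx_basis[symmetric]])
      (intro has_derivative_add has_derivative_scaleR_right ddx[OF w])
  from dderiv_eqI[OF this, of c]
  have 3: "Re (V w) *\<^sub>R hess c 1 w + Im (V w) *\<^sub>R hess c \<i> w = hess c (V w) w"
    unfolding hess_eq[OF w] dx_basis[OF w, of "V w"] B
    by (simp add: algebra_simps)
  have "dS_metric (x w) (cov w c (hess a b)) (dderiv z x w) =
    dS_metric (x w) (dderiv (dderiv c V w) x w) (dderiv z x w) + dS_metric (x w) (hess c (V w) w) (dderiv z x w)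
    + dderiv c (beta a b) w * dS_metric (x w) (dderiv z x w) (N w) + beta a b w * dS_metric (x w) (cov w c (\<lambda>q. N q)) (dderiv z x w)"
    unfolding 2 3 by (simp add: dS_metric_lorentz lorentz_simps add_divide_distrib lorentz_commute[of "dderiv z x w" "\<eta> w"])
  also have "\<dots> = h w (dderiv c V w) z + h w (christoffel h w c (V w)) z + beta a b w * beta c z w"
    unfolding dS_metric_dx_N[OF w] beta_cov_N[OF w, symmetric] h_christoffel[OF w] by (simp add: induced_metric_def)
  also have "h w (dderiv c V w) z + h w (christoffel h w c (V w)) z = h w (dderiv c V w + christoffel h w c (V w)) z"
    by (simp add: induced_metric_def dderiv_x_simps w dS_metric_lorentz lorentz_simps add_divide_distrib)
  finally show ?thesis unfolding V_def[abs_def] .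
qed

lemma cov_hess_eq:
  assumes w: "w \<in> U"
  shows "cov w c (hess a b) = dderiv c (dderiv a (dderiv b x)) w
    - (1 / x w $ 3) *\<^sub>R (hs_conn (dderiv c (dderiv a x) w) (dderiv b x w) + hs_conn (dderiv a x w) (dderiv c (dderiv b x) w))
    + (dderiv c x w $ 3 / (x w $ 3)\<^sup>2) *\<^sub>R hs_conn (dderiv a x w) (dderiv b x w)
    - (1 / x w $ 3) *\<^sub>R hs_conn (dderiv c x w) (dderiv a (dderiv b x) w)
    + (1 / (x w $ 3)\<^sup>2) *\<^sub>R hs_conn (dderiv c x w) (hs_conn (dderiv a x w) (dderiv b x w))"
proof -
  have r: "x w $ 3 \<noteq> 0" using pos[OF w] by simp
  have 1: "((\<lambda>q. 1 / x q $ 3) has_derivative (\<lambda>v. - dderiv v x w $ 3 / (x w $ 3)\<^sup>2)) (at w)"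
    by (rule has_derivative_eq_rhs[OF has_derivative_divide[OF has_derivative_const 
      bounded_linear.has_derivative[OF bounded_linear_vec_nth dx[OF w]] r]])
     (use r in \<open>simp add: fun_eq_iff field_simps power2_eq_square\<close>)
  have "(hess a b has_derivative (\<lambda>v. dderiv v (dderiv a (dderiv b x)) w - 
     ((1 / x w $ 3) *\<^sub>R (hs_conn (dderiv a x w) (dderiv v (dderiv b x) w) + hs_conn (dderiv v (dderiv a x) w) (dderiv b x w))
      + (- dderiv v x w $ 3 / (x w $ 3)\<^sup>2) *\<^sub>R hs_conn (dderiv a x w) (dderiv b x w)))) (at w)"
    by (rule has_derivative_transform_within_open[OF _ open_U w hess_eq[symmetric]])
      (intro has_derivative_diff dddx[OF w] has_derivative_scaleR 1 ddx[OF w]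
       bounded_bilinear.FDERIV[OF bounded_bilinear_hs_conn])
  from dderiv_eqI[OF this, of c]
  show ?thesis
    unfolding cov_eq[OF w] hess_eq[OF w]
    by (simp add: bounded_bilinear.diff_right[OF bounded_bilinear_hs_conn] bounded_bilinear.scaleR_right[OF bounded_bilinear_hs_conn]
      algebra_simps power2_eq_square)
qed

lemma hs_conn_curvature:
  "(X$3) *\<^sub>R hs_conn Y Y - (Y$3) *\<^sub>R hs_conn X Y + hs_conn X (hs_conn Y Y) - hs_conn Y (hs_conn X Y) =
    lorentz Y Y *\<^sub>R X - lorentz X Y *\<^sub>R Y"
  unfolding hs_conn_def lorentz_def by (simp add: vec_eq_iff forall_3 axis3_nth algebra_simps)

theorem gauss_equation:
  assumes w: "w \<in> U"
  shows "gauss_curvature h w = 1 - (beta 1 1 w * beta \<i> \<i> w - (beta 1 \<i> w)\<^sup>2) / (h w 1 1 * h w \<i> \<i> - (h w 1 \<i>)\<^sup>2)"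
proof -
  have c3: "dderiv \<i> (dderiv 1 (dderiv \<i> x)) w = dderiv 1 (dderiv \<i> (dderiv \<i> x)) w"
    by (rule dderiv_commute[OF open_U smooth_on_dderiv[OF smooth_x] w])
  have c2: "dderiv \<i> (dderiv 1 x) w = dderiv 1 (dderiv \<i> x) w"
    by (rule dderiv_commute[OF open_U smooth_x w])
  let ?a = "dderiv 1 x w" and ?b = "dderiv \<i> x w" and ?r = "x w $ 3"
  have "cov w 1 (hess \<i> \<i>) - cov w \<i> (hess 1 \<i>) = 
     (1 / ?r\<^sup>2) *\<^sub>R ((?a$3) *\<^sub>R hs_conn ?b ?b - (?b$3) *\<^sub>R hs_conn ?a ?b + hs_conn ?a (hs_conn ?b ?b) - hs_conn ?b (hs_conn ?a ?b))"
    unfolding cov_hess_eq[OF w] c3 c2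
    by (simp add: algebra_simps hs_conn_commute)
  then have 1: "cov w 1 (hess \<i> \<i>) - cov w \<i> (hess 1 \<i>) = (1 / ?r\<^sup>2) *\<^sub>R (lorentz ?b ?b *\<^sub>R ?a - lorentz ?a ?b *\<^sub>R ?b)"
    unfolding hs_conn_curvature .
  have "dS_metric (x w) (cov w 1 (hess \<i> \<i>)) ?a - dS_metric (x w) (cov w \<i> (hess 1 \<i>)) ?a =
     dS_metric (x w) (cov w 1 (hess \<i> \<i>) - cov w \<i> (hess 1 \<i>)) ?a"
    by (simp add: dS_metric_lorentz lorentz_simps diff_divide_distrib)
  also have "\<dots> = h w 1 1 * h w \<i> \<i> - (h w 1 \<i>)\<^sup>2"
    unfolding 1 using pos[OF w]
    by (simp add: dS_metric_lorentz lorentz_simps induced_metric_def lorentz_commute[of ?b ?a] field_simps power2_eq_square)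
  finally have 2: "dS_metric (x w) (cov w 1 (hess \<i> \<i>)) ?a - dS_metric (x w) (cov w \<i> (hess 1 \<i>)) ?a = h w 1 1 * h w \<i> \<i> - (h w 1 \<i>)\<^sup>2" .
  define R1 where "R1 = dderiv 1 (\<lambda>q. christoffel h q \<i> \<i>) w + christoffel h w 1 (christoffel h w \<i> \<i>)"
  define R2 where "R2 = dderiv \<i> (\<lambda>q. christoffel h q 1 \<i>) w + christoffel h w \<i> (christoffel h w 1 \<i>)"
  have "curvature_tensor h w 1 \<i> \<i> = R1 - R2" by (simp add: curvature_tensor_def R1_def R2_def)
  then have "h w (curvature_tensor h w 1 \<i> \<i>) 1 = h w R1 1 - h w R2 1"
    by (simp add: induced_metric_def dderiv_x_simps w dS_metric_lorentz lorentz_simps diff_divide_distrib)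
  also have "\<dots> = (h w 1 1 * h w \<i> \<i> - (h w 1 \<i>)\<^sup>2) - (beta 1 1 w * beta \<i> \<i> w - (beta 1 \<i> w)\<^sup>2)"
    using 2 unfolding cov_hess_tangent[OF w] R1_def[symmetric] R2_def[symmetric]
    by (simp add: beta_commute[OF w, of \<i> 1] power2_eq_square algebra_simps)
  finally show ?thesis using gram_pos[OF w] by (simp add: gauss_curvature_def diff_divide_distrib)
qed

end

section \<open>The Poincare disc frame\<close>

definition hs_vec :: "complex \<Rightarrow> real \<Rightarrow> real^3" where
  "hs_vec p r = vector [Re p, Im p, r]"

lemma hs_vec_nth [simp]: "hs_vec p r $ 1 = Re p" "hs_vec p r $ 2 = Im p" "hs_vec p r $ 3 = r"
  by (simp_all add: hs_vec_def)

lemma hs_vec_eta: "hs_vec (Complex (x$1) (x$2)) (x$3) = x"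
  by (simp add: vec_eq_iff forall_3)

lemma lorentz_hs_vec: "lorentz (hs_vec p r) (hs_vec q s) = Re (p * cnj q) - r * s"
  by (simp add: lorentz_def)

lemma hs_vec_scaleR: "a *\<^sub>R hs_vec p r = hs_vec (of_real a * p) (a * r)"
  by (simp add: vec_eq_iff forall_3)

lemma has_derivative_hs_vec:
  assumes "(p has_derivative p') (at w)" "(r has_derivative r') (at w)"
  shows "((\<lambda>q. hs_vec (p q) (r q)) has_derivative (\<lambda>v. hs_vec (p' v) (r' v))) (at w)"
proof -
  have "((\<lambda>q. hs_vec (p q) (r q) $ i) has_derivative (\<lambda>v. hs_vec (p' v) (r' v) $ i)) (at w)" for i
    using exhaust_3[of i] bounded_linear.has_derivative[OF bounded_linear_Re assms(1)]
      bounded_linear.has_derivative[OF bounded_linear_Im assms(1)] assms(2)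
    by auto
  then show ?thesis
    unfolding has_derivative_componentwise_within[of "\<lambda>q. hs_vec (p q) (r q)"] Basis_vec_def
    by (auto simp: inner_axis)
qed

lemma smooth_on_hs_vec [smooth_intros]:
  "open U \<Longrightarrow> smooth_on U p \<Longrightarrow> smooth_on U r \<Longrightarrow> smooth_on U (\<lambda>q. hs_vec (p q) (r q))"
  unfolding hs_vec_def by (intro smooth_intros)

definition disc_D :: "complex \<Rightarrow> real" where "disc_D m = 1 - (cmod m)\<^sup>2"
definition disc_S :: "complex \<Rightarrow> real" where "disc_S m = 1 + (cmod m)\<^sup>2"

definition disc_normal :: "complex \<Rightarrow> real^3" where
  "disc_normal m = hs_vec (- 2 * cnj m / of_real (disc_D m)) (disc_S m / disc_D m)"

text \<open>A linear isometry from the plane onto the Lorentz-orthogonal complement of \<open>disc_normal m\<close>.\<close>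

definition disc_frame :: "complex \<Rightarrow> complex \<Rightarrow> real^3" where
  "disc_frame m t = hs_vec (- (t + (cnj m)\<^sup>2 * cnj t) / of_real (disc_D m)) (2 * Re (m * t) / disc_D m)"

lemma disc_D_pos: "cmod m < 1 \<Longrightarrow> disc_D m > 0"
  by (simp add: disc_D_def power_less_one_iff abs_square_less_1)

lemma disc_S_pos: "disc_S m > 0"
  by (simp add: disc_S_def add_pos_nonneg)

lemma disc_D_complex: "complex_of_real (disc_D m) = 1 - m * cnj m"
  and disc_S_complex: "complex_of_real (disc_S m) = 1 + m * cnj m"
  by (simp_all add: disc_D_def disc_S_def complex_norm_square[symmetric])

lemma smooth_on_disc_D [smooth_intros]: "open U \<Longrightarrow> smooth_on U m \<Longrightarrow> smooth_on U (\<lambda>w. disc_D (m w))"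
  and smooth_on_disc_S [smooth_intros]: "open U \<Longrightarrow> smooth_on U m \<Longrightarrow> smooth_on U (\<lambda>w. disc_S (m w))"
  unfolding disc_D_def disc_S_def by (intro smooth_intros; assumption)+

lemma lorentz_disc_frame:
  assumes "cmod m < 1"
  shows "lorentz (disc_frame m s) (disc_frame m t) = Re (s * cnj t)"
proof -
  have D: "disc_D m \<noteq> 0" using disc_D_pos[OF assms] by simp
  have "Re ((s + (cnj m)\<^sup>2 * cnj s) * cnj (t + (cnj m)\<^sup>2 * cnj t)) - 2 * Re (m * s) * (2 * Re (m * t)) =
      (disc_D m)\<^sup>2 * Re (s * cnj t)"
    unfolding disc_D_def cmod_power2 unfolding power2_eq_square by (simp add: algebra_simps)
  moreover have "lorentz (disc_frame m s) (disc_frame m t) =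
     (Re ((s + (cnj m)\<^sup>2 * cnj s) * cnj (t + (cnj m)\<^sup>2 * cnj t)) - 2 * Re (m * s) * (2 * Re (m * t))) / (disc_D m)\<^sup>2"
  proof -
    have "Re ((- A / of_real d) * cnj (- B / of_real d)) - a / d * (b / d) = (Re (A * cnj B) - a * b) / d\<^sup>2" for A B a b d
      by (simp add: Re_divide_of_real Im_divide_of_real power2_eq_square diff_divide_distrib add_divide_distrib)
    then show ?thesis unfolding disc_frame_def lorentz_hs_vec .
  qed
  ultimately show ?thesis using D by simp
qed

lemma lorentz_disc_frame_normal: "lorentz (disc_frame m t) (disc_normal m) = 0"
proof -
  have "Re ((t + (cnj m)\<^sup>2 * cnj t) * (2 * m)) - 2 * Re (m * t) * disc_S m = 0"
    unfolding disc_S_def cmod_power2 unfolding power2_eq_square by (simp add: algebra_simps)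
  moreover have "lorentz (disc_frame m t) (disc_normal m) =
    (Re ((t + (cnj m)\<^sup>2 * cnj t) * (2 * m)) - 2 * Re (m * t) * disc_S m) / (disc_D m)\<^sup>2"
    unfolding disc_frame_def disc_normal_def lorentz_hs_vec
    by (simp add: power2_eq_square diff_divide_distrib add_divide_distrib algebra_simps)
  ultimately show ?thesis by simp
qed

lemma lorentz_disc_normal: "cmod m < 1 \<Longrightarrow> lorentz (disc_normal m) (disc_normal m) = -1"
proof -
  assume "cmod m < 1"
  then have "disc_D m \<noteq> 0" using disc_D_pos by force
  moreover have "(Re (2 * m * (2 * cnj m)) - disc_S m * disc_S m) = - (disc_D m)\<^sup>2"
    unfolding disc_S_def disc_D_def cmod_power2 unfolding power2_eq_square by (simp add: algebra_simps)
  moreover have "lorentz (disc_normal m) (disc_normal m) = (Re (2 * m * (2 * cnj m)) - disc_S m * disc_S m) / (disc_D m)\<^sup>2"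
    unfolding disc_normal_def lorentz_hs_vec
    by (simp add: power2_eq_square diff_divide_distrib add_divide_distrib)
  ultimately show ?thesis by simp
qed

lemma lorentz_disc_normal_scaled:
  assumes "cmod m < 1" "e * e = 1"
  shows "((e *\<^sub>R disc_normal m) $ 1)\<^sup>2 + ((e *\<^sub>R disc_normal m) $ 2)\<^sup>2 - ((e *\<^sub>R disc_normal m) $ 3)\<^sup>2 = -1"
proof -
  have "((e *\<^sub>R disc_normal m) $ 1)\<^sup>2 + ((e *\<^sub>R disc_normal m) $ 2)\<^sup>2 - ((e *\<^sub>R disc_normal m) $ 3)\<^sup>2 =
    e * e * lorentz (disc_normal m) (disc_normal m)"
    unfolding lorentz_def by (simp add: power2_eq_square algebra_simps)
  then show ?thesis using assms lorentz_disc_normal by simp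
qed

lemma det_disc_frame:
  assumes "cmod m < 1"
  shows "det (vector [disc_frame m s, disc_frame m t, r *\<^sub>R disc_normal m] :: real^3^3) = r * Im (cnj s * t)"
proof -
  have D: "disc_D m \<noteq> 0" using disc_D_pos[OF assms] by simp
  define a b where "a = Re m" and "b = Im m"
  have m: "m = Complex a b" by (simp add: a_def b_def)
  have lin: "disc_frame m u = Re u *\<^sub>R disc_frame m 1 + Im u *\<^sub>R disc_frame m \<i>" for u
    using D by (simp add: disc_frame_def vec_eq_iff forall_3 Re_divide_of_real Im_divide_of_real field_simps power2_eq_square)
  have e: "disc_frame m 1 = (1 / disc_D m) *\<^sub>R vector [- (1 + a\<^sup>2 - b\<^sup>2), 2 * a * b, 2 * a]"
    "disc_frame m \<i> = (1 / disc_D m) *\<^sub>R vector [2 * a * b, - (1 - a\<^sup>2 + b\<^sup>2), - 2 * b]"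
    "disc_normal m = (1 / disc_D m) *\<^sub>R vector [- 2 * a, 2 * b, 1 + a\<^sup>2 + b\<^sup>2]"
    unfolding disc_frame_def disc_normal_def disc_S_def cmod_power2
    by (simp_all add: vec_eq_iff forall_3 a_def b_def
        Re_divide_of_real Im_divide_of_real field_simps power2_eq_square)
  have "(1 - a\<^sup>2 - b\<^sup>2)^3 = - (1 + a\<^sup>2 - b\<^sup>2) * (- (1 - a\<^sup>2 + b\<^sup>2) * (1 + a\<^sup>2 + b\<^sup>2) - 2 * b * (- 2 * b))
     - 2 * a * b * (2 * a * b * (1 + a\<^sup>2 + b\<^sup>2) - (- 2 * b) * (- 2 * a))
     + 2 * a * (2 * a * b * (2 * b) - (- (1 - a\<^sup>2 + b\<^sup>2)) * (- 2 * a))"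
    by algebra
  moreover have "disc_D m = 1 - a\<^sup>2 - b\<^sup>2" by (simp add: disc_D_def cmod_power2 a_def b_def)
  ultimately have D3: "(disc_D m)^3 = - (1 + a\<^sup>2 - b\<^sup>2) * (- (1 - a\<^sup>2 + b\<^sup>2) * (1 + a\<^sup>2 + b\<^sup>2) - 2 * b * (- 2 * b))
     - 2 * a * b * (2 * a * b * (1 + a\<^sup>2 + b\<^sup>2) - (- 2 * b) * (- 2 * a))
     + 2 * a * (2 * a * b * (2 * b) - (- (1 - a\<^sup>2 + b\<^sup>2)) * (- 2 * a))" by simp
  have scale: "det (vector [k *\<^sub>R A, k *\<^sub>R B, k *\<^sub>R C] :: real^3^3) = k^3 * det (vector [A, B, C] :: real^3^3)"
    for k and A B C :: "real^3"
    unfolding det_3 vector_3 by (simp add: power3_eq_cube algebra_simps)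
  have "det (vector [disc_frame m 1, disc_frame m \<i>, disc_normal m] :: real^3^3) = (1 / disc_D m)^3 * (disc_D m)^3"
    unfolding e scale unfolding D3 unfolding det_3 vector_3 by algebra
  then have 1: "det (vector [disc_frame m 1, disc_frame m \<i>, disc_normal m] :: real^3^3) = 1"
    using D by (simp add: power_divide)
  have comb: "det (vector [p *\<^sub>R A + q *\<^sub>R B, p' *\<^sub>R A + q' *\<^sub>R B, k *\<^sub>R C] :: real^3^3) =
     k * (p * q' - q * p') * det (vector [A, B, C] :: real^3^3)" for p q p' q' k and A B C :: "real^3"
    unfolding det_3 vector_3 by (simp add: algebra_simps)
  show ?thesis unfolding lin[of s] lin[of t] comb 1 by simp
qed

lemma disc_frame_exists:
  assumes "cmod m < 1" "lorentz X (disc_normal m) = 0"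
  shows "X = disc_frame m ((- Complex (X$1) (X$2) + (cnj m)\<^sup>2 * cnj (Complex (X$1) (X$2))) / of_real (disc_S m))"
proof -
  have D: "disc_D m \<noteq> 0" and S: "disc_S m \<noteq> 0" using disc_D_pos[OF assms(1)] disc_S_pos[of m] by auto
  define p where "p = Complex (X$1) (X$2)"
  define t where "t = (- p + (cnj m)\<^sup>2 * cnj p) / of_real (disc_S m)"
  have X: "X = hs_vec p (X$3)" by (simp add: p_def hs_vec_eta)
  have "lorentz X (disc_normal m) = (Re (p * (- 2 * m)) - X$3 * disc_S m) / disc_D m"
    by (subst X) (simp add: disc_normal_def lorentz_hs_vec diff_divide_distrib)
  then have 3: "X$3 * disc_S m = - 2 * Re (p * m)" using assms(2) D by (simp add: algebra_simps)
  have cS: "complex_of_real (disc_S m) \<noteq> 0" and cD: "complex_of_real (disc_D m) \<noteq> 0" using S D by auto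
  have "of_real (disc_S m) * (- (t + (cnj m)\<^sup>2 * cnj t)) = of_real (disc_S m) * (of_real (disc_D m) * p)"
  proof -
    have St: "of_real (disc_S m) * t = - p + (cnj m)\<^sup>2 * cnj p" using cS by (simp add: t_def)
    then have cSt: "of_real (disc_S m) * cnj t = cnj (- p + (cnj m)\<^sup>2 * cnj p)" by (metis complex_cnj_complex_of_real complex_cnj_mult)
    then have "of_real (disc_S m) * (- (t + (cnj m)\<^sup>2 * cnj t)) = - ((- p + (cnj m)\<^sup>2 * cnj p) + (cnj m)\<^sup>2 * cnj (- p + (cnj m)\<^sup>2 * cnj p))"
      unfolding St[symmetric] cSt[symmetric] by (simp add: algebra_simps)
    also have "\<dots> = of_real (disc_S m) * (of_real (disc_D m) * p)"
      unfolding disc_S_complex disc_D_complex by (simp add: algebra_simps power2_eq_square)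
    finally show ?thesis .
  qed
  then have p: "- (t + (cnj m)\<^sup>2 * cnj t) / of_real (disc_D m) = p"
    using cS cD by (simp only: mult_left_cancel divide_eq_eq not_False_eq_True if_True mult.commute)
  have "2 * Re (m * t) * disc_S m = - 2 * Re (p * m) * disc_D m"
  proof -
    have "Re (m * t) * disc_S m = Re (m * (- p + (cnj m)\<^sup>2 * cnj p))"
      using S by (simp add: t_def Re_divide_of_real Im_divide_of_real add_divide_distrib diff_divide_distrib algebra_simps)
    then show ?thesis unfolding disc_D_def cmod_power2 by (simp add: algebra_simps power2_eq_square)
  qed
  then have "2 * Re (m * t) / disc_D m * disc_S m = X$3 * disc_S m" unfolding 3 using D by (simp add: field_simps)
  then have "2 * Re (m * t) / disc_D m = X$3" using S mult_right_cancel by blast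
  then show ?thesis using p X unfolding disc_frame_def t_def p_def by simp
qed

lemma has_derivative_of_real_imp:
  assumes "has_wirtinger (\<lambda>q. complex_of_real (r q)) w \<alpha> \<beta>"
  shows "(r has_derivative (\<lambda>v. Re (\<alpha> * v + \<beta> * cnj v))) (at w)"
  using bounded_linear.has_derivative[OF bounded_linear_Re assms[unfolded has_wirtinger_def]] by simp

lemma has_wirtinger_disc_D:
  "has_wirtinger m w \<mu> \<nu> \<Longrightarrow> has_wirtinger (\<lambda>q. complex_of_real (disc_D (m q))) w
     (- (m w * cnj \<nu> + \<mu> * cnj (m w))) (- (m w * cnj \<mu> + \<nu> * cnj (m w)))"
  unfolding disc_D_complex
  by (rule has_wirtinger_eq[OF has_wirtinger_diff[OF has_wirtinger_const has_wirtinger_mult[OF _ has_wirtinger_cnj]]])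
    auto

lemma has_wirtinger_disc_S:
  "has_wirtinger m w \<mu> \<nu> \<Longrightarrow> has_wirtinger (\<lambda>q. complex_of_real (disc_S (m q))) w
     (m w * cnj \<nu> + \<mu> * cnj (m w)) (m w * cnj \<mu> + \<nu> * cnj (m w))"
  unfolding disc_S_complex
  by (rule has_wirtinger_eq[OF has_wirtinger_add[OF has_wirtinger_const has_wirtinger_mult[OF _ has_wirtinger_cnj]]])
    auto

lemma has_derivative_disc_normal:
  assumes "cmod (m w) < 1" and m: "has_wirtinger m w \<mu> \<nu>"
  shows "((\<lambda>q. disc_normal (m q)) has_derivative
    (\<lambda>v. (2 / disc_D (m w)) *\<^sub>R disc_frame (m w) (cnj (\<mu> * v + \<nu> * cnj v)))) (at w)"
proof -
  have D: "disc_D (m w) \<noteq> 0" using disc_D_pos[OF assms(1)] by simp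
  then have cD: "complex_of_real (disc_D (m w)) \<noteq> 0" by simp
  note d = has_wirtinger_disc_D[OF m] and s = has_wirtinger_disc_S[OF m]
  have 1: "has_wirtinger (\<lambda>q. - 2 * cnj (m q) / of_real (disc_D (m q))) w
     (- 2 * (cnj \<nu> + (cnj (m w))\<^sup>2 * \<mu>) / (of_real (disc_D (m w)))\<^sup>2)
     (- 2 * (cnj \<mu> + (cnj (m w))\<^sup>2 * \<nu>) / (of_real (disc_D (m w)))\<^sup>2)"
    by (rule has_wirtinger_eq[OF has_wirtinger_divide[OF has_wirtinger_mult[OF has_wirtinger_const has_wirtinger_cnj[OF m]] d cD]])
      (simp_all add: disc_D_complex algebra_simps power2_eq_square)
  have "has_wirtinger (\<lambda>q. complex_of_real (disc_S (m q)) / of_real (disc_D (m q))) w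
     (2 * (m w * cnj \<nu> + \<mu> * cnj (m w)) / (of_real (disc_D (m w)))\<^sup>2)
     (2 * (m w * cnj \<mu> + \<nu> * cnj (m w)) / (of_real (disc_D (m w)))\<^sup>2)"
    by (rule has_wirtinger_eq[OF has_wirtinger_divide[OF s d cD]])
      (simp_all add: disc_D_complex disc_S_complex algebra_simps power2_eq_square)
  then have 2: "has_wirtinger (\<lambda>q. complex_of_real (disc_S (m q) / disc_D (m q))) w
     (2 * (m w * cnj \<nu> + \<mu> * cnj (m w)) / (of_real (disc_D (m w)))\<^sup>2)
     (2 * (m w * cnj \<mu> + \<nu> * cnj (m w)) / (of_real (disc_D (m w)))\<^sup>2)"
    by simp
  have e1: "- 2 * (cnj \<nu> + (cnj (m w))\<^sup>2 * \<mu>) / (of_real (disc_D (m w)))\<^sup>2 * v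
     + - 2 * (cnj \<mu> + (cnj (m w))\<^sup>2 * \<nu>) / (of_real (disc_D (m w)))\<^sup>2 * cnj v =
     of_real (2 / disc_D (m w)) * (- (cnj (\<mu> * v + \<nu> * cnj v) + (cnj (m w))\<^sup>2 * cnj (cnj (\<mu> * v + \<nu> * cnj v))) / of_real (disc_D (m w)))" for v
    using cD by (simp add: field_simps power2_eq_square)
  have e2: "Re (2 * (m w * cnj \<nu> + \<mu> * cnj (m w)) / (of_real (disc_D (m w)))\<^sup>2 * v
     + 2 * (m w * cnj \<mu> + \<nu> * cnj (m w)) / (of_real (disc_D (m w)))\<^sup>2 * cnj v) =
     2 / disc_D (m w) * (2 * Re (m w * cnj (\<mu> * v + \<nu> * cnj v)) / disc_D (m w))" for v
  proof -
    have "2 * (m w * cnj \<nu> + \<mu> * cnj (m w)) / (of_real (disc_D (m w)))\<^sup>2 * v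
     + 2 * (m w * cnj \<mu> + \<nu> * cnj (m w)) / (of_real (disc_D (m w)))\<^sup>2 * cnj v =
      2 * (m w * cnj (\<mu> * v + \<nu> * cnj v) + cnj (m w * cnj (\<mu> * v + \<nu> * cnj v))) / of_real ((disc_D (m w))\<^sup>2)"
      using cD by (simp add: field_simps power2_eq_square)
    also have "Re \<dots> = 2 * (2 * Re (m w * cnj (\<mu> * v + \<nu> * cnj v))) / (disc_D (m w))\<^sup>2"
      by (simp only: Re_divide_of_real) (simp add: field_simps)
    finally show ?thesis by (simp add: power2_eq_square)
  qed
  show ?thesis
    unfolding disc_normal_def disc_frame_def hs_vec_scaleR
    using has_derivative_hs_vec[OF 1[unfolded has_wirtinger_def] has_derivative_of_real_imp[OF 2]]
    unfolding e1 e2 .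
qed

lemma stereographic_disc_normal:
  assumes "cmod m < 1"
  shows "stereographic (disc_normal m) = (if m = 0 then None else Some (inverse m))"
    and "stereographic (- disc_normal m) = Some (cnj m)"
proof -
  have D: "disc_D m > 0" by (rule disc_D_pos[OF assms])
  have c: "Complex (Re z) (Im z) = z" for z by (rule complex_surj)
  have 1: "disc_normal m $ 3 = 1 \<longleftrightarrow> m = 0" using D
    by (simp add: disc_normal_def divide_eq_eq) (simp add: disc_S_def disc_D_def)
  have D': "1 \<noteq> m * cnj m" using D disc_D_complex[of m] by (metis diff_self of_real_eq_0_iff less_irrefl)
  have "Complex (disc_normal m $ 1) (disc_normal m $ 2) / of_real (1 - disc_normal m $ 3) = inverse m" if "m \<noteq> 0"
    unfolding disc_normal_def hs_vec_nth c of_real_diff of_real_divide disc_S_complex disc_D_complex of_real_1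
    using D' that by (simp add: field_simps)
  then show "stereographic (disc_normal m) = (if m = 0 then None else Some (inverse m))"
    unfolding stereographic_def 1 by simp
  have "(- disc_normal m) $ 3 < 0" using D disc_S_pos[of m] by (simp add: disc_normal_def)
  then have 2: "(- disc_normal m) $ 3 \<noteq> 1" by linarith
  have "- disc_normal m = hs_vec (2 * cnj m / of_real (disc_D m)) (- (disc_S m / disc_D m))"
    by (simp add: disc_normal_def vec_eq_iff forall_3)
  then have "Complex ((- disc_normal m) $ 1) ((- disc_normal m) $ 2) / of_real (1 - (- disc_normal m) $ 3)
     = 2 * cnj m / (1 - m * cnj m) / (1 + (1 + m * cnj m) / (1 - m * cnj m))"
    unfolding hs_vec_nth by (simp only: hs_vec_nth c) (simp add: disc_S_complex disc_D_complex)
  also have "1 + (1 + m * cnj m) / (1 - m * cnj m) = 2 / (1 - m * cnj m)" using D' by (simp add: field_simps)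
  also have "2 * cnj m / (1 - m * cnj m) / (2 / (1 - m * cnj m)) = cnj m" using D' by simp
  finally show "stereographic (- disc_normal m) = Some (cnj m)"
    unfolding stereographic_def using 2 by simp
qed

lemma stereographic_height_disc:
  assumes "cmod m < 1"
  shows "stereographic_height (if m = 0 then None else Some (inverse m)) = disc_S m / disc_D m"
    and "stereographic_height (Some (cnj m)) = - (disc_S m / disc_D m)"
proof -
  have D: "disc_D m > 0" by (rule disc_D_pos[OF assms])
  show "stereographic_height (Some (cnj m)) = - (disc_S m / disc_D m)"
    using D by (simp add: stereographic_height_def disc_S_def disc_D_def minus_divide_right)
  show "stereographic_height (if m = 0 then None else Some (inverse m)) = disc_S m / disc_D m"
  proof (cases "m = 0")
    case False
    then have "1 + (inverse (cmod m))\<^sup>2 = disc_S m / (cmod m)\<^sup>2" "(inverse (cmod m))\<^sup>2 - 1 = disc_D m / (cmod m)\<^sup>2"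
      by (simp_all add: disc_S_def disc_D_def field_simps power_inverse)
    then show ?thesis using False by (simp add: stereographic_height_def norm_inverse)
  qed (simp add: stereographic_height_def disc_S_def disc_D_def)
qed

text \<open>The inverse of the Poincare disc parametrisation of the upper sheet of the hyperboloid.\<close>

lemma disc_normal_inverse:
  fixes e :: "real^3"
  assumes "(e$1)\<^sup>2 + (e$2)\<^sup>2 - (e$3)\<^sup>2 = -1" "e$3 \<ge> 0"
  defines "m \<equiv> - cnj (Complex (e$1) (e$2)) / of_real (e$3 + 1)"
  shows "cmod m < 1" "disc_normal m = e"
proof -
  have e3: "e$3 + 1 > 0" using assms(2) by simp
  have sq: "(cmod (Complex (e$1) (e$2)))\<^sup>2 = (e$3 - 1) * (e$3 + 1)"
    using assms(1) unfolding cmod_power2 by (simp add: power2_eq_square algebra_simps)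
  have m2: "(cmod m)\<^sup>2 = (e$3 - 1) / (e$3 + 1)"
  proof -
    have "cmod m = cmod (Complex (e$1) (e$2)) / (e$3 + 1)"
      using e3 unfolding m_def norm_divide norm_minus_cancel complex_mod_cnj norm_of_real by simp
    then show ?thesis using e3 by (simp add: power_divide sq) (simp add: power2_eq_square)
  qed
  then have D: "disc_D m = 2 / (e$3 + 1)" and S: "disc_S m = 2 * e$3 / (e$3 + 1)"
    using e3 by (simp_all add: disc_D_def disc_S_def field_simps)
  have "(cmod m)\<^sup>2 < 1" using e3 unfolding m2 by (simp add: divide_less_eq)
  then show "cmod m < 1" using abs_square_less_1[of "cmod m"] by simp
  have "- 2 * cnj m / of_real (disc_D m) = Complex (e$1) (e$2)"
    unfolding D using e3 by (simp add: m_def complex_eq_iff Re_divide_of_real Im_divide_of_real)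
  moreover have "disc_S m / disc_D m = e$3" unfolding D S using e3 by simp
  ultimately show "disc_normal m = e" by (simp add: disc_normal_def hs_vec_eta)
qed

locale disc_surface = half_space_surface +
  fixes m :: "complex \<Rightarrow> complex" and \<epsilon> :: real
  assumes eps: "\<epsilon> = 1 \<or> \<epsilon> = -1"
    and m_less: "w \<in> U \<Longrightarrow> cmod (m w) < 1"
    and eta: "w \<in> U \<Longrightarrow> \<eta> w = \<epsilon> *\<^sub>R disc_normal (m w)"
begin

lemma eps_sq: "\<epsilon> * \<epsilon> = 1" using eps by auto

lemma D_pos: "w \<in> U \<Longrightarrow> disc_D (m w) > 0"
  using disc_D_pos m_less by blast

lemma eta3: "w \<in> U \<Longrightarrow> \<eta> w $ 3 = \<epsilon> * (disc_S (m w) / disc_D (m w))"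
  by (simp add: eta disc_normal_def)

lemma orth_disc_normal: "w \<in> U \<Longrightarrow> lorentz (dderiv v x w) (disc_normal (m w)) = 0"
  using orth[of w v] eps by (auto simp: eta lorentz_simps)

lemma frame_exists:
  assumes "w \<in> U"
  shows "\<exists>b c. \<forall>v. dderiv v x w = disc_frame (m w) (b * v + cnj c * cnj v)"
proof -
  define p where "p q = Complex (x q $ 1) (x q $ 2)" for q
  have peq: "p q = of_real (x q $ 1) + \<i> * of_real (x q $ 2)" for q by (simp add: p_def complex_eq_iff)
  note nth = bounded_linear.has_derivative[OF bounded_linear_vec_nth dx[OF assms]]
  have "(p has_derivative (\<lambda>v. of_real (dderiv v x w $ 1) + \<i> * of_real (dderiv v x w $ 2))) (at w)"
    unfolding peq[abs_def]
    by (intro has_derivative_add has_derivative_mult_right bounded_linear.has_derivative[OF bounded_linear_of_real] nth)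
  then have d: "dderiv v p w = Complex (dderiv v x w $ 1) (dderiv v x w $ 2)" 
    and diff: "p differentiable (at w)" for v
    unfolding differentiable_def by (auto dest: dderiv_eqI simp: complex_eq_iff)
  define \<alpha> \<beta> where "\<alpha> = dz p w" and "\<beta> = dzbar p w"
  have pv: "Complex (dderiv v x w $ 1) (dderiv v x w $ 2) = \<alpha> * v + \<beta> * cnj v" for v
    using has_wirtinger_dderiv[OF has_wirtinger_self[OF diff], of v] d[of v] by (simp add: \<alpha>_def \<beta>_def)
  let ?S = "complex_of_real (disc_S (m w))"
  have "dderiv v x w = disc_frame (m w) ((- \<alpha> + (cnj (m w))\<^sup>2 * cnj \<beta>) / ?S * v
     + cnj (cnj (- \<beta> + (cnj (m w))\<^sup>2 * cnj \<alpha>) / ?S) * cnj v)" for v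
  proof -
    have "(- \<alpha> + (cnj (m w))\<^sup>2 * cnj \<beta>) / ?S * v + cnj (cnj (- \<beta> + (cnj (m w))\<^sup>2 * cnj \<alpha>) / ?S) * cnj v =
      (- (\<alpha> * v + \<beta> * cnj v) + (cnj (m w))\<^sup>2 * cnj (\<alpha> * v + \<beta> * cnj v)) / ?S"
      by (simp add: add_divide_distrib diff_divide_distrib algebra_simps)
    then show ?thesis
      using disc_frame_exists[OF m_less[OF assms] orth_disc_normal[OF assms], of v] unfolding pv by simp
  qed
  then show ?thesis by blast
qed

context
  fixes w b c assumes w: "w \<in> U"
    and frame: "\<And>v. dderiv v x w = disc_frame (m w) (b * v + cnj c * cnj v)"
begin

lemma h_frame: "h w u v = Re ((b * u + cnj c * cnj u) * cnj (b * v + cnj c * cnj v)) / (x w $ 3)\<^sup>2"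
  unfolding induced_metric_def dS_metric_lorentz frame lorentz_disc_frame[OF m_less[OF w]] ..

lemma gram_frame: "h w 1 1 * h w \<i> \<i> - (h w 1 \<i>)\<^sup>2 = ((cmod b)\<^sup>2 - (cmod c)\<^sup>2)\<^sup>2 / (x w $ 3)^4"
proof -
  have "Re ((b * 1 + cnj c * cnj 1) * cnj (b * 1 + cnj c * cnj 1)) * Re ((b * \<i> + cnj c * cnj \<i>) * cnj (b * \<i> + cnj c * cnj \<i>)) - 
    (Re ((b * 1 + cnj c * cnj 1) * cnj (b * \<i> + cnj c * cnj \<i>)))\<^sup>2 = ((cmod b)\<^sup>2 - (cmod c)\<^sup>2)\<^sup>2"
    unfolding cmod_power2 unfolding power2_eq_square by (simp add: algebra_simps)
  moreover have "h w 1 1 * h w \<i> \<i> - (h w 1 \<i>)\<^sup>2 = (Re ((b * 1 + cnj c * cnj 1) * cnj (b * 1 + cnj c * cnj 1)) * Re ((b * \<i> + cnj c * cnj \<i>) * cnj (b * \<i> + cnj c * cnj \<i>)) - 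
    (Re ((b * 1 + cnj c * cnj 1) * cnj (b * \<i> + cnj c * cnj \<i>)))\<^sup>2) / (x w $ 3)^4"
  proof -
    have "a / r\<^sup>2 * (b / r\<^sup>2) - (e / r\<^sup>2)\<^sup>2 = (a * b - e\<^sup>2) / r^4" for a b e r :: real
      by (simp add: diff_divide_distrib power2_eq_square power4_eq_xxxx)
    then show ?thesis unfolding h_frame .
  qed
  ultimately show ?thesis by simp
qed

lemma beta_frame:
  assumes mw: "has_wirtinger m w \<mu> \<nu>"
  shows "beta u v w = \<epsilon> / (disc_D (m w) * (x w $ 3)\<^sup>2) *
    (2 * x w $ 3 * Re ((b * v + cnj c * cnj v) * (\<mu> * u + \<nu> * cnj u))
     - disc_S (m w) * Re ((b * u + cnj c * cnj u) * cnj (b * v + cnj c * cnj v)))"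
proof -
  have "((\<lambda>q. \<epsilon> *\<^sub>R disc_normal (m q)) has_derivative
     (\<lambda>v. \<epsilon> *\<^sub>R ((2 / disc_D (m w)) *\<^sub>R disc_frame (m w) (cnj (\<mu> * v + \<nu> * cnj v))))) (at w)"
    by (rule has_derivative_scaleR_right[OF has_derivative_disc_normal[OF m_less[OF w] mw]])
  then have "(\<eta> has_derivative
     (\<lambda>v. \<epsilon> *\<^sub>R ((2 / disc_D (m w)) *\<^sub>R disc_frame (m w) (cnj (\<mu> * v + \<nu> * cnj v))))) (at w)"
    by (rule has_derivative_transform_within_open[OF _ open_U w eta[symmetric]])
  then have e: "dderiv u \<eta> w = \<epsilon> *\<^sub>R ((2 / disc_D (m w)) *\<^sub>R disc_frame (m w) (cnj (\<mu> * u + \<nu> * cnj u)))"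
    by (rule dderiv_eqI)
  define A where "A = Re ((b * v + cnj c * cnj v) * (\<mu> * u + \<nu> * cnj u))"
  define B where "B = Re ((b * u + cnj c * cnj u) * cnj (b * v + cnj c * cnj v))"
  have A: "Re (cnj (\<mu> * u + \<nu> * cnj u) * cnj (b * v + cnj c * cnj v)) = A"
    unfolding A_def by (simp only: complex_cnj_mult[symmetric] cnj.sel mult.commute)
  show ?thesis
    unfolding beta_eq[OF w] e frame lorentz_simps lorentz_disc_frame[OF m_less[OF w]] eta3[OF w] A
      A_def[symmetric] B_def[symmetric]
    using pos[OF w] D_pos[OF w] by (simp add: field_simps power2_eq_square)
qed

lemma det_frame_eq:
  "det (vector [dderiv 1 x w, dderiv \<i> x w, N w] :: real^3^3) = x w $ 3 * \<epsilon> * ((cmod b)\<^sup>2 - (cmod c)\<^sup>2)"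
proof -
  have "Im (cnj (b * 1 + cnj c * cnj 1) * (b * \<i> + cnj c * cnj \<i>)) = (cmod b)\<^sup>2 - (cmod c)\<^sup>2"
    unfolding cmod_power2 unfolding power2_eq_square by (simp add: algebra_simps)
  then show ?thesis
    unfolding frame eta[OF w] scaleR_scaleR det_disc_frame[OF m_less[OF w]] by simp
qed

lemma beta_conformal:
  assumes mw: "has_wirtinger m w \<mu> 0" and mu: "of_real (x w $ 3) * \<mu> = of_real (disc_S (m w)) * c"
  shows "beta u v w = \<epsilon> * disc_S (m w) / (disc_D (m w) * (x w $ 3)\<^sup>2) * ((cmod c)\<^sup>2 - (cmod b)\<^sup>2) * Re (u * cnj v)"
proof -
  have "x w $ 3 * Re ((b * v + cnj c * cnj v) * (\<mu> * u)) = Re ((b * v + cnj c * cnj v) * ((of_real (x w $ 3) * \<mu>) * u))"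
    by (simp add: algebra_simps)
  also have "\<dots> = disc_S (m w) * Re ((b * v + cnj c * cnj v) * (c * u))"
    unfolding mu by (simp add: algebra_simps)
  finally have "2 * x w $ 3 * Re ((b * v + cnj c * cnj v) * (\<mu> * u + 0 * cnj u))
     - disc_S (m w) * Re ((b * u + cnj c * cnj u) * cnj (b * v + cnj c * cnj v)) = 
     disc_S (m w) * (2 * Re ((b * v + cnj c * cnj v) * (c * u)) - Re ((b * u + cnj c * cnj u) * cnj (b * v + cnj c * cnj v)))"
    by (simp add: right_diff_distrib)
  also have "2 * Re ((b * v + cnj c * cnj v) * (c * u)) - Re ((b * u + cnj c * cnj u) * cnj (b * v + cnj c * cnj v)) = 
     ((cmod c)\<^sup>2 - (cmod b)\<^sup>2) * Re (u * cnj v)"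
    unfolding cmod_power2 unfolding power2_eq_square by (simp add: algebra_simps)
  finally show ?thesis unfolding beta_frame[OF mw] by simp
qed

lemma curvature_conformal:
  assumes mw: "has_wirtinger m w \<mu> 0" and mu: "of_real (x w $ 3) * \<mu> = of_real (disc_S (m w)) * c"
    and bc: "(cmod b)\<^sup>2 \<noteq> (cmod c)\<^sup>2"
  shows "gauss_curvature h w = 1 - (disc_S (m w) / disc_D (m w))\<^sup>2"
proof -
  have "beta 1 1 w * beta \<i> \<i> w - (beta 1 \<i> w)\<^sup>2 =
     (disc_S (m w) / disc_D (m w))\<^sup>2 * (((cmod b)\<^sup>2 - (cmod c)\<^sup>2)\<^sup>2 / (x w $ 3)^4)"
  proof -
    have e: "\<epsilon>\<^sup>2 = 1" using eps_sq by (simp add: power2_eq_square)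
    have "k * ((cmod c)\<^sup>2 - (cmod b)\<^sup>2) * (k * ((cmod c)\<^sup>2 - (cmod b)\<^sup>2)) = k\<^sup>2 * ((cmod b)\<^sup>2 - (cmod c)\<^sup>2)\<^sup>2" for k
      by (simp add: power2_eq_square algebra_simps)
    moreover have "(\<epsilon> * disc_S (m w) / (disc_D (m w) * (x w $ 3)\<^sup>2))\<^sup>2 = (disc_S (m w) / disc_D (m w))\<^sup>2 / (x w $ 3)^4"
      by (simp add: power_mult_distrib power_divide e flip: power_mult)
    ultimately show ?thesis unfolding beta_conformal[OF mw mu]
      by (simp only: complex_cnj_one complex_cnj_i mult_1 mult_1_right one_complex.sel imaginary_unit.sel Re_i_times
          minus_minus mult_minus_right i_squared uminus_complex.sel) simp
  qed
  moreover have "((cmod b)\<^sup>2 - (cmod c)\<^sup>2)\<^sup>2 / (x w $ 3)^4 \<noteq> 0" using bc pos[OF w] by simp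
  ultimately show ?thesis unfolding gauss_equation[OF w] gram_frame by (simp add: mult_eq_0_iff)
qed

text \<open>Conformality of II and the Gauss equation are two complex equations, linear in the derivatives
  \<open>m\<^sub>z\<close> and \<open>cnj m\<^sub>z\<close>, with determinant \<open>|c|\<^sup>2 - |b|\<^sup>2\<close>; the sign in the square root of the Gauss
  equation is fixed by negativity of II and the orientation.\<close>

lemma conformal_if_neg_II:
  assumes mw: "has_wirtinger m w \<mu> \<nu>"
    and c1: "beta 1 1 w = beta \<i> \<i> w" and c2: "beta 1 \<i> w = 0" and c3: "beta \<i> 1 w = 0" and neg: "beta 1 1 w < 0"
    and dpos: "det (vector [dderiv 1 x w, dderiv \<i> x w, N w] :: real^3^3) > 0"
    and K: "1 - gauss_curvature h w = (disc_S (m w) / disc_D (m w))\<^sup>2"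
  shows "of_real (x w $ 3) * \<mu> = of_real (disc_S (m w)) * c" "\<nu> = 0" "\<epsilon> * ((cmod b)\<^sup>2 - (cmod c)\<^sup>2) > 0"
proof -
  define r S D where "r = x w $ 3" and "S = disc_S (m w)" and "D = disc_D (m w)"
  have r: "r > 0" and S: "S > 0" and D: "D > 0" using pos[OF w] disc_S_pos D_pos[OF w] by (auto simp: r_def S_def D_def)
  show pbc: "\<epsilon> * ((cmod b)\<^sup>2 - (cmod c)\<^sup>2) > 0"
    using dpos pos[OF w] unfolding det_frame_eq mult.assoc by (rule zero_less_mult_pos)
  define Q where "Q u v = 2 * r * Re ((b * v + cnj c * cnj v) * (\<mu> * u + \<nu> * cnj u))
     - S * Re ((b * u + cnj c * cnj u) * cnj (b * v + cnj c * cnj v))" for u v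
  have k: "\<epsilon> / (D * r\<^sup>2) \<noteq> 0" using eps r D by auto
  have beta: "beta u v w = \<epsilon> / (D * r\<^sup>2) * Q u v" for u v
    unfolding beta_frame[OF mw] Q_def r_def S_def D_def ..
  have q1: "Q 1 1 = Q \<i> \<i>" and q2: "Q 1 \<i> = 0" and q3: "Q \<i> 1 = 0"
    using c1 c2 c3 k unfolding beta by auto
  have "\<epsilon> * Q 1 1 = beta 1 1 w * (D * r\<^sup>2)" using r D unfolding beta by simp
  then have "\<epsilon> * Q 1 1 < 0" using neg r D by (simp add: mult_neg_pos)
  moreover have "(Q 1 1)\<^sup>2 = (S * ((cmod b)\<^sup>2 - (cmod c)\<^sup>2))\<^sup>2"
  proof -
    have g: "((cmod b)\<^sup>2 - (cmod c)\<^sup>2)\<^sup>2 / r^4 > 0"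
    proof -
      have "(cmod b)\<^sup>2 - (cmod c)\<^sup>2 \<noteq> 0" using pbc by force
      then show ?thesis using r by (simp add: zero_less_divide_iff)
    qed
    have "beta 1 1 w * beta \<i> \<i> w - (beta 1 \<i> w)\<^sup>2 = (S / D)\<^sup>2 * (((cmod b)\<^sup>2 - (cmod c)\<^sup>2)\<^sup>2 / r^4)"
    proof -
      have *: "X = y * z" if "1 - (1 - X / z) = y" "z > 0" for X y z :: real
        using that by (simp add: field_simps)
      show ?thesis
        by (rule *[OF K[unfolded gauss_equation[OF w] gram_frame, folded r_def S_def D_def] g])
    qed
    then have "(\<epsilon> / (D * r\<^sup>2) * Q 1 1)\<^sup>2 = (S / D)\<^sup>2 * (((cmod b)\<^sup>2 - (cmod c)\<^sup>2)\<^sup>2 / r^4)"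
      unfolding c1[symmetric] c2 by (simp add: beta power2_eq_square)
    moreover have "\<epsilon>\<^sup>2 = 1" using eps_sq by (simp add: power2_eq_square)
    ultimately show ?thesis using r D by (simp add: power_mult_distrib power_divide divide_eq_eq flip: power_mult)
  qed
  ultimately have Q11: "Q 1 1 = - (S * ((cmod b)\<^sup>2 - (cmod c)\<^sup>2))"
  proof -
    assume 1: "\<epsilon> * Q 1 1 < 0" and 2: "(Q 1 1)\<^sup>2 = (S * ((cmod b)\<^sup>2 - (cmod c)\<^sup>2))\<^sup>2"
    have "\<epsilon> * (S * ((cmod b)\<^sup>2 - (cmod c)\<^sup>2)) > 0"
      using mult_pos_pos[OF S pbc] by (simp only: mult.left_commute)
    then show ?thesis using 1 power2_eq_iff[THEN iffD1, OF 2] by auto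
  qed
  have I: "of_real r * (b * \<mu> + c * cnj \<nu>) = of_real S * (b * c)"
  proof (rule complex_eqI)
    show "Re (of_real r * (b * \<mu> + c * cnj \<nu>)) = Re (of_real S * (b * c))"
      using q1 unfolding Q_def by (simp add: algebra_simps)
    show "Im (of_real r * (b * \<mu> + c * cnj \<nu>)) = Im (of_real S * (b * c))"
      using q2 q3 unfolding Q_def by (simp add: algebra_simps)
  qed
  have II: "of_real r * (cnj b * cnj \<nu> + cnj c * \<mu>) = of_real (S * (cmod c)\<^sup>2)"
  proof (rule complex_eqI)
    have "Q 1 1 + Q \<i> \<i> = - (2 * S * ((cmod b)\<^sup>2 - (cmod c)\<^sup>2))" using Q11 q1 by simp
    then show "Re (of_real r * (cnj b * cnj \<nu> + cnj c * \<mu>)) = Re (of_real (S * (cmod c)\<^sup>2))"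
      unfolding Q_def cmod_power2 unfolding power2_eq_square by (simp add: algebra_simps)
    show "Im (of_real r * (cnj b * cnj \<nu> + cnj c * \<mu>)) = Im (of_real (S * (cmod c)\<^sup>2))"
      using q2 q3 unfolding Q_def by (simp add: algebra_simps)
  qed
  have cb: "complex_of_real ((cmod z)\<^sup>2) = z * cnj z" for z by (rule complex_norm_square)
  have n: "complex_of_real ((cmod b)\<^sup>2 - (cmod c)\<^sup>2) \<noteq> 0"
    using pbc by (metis less_irrefl mult_zero_right of_real_eq_0_iff)
  have "complex_of_real ((cmod b)\<^sup>2 - (cmod c)\<^sup>2) * (of_real r * \<mu>) = 
      cnj b * (of_real r * (b * \<mu> + c * cnj \<nu>)) - c * (of_real r * (cnj b * cnj \<nu> + cnj c * \<mu>))"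
    by (simp add: of_real_diff cb algebra_simps del: of_real_power)
  also have "\<dots> = complex_of_real ((cmod b)\<^sup>2 - (cmod c)\<^sup>2) * (of_real S * c)"
    unfolding I II by (simp add: of_real_diff cb algebra_simps del: of_real_power)
  finally show "of_real (x w $ 3) * \<mu> = of_real (disc_S (m w)) * c" using n by (simp add: r_def S_def)
  have "complex_of_real ((cmod b)\<^sup>2 - (cmod c)\<^sup>2) * (of_real r * cnj \<nu>) = 
      b * (of_real r * (cnj b * cnj \<nu> + cnj c * \<mu>)) - cnj c * (of_real r * (b * \<mu> + c * cnj \<nu>))"
    by (simp add: of_real_diff cb algebra_simps del: of_real_power)
  also have "\<dots> = 0"
    unfolding I II by (simp add: cb algebra_simps del: of_real_power)
  finally show "\<nu> = 0" using n r by simp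
qed

end

end

section \<open>The first order system\<close>

text \<open>In the variable \<open>m = 1/g\<close> (holomorphic \<open>g\<close>) or \<open>m = cnj g\<close> (antiholomorphic
  \<open>g\<close>), with \<open>l = x\<^sub>3 / (1 + |m|\<^sup>2)\<close> and \<open>P = x\<^sub>1 + i x\<^sub>2\<close>, both cases of the representation
  are governed by the same first order system.\<close>

locale disc_data =
  fixes U :: "complex set" and m P :: "complex \<Rightarrow> complex" and l :: "complex \<Rightarrow> real"
  assumes open_U: "open U" and hol: "m holomorphic_on U"
    and m_less: "w \<in> U \<Longrightarrow> cmod (m w) < 1"
    and smooth_l: "smooth_on U l" and l_pos: "w \<in> U \<Longrightarrow> l w > 0"
    and smooth_P: "smooth_on U P"
    and core_z: "w \<in> U \<Longrightarrow> dz P w * m w = - disc_S (m w) * dz (\<lambda>q. of_real (l q)) w"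
    and core_zbar: "w \<in> U \<Longrightarrow> dzbar P w =
      - disc_S (m w) * (cnj (deriv m w) * l w + cnj (m w) * dzbar (\<lambda>q. of_real (l q)) w)"
begin

text \<open>Here \<open>l\<^sub>z = m a\<close>, \<open>c = l m'\<close>, and \<open>b\<close>, \<open>c\<close> are the coefficients of the differential of the
  surface in the frame: \<open>dx(v) = disc_frame m (b v + cnj c cnj v)\<close>. The surface is regular where
  \<open>|b|\<close> and \<open>|c|\<close> differ, and the two cases of the theorem are \<open>|b| > |c|\<close> and \<open>|b| < |c|\<close>.\<close>

definition "a w = - dz P w / of_real (disc_S (m w))"
definition "c w = of_real (l w) * deriv m w"
definition "b w = of_real (disc_S (m w)) * of_real (disc_D (m w)) * a w - (cnj (m w))\<^sup>2 * c w"

lemma smooth_m: "smooth_on U m" by (rule smooth_on_holomorphic[OF open_U hol])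

lemma S_nonzero: "complex_of_real (disc_S (m w)) \<noteq> 0" using disc_S_pos[of "m w"] by simp
lemma D_nonzero: "w \<in> U \<Longrightarrow> complex_of_real (disc_D (m w)) \<noteq> 0" using disc_D_pos[OF m_less, of w] by simp

lemma smooth_c: "smooth_on U c" and smooth_b: "smooth_on U b"
proof -
  have a: "smooth_on U a" unfolding a_def[abs_def]
    using S_nonzero by (auto intro!: smooth_intros open_U smooth_P smooth_m)
  show c: "smooth_on U c" unfolding c_def[abs_def]
    by (intro smooth_intros open_U smooth_l smooth_on_holomorphic holomorphic_deriv hol)
  show "smooth_on U b" unfolding b_def[abs_def]
    by (intro smooth_intros open_U smooth_m a c)
qed

context
  fixes w assumes w: "w \<in> U"
begin

lemma mw: "has_wirtinger m w (deriv m w) 0"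
  by (rule has_wirtinger_holomorphic[OF hol open_U w])

lemma Pw: "has_wirtinger P w (dz P w) (dzbar P w)"
  by (rule has_wirtinger_self[OF smooth_on_imp_differentiable[OF smooth_P w]])

lemma dz_P: "dz P w = - (of_real (disc_S (m w)) * a w)"
  using S_nonzero by (simp add: a_def)

lemma dz_l: "dz (\<lambda>q. of_real (l q)) w = m w * a w"
  using core_z[OF w] S_nonzero unfolding dz_P by (simp add: algebra_simps)

lemma lw: "has_wirtinger (\<lambda>q. of_real (l q)) w (m w * a w) (cnj (m w * a w))"
proof -
  have d: "(\<lambda>q. complex_of_real (l q)) differentiable (at w)"
    by (rule smooth_on_imp_differentiable[OF _ w]) (intro smooth_intros open_U smooth_l)
  show ?thesis using has_wirtinger_self[OF d] dzbar_of_real[OF d] dz_l by simp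
qed

lemma dzbar_P: "dzbar P w = - (of_real (disc_S (m w)) * (cnj (c w) + (cnj (m w))\<^sup>2 * cnj (a w)))"
  unfolding core_zbar[OF w] has_wirtinger_dzbar[OF lw] c_def by (simp add: algebra_simps power2_eq_square)

lemma rw: "has_wirtinger (\<lambda>q. of_real (l q * disc_S (m q))) w
    (of_real (disc_S (m w)) * m w * a w + cnj (m w) * c w)
    (cnj (of_real (disc_S (m w)) * m w * a w + cnj (m w) * c w))"
  unfolding of_real_mult
  by (rule has_wirtinger_eq[OF has_wirtinger_mult[OF lw has_wirtinger_disc_S[OF mw]]])
    (simp_all add: c_def algebra_simps)

lemma dderiv_hs_vec:
  assumes x: "\<And>q. q \<in> U \<Longrightarrow> x q = hs_vec (P q) (l q * disc_S (m q))"
  shows "dderiv v x w = disc_frame (m w) (b w * v + cnj (c w) * cnj v)"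
proof -
  have "((\<lambda>q. hs_vec (P q) (l q * disc_S (m q))) has_derivative
     (\<lambda>v. hs_vec (dz P w * v + dzbar P w * cnj v)
      (Re ((of_real (disc_S (m w)) * m w * a w + cnj (m w) * c w) * v + 
        (cnj (of_real (disc_S (m w)) * m w * a w + cnj (m w) * c w)) * cnj v)))) (at w)"
    by (rule has_derivative_hs_vec[OF Pw[unfolded has_wirtinger_def] has_derivative_of_real_imp[OF rw]])
  then have "dderiv v (\<lambda>q. hs_vec (P q) (l q * disc_S (m q))) w = hs_vec (dz P w * v + dzbar P w * cnj v)
      (Re ((of_real (disc_S (m w)) * m w * a w + cnj (m w) * c w) * v + 
        (cnj (of_real (disc_S (m w)) * m w * a w + cnj (m w) * c w)) * cnj v))"
    by (rule dderiv_eqI)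
  moreover have "dderiv v x w = dderiv v (\<lambda>q. hs_vec (P q) (l q * disc_S (m q))) w"
    by (rule dderiv_cong_open[OF open_U w x])
  ultimately have 1: "dderiv v x w = hs_vec (dz P w * v + dzbar P w * cnj v)
      (Re ((of_real (disc_S (m w)) * m w * a w + cnj (m w) * c w) * v + 
        (cnj (of_real (disc_S (m w)) * m w * a w + cnj (m w) * c w)) * cnj v))" by simp
  have 2: "dz P w * v + dzbar P w * cnj v = - (b w * v + cnj (c w) * cnj v +
     (cnj (m w))\<^sup>2 * cnj (b w * v + cnj (c w) * cnj v)) / of_real (disc_D (m w))"
    unfolding dz_P dzbar_P b_def using D_nonzero[OF w]
    by (simp add: nonzero_eq_divide_eq)
      (simp add: disc_D_complex disc_S_complex algebra_simps power2_eq_square)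
  define z where "z = (of_real (disc_S (m w)) * m w * a w + cnj (m w) * c w) * v"
  have "z + cnj z = (m w * (b w * v + cnj (c w) * cnj v) + cnj (m w * (b w * v + cnj (c w) * cnj v))) / of_real (disc_D (m w))"
    unfolding b_def z_def using D_nonzero[OF w]
    by (simp add: nonzero_eq_divide_eq)
      (simp add: disc_D_complex disc_S_complex algebra_simps power2_eq_square)
  then have "Re (z + cnj z) = Re ((m w * (b w * v + cnj (c w) * cnj v) + cnj (m w * (b w * v + cnj (c w) * cnj v))) / of_real (disc_D (m w)))"
    by (rule arg_cong)
  then have 3: "Re (z + cnj z) = 2 * Re (m w * (b w * v + cnj (c w) * cnj v)) / disc_D (m w)"
    unfolding Re_divide_of_real plus_complex.sel cnj.sel by simp
  show ?thesis unfolding 1 disc_frame_def 2 using 3 by (simp add: z_def)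
qed

end

lemma disc_surfaceI:
  assumes x: "\<And>q. q \<in> U \<Longrightarrow> x q = hs_vec (P q) (l q * disc_S (m q))"
    and \<eta>: "\<And>q. q \<in> U \<Longrightarrow> \<eta> q = \<epsilon> *\<^sub>R disc_normal (m q)"
    and eps: "\<epsilon> = 1 \<or> \<epsilon> = -1"
    and bc: "\<And>w. w \<in> U \<Longrightarrow> \<epsilon> * ((cmod (b w))\<^sup>2 - (cmod (c w))\<^sup>2) > 0"
  shows "disc_surface U x \<eta> m \<epsilon>"
proof
  show "open U" by (rule open_U)
  show "smooth_on U x"
  proof (rule smooth_on_cong[OF open_U x[symmetric]])
    show "smooth_on U (\<lambda>q. hs_vec (P q) (l q * disc_S (m q)))"
      by (intro smooth_intros open_U smooth_P smooth_l smooth_m)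
  qed
  have "disc_D (m w) \<noteq> 0" if "w \<in> U" for w using disc_D_pos[OF m_less[OF that]] by simp
  then show "smooth_on U \<eta>"
    by (intro smooth_on_cong[OF open_U \<eta>[symmetric]])
      (auto simp: disc_normal_def intro!: smooth_intros open_U smooth_m)
  show "\<epsilon> = 1 \<or> \<epsilon> = -1" by (rule eps)
  fix w assume w: "w \<in> U"
  show "0 < x w $ 3" using x[OF w] l_pos[OF w] disc_S_pos[of "m w"] by simp
  show "(\<eta> w $ 1)\<^sup>2 + (\<eta> w $ 2)\<^sup>2 - (\<eta> w $ 3)\<^sup>2 = - 1"
    unfolding \<eta>[OF w] using eps by (intro lorentz_disc_normal_scaled m_less w) auto
  show "cmod (m w) < 1" by (rule m_less[OF w])
  show "\<eta> w = \<epsilon> *\<^sub>R disc_normal (m w)" by (rule \<eta>[OF w])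
  have d: "dderiv v x w = disc_frame (m w) (b w * v + cnj (c w) * cnj v)" for v
    by (rule dderiv_hs_vec[OF w x])
  show "lorentz (dderiv v x w) (\<eta> w) = 0" for v
    unfolding d by (simp add: \<eta>[OF w] lorentz_simps lorentz_disc_frame_normal)
  show "0 < lorentz (dderiv v x w) (dderiv v x w)" if "v \<noteq> 0" for v
  proof -
    have ne: "cmod (b w) \<noteq> cmod (c w)" using bc[OF w] by auto
    have "b w * v + cnj (c w) * cnj v \<noteq> 0"
    proof
      assume "b w * v + cnj (c w) * cnj v = 0"
      then have "cmod (b w * v) = cmod (cnj (c w) * cnj v)" by (metis add_eq_0_iff norm_minus_cancel)
      then show False using ne that by (simp add: norm_mult)
    qed
    then have "0 < (cmod (b w * v + cnj (c w) * cnj v))\<^sup>2" by simp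
    then show ?thesis unfolding d lorentz_disc_frame[OF m_less[OF w]] complex_norm_square[symmetric] Re_complex_of_real .
  qed
qed

lemma surface_properties:
  assumes x: "\<And>q. q \<in> U \<Longrightarrow> x q = hs_vec (P q) (l q * disc_S (m q))"
    and \<eta>: "\<And>q. q \<in> U \<Longrightarrow> \<eta> q = \<epsilon> *\<^sub>R disc_normal (m q)"
    and eps: "\<epsilon> = 1 \<or> \<epsilon> = -1"
    and bc: "\<And>w. w \<in> U \<Longrightarrow> \<epsilon> * ((cmod (b w))\<^sup>2 - (cmod (c w))\<^sup>2) > 0"
    and w: "w \<in> U"
  defines "N \<equiv> \<lambda>w. (x w $ 3) *\<^sub>R \<eta> w"
  shows "\<exists>k<0. \<forall>u v. second_form x N w u v = k * Re (u * cnj v)"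
    "det (vector [dderiv 1 x w, dderiv \<i> x w, N w] :: real^3^3) > 0"
    "gauss_curvature (induced_metric x) w = 1 - (disc_S (m w) / disc_D (m w))\<^sup>2"
proof -
  interpret disc_surface U x \<eta> m \<epsilon> by (rule disc_surfaceI[OF x \<eta> eps bc])
  have d: "dderiv v x w = disc_frame (m w) (b w * v + cnj (c w) * cnj v)" for v
    by (rule dderiv_hs_vec[OF w x])
  have mu: "of_real (x w $ 3) * deriv m w = of_real (disc_S (m w)) * c w"
    unfolding x[OF w] c_def by simp
  have xp: "x w $ 3 > 0" by (rule pos[OF w])
  define k where "k = disc_S (m w) / (disc_D (m w) * (x w $ 3)\<^sup>2)"
  have k: "k > 0" using disc_S_pos disc_D_pos[OF m_less[OF w]] xp by (simp add: k_def)
  have "second_form x N w u v = - (k * (\<epsilon> * ((cmod (b w))\<^sup>2 - (cmod (c w))\<^sup>2))) * Re (u * cnj v)" for u v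
  proof -
    have B: "beta u v w = \<epsilon> * disc_S (m w) / (disc_D (m w) * (x w $ 3)\<^sup>2) * ((cmod (c w))\<^sup>2 - (cmod (b w))\<^sup>2) * Re (u * cnj v)"
      by (rule beta_conformal[OF w d mw[OF w] mu])
    have K: "\<epsilon> * disc_S (m w) / (disc_D (m w) * (x w $ 3)\<^sup>2) = \<epsilon> * k" by (simp add: k_def)
    show ?thesis unfolding N_def second_form_eq[OF w] B K by (simp add: algebra_simps)
  qed
  moreover have "- (k * (\<epsilon> * ((cmod (b w))\<^sup>2 - (cmod (c w))\<^sup>2))) < 0" using mult_pos_pos[OF k bc[OF w]] by linarith
  ultimately show "\<exists>k<0. \<forall>u v. second_form x N w u v = k * Re (u * cnj v)" by blast
  show "det (vector [dderiv 1 x w, dderiv \<i> x w, N w] :: real^3^3) > 0"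
    unfolding N_def det_frame_eq[OF w d] using mult_pos_pos[OF xp bc[OF w]] by (simp only: mult.assoc)
  show "gauss_curvature (induced_metric x) w = 1 - (disc_S (m w) / disc_D (m w))\<^sup>2"
    using curvature_conformal[OF w d mw[OF w] mu] bc[OF w] by force
qed

end

lemma (in disc_surface) disc_data_if_neg_II:
  assumes sm: "smooth_on U m"
    and c1: "\<And>w. w \<in> U \<Longrightarrow> second_form x (\<lambda>w. N w) w 1 1 = second_form x (\<lambda>w. N w) w \<i> \<i>"
    and c2: "\<And>w. w \<in> U \<Longrightarrow> second_form x (\<lambda>w. N w) w 1 \<i> = 0"
    and c3: "\<And>w. w \<in> U \<Longrightarrow> second_form x (\<lambda>w. N w) w \<i> 1 = 0"
    and neg: "\<And>w. w \<in> U \<Longrightarrow> second_form x (\<lambda>w. N w) w 1 1 < 0"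
    and dpos: "\<And>w. w \<in> U \<Longrightarrow> det (vector [dderiv 1 x w, dderiv \<i> x w, N w] :: real^3^3) > 0"
    and K: "\<And>w. w \<in> U \<Longrightarrow> 1 - gauss_curvature h w = (disc_S (m w) / disc_D (m w))\<^sup>2"
  defines "l \<equiv> \<lambda>q. x q $ 3 / disc_S (m q)" and "P \<equiv> \<lambda>q. Complex (x q $ 1) (x q $ 2)"
  shows "disc_data U m P l"
    "w \<in> U \<Longrightarrow> \<epsilon> * ((cmod (disc_data.b m P l w))\<^sup>2 - (cmod (disc_data.c m l w))\<^sup>2) > 0"
proof -
  have Peq: "P q = of_real (x q $ 1) + \<i> * of_real (x q $ 2)" for q by (simp add: P_def complex_eq_iff)
  have Snz: "complex_of_real (disc_S (m q)) \<noteq> 0" for q using disc_S_pos[of "m q"] by simp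
  have sP: "smooth_on U P" unfolding Peq[abs_def] by (intro smooth_intros open_U smooth_x)
  have sl: "smooth_on U l" unfolding l_def
    using disc_S_pos by (auto intro!: smooth_intros open_U smooth_x sm simp: less_imp_neq[symmetric])
  have *: "m differentiable (at w) \<and> dzbar m w = 0 \<and>
      dz P w * m w = - disc_S (m w) * dz (\<lambda>q. of_real (l q)) w \<and> 
      dzbar P w = - disc_S (m w) * (cnj (deriv m w) * l w + cnj (m w) * dzbar (\<lambda>q. of_real (l q)) w) \<and>
      deriv m w = dz m w \<and>
      \<epsilon> * ((cmod (- (of_real (disc_D (m w)) * dz P w) - (cnj (m w))\<^sup>2 * (of_real (l w) * dz m w)))\<^sup>2
         - (cmod (of_real (l w) * dz m w))\<^sup>2) > 0" if w: "w \<in> U" for w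
  proof -
    obtain b c where f: "\<And>v. dderiv v x w = disc_frame (m w) (b * v + cnj c * cnj v)"
      using frame_exists[OF w] by blast
    have md: "m differentiable (at w)" by (rule smooth_on_imp_differentiable[OF sm w])
    note C = conformal_if_neg_II[OF w f has_wirtinger_self[OF md] c1[OF w, unfolded second_form_eq[OF w]]
        c2[OF w, unfolded second_form_eq[OF w]] c3[OF w, unfolded second_form_eq[OF w]]
        neg[OF w, unfolded second_form_eq[OF w]] dpos[OF w] K[OF w]]
    have mw: "has_wirtinger m w (dz m w) 0" using has_wirtinger_self[OF md] C(2) by simp
    then have dm: "deriv m w = dz m w" 
      by (auto simp: has_wirtinger_def has_field_derivative_def intro!: DERIV_imp_deriv)
    have r: "x w $ 3 > 0" by (rule pos[OF w])
    have cl: "c = of_real (l w) * dz m w" using C(1) Snz[of w] by (simp add: l_def field_simps)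
    have Dnz: "complex_of_real (disc_D (m w)) \<noteq> 0" using D_pos[OF w] by simp
    have dd: "A / of_real (disc_D (m w)) - B = X / of_real (disc_D (m w))"
      if "A - B * of_real (disc_D (m w)) = X" for A B X :: complex
      using Dnz that by (auto simp: diff_divide_distrib)
    have dd2: "B - A / of_real (disc_D (m w)) = X / of_real (disc_D (m w))"
      if "B * of_real (disc_D (m w)) - A = X" for A B X :: complex
      using Dnz that by (auto simp: diff_divide_distrib)
    have nth: "dderiv v (\<lambda>q. x q $ i) w = dderiv v x w $ i" for v i
      by (rule dderiv_linear[OF bounded_linear_vec_nth x_differentiable[OF w]])
    have dP: "dderiv v P w = - (b * v + cnj c * cnj v + (cnj (m w))\<^sup>2 * cnj (b * v + cnj c * cnj v)) / of_real (disc_D (m w))" for v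
    proof -
      have "(P has_derivative (\<lambda>v. of_real (dderiv v x w $ 1) + \<i> * of_real (dderiv v x w $ 2))) (at w)"
        unfolding Peq[abs_def]
        by (intro has_derivative_add has_derivative_mult_right bounded_linear.has_derivative[OF bounded_linear_of_real]
          bounded_linear.has_derivative[OF bounded_linear_vec_nth dx[OF w]])
      then show ?thesis unfolding f disc_frame_def hs_vec_nth complex_eq[symmetric] by (rule dderiv_eqI)
    qed
    have "dz P w = - (b + (cnj (m w))\<^sup>2 * c) / of_real (disc_D (m w))"
      unfolding dz_def dP using Dnz by (simp add: field_simps) 
    moreover have "dzbar P w = - (cnj c + (cnj (m w))\<^sup>2 * cnj b) / of_real (disc_D (m w))"
      unfolding dzbar_def dP using Dnz by (simp add: field_simps)
    ultimately have dzP: "dz P w = - (b + (cnj (m w))\<^sup>2 * c) / of_real (disc_D (m w))"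
      and dzbarP: "dzbar P w = - (cnj c + (cnj (m w))\<^sup>2 * cnj b) / of_real (disc_D (m w))" by auto
    have rd: "(\<lambda>q. x q $ 3) differentiable (at w)" 
      by (rule smooth_on_imp_differentiable[OF _ w]) (intro smooth_intros open_U smooth_x)
    have dr: "dderiv v (\<lambda>q. complex_of_real (x q $ 3)) w = of_real (2 * Re (m w * (b * v + cnj c * cnj v)) / disc_D (m w))" for v
      unfolding dderiv_of_real[OF rd] nth f disc_frame_def by simp
    have dzr: "dz (\<lambda>q. complex_of_real (x q $ 3)) w = (m w * b + cnj (m w) * c) / of_real (disc_D (m w))"
    proof -
      have e: "complex_of_real (2 * Re z) = z + cnj z" for z by (simp add: complex_eq_iff)
      show ?thesis unfolding dz_def dr of_real_divide e using Dnz by (simp add: field_simps)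
    qed
    have ld: "(\<lambda>q. complex_of_real (l q)) differentiable (at w)"
      by (rule smooth_on_imp_differentiable[OF _ w]) (intro smooth_intros open_U sl)
    define L where "L = dz (\<lambda>q. complex_of_real (l q)) w"
    have lw: "has_wirtinger (\<lambda>q. complex_of_real (l q)) w L (cnj L)"
      using has_wirtinger_self[OF ld] dzbar_of_real[OF ld] by (simp add: L_def)
    have "(\<lambda>q. complex_of_real (x q $ 3)) = (\<lambda>q. of_real (l q) * of_real (disc_S (m q)))"
      using Snz by (simp add: l_def)
    then have "dz (\<lambda>q. complex_of_real (x q $ 3)) w = of_real (l w) * (dz m w * cnj (m w)) + L * of_real (disc_S (m w))"
      using has_wirtinger_dz[OF has_wirtinger_mult[OF lw has_wirtinger_disc_S[OF mw]]] by simp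
    then have "L * of_real (disc_S (m w)) = (m w * b + cnj (m w) * c) / of_real (disc_D (m w)) - cnj (m w) * c"
      unfolding dzr cl by (simp add: algebra_simps)
    also have "\<dots> = m w * (b + (cnj (m w))\<^sup>2 * c) / of_real (disc_D (m w))"
      by (rule dd) (simp add: disc_D_complex algebra_simps power2_eq_square)
    finally have L: "L * of_real (disc_S (m w)) = m w * (b + (cnj (m w))\<^sup>2 * c) / of_real (disc_D (m w))" .
    have z: "dz P w * m w = - disc_S (m w) * L" using L unfolding dzP by (simp add: minus_divide_left algebra_simps)
    have cL: "cnj L * of_real (disc_S (m w)) = cnj (m w) * (cnj b + (m w)\<^sup>2 * cnj c) / of_real (disc_D (m w))"
      using arg_cong[OF L, of cnj] by simp
    have "- of_real (disc_S (m w)) * (cnj (dz m w) * of_real (l w) + cnj (m w) * cnj L) = 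
       - (of_real (disc_S (m w)) * cnj c) - cnj (m w) * (cnj L * of_real (disc_S (m w)))"
      unfolding cl by (simp add: algebra_simps)
    also have "\<dots> = dzbar P w"
      unfolding cL dzbarP times_divide_eq_right
      by (rule dd2) (simp add: disc_D_complex disc_S_complex algebra_simps power2_eq_square)
    finally have zb: "dzbar P w = - disc_S (m w) * (cnj (deriv m w) * l w + cnj (m w) * cnj L)"
      unfolding dm by simp
    have "- (of_real (disc_D (m w)) * dz P w) - (cnj (m w))\<^sup>2 * (of_real (l w) * dz m w) = b"
      using Dnz unfolding dzP cl[symmetric] by simp
    then show ?thesis
      using md C(2,3) z zb dm has_wirtinger_dzbar[OF lw] unfolding cl[symmetric] L_def by simp
  qed
  show data: "disc_data U m P l"
  proof
    show "m holomorphic_on U" using holomorphic_on_if_dzbar_zero[OF open_U] * by blast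
    show "0 < l w" if "w \<in> U" for w using pos[OF that] disc_S_pos[of "m w"] by (simp add: l_def)
  qed (use open_U m_less sl sP * in auto)
  interpret d: disc_data U m P l by (rule data)
  show "\<epsilon> * ((cmod (d.b w))\<^sup>2 - (cmod (d.c w))\<^sup>2) > 0" if "w \<in> U"
    using *[OF that] Snz[of w] unfolding d.b_def d.c_def d.a_def by simp
qed

lemma cmod_less_one_D_S:
  assumes "cmod M < 1"
  shows "(complex_of_real (cmod M))^4 - 1 = - (of_real (disc_S M) * of_real (disc_D M))"
    "complex_of_real (disc_S M) \<noteq> 0" "complex_of_real (disc_D M) \<noteq> 0"
proof -
  have "(cmod M)^4 - 1 = - (disc_S M * disc_D M)"
    by (simp add: disc_S_def disc_D_def algebra_simps power4_eq_xxxx power2_eq_square)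
  then have "complex_of_real ((cmod M)^4 - 1) = of_real (- (disc_S M * disc_D M))" by (rule arg_cong)
  then show "(complex_of_real (cmod M))^4 - 1 = - (of_real (disc_S M) * of_real (disc_D M))" by simp
qed (use disc_S_pos[of M] disc_D_pos[OF assms] in auto)

text \<open>The second order equations in the two cases, with \<open>\<beta>\<close> resp. \<open>\<alpha>\<close> the free first
  derivative of \<open>G\<close>, are linear in that derivative.\<close>

lemma holo_pde_factor:
  fixes M \<mu> \<kappa> l \<beta> :: complex
  assumes "M \<noteq> 0" "cmod M < 1"
  shows "- (\<kappa> * \<mu> / M\<^sup>2)
     + - cnj \<mu> / (cnj M)\<^sup>2 / (((cmod (inverse M)) ^ 4 - 1) * cnj (inverse M)) * (- (l * \<mu> / M\<^sup>2))
     - (cmod (inverse M))\<^sup>2 * cnj (inverse M) * (- \<mu> / M\<^sup>2) / ((cmod (inverse M)) ^ 4 - 1) * \<beta>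
    = \<mu> / (M * (disc_S M * disc_D M)) * (\<beta> - (disc_S M * disc_D M * \<kappa> / M - M * cnj M * l * cnj \<mu>))"
proof -
  define N where "N = cnj M"
  define SD where "SD = complex_of_real (disc_S M) * of_real (disc_D M)"
  have N: "N \<noteq> 0" using assms(1) by (simp add: N_def)
  have SD: "SD \<noteq> 0" using cmod_less_one_D_S[OF assms(2)] by (simp add: SD_def)
  have 2: "(complex_of_real (cmod (inverse M)))\<^sup>2 = 1 / (M * N)"
    unfolding of_real_power[symmetric] norm_inverse power_inverse of_real_inverse complex_norm_square N_def
    by (simp add: inverse_eq_divide)
  have SD2: "SD = 1 - (M * N)\<^sup>2"
    unfolding SD_def disc_S_complex disc_D_complex N_def by (simp add: algebra_simps power2_eq_square)
  then have 4: "(complex_of_real (cmod (inverse M)))^4 - 1 = SD / (M * N)\<^sup>2"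
  proof -
    have "(complex_of_real (cmod (inverse M)))^4 = ((complex_of_real (cmod (inverse M)))\<^sup>2)\<^sup>2" by simp
    then show ?thesis unfolding 2 SD2 using N assms(1) by (simp add: field_simps)
  qed
  have 3: "cnj (inverse M) = 1 / N" by (simp add: N_def inverse_eq_divide)
  have "- (\<kappa> * \<mu> / M\<^sup>2)
     + - cnj \<mu> / N\<^sup>2 / (SD / (M * N)\<^sup>2 * (1 / N)) * (- (l * \<mu> / M\<^sup>2))
     - 1 / (M * N) * (1 / N) * (- \<mu> / M\<^sup>2) / (SD / (M * N)\<^sup>2) * \<beta>
    = \<mu> / (M * SD) * (\<beta> - (SD * \<kappa> / M - M * N * l * cnj \<mu>))"
    using N SD assms(1) by (simp add: field_simps power2_eq_square)
  then show ?thesis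
    using 2 4 3 unfolding SD_def N_def by simp
qed

lemma antiholo_pde_factor:
  fixes M \<mu> \<kappa> l \<alpha> :: complex
  assumes "M \<noteq> 0" "cmod M < 1"
  shows "cnj M * cnj \<mu> * (\<kappa> * M + l * \<mu>)
     + \<mu> / (((cmod (cnj M)) ^ 4 - 1) * cnj (cnj M)) * (l * (M * cnj M) * cnj \<mu>)
     - (cmod (cnj M))\<^sup>2 * cnj (cnj M) * cnj \<mu> / ((cmod (cnj M)) ^ 4 - 1) * \<alpha>
    = cnj M * cnj \<mu> / (disc_S M * disc_D M) * (disc_S M * disc_D M * (\<kappa> * M + l * \<mu>) - l * \<mu> + M\<^sup>2 * \<alpha>)"
proof -
  define N where "N = cnj M"
  define SD where "SD = complex_of_real (disc_S M) * of_real (disc_D M)"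
  have SD: "SD \<noteq> 0" using cmod_less_one_D_S[OF assms(2)] by (simp add: SD_def)
  have 2: "(complex_of_real (cmod (cnj M)))\<^sup>2 = M * N"
    unfolding of_real_power[symmetric] complex_mod_cnj complex_norm_square N_def ..
  have 4: "(complex_of_real (cmod (cnj M)))^4 - 1 = - SD"
    unfolding complex_mod_cnj cmod_less_one_D_S(1)[OF assms(2)] SD_def ..
  have "N * cnj \<mu> * (\<kappa> * M + l * \<mu>) + \<mu> / (- SD * M) * (l * (M * N) * cnj \<mu>) - M * N * M * cnj \<mu> / (- SD) * \<alpha>
    = N * cnj \<mu> / SD * (SD * (\<kappa> * M + l * \<mu>) - l * \<mu> + M\<^sup>2 * \<alpha>)"
    using SD assms(1) by (simp add: field_simps power2_eq_square)
  then show ?thesis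
    using 2 4 unfolding SD_def N_def by simp
qed

abbreviation (input) holo_pde_lhs :: "(complex \<Rightarrow> complex) \<Rightarrow> (complex \<Rightarrow> complex) \<Rightarrow> complex \<Rightarrow> complex" where
  "holo_pde_lhs g G w \<equiv> dzbar (dz G) w
     + dzbar (\<lambda>q. cnj (g q)) w / (((cmod (g w)) ^ 4 - 1) * cnj (g w)) * dz G w
     - (cmod (g w))\<^sup>2 * cnj (g w) * dz g w / ((cmod (g w)) ^ 4 - 1) * dzbar G w"

abbreviation (input) antiholo_pde_lhs :: "(complex \<Rightarrow> complex) \<Rightarrow> (complex \<Rightarrow> complex) \<Rightarrow> complex \<Rightarrow> complex" where
  "antiholo_pde_lhs g G w \<equiv> dzbar (dz G) w
     + dz (\<lambda>q. cnj (g q)) w / (((cmod (g w)) ^ 4 - 1) * cnj (g w)) * dzbar G w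
     - (cmod (g w))\<^sup>2 * cnj (g w) * dzbar g w / ((cmod (g w)) ^ 4 - 1) * dz G w"

lemma open_nonzero_set:
  assumes "open U" "m holomorphic_on U"
  shows "open {q \<in> U. m q \<noteq> 0}"
proof -
  have "{q \<in> U. m q \<noteq> 0} = U \<inter> m -` (- {0})" by auto
  then show ?thesis
    using continuous_open_preimage[OF holomorphic_on_imp_continuous_on[OF assms(2)] assms(1) open_Compl[OF closed_singleton]]
    by simp
qed

context disc_data
begin

context
  fixes w and g' G' :: "complex \<Rightarrow> complex"
  assumes w: "w \<in> U" and mw0: "m w \<noteq> 0"
    and g': "\<And>q. q \<in> U \<Longrightarrow> m q \<noteq> 0 \<Longrightarrow> g' q = inverse (m q)"
    and G': "\<And>q. q \<in> U \<Longrightarrow> m q \<noteq> 0 \<Longrightarrow> G' q = P q + of_real (l q * disc_S (m q)) / m q"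
begin

lemmas open_V = open_nonzero_set[OF open_U hol]

lemma holo_g: "has_wirtinger g' w (- deriv m w / (m w)\<^sup>2) 0"
  by (rule has_wirtinger_cong[OF open_V, of _ "\<lambda>q. inverse (m q)"])
    (use w mw0 g' has_wirtinger_inverse[OF mw[OF w] mw0] in auto)

lemma holo_G: "q \<in> U \<Longrightarrow> m q \<noteq> 0 \<Longrightarrow>
  has_wirtinger G' q (- (of_real (l q) * deriv m q / (m q)\<^sup>2)) (cnj (m q) / m q * cnj (b q))"
proof -
  assume q: "q \<in> U" "m q \<noteq> 0"
  have "has_wirtinger (\<lambda>q. P q + of_real (l q * disc_S (m q)) / m q) q
     (- (of_real (l q) * deriv m q / (m q)\<^sup>2)) (cnj (m q) / m q * cnj (b q))"
  proof (rule has_wirtinger_eq[OF has_wirtinger_add[OF Pw[OF q(1)] has_wirtinger_divide[OF rw[OF q(1)] mw[OF q(1)] q(2)]]])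
    show "dz P q + ((of_real (disc_S (m q)) * m q * a q + cnj (m q) * c q) * m q -
       complex_of_real (l q * disc_S (m q)) * deriv m q) / (m q)\<^sup>2 =
       - (of_real (l q) * deriv m q / (m q)\<^sup>2)"
      unfolding dz_P[OF q(1)] c_def of_real_mult disc_S_complex
      using q(2) by (simp add: field_simps power2_eq_square)
    show "dzbar P q + (cnj (of_real (disc_S (m q)) * m q * a q + cnj (m q) * c q) * m q -
       complex_of_real (l q * disc_S (m q)) * 0) / (m q)\<^sup>2 =
       cnj (m q) / m q * cnj (b q)"
      unfolding dzbar_P[OF q(1)] b_def using q(2)
      by (simp add: disc_S_complex disc_D_complex field_simps power2_eq_square)
  qed
  then show ?thesis
    by (rule has_wirtinger_cong[OF open_V, rotated 2]) (use q G' in auto)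
qed

lemma holo_dz_relation: "dz G' w = of_real (l w) * dz g' w"
  and holo_cmod_dzbar: "cmod (dzbar G' w) = cmod (b w)"
  and holo_cmod_dz: "cmod (dz G' w) / (cmod (g' w))\<^sup>2 = cmod (c w)"
  using mw0
  by (simp_all add: has_wirtinger_dz[OF holo_G[OF w mw0]] has_wirtinger_dzbar[OF holo_G[OF w mw0]]
      has_wirtinger_dz[OF holo_g] g'[OF w mw0] c_def norm_mult norm_divide norm_power norm_inverse field_simps)

lemma holo_pde:
  "holo_pde_lhs g' G' w = 0"
proof -
  have d: "has_wirtinger (deriv m) w (deriv (deriv m) w) 0"
    by (rule has_wirtinger_holomorphic[OF holomorphic_deriv[OF hol open_U] open_U w])
  have m2: "has_wirtinger (\<lambda>q. (m q)\<^sup>2) w (m w * deriv m w + deriv m w * m w) 0"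
    unfolding power2_eq_square by (rule has_wirtinger_eq[OF has_wirtinger_mult[OF mw[OF w] mw[OF w]]]) auto
  have m20: "(m w)\<^sup>2 \<noteq> 0" using mw0 by simp
  note W = has_wirtinger_minus[OF has_wirtinger_divide[OF has_wirtinger_mult[OF lw[OF w] d] m2 m20]]
  have "has_wirtinger (dz G') w
     (- (((of_real (l w) * deriv (deriv m) w + m w * a w * deriv m w) * (m w)\<^sup>2 -
       of_real (l w) * deriv m w * (m w * deriv m w + deriv m w * m w)) / ((m w)\<^sup>2)\<^sup>2))
     (- (((of_real (l w) * 0 + cnj (m w * a w) * deriv m w) * (m w)\<^sup>2 -
       of_real (l w) * deriv m w * 0) / ((m w)\<^sup>2)\<^sup>2))"
    by (rule has_wirtinger_cong[OF open_V _ _ W])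
      (use w mw0 has_wirtinger_dz[OF holo_G] in auto)
  from has_wirtinger_dzbar[OF this]
  have 1: "dzbar (dz G') w = - (cnj (m w * a w) * deriv m w / (m w)\<^sup>2)"
    using mw0 by (simp add: field_simps power2_eq_square)
  have 2: "dzbar (\<lambda>q. cnj (g' q)) w = - cnj (deriv m w) / (cnj (m w))\<^sup>2"
    using has_wirtinger_dzbar[OF has_wirtinger_cnj[OF holo_g]] by simp
  have 3: "cnj (m w) / m w * cnj (b w) - (disc_S (m w) * disc_D (m w) * cnj (m w * a w) / m w - m w * cnj (m w) * l w * cnj (deriv m w)) = 0"
    unfolding b_def c_def using mw0 by (simp add: field_simps power2_eq_square)
  show ?thesis
    unfolding 1 2 g'[OF w mw0] has_wirtinger_dz[OF holo_G[OF w mw0]] has_wirtinger_dzbar[OF holo_G[OF w mw0]]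
      has_wirtinger_dz[OF holo_g] holo_pde_factor[OF mw0 m_less[OF w]] 3 by simp
qed

end

context
  fixes w and g' G' :: "complex \<Rightarrow> complex"
  assumes w: "w \<in> U"
    and g': "\<And>q. q \<in> U \<Longrightarrow> g' q = cnj (m q)"
    and G': "\<And>q. q \<in> U \<Longrightarrow> G' q = P q + of_real (l q * disc_S (m q)) * cnj (m q)"
begin

lemma antiholo_g: "has_wirtinger g' w 0 (cnj (deriv m w))"
  by (rule has_wirtinger_cong[OF open_U w, of "\<lambda>q. cnj (m q)"])
    (use w g' has_wirtinger_cnj[OF mw[OF w]] in auto)

lemma antiholo_G: "q \<in> U \<Longrightarrow>
  has_wirtinger G' q (- b q) (of_real (l q) * (m q * cnj (m q)) * cnj (deriv m q))"
proof -
  assume q: "q \<in> U"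
  have "has_wirtinger (\<lambda>q. P q + of_real (l q * disc_S (m q)) * cnj (m q)) q
     (- b q) (of_real (l q) * (m q * cnj (m q)) * cnj (deriv m q))"
  proof (rule has_wirtinger_eq[OF has_wirtinger_add[OF Pw[OF q] has_wirtinger_mult[OF rw[OF q] has_wirtinger_cnj[OF mw[OF q]]]]])
    show "dz P q + (complex_of_real (l q * disc_S (m q)) * cnj 0 + (of_real (disc_S (m q)) * m q * a q + cnj (m q) * c q) * cnj (m q)) = - b q"
      unfolding dz_P[OF q] b_def of_real_mult 
      by (simp add: disc_S_complex disc_D_complex algebra_simps power2_eq_square)
    show "dzbar P q + (complex_of_real (l q * disc_S (m q)) * cnj (deriv m q)
       + cnj (of_real (disc_S (m q)) * m q * a q + cnj (m q) * c q) * cnj (m q)) =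
       of_real (l q) * (m q * cnj (m q)) * cnj (deriv m q)"
      unfolding dzbar_P[OF q] c_def of_real_mult
      by (simp add: disc_S_complex algebra_simps power2_eq_square)
  qed
  then show ?thesis
    by (rule has_wirtinger_cong[OF open_U q, rotated 1]) (use G' in auto)
qed

lemma antiholo_dzbar_relation: "dzbar G' w = of_real (l w) * ((cmod (g' w))\<^sup>2 * dzbar g' w)"
proof -
  have "(complex_of_real (cmod (cnj (m w))))\<^sup>2 = m w * cnj (m w)"
    unfolding of_real_power[symmetric] complex_mod_cnj complex_norm_square ..
  then show ?thesis
    unfolding has_wirtinger_dzbar[OF antiholo_G[OF w]] has_wirtinger_dzbar[OF antiholo_g] g'[OF w] by simp
qed

lemma antiholo_cmod: "m w \<noteq> 0 \<Longrightarrow> (cmod (g' w))\<^sup>2 * cmod (dz G' w) / cmod (dzbar G' w) = cmod (b w) / cmod (c w)"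
  unfolding has_wirtinger_dzbar[OF antiholo_G[OF w]] has_wirtinger_dz[OF antiholo_G[OF w]] g'[OF w] c_def
  by (simp add: norm_mult power2_eq_square)

lemma antiholo_pde:
  assumes "m w \<noteq> 0"
  shows "antiholo_pde_lhs g' G' w = 0"
proof -
  have sG: "smooth_on U G'"
  proof (rule smooth_on_cong[OF open_U G'[symmetric]])
    show "smooth_on U (\<lambda>q. P q + of_real (l q * disc_S (m q)) * cnj (m q))"
      by (intro smooth_intros open_U smooth_P smooth_l smooth_m)
  qed
  have d: "has_wirtinger (deriv m) w (deriv (deriv m) w) 0"
    by (rule has_wirtinger_holomorphic[OF holomorphic_deriv[OF hol open_U] open_U w])
  note W = has_wirtinger_mult[OF has_wirtinger_mult[OF lw[OF w] has_wirtinger_mult[OF mw[OF w] has_wirtinger_cnj[OF mw[OF w]]]]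
     has_wirtinger_cnj[OF d]]
  have "dzbar (dz G') w = dz (dzbar G') w" by (rule dzbar_dz_commute[OF open_U sG w])
  also have "\<dots> = cnj (m w) * cnj (deriv m w) * (m w * a w * m w + of_real (l w) * deriv m w)"
    using has_wirtinger_dz[OF has_wirtinger_cong[OF open_U w _ W, of "dzbar G'"]] has_wirtinger_dzbar[OF antiholo_G]
    by (simp add: algebra_simps)
  finally have 1: "dzbar (dz G') w = cnj (m w) * cnj (deriv m w) * (m w * a w * m w + of_real (l w) * deriv m w)" .
  have 2: "dz (\<lambda>q. cnj (g' q)) w = deriv m w"
    using has_wirtinger_dz[OF has_wirtinger_cnj[OF antiholo_g]] by simp
  have 3: "disc_S (m w) * disc_D (m w) * (m w * a w * m w + of_real (l w) * deriv m w) - of_real (l w) * deriv m w + (m w)\<^sup>2 * (- b w) = 0"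
    unfolding b_def c_def by (simp add: disc_S_complex disc_D_complex algebra_simps power2_eq_square)
  show ?thesis
    unfolding 1 2 g'[OF w] has_wirtinger_dzbar[OF antiholo_G[OF w]] has_wirtinger_dz[OF antiholo_G[OF w]]
      has_wirtinger_dzbar[OF antiholo_g] antiholo_pde_factor[OF assms m_less[OF w]] 3 by simp
qed

end

end

lemma continuous_eq_if_frequently_eq:
  fixes f h :: "complex \<Rightarrow> 'b::t2_space"
  assumes "open V" "continuous_on V f" "continuous_on V h" "w \<in> V"
    "\<forall>\<^sub>F q in at w. q \<in> V \<longrightarrow> f q = h q"
  shows "f w = h w"
proof -
  have c: "(f \<longlongrightarrow> f w) (at w)" "(h \<longlongrightarrow> h w) (at w)"
    using assms continuous_on_eq_continuous_at[OF assms(1)] by (auto simp: isCont_def)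
  have "\<forall>\<^sub>F q in at w. q \<in> V" using assms(1,4) by (simp add: eventually_at_in_open')
  then have "\<forall>\<^sub>F q in at w. f q = h q" using assms(5) by eventually_elim auto
  then have "(h \<longlongrightarrow> f w) (at w)" using c(1) by (rule Lim_transform_eventually[rotated])
  then show ?thesis using c(2) tendsto_unique by (metis at_neq_bot)
qed

lemma holo_core:
  fixes m g' G' :: "complex \<Rightarrow> complex" and l :: "complex \<Rightarrow> real"
  assumes V: "open V" and hol: "m holomorphic_on V"
    and m_less: "\<And>w. w \<in> V \<Longrightarrow> cmod (m w) < 1" and m0: "\<And>w. w \<in> V \<Longrightarrow> m w \<noteq> 0"
    and crit: "\<And>w. w \<in> V \<Longrightarrow> \<forall>\<^sub>F q in at w. deriv m q \<noteq> 0"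
    and sl: "smooth_on V l" and l_pos: "\<And>w. w \<in> V \<Longrightarrow> l w > 0" and sG: "smooth_on V G'"
    and g': "\<And>q. q \<in> V \<Longrightarrow> g' q = inverse (m q)"
    and rel: "\<And>w. w \<in> V \<Longrightarrow> dz g' w \<noteq> 0 \<Longrightarrow> dz G' w / dz g' w = of_real (l w)"
    and pde: "\<And>w. w \<in> V \<Longrightarrow> holo_pde_lhs g' G' w = 0"
  shows "disc_data V m (\<lambda>q. G' q - of_real (l q * disc_S (m q)) / m q) l"
proof -
  define P where "P q = G' q - of_real (l q * disc_S (m q)) / m q" for q
  have sm: "smooth_on V m" by (rule smooth_on_holomorphic[OF V hol])
  have sd: "smooth_on V (deriv m)" by (rule smooth_on_holomorphic[OF V holomorphic_deriv[OF hol V]])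
  have sP: "smooth_on V P" unfolding P_def[abs_def] using m0 by (intro smooth_intros V sG sl sm) auto
  have slc: "smooth_on V (\<lambda>q. complex_of_real (l q))" by (intro smooth_intros V sl)
  have mw: "has_wirtinger m w (deriv m w) 0" if "w \<in> V" for w
    by (rule has_wirtinger_holomorphic[OF hol V that])
  have gw: "has_wirtinger g' w (- deriv m w / (m w)\<^sup>2) 0" if "w \<in> V" for w
    by (rule has_wirtinger_cong[OF V that, of "\<lambda>q. inverse (m q)"])
      (use that g' has_wirtinger_inverse[OF mw m0] in auto)
  have dzG: "dz G' w = - (of_real (l w) * deriv m w / (m w)\<^sup>2)" if w: "w \<in> V" for w
  proof (rule continuous_eq_if_frequently_eq[OF V _ _ w])
    show "continuous_on V (dz G')" by (intro smooth_on_imp_continuous_on smooth_intros V sG)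
    show "continuous_on V (\<lambda>w. - (of_real (l w) * deriv m w / (m w)\<^sup>2))"
      using m0 by (intro smooth_on_imp_continuous_on smooth_intros V slc sd sm) auto
    show "\<forall>\<^sub>F q in at w. q \<in> V \<longrightarrow> dz G' q = - (complex_of_real (l q) * deriv m q / (m q)\<^sup>2)"
      using crit[OF w]
    proof eventually_elim
      case (elim q)
      show ?case
      proof
        assume q: "q \<in> V"
        have dzg: "dz g' q = - deriv m q / (m q)\<^sup>2" by (rule has_wirtinger_dz[OF gw[OF q]])
        show "dz G' q = - (complex_of_real (l q) * deriv m q / (m q)\<^sup>2)"
        proof -
          have ne: "dz g' q \<noteq> 0" using dzg elim m0[OF q] by simp
          then have "dz G' q = of_real (l q) * dz g' q" using rel[OF q ne] by (metis nonzero_divide_eq_eq)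
          then show ?thesis by (simp add: dzg)
        qed
      qed
    qed
  qed
  have lw: "has_wirtinger (\<lambda>q. complex_of_real (l q)) w (dz (\<lambda>q. of_real (l q)) w) (dzbar (\<lambda>q. of_real (l q)) w)"
    if "w \<in> V" for w
    by (rule has_wirtinger_self[OF smooth_on_imp_differentiable[OF slc that]])
  have Gw: "has_wirtinger G' w (dz G' w) (dzbar G' w)" if "w \<in> V" for w
    by (rule has_wirtinger_self[OF smooth_on_imp_differentiable[OF sG that]])
  have PW: "has_wirtinger P w 
      (dz G' w - ((of_real (l w) * (deriv m w * cnj (m w)) + dz (\<lambda>q. of_real (l q)) w * disc_S (m w)) * m w 
         - of_real (l w) * disc_S (m w) * deriv m w) / (m w)\<^sup>2)
      (dzbar G' w - (of_real (l w) * (m w * cnj (deriv m w)) + dzbar (\<lambda>q. of_real (l q)) w * disc_S (m w)) / m w)"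
    if w: "w \<in> V" for w
    unfolding P_def[abs_def] of_real_mult
    by (rule has_wirtinger_eq[OF has_wirtinger_diff[OF Gw[OF w] has_wirtinger_divide[OF has_wirtinger_mult[OF lw[OF w]
      has_wirtinger_disc_S[OF mw[OF w]]] mw[OF w] m0[OF w]]]])
      (use m0[OF w] in \<open>simp_all add: field_simps power2_eq_square\<close>)
  have dzP: "dz P w * m w = - disc_S (m w) * dz (\<lambda>q. of_real (l q)) w" if w: "w \<in> V" for w
    unfolding has_wirtinger_dz[OF PW[OF w]] dzG[OF w] using m0[OF w]
    by (simp add: disc_S_complex field_simps power2_eq_square)
  have dzbG: "dzbar G' w = disc_S (m w) * disc_D (m w) * dzbar (\<lambda>q. of_real (l q)) w / m w - m w * cnj (m w) * l w * cnj (deriv m w)"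
    if w: "w \<in> V" for w
  proof (rule continuous_eq_if_frequently_eq[OF V _ _ w])
    show "continuous_on V (dzbar G')" by (intro smooth_on_imp_continuous_on smooth_intros V sG)
    show "continuous_on V (\<lambda>w. disc_S (m w) * disc_D (m w) * dzbar (\<lambda>q. of_real (l q)) w / m w - m w * cnj (m w) * l w * cnj (deriv m w))"
      using m0 by (intro smooth_on_imp_continuous_on smooth_intros V slc sd sm sl) auto
    show "\<forall>\<^sub>F q in at w. q \<in> V \<longrightarrow> dzbar G' q = disc_S (m q) * disc_D (m q) * dzbar (\<lambda>q. of_real (l q)) q / m q - m q * cnj (m q) * l q * cnj (deriv m q)"
      using crit[OF w]
    proof eventually_elim
      case (elim q)
      show ?case
      proof
        assume q: "q \<in> V"
        have d: "has_wirtinger (deriv m) q (deriv (deriv m) q) 0"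
          by (rule has_wirtinger_holomorphic[OF holomorphic_deriv[OF hol V] V q])
        have m2: "has_wirtinger (\<lambda>q. (m q)\<^sup>2) q (m q * deriv m q + deriv m q * m q) 0"
          unfolding power2_eq_square by (rule has_wirtinger_eq[OF has_wirtinger_mult[OF mw[OF q] mw[OF q]]]) auto
        have m20: "(m q)\<^sup>2 \<noteq> 0" using m0[OF q] by simp
        note W = has_wirtinger_minus[OF has_wirtinger_divide[OF has_wirtinger_mult[OF lw[OF q] d] m2 m20]]
        have 1: "dzbar (dz G') q = - (dzbar (\<lambda>q. of_real (l q)) q * deriv m q / (m q)\<^sup>2)"
          using has_wirtinger_dzbar[OF has_wirtinger_cong[OF V q _ W, of "dz G'"]] dzG m0[OF q]
          by (simp add: field_simps power2_eq_square)
        have 2: "dzbar (\<lambda>q. cnj (g' q)) q = - cnj (deriv m q) / (cnj (m q))\<^sup>2"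
          using has_wirtinger_dzbar[OF has_wirtinger_cnj[OF gw[OF q]]] by simp
        have ne: "deriv m q / (m q * (disc_S (m q) * disc_D (m q))) \<noteq> 0"
          using elim m0[OF q] cmod_less_one_D_S[OF m_less[OF q]] by simp
        show "dzbar G' q = disc_S (m q) * disc_D (m q) * dzbar (\<lambda>q. of_real (l q)) q / m q - m q * cnj (m q) * l q * cnj (deriv m q)"
          using pde[OF q] ne
          unfolding 1 2 g'[OF q] dzG[OF q] has_wirtinger_dz[OF gw[OF q]] holo_pde_factor[OF m0[OF q] m_less[OF q]]
          by (simp only: mult_eq_0_iff right_minus_eq simp_thms)
      qed
    qed
  qed
  have dzbP: "dzbar P w = - disc_S (m w) * (cnj (deriv m w) * l w + cnj (m w) * dzbar (\<lambda>q. of_real (l q)) w)"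
    if w: "w \<in> V" for w
    unfolding has_wirtinger_dzbar[OF PW[OF w]] dzbG[OF w] using m0[OF w]
    by (simp add: disc_S_complex disc_D_complex field_simps power2_eq_square)
  have "disc_data V m P l"
    by unfold_locales (use V hol m_less sl l_pos sP dzP dzbP in auto)
  then show ?thesis by (simp add: P_def[abs_def])
qed

lemma eventually_nonzero_if_deriv:
  fixes f :: "complex \<Rightarrow> complex"
  assumes "(f has_field_derivative d) (at w)" "d \<noteq> 0"
  shows "\<forall>\<^sub>F q in at w. f q \<noteq> 0"
proof (cases "f w = 0")
  case True
  have "((\<lambda>q. (f q - f w) / (q - w)) \<longlongrightarrow> d) (at w)" using assms(1) by (simp add: has_field_derivative_iff)
  then have "\<forall>\<^sub>F q in at w. (f q - f w) / (q - w) \<noteq> 0" using assms(2) by (rule tendsto_imp_eventually_ne)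
  then show ?thesis by eventually_elim (use True in auto)
next
  case False
  then show ?thesis
    using DERIV_isCont[OF assms(1)] tendsto_imp_eventually_ne by (fastforce simp: isCont_def)
qed

lemma antiholo_core:
  fixes m g' G' :: "complex \<Rightarrow> complex" and l :: "complex \<Rightarrow> real"
  assumes U: "open U" and hol: "m holomorphic_on U"
    and m_less: "\<And>w. w \<in> U \<Longrightarrow> cmod (m w) < 1" and crit: "\<And>w. w \<in> U \<Longrightarrow> deriv m w \<noteq> 0"
    and sl: "smooth_on U l" and l_pos: "\<And>w. w \<in> U \<Longrightarrow> l w > 0" and sG: "smooth_on U G'"
    and g': "\<And>q. q \<in> U \<Longrightarrow> g' q = cnj (m q)"
    and rel: "\<And>w. w \<in> U \<Longrightarrow> g' w \<noteq> 0 \<Longrightarrow> dzbar G' w / ((cmod (g' w))\<^sup>2 * dzbar g' w) = of_real (l w)"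
    and pde: "\<And>w. w \<in> U \<Longrightarrow> g' w \<noteq> 0 \<Longrightarrow> 
     antiholo_pde_lhs g' G' w = 0"
  shows "disc_data U m (\<lambda>q. G' q - of_real (l q * disc_S (m q)) * cnj (m q)) l"
proof -
  define P where "P q = G' q - of_real (l q * disc_S (m q)) * cnj (m q)" for q
  have sm: "smooth_on U m" by (rule smooth_on_holomorphic[OF U hol])
  have sd: "smooth_on U (deriv m)" by (rule smooth_on_holomorphic[OF U holomorphic_deriv[OF hol U]])
  have sP: "smooth_on U P" unfolding P_def[abs_def] by (intro smooth_intros U sG sl sm)
  have slc: "smooth_on U (\<lambda>q. complex_of_real (l q))" by (intro smooth_intros U sl)
  have mw: "has_wirtinger m w (deriv m w) 0" if "w \<in> U" for w
    by (rule has_wirtinger_holomorphic[OF hol U that])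
  have ev: "\<forall>\<^sub>F q in at w. m q \<noteq> 0" if "w \<in> U" for w
    by (rule eventually_nonzero_if_deriv[OF holomorphic_derivI[OF hol U that] crit[OF that]])
  have gw: "has_wirtinger g' w 0 (cnj (deriv m w))" if "w \<in> U" for w
    by (rule has_wirtinger_cong[OF U that, of "\<lambda>q. cnj (m q)"])
      (use that g' has_wirtinger_cnj[OF mw] in auto)
  have cc: "(complex_of_real (cmod (cnj M)))\<^sup>2 = M * cnj M" for M
    unfolding of_real_power[symmetric] complex_mod_cnj complex_norm_square ..
  have dzbG: "dzbar G' w = of_real (l w) * (m w * cnj (m w)) * cnj (deriv m w)" if w: "w \<in> U" for w
  proof (rule continuous_eq_if_frequently_eq[OF U _ _ w])
    show "continuous_on U (dzbar G')" by (intro smooth_on_imp_continuous_on smooth_intros U sG)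
    show "continuous_on U (\<lambda>w. of_real (l w) * (m w * cnj (m w)) * cnj (deriv m w))"
      by (intro smooth_on_imp_continuous_on smooth_intros U slc sd sm)
    show "\<forall>\<^sub>F q in at w. q \<in> U \<longrightarrow> dzbar G' q = of_real (l q) * (m q * cnj (m q)) * cnj (deriv m q)"
      using ev[OF w]
    proof eventually_elim
      case (elim q)
      show ?case
      proof
        assume q: "q \<in> U"
        show "dzbar G' q = of_real (l q) * (m q * cnj (m q)) * cnj (deriv m q)"
          using rel[OF q] elim crit[OF q] unfolding g'[OF q] has_wirtinger_dzbar[OF gw[OF q]] of_real_power cc
          by (simp add: divide_eq_eq mult.assoc del: complex_mod_cnj)
      qed
    qed
  qed
  have lw: "has_wirtinger (\<lambda>q. complex_of_real (l q)) w (dz (\<lambda>q. of_real (l q)) w) (dzbar (\<lambda>q. of_real (l q)) w)"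
    if "w \<in> U" for w
    by (rule has_wirtinger_self[OF smooth_on_imp_differentiable[OF slc that]])
  have Gw: "has_wirtinger G' w (dz G' w) (dzbar G' w)" if "w \<in> U" for w
    by (rule has_wirtinger_self[OF smooth_on_imp_differentiable[OF sG that]])
  have PW: "has_wirtinger P w 
      (dz G' w - (of_real (l w) * (deriv m w * cnj (m w)) + dz (\<lambda>q. of_real (l q)) w * disc_S (m w)) * cnj (m w))
      (dzbar G' w - (of_real (l w) * disc_S (m w) * cnj (deriv m w)
        + (of_real (l w) * (m w * cnj (deriv m w)) + dzbar (\<lambda>q. of_real (l q)) w * disc_S (m w)) * cnj (m w)))"
    if w: "w \<in> U" for w
    unfolding P_def[abs_def] of_real_mult
    by (rule has_wirtinger_eq[OF has_wirtinger_diff[OF Gw[OF w] has_wirtinger_mult[OF has_wirtinger_mult[OF lw[OF w]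
      has_wirtinger_disc_S[OF mw[OF w]]] has_wirtinger_cnj[OF mw[OF w]]]]])
      simp_all
  have dzbP: "dzbar P w = - disc_S (m w) * (cnj (deriv m w) * l w + cnj (m w) * dzbar (\<lambda>q. of_real (l q)) w)"
    if w: "w \<in> U" for w
    unfolding has_wirtinger_dzbar[OF PW[OF w]] dzbG[OF w]
    by (simp add: disc_S_complex algebra_simps power2_eq_square)
  have dzP: "dz P w * m w = - disc_S (m w) * dz (\<lambda>q. of_real (l q)) w" if w: "w \<in> U" for w
  proof (rule continuous_eq_if_frequently_eq[OF U _ _ w])
    show "continuous_on U (\<lambda>w. dz P w * m w)" by (intro smooth_on_imp_continuous_on smooth_intros U sP sm)
    show "continuous_on U (\<lambda>w. - disc_S (m w) * dz (\<lambda>q. of_real (l q)) w)"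
      by (intro smooth_on_imp_continuous_on smooth_intros U slc sm)
    show "\<forall>\<^sub>F q in at w. q \<in> U \<longrightarrow> dz P q * m q = - disc_S (m q) * dz (\<lambda>q. of_real (l q)) q"
      using ev[OF w]
    proof eventually_elim
      case (elim q)
      show ?case
      proof
        assume q: "q \<in> U"
        have d: "has_wirtinger (deriv m) q (deriv (deriv m) q) 0"
          by (rule has_wirtinger_holomorphic[OF holomorphic_deriv[OF hol U] U q])
        note W = has_wirtinger_mult[OF has_wirtinger_mult[OF lw[OF q] has_wirtinger_mult[OF mw[OF q] has_wirtinger_cnj[OF mw[OF q]]]]
          has_wirtinger_cnj[OF d]]
        have "dzbar (dz G') q = dz (dzbar G') q" by (rule dzbar_dz_commute[OF U sG q])
        also have "\<dots> = cnj (m q) * cnj (deriv m q) * (dz (\<lambda>q. of_real (l q)) q * m q + of_real (l q) * deriv m q)"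
          using has_wirtinger_dz[OF has_wirtinger_cong[OF U q _ W, of "dzbar G'"]] dzbG
          by (simp add: algebra_simps)
        finally have 1: "dzbar (dz G') q = cnj (m q) * cnj (deriv m q) * (dz (\<lambda>q. of_real (l q)) q * m q + of_real (l q) * deriv m q)" .
        have 2: "dz (\<lambda>q. cnj (g' q)) q = deriv m q"
          using has_wirtinger_dz[OF has_wirtinger_cnj[OF gw[OF q]]] by simp
        have g0: "g' q \<noteq> 0" using g'[OF q] elim by simp
        have ne: "cnj (m q) * cnj (deriv m q) / (disc_S (m q) * disc_D (m q)) \<noteq> 0"
          using elim crit[OF q] cmod_less_one_D_S[OF m_less[OF q]] by simp
        have 3: "disc_S (m q) * disc_D (m q) * (dz (\<lambda>q. of_real (l q)) q * m q + of_real (l q) * deriv m q) - of_real (l q) * deriv m q + (m q)\<^sup>2 * dz G' q = 0"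
          using pde[OF q g0] ne
          unfolding 1 2 g'[OF q] dzbG[OF q] has_wirtinger_dzbar[OF gw[OF q]] antiholo_pde_factor[OF elim m_less[OF q]]
          by (simp only: mult_eq_0_iff simp_thms)
        have "m q * (dz P q * m q) = m q * (- disc_S (m q) * dz (\<lambda>q. of_real (l q)) q)"
        proof -
          have *: "M * ((\<alpha> - (L * (\<mu> * N) + k * (1 + M * N)) * N) * M) = M * (- (1 + M * N) * k)"
            if "(1 + M * N) * (1 - M * N) * (k * M + L * \<mu>) - L * \<mu> + M\<^sup>2 * \<alpha> = 0" for M N L \<mu> k \<alpha> :: complex
            using that by algebra
          show ?thesis
            unfolding has_wirtinger_dz[OF PW[OF q]] using *[OF 3[unfolded of_real_mult disc_S_complex disc_D_complex]]
            by (simp add: disc_S_complex)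
        qed
        then show "dz P q * m q = - disc_S (m q) * dz (\<lambda>q. of_real (l q)) q"
          using elim mult_left_cancel by blast
      qed
    qed
  qed
  have "disc_data U m P l"
    by unfold_locales (use U hol m_less sl l_pos sP dzP dzbP in auto)
  then show ?thesis by (simp add: P_def[abs_def])
qed

section \<open>Smooth division and extension across poles\<close>

definition radial_integral :: "complex \<Rightarrow> nat \<Rightarrow> (complex \<Rightarrow> complex) \<Rightarrow> complex \<Rightarrow> complex" where
  "radial_integral w0 n f z = integral (cbox 0 1) (\<lambda>t::real. of_real t ^ n * f (w0 + of_real t * (z - w0)))"

lemma radial_in_ball:
  fixes z w0 :: complex
  assumes "z \<in> ball w0 R" "t \<in> {0..1::real}"
  shows "w0 + of_real t * (z - w0) \<in> ball w0 R"
proof -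
  have "cmod (of_real t * (z - w0)) \<le> 1 * cmod (z - w0)"
    using assms(2) unfolding norm_mult by (intro mult_right_mono) auto
  also have "\<dots> < R" using assms(1) by (simp add: dist_norm norm_minus_commute)
  finally show ?thesis by (simp add: dist_norm)
qed

lemma continuous_on_radial:
  fixes f :: "complex \<Rightarrow> complex"
  assumes "continuous_on (ball w0 R) f"
  shows "continuous_on (ball w0 R \<times> cbox 0 (1::real)) (\<lambda>(z, t). of_real t ^ n * f (w0 + of_real t * (z - w0)))"
  unfolding split_beta
  by (intro continuous_intros continuous_on_compose2[OF assms]) (auto simp del: mem_ball intro!: radial_in_ball)

lemma radial_integrable:
  fixes f :: "complex \<Rightarrow> complex"
  assumes "continuous_on (ball w0 R) f" "z \<in> ball w0 R"
  shows "(\<lambda>t::real. of_real t ^ n * f (w0 + of_real t * (z - w0))) integrable_on cbox 0 1"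
  by (intro integrable_continuous continuous_intros continuous_on_compose2[OF assms(1)])
    (use assms(2) in \<open>auto simp del: mem_ball intro!: radial_in_ball\<close>)

lemma radial_integral_derivative:
  assumes f: "smooth_on (ball w0 R) f" and z: "z \<in> ball w0 R"
  shows "(radial_integral w0 n f has_derivative (\<lambda>v. radial_integral w0 (Suc n) (dderiv v f) z)) (at z)"
proof -
  define A where "A z t v = of_real t ^ Suc n * dderiv v f (w0 + of_real t * (z - w0))" for z v and t :: real
  define fx where "fx z t = blinfun_compose (blinfun_scaleR_left (A z t 1)) (Blinfun Re) + blinfun_compose (blinfun_scaleR_left (A z t \<i>)) (Blinfun Im)" for z t
  note blR = bounded_linear_Blinfun_apply[OF bounded_linear_Re]
  note blI = bounded_linear_Blinfun_apply[OF bounded_linear_Im]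
  have fx: "blinfun_apply (fx z t) v = A z t v" if z: "z \<in> ball w0 R" "t \<in> cbox 0 1" for z t v
  proof -
    have "f differentiable (at (w0 + of_real t * (z - w0)))"
      using smooth_on_imp_differentiable[OF f] radial_in_ball[of z w0 R t] z by simp
    from dderiv_basis[OF this, of v]
    show ?thesis by (simp add: fx_def A_def blinfun.add_left blR blI scaleR_conv_of_real algebra_simps)
  qed
  have c: "continuous_on (ball w0 R) f" by (rule smooth_on_imp_continuous_on[OF f])
  have cd: "continuous_on (ball w0 R) (dderiv v f)" for v by (rule smooth_on_imp_continuous_on[OF smooth_on_dderiv[OF f]])
  have cA: "continuous_on (ball w0 R \<times> cbox 0 1) (\<lambda>p. A (fst p) (snd p) v)" for v
    using continuous_on_radial[OF cd, of "Suc n" v] by (simp add: A_def split_beta)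
  have cfx: "continuous_on (ball w0 R \<times> cbox 0 1) (\<lambda>(z, t). fx z t)"
    unfolding fx_def split_beta by (intro continuous_intros bounded_linear.continuous_on[OF bounded_linear_blinfun_scaleR_left] cA)
  have "((\<lambda>z. integral (cbox 0 1) (\<lambda>t. of_real t ^ n * f (w0 + of_real t * (z - w0)))) has_derivative
      blinfun_apply (integral (cbox 0 1) (fx z))) (at z within ball w0 R)"
  proof (rule leibniz_rule[OF _ _ cfx z convex_ball])
    show "(\<lambda>t. of_real t ^ n * f (w0 + of_real t * (z - w0))) integrable_on cbox 0 (1::real)" if "z \<in> ball w0 R" for z
      by (rule radial_integrable[OF c that])
    fix z and t :: real assume z: "z \<in> ball w0 R" and t: "t \<in> cbox 0 1"
    have "f differentiable (at (w0 + of_real t * (z - w0)))"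
      using smooth_on_imp_differentiable[OF f] radial_in_ball[of z w0 R t] z t by simp
    note d = has_derivative_dderiv[OF this]
    have "((\<lambda>z. w0 + of_real t * (z - w0)) has_derivative (\<lambda>v. of_real t * v)) (at z)"
      by (auto intro!: derivative_eq_intros)
    from has_derivative_compose[OF this d]
    have "((\<lambda>z. of_real t ^ n * f (w0 + of_real t * (z - w0))) has_derivative
       (\<lambda>v. of_real t ^ n * dderiv (of_real t * v) f (w0 + of_real t * (z - w0)))) (at z)"
      by (rule has_derivative_mult_right)
    moreover have "of_real t ^ n * dderiv (of_real t * v) f (w0 + of_real t * (z - w0)) = A z t v" for v
      using linear_scale[OF has_derivative_linear[OF d], of t v] unfolding A_def
      by (simp add: scaleR_conv_of_real)
    ultimately have "((\<lambda>z. of_real t ^ n * f (w0 + of_real t * (z - w0))) has_derivative A z t) (at z)"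
      by (simp only: eta_contract_eq)
    moreover have "A z t = blinfun_apply (fx z t)" by (simp add: fun_eq_iff fx[OF z t])
    ultimately have "((\<lambda>z. of_real t ^ n * f (w0 + of_real t * (z - w0))) has_derivative blinfun_apply (fx z t)) (at z)"
      by simp
    then show "((\<lambda>z. of_real t ^ n * f (w0 + of_real t * (z - w0))) has_derivative blinfun_apply (fx z t)) (at z within ball w0 R)"
      by (rule has_derivative_at_withinI)
  qed
  then have 1: "(radial_integral w0 n f has_derivative blinfun_apply (integral (cbox 0 1) (fx z))) (at z)"
    using z unfolding radial_integral_def[abs_def] by (simp add: at_within_open[OF z open_ball])
  have "continuous_on (cbox 0 1) (fx z)"
  proof -
    have "continuous_on (cbox 0 1) (\<lambda>t::real. (z, t))" by (intro continuous_intros)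
    moreover have "(\<lambda>t. (z, t)) ` cbox 0 1 \<subseteq> ball w0 R \<times> cbox 0 (1::real)" using z by auto
    ultimately show ?thesis using continuous_on_compose2[OF cfx] by fastforce
  qed
  then have "blinfun_apply (integral (cbox 0 1) (fx z)) v = radial_integral w0 (Suc n) (dderiv v f) z" for v
    using fx[OF z] unfolding radial_integral_def
    by (subst blinfun_apply_integral[OF integrable_continuous]) (auto intro!: integral_cong simp: A_def)
  then show ?thesis using 1 by (metis (no_types, lifting) ext)
qed

lemma Ck_on_radial_integral:
  assumes "smooth_on (ball w0 R) f"
  shows "Ck_on k (ball w0 R) (radial_integral w0 n f)"
  using assms
proof (induction k arbitrary: n f)
  case 0
  have "continuous_on (ball w0 R) (radial_integral w0 n f)"
    by (intro continuous_at_imp_continuous_on ballI has_derivative_continuous[OF radial_integral_derivative[OF 0]])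
  then show ?case by simp
next
  case (Suc k)
  note D = radial_integral_derivative[OF Suc.prems]
  have "Ck_on k (ball w0 R) (dderiv v (radial_integral w0 n f))" for v
    by (rule Ck_on_cong[OF open_ball dderiv_eqI[OF D, symmetric] Suc.IH[OF smooth_on_dderiv[OF Suc.prems]]])
  moreover have "radial_integral w0 n f differentiable (at p)" if "p \<in> ball w0 R" for p
    using D[OF that] unfolding differentiable_def by blast
  ultimately show ?case by simp
qed

lemma smooth_on_radial_integral: "smooth_on (ball w0 R) f \<Longrightarrow> smooth_on (ball w0 R) (radial_integral w0 n f)"
  using Ck_on_radial_integral unfolding smooth_on_def[of _ "radial_integral w0 n f"] by blast

lemma radial_integral_cmul_add:
  assumes "continuous_on (ball w0 R) f" "continuous_on (ball w0 R) h" "z \<in> ball w0 R"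
  shows "radial_integral w0 n (\<lambda>q. a * f q + b * h q) z = a * radial_integral w0 n f z + b * radial_integral w0 n h z"
proof -
  have "radial_integral w0 n (\<lambda>q. a * f q + b * h q) z = integral (cbox 0 1) (\<lambda>t::real.
      a * (of_real t ^ n * f (w0 + of_real t * (z - w0))) + b * (of_real t ^ n * h (w0 + of_real t * (z - w0))))"
    unfolding radial_integral_def by (simp add: algebra_simps)
  also have "\<dots> = integral (cbox 0 1) (\<lambda>t::real. a * (of_real t ^ n * f (w0 + of_real t * (z - w0))))
     + integral (cbox 0 1) (\<lambda>t::real. b * (of_real t ^ n * h (w0 + of_real t * (z - w0))))"
    by (intro Henstock_Kurzweil_Integration.integral_add integrable_on_mult_right radial_integrable[OF _ assms(3)] assms(1,2))
  finally show ?thesis unfolding radial_integral_def by simp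
qed

lemma has_wirtinger_radial_integral:
  assumes f: "smooth_on (ball w0 R) f" and z: "z \<in> ball w0 R"
  shows "has_wirtinger (radial_integral w0 n f) z (radial_integral w0 (Suc n) (dz f) z) (radial_integral w0 (Suc n) (dzbar f) z)"
proof -
  note D = radial_integral_derivative[OF assms]
  have cd: "continuous_on (ball w0 R) (dderiv v f)" for v by (rule smooth_on_imp_continuous_on[OF smooth_on_dderiv[OF f]])
  have e: "dz f = (\<lambda>q. (1/2) * dderiv 1 f q + (- \<i> / 2) * dderiv \<i> f q)"
    "dzbar f = (\<lambda>q. (1/2) * dderiv 1 f q + (\<i> / 2) * dderiv \<i> f q)"
    by (simp_all add: fun_eq_iff dz_def dzbar_def field_simps)
  show ?thesis
  proof (rule has_wirtinger_eq[OF has_wirtinger_self])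
    show "radial_integral w0 n f differentiable at z" using D by (auto simp: differentiable_def)
  qed (unfold e radial_integral_cmul_add[OF cd cd z], unfold dz_def dzbar_def dderiv_eqI[OF D], simp_all add: field_simps)
qed

lemma radial_has_vector_derivative:
  assumes f: "smooth_on (ball w0 R) f" and z: "z \<in> ball w0 R" and t: "t \<in> {0..1}"
  shows "((\<lambda>t. f (w0 + of_real t * (z - w0))) has_vector_derivative
    (z - w0) * dz f (w0 + of_real t * (z - w0)) + cnj (z - w0) * dzbar f (w0 + of_real t * (z - w0))) (at t)"
proof -
  have "f differentiable (at (w0 + of_real t * (z - w0)))"
    using smooth_on_imp_differentiable[OF f radial_in_ball[OF z t]] .
  note W = has_wirtinger_self[OF this, unfolded has_wirtinger_def]
  have "((\<lambda>t. w0 + of_real t * (z - w0)) has_derivative (\<lambda>h. of_real h * (z - w0))) (at t)"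
    by (auto intro!: derivative_eq_intros bounded_linear.has_derivative[OF bounded_linear_of_real])
  from has_derivative_compose[OF this W]
  show ?thesis unfolding has_vector_derivative_def
    by (rule has_derivative_eq_rhs) (simp add: fun_eq_iff scaleR_conv_of_real algebra_simps)
qed

lemma radial_taylor:
  assumes f: "smooth_on (ball w0 R) f" and z: "z \<in> ball w0 R"
  shows "f z - f w0 = (z - w0) * radial_integral w0 0 (dz f) z + cnj (z - w0) * radial_integral w0 0 (dzbar f) z"
    and "f z = radial_integral w0 0 f z + (z - w0) * radial_integral w0 1 (dz f) z + cnj (z - w0) * radial_integral w0 1 (dzbar f) z"
proof -
  let ?g = "\<lambda>t. w0 + of_real t * (z - w0)"
  note D = radial_has_vector_derivative[OF f z]
  have sm: "smooth_on (ball w0 R) (dz f)" "smooth_on (ball w0 R) (dzbar f)" by (intro smooth_intros open_ball f)+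
  note i = radial_integrable[OF smooth_on_imp_continuous_on z]
  have 1: "((\<lambda>t. (z - w0) * dz f (?g t) + cnj (z - w0) * dzbar f (?g t)) has_integral
     f (?g 1) - f (?g 0)) {0..1}"
    by (rule fundamental_theorem_of_calculus[OF _ has_vector_derivative_at_within[OF D]]) auto
  have 2: "integral (cbox 0 1) (\<lambda>t::real. (z - w0) * (of_real t ^ n * dz f (?g t)) + cnj (z - w0) * (of_real t ^ n * dzbar f (?g t)))
    = (z - w0) * radial_integral w0 n (dz f) z + cnj (z - w0) * radial_integral w0 n (dzbar f) z" for n
  proof -
    have "integral (cbox 0 1) (\<lambda>t::real. (z - w0) * (of_real t ^ n * dz f (?g t)) + cnj (z - w0) * (of_real t ^ n * dzbar f (?g t)))
      = integral (cbox 0 1) (\<lambda>t::real. (z - w0) * (of_real t ^ n * dz f (?g t)))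
        + integral (cbox 0 1) (\<lambda>t::real. cnj (z - w0) * (of_real t ^ n * dzbar f (?g t)))"
      by (intro Henstock_Kurzweil_Integration.integral_add integrable_on_mult_right i sm)
    then show ?thesis by (simp add: radial_integral_def)
  qed
  show "f z - f w0 = (z - w0) * radial_integral w0 0 (dz f) z + cnj (z - w0) * radial_integral w0 0 (dzbar f) z"
    using integral_unique[OF 1] 2[of 0] by simp
  have D1: "((\<lambda>t. of_real t * f (?g t)) has_vector_derivative of_real t * ((z - w0) * dz f (?g t) + cnj (z - w0) * dzbar f (?g t)) + 1 * f (?g t)) (at t)"
    if "t \<in> {0..1}" for t :: real
    by (rule has_vector_derivative_mult[OF _ D[OF that]])
      (auto intro!: derivative_eq_intros has_vector_derivative_of_real)
  have "((\<lambda>t. of_real t * ((z - w0) * dz f (?g t) + cnj (z - w0) * dzbar f (?g t)) + 1 * f (?g t)) has_integral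
     of_real 1 * f (?g 1) - of_real 0 * f (?g 0)) {0..1}"
    by (rule fundamental_theorem_of_calculus[OF _ has_vector_derivative_at_within[OF D1]]) auto
  from integral_unique[OF this]
  have "f z = integral (cbox 0 1) (\<lambda>t::real. ((z - w0) * (of_real t ^ 1 * dz f (?g t)) + cnj (z - w0) * (of_real t ^ 1 * dzbar f (?g t)))
     + of_real t ^ 0 * f (?g t))"
    by (simp add: algebra_simps)
  also have "\<dots> = integral (cbox 0 1) (\<lambda>t::real. ((z - w0) * (of_real t ^ 1 * dz f (?g t)) + cnj (z - w0) * (of_real t ^ 1 * dzbar f (?g t))))
     + radial_integral w0 0 f z"
    unfolding radial_integral_def
    by (rule Henstock_Kurzweil_Integration.integral_add) (intro integrable_add integrable_on_mult_right i sm f)+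
  finally show "f z = radial_integral w0 0 f z + (z - w0) * radial_integral w0 1 (dz f) z + cnj (z - w0) * radial_integral w0 1 (dzbar f) z"
    unfolding 2 by simp
qed

text \<open>Hadamard's lemma: the \<open>dzbar\<close>-part of the first order Taylor remainder also carries a factor
  \<open>z - w0\<close>.\<close>

lemma smooth_divide_linear:
  assumes f: "smooth_on (ball w0 R) f" and h: "smooth_on (ball w0 R) h" and R: "R > 0" and f0: "f w0 = 0"
    and df: "\<And>z. z \<in> ball w0 R \<Longrightarrow> dzbar f z = (z - w0) * h z"
  obtains q where "smooth_on (ball w0 R) q" "\<And>z. z \<in> ball w0 R \<Longrightarrow> f z = (z - w0) * q z"
    "\<And>z. z \<in> ball w0 R \<Longrightarrow> dzbar q z = h z"
proof -
  define q where "q z = radial_integral w0 0 (dz f) z + cnj (z - w0) * radial_integral w0 1 h z" for z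
  have sq: "smooth_on (ball w0 R) q"
    unfolding q_def[abs_def] by (intro smooth_intros open_ball smooth_on_radial_integral f h)
  have fq: "f z = (z - w0) * q z" if z: "z \<in> ball w0 R" for z
  proof -
    have I0: "radial_integral w0 0 (dzbar f) z = integral (cbox 0 1) (\<lambda>t::real. (z - w0) * (of_real t ^ 1 * h (w0 + of_real t * (z - w0))))"
      unfolding radial_integral_def
      by (intro integral_cong) (use radial_in_ball[OF z] in \<open>simp add: df\<close>)
    also have "\<dots> = (z - w0) * radial_integral w0 1 h z" by (simp add: radial_integral_def)
    finally have I: "radial_integral w0 0 (dzbar f) z = (z - w0) * radial_integral w0 1 h z" .
    show ?thesis using radial_taylor(1)[OF f z] unfolding I f0 q_def by (simp add: algebra_simps)
  qed
  have off: "dzbar q z = h z" if z: "z \<in> ball w0 R" and zn: "z \<noteq> w0" for z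
  proof -
    have d: "q differentiable (at z)" by (rule smooth_on_imp_differentiable[OF sq z])
    have lin: "has_wirtinger (\<lambda>z. z - w0) z 1 0" 
      by (intro has_wirtinger_field) (auto intro!: derivative_eq_intros)
    have "has_wirtinger f z ((z - w0) * dz q z + 1 * q z) ((z - w0) * dzbar q z + 0 * q z)"
      by (rule has_wirtinger_cong[OF open_ball z fq[symmetric] has_wirtinger_mult[OF lin has_wirtinger_self[OF d]]])
    then show ?thesis using df[OF z] has_wirtinger_dzbar zn by fastforce
  qed
  have "dzbar q z = h z" if z: "z \<in> ball w0 R" for z
  proof (cases "z = w0")
    case True
    show ?thesis unfolding True
    proof (rule continuous_eq_if_frequently_eq[OF open_ball[of w0 R], of "dzbar q" h w0])
      show "continuous_on (ball w0 R) (dzbar q)" "continuous_on (ball w0 R) h" "w0 \<in> ball w0 R"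
        using R by (auto intro!: smooth_on_imp_continuous_on smooth_intros sq h)
      show "\<forall>\<^sub>F q' in at w0. q' \<in> ball w0 R \<longrightarrow> dzbar q q' = h q'"
        using off by (auto simp: eventually_at_filter)
    qed
  qed (use off z in auto)
  then show ?thesis using that sq fq by blast
qed

lemma smooth_divide_power:
  assumes "smooth_on (ball w0 R) f" "smooth_on (ball w0 R) h" "R > 0"
    and "\<And>z. z \<in> ball w0 R \<Longrightarrow> dzbar f z = (z - w0) ^ k * h z"
    and "\<forall>\<^sub>F z in at w0. cmod (f z) \<le> B * cmod (z - w0) ^ k"
  obtains q where "smooth_on (ball w0 R) q" "\<And>z. z \<in> ball w0 R \<Longrightarrow> f z = (z - w0) ^ k * q z"
  using assms
proof (induction k arbitrary: f thesis)
  case 0 then show ?case by (metis mult_1 power_0)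
next
  case (Suc k)
  have w0: "w0 \<in> ball w0 R" using Suc.prems by simp
  have "((\<lambda>z. B * cmod (z - w0) ^ Suc k) \<longlongrightarrow> B * cmod (w0 - w0) ^ Suc k) (at w0)" by (intro tendsto_intros)
  then have "((\<lambda>z. B * cmod (z - w0) ^ Suc k) \<longlongrightarrow> 0) (at w0)" by simp
  then have "(f \<longlongrightarrow> 0) (at w0)" by (rule Lim_null_comparison[OF Suc.prems(6)])
  moreover have "(f \<longlongrightarrow> f w0) (at w0)"
    using smooth_on_imp_continuous_on[OF Suc.prems(2)] w0 continuous_on_eq_continuous_at[OF open_ball, of w0 R f]
    by (auto simp only: isCont_def)
  ultimately have f0: "f w0 = 0" using tendsto_unique by (metis at_neq_bot)
  have "smooth_on (ball w0 R) (\<lambda>z. (z - w0) ^ k * h z)" by (intro smooth_intros open_ball Suc.prems)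
  then obtain q1 where q1: "smooth_on (ball w0 R) q1" "\<And>z. z \<in> ball w0 R \<Longrightarrow> f z = (z - w0) * q1 z"
    "\<And>z. z \<in> ball w0 R \<Longrightarrow> dzbar q1 z = (z - w0) ^ k * h z"
    using smooth_divide_linear[OF Suc.prems(2) _ Suc.prems(4) f0, of "\<lambda>z. (z - w0) ^ k * h z"] Suc.prems(5)
    by (auto simp: mult.assoc)
  have "\<forall>\<^sub>F z in at w0. z \<in> ball w0 R" using w0 eventually_at_in_open'[OF open_ball] by blast
  moreover have "\<forall>\<^sub>F z in at w0. z \<noteq> w0" by (simp add: eventually_at_filter)
  ultimately have "\<forall>\<^sub>F z in at w0. cmod (q1 z) \<le> B * cmod (z - w0) ^ k"
    using Suc.prems(6)
  proof eventually_elim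
    case (elim z)
    then have "cmod (z - w0) * cmod (q1 z) \<le> cmod (z - w0) * (B * cmod (z - w0) ^ k)"
      using q1(2)[OF elim(1)] by (simp add: norm_mult mult.left_commute)
    then show ?case using elim(2) by (simp only: mult_le_cancel_left_pos zero_less_norm_iff right_minus_eq not_False_eq_True)
  qed
  from Suc.IH[OF _ q1(1) Suc.prems(3,4) q1(3) this]
  obtain q where "smooth_on (ball w0 R) q" "\<And>z. z \<in> ball w0 R \<Longrightarrow> q1 z = (z - w0) ^ k * q z" by blast
  then show ?case using Suc.prems(1) q1(2) by (simp add: mult.assoc)
qed

text \<open>The Poincare lemma on a disc, applied to the differential of \<open>P\<close>.\<close>

lemma smooth_extension:
  assumes R: "R > 0" and P: "smooth_on (ball w0 R - {w0}) P"
    and F: "smooth_on (ball w0 R) F1" "smooth_on (ball w0 R) F2"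
    and dP: "\<And>z. z \<in> ball w0 R - {w0} \<Longrightarrow> dz P z = F1 z" "\<And>z. z \<in> ball w0 R - {w0} \<Longrightarrow> dzbar P z = F2 z"
  obtains Q where "smooth_on (ball w0 R) Q" "\<And>z. z \<in> ball w0 R - {w0} \<Longrightarrow> Q z = P z"
    "\<And>z. z \<in> ball w0 R \<Longrightarrow> dz Q z = F1 z" "\<And>z. z \<in> ball w0 R \<Longrightarrow> dzbar Q z = F2 z"
proof -
  let ?B = "ball w0 R" and ?V = "ball w0 R - {w0}"
  have oV: "open ?V" by (intro open_Diff) auto
  have off: "dzbar F1 z = dz F2 z" if z: "z \<in> ?V" for z
  proof -
    have W: "has_wirtinger (dz P) z (dz (dz P) z) (dzbar (dz P) z)" "has_wirtinger (dzbar P) z (dz (dzbar P) z) (dzbar (dzbar P) z)"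
      using z by (auto intro!: has_wirtinger_self smooth_on_imp_differentiable[of ?V] smooth_intros oV P)
    have "dzbar F1 z = dzbar (dz P) z"
      by (rule has_wirtinger_dzbar[OF has_wirtinger_cong[OF oV z dP(1) W(1)]])
    also have "\<dots> = dz (dzbar P) z" by (rule dzbar_dz_commute[OF oV P z])
    also have "\<dots> = dz F2 z"
      by (rule has_wirtinger_dz[OF has_wirtinger_cong[OF oV z dP(2) W(2)], symmetric])
    finally show ?thesis .
  qed
  have closed: "dzbar F1 z = dz F2 z" if z: "z \<in> ?B" for z
  proof (cases "z = w0")
    case True
    show ?thesis unfolding True
    proof (rule continuous_eq_if_frequently_eq[OF open_ball[of w0 R], of "dzbar F1" "dz F2" w0])
      show "continuous_on ?B (dzbar F1)" "continuous_on ?B (dz F2)" "w0 \<in> ?B"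
        using R by (auto intro!: smooth_on_imp_continuous_on smooth_intros F)
      show "\<forall>\<^sub>F q in at w0. q \<in> ?B \<longrightarrow> dzbar F1 q = dz F2 q"
        using off by (auto simp: eventually_at_filter)
    qed
  qed (use off z in auto)
  define Q where "Q z = (z - w0) * radial_integral w0 0 F1 z + cnj (z - w0) * radial_integral w0 0 F2 z" for z
  have sQ: "smooth_on ?B Q"
    unfolding Q_def[abs_def] by (intro smooth_intros open_ball smooth_on_radial_integral F)
  have QW: "has_wirtinger Q z (F1 z) (F2 z)" if z: "z \<in> ?B" for z
  proof -
    have lin: "has_wirtinger (\<lambda>z. z - w0) z 1 0" 
      by (intro has_wirtinger_field) (auto intro!: derivative_eq_intros)
    have e: "radial_integral w0 1 (dzbar F1) z = radial_integral w0 1 (dz F2) z"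
      unfolding radial_integral_def
      by (intro integral_cong) (use radial_in_ball[OF z] in \<open>simp add: closed\<close>)
    show ?thesis unfolding Q_def[abs_def]
      by (rule has_wirtinger_eq[OF has_wirtinger_add[OF has_wirtinger_mult[OF lin has_wirtinger_radial_integral[OF F(1) z]]
        has_wirtinger_mult[OF has_wirtinger_cnj[OF lin] has_wirtinger_radial_integral[OF F(2) z]]]])
        (use radial_taylor(2)[OF F(1) z] radial_taylor(2)[OF F(2) z] e in \<open>simp_all add: algebra_simps\<close>)
  qed
  have PW: "has_wirtinger P z (F1 z) (F2 z)" if "z \<in> ?V" for z
    using has_wirtinger_self[OF smooth_on_imp_differentiable[OF P that]] dP[OF that] by simp
  have D: "((\<lambda>z. P z - Q z) has_derivative (\<lambda>v. 0)) (at z)" if z: "z \<in> ?V" for z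
    using has_wirtinger_diff[OF PW[OF z] QW] z unfolding has_wirtinger_def by auto
  have "connected ?V" by (intro connected_open_delete) auto
  moreover define z1 where "z1 = w0 + of_real (R / 2)"
  moreover have "z1 \<in> ?V" using R by (simp add: z1_def dist_norm)
  moreover define C where "C = P z1 - Q z1"
  ultimately have C: "P z - Q z = C" if "z \<in> ?V" for z
    using has_derivative_zero_unique_connected[OF oV _ D that] by metis
  show ?thesis
  proof (rule that[of "\<lambda>z. Q z + C"])
    show "smooth_on ?B (\<lambda>z. Q z + C)" by (intro smooth_intros open_ball sQ)
    show "Q z + C = P z" if "z \<in> ?V" for z using C[OF that] by (simp add: algebra_simps)
    have "has_wirtinger (\<lambda>z. Q z + C) z (F1 z) (F2 z)" if "z \<in> ?B" for z
      using has_wirtinger_add[OF QW[OF that] has_wirtinger_const] by simp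
    then show "dz (\<lambda>z. Q z + C) z = F1 z" "dzbar (\<lambda>z. Q z + C) z = F2 z" if "z \<in> ?B" for z
      using that has_wirtinger_dz has_wirtinger_dzbar by blast+
  qed
qed

lemma disc_data_cong:
  assumes d: "disc_data U m P l" and "\<And>q. q \<in> U \<Longrightarrow> P' q = P q"
  shows "disc_data U m P' l"
proof -
  interpret disc_data U m P l by (rule d)
  have W: "has_wirtinger P' w (dz P w) (dzbar P w)" if "w \<in> U" for w
    by (rule has_wirtinger_cong[OF open_U that _ Pw[OF that]]) (simp add: assms(2))
  have s: "smooth_on U P'"
    by (rule smooth_on_cong[OF open_U _ smooth_P]) (simp add: assms(2))
  show ?thesis
    by unfold_locales
      (use open_U hol m_less smooth_l l_pos s core_z core_zbar has_wirtinger_dz[OF W] has_wirtinger_dzbar[OF W] in auto)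
qed

lemma disc_data_local:
  assumes "open U" and loc: "\<And>w. w \<in> U \<Longrightarrow> \<exists>T. w \<in> T \<and> disc_data T m P l"
  shows "disc_data U m P l"
proof
  show "open U" by fact
  show "m holomorphic_on U"
    unfolding holomorphic_on_open[OF \<open>open U\<close>]
  proof
    fix x assume x: "x \<in> U"
    obtain T where "x \<in> T" "disc_data T m P l" using loc[OF x] by blast
    then show "\<exists>f'. (m has_field_derivative f') (at x)"
      using holomorphic_derivI[OF disc_data.hol disc_data.open_U] by blast
  qed
  have T: "\<exists>T. open T \<and> x \<in> T \<and> smooth_on T l \<and> smooth_on T P" if x: "x \<in> U" for x
  proof -
    obtain T where "x \<in> T" "disc_data T m P l" using loc[OF x] by blast
    then show ?thesis
      using disc_data.smooth_l disc_data.smooth_P disc_data.open_U by (intro exI[of _ T]) blast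
  qed
  show "smooth_on U l" by (rule smooth_on_local) (use T in blast)
  show "smooth_on U P" by (rule smooth_on_local) (use T in blast)
  fix w assume "w \<in> U"
  then obtain T where T: "w \<in> T" "disc_data T m P l" using loc by blast
  then show "cmod (m w) < 1" "0 < l w" "dz P w * m w = - disc_S (m w) * dz (\<lambda>q. of_real (l q)) w"
    "dzbar P w = - disc_S (m w) * (cnj (deriv m w) * l w + cnj (m w) * dzbar (\<lambda>q. of_real (l q)) w)"
    using disc_data.m_less disc_data.l_pos disc_data.core_z disc_data.core_zbar by blast+
qed

text \<open>The integrability condition of the system shows that \<open>l\<^sub>z\<close> has a \<open>dzbar\<close>-derivative divisible by
  \<open>m\<close>. Boundedness of \<open>b\<close> bounds \<open>l\<^sub>z / m\<close>, so \<open>m\<close> divides \<open>l\<^sub>z\<close> smoothly, and the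
  differential of \<open>P\<close> extends across the zero \<open>w0\<close> of \<open>m\<close>.\<close>

lemma disc_data_pole:
  fixes m P :: "complex \<Rightarrow> complex" and l :: "complex \<Rightarrow> real"
  assumes U: "open U" and hol: "m holomorphic_on U" and m_less: "\<And>w. w \<in> U \<Longrightarrow> cmod (m w) < 1"
    and sl: "smooth_on U l" and l_pos: "\<And>w. w \<in> U \<Longrightarrow> l w > 0"
    and w0: "w0 \<in> U" and m0: "m w0 = 0" and iso: "\<forall>\<^sub>F q in at w0. m q \<noteq> 0"
    and data: "disc_data {q \<in> U. m q \<noteq> 0} m P l"
    and bound: "\<forall>\<^sub>F q in at w0. cmod (disc_data.b m P l q) \<le> C"
  obtains R Q where "R > 0" "ball w0 R \<subseteq> U" "\<And>q. q \<in> ball w0 R - {w0} \<Longrightarrow> m q \<noteq> 0"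
    "\<And>q. q \<in> ball w0 R - {w0} \<Longrightarrow> Q q = P q" "disc_data (ball w0 R) m Q l"
proof -
  define V where "V = {q \<in> U. m q \<noteq> 0}"
  interpret d: disc_data V m P l using data by (simp add: V_def)
  obtain r where r: "r > 0" "ball w0 r \<subseteq> U" using U w0 open_contains_ball by blast
  have "\<not> m constant_on ball w0 r"
  proof
    assume "m constant_on ball w0 r"
    then have "\<forall>q\<in>ball w0 r. m q = m w0" using r by (auto simp: constant_on_def)
    then have z: "\<forall>q\<in>ball w0 r. m q = 0" using m0 by simp
    have "\<forall>\<^sub>F q in at w0. q \<in> ball w0 r"
      using eventually_at_in_open'[OF open_ball[of w0 r], of w0] r by simp
    then have "\<forall>\<^sub>F q in at w0. False"
      using iso by eventually_elim (use z in blast)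
    then show False by simp
  qed
  then obtain u R n where f: "0 < n" "0 < R" "ball w0 R \<subseteq> ball w0 r" "u holomorphic_on ball w0 R"
    "\<And>w. w \<in> ball w0 R \<Longrightarrow> m w = (w - w0) ^ n * u w" "\<And>w. w \<in> ball w0 R \<Longrightarrow> u w \<noteq> 0"
    using holomorphic_factor_zero_nonconstant[OF holomorphic_on_subset[OF hol r(2)] open_ball connected_ball _ m0]
    using r by (metis centre_in_ball)
  let ?B = "ball w0 R"
  have BU: "?B \<subseteq> U" using f r by blast
  have BV: "?B - {w0} \<subseteq> V" using BU f(5,6) by (auto simp: V_def)
  define L where "L = dz (\<lambda>q. complex_of_real (l q))"
  define L' where "L' = dzbar (\<lambda>q. complex_of_real (l q))"
  have slc: "smooth_on U (\<lambda>q. complex_of_real (l q))" by (intro smooth_intros U sl)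
  have sL: "smooth_on U L" and sL': "smooth_on U L'" unfolding L_def L'_def by (intro smooth_intros U slc)+
  have sm: "smooth_on U m" by (rule smooth_on_holomorphic[OF U hol])
  have sd: "smooth_on U (deriv m)" by (rule smooth_on_holomorphic[OF U holomorphic_deriv[OF hol U]])
  have SD: "complex_of_real (disc_S (m w)) \<noteq> 0" "complex_of_real (disc_D (m w)) \<noteq> 0" if "w \<in> U" for w
    using cmod_less_one_D_S[OF m_less[OF that]] by auto
  define F2 where "F2 q = - of_real (disc_S (m q)) * (cnj (deriv m q) * of_real (l q) + cnj (m q) * L' q)" for q
  have sF2: "smooth_on U F2" unfolding F2_def[abs_def] by (intro smooth_intros U sm sd slc sL' sl)
  define K where "K q = (deriv m q * cnj (m q) * (cnj (deriv m q) * of_real (l q) + cnj (m q) * L' q)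
      + (of_real (disc_S (m q)) - 1) * cnj (deriv m q) * L q) / (of_real (disc_S (m q)) * of_real (disc_D (m q)))" for q
  have sK: "smooth_on U K" unfolding K_def[abs_def] using SD by (intro smooth_intros U sm sd slc sL sL' sl) auto
  have offK: "dzbar L w = m w * K w" if w: "w \<in> V" for w
  proof -
    have wU: "w \<in> U" and mw0: "m w \<noteq> 0" using w by (auto simp: V_def)
    have mw: "has_wirtinger m w (deriv m w) 0" by (rule d.mw[OF w])
    have dw: "has_wirtinger (deriv m) w (deriv (deriv m) w) 0"
      by (rule has_wirtinger_holomorphic[OF holomorphic_deriv[OF hol U] U wU])
    have lw: "has_wirtinger (\<lambda>q. complex_of_real (l q)) w (L w) (L' w)"
      unfolding L_def L'_def by (rule has_wirtinger_self[OF smooth_on_imp_differentiable[OF slc wU]])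
    have Lw: "has_wirtinger L w (dz L w) (dzbar L w)" and Lw': "has_wirtinger L' w (dz L' w) (dzbar L' w)"
      by (rule has_wirtinger_self[OF smooth_on_imp_differentiable[OF _ wU]], rule sL sL')+
    have LL': "dz L' w = dzbar L w" unfolding L_def L'_def by (rule dzbar_dz_commute[OF U slc wU, symmetric])
    have Pz: "has_wirtinger (dz P) w (dz (dz P) w) (dzbar (dz P) w)"
      by (rule has_wirtinger_self[OF smooth_on_imp_differentiable[OF _ w]]) (intro smooth_intros d.open_U d.smooth_P)
    note 1 = has_wirtinger_mult[OF Pz mw]
    have 2: "has_wirtinger (\<lambda>q. dz P q * m q) w
      (- (of_real (disc_S (m w)) * dz L w + (m w * cnj 0 + deriv m w * cnj (m w)) * L w))
      (- (of_real (disc_S (m w)) * dzbar L w + (m w * cnj (deriv m w) + 0 * cnj (m w)) * L w))"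
      by (rule has_wirtinger_cong[OF d.open_U w _ has_wirtinger_minus[OF has_wirtinger_mult[OF has_wirtinger_disc_S[OF mw] Lw]]])
        (simp add: d.core_z L_def)
    have 3: "dzbar (dz P) w * m w = - (of_real (disc_S (m w)) * dzbar L w + m w * cnj (deriv m w) * L w)"
      using has_wirtinger_dzbar[OF 1] has_wirtinger_dzbar[OF 2] by simp
    note 4 = has_wirtinger_minus[OF has_wirtinger_mult[OF has_wirtinger_disc_S[OF mw]
        has_wirtinger_add[OF has_wirtinger_mult[OF has_wirtinger_cnj[OF dw] lw] has_wirtinger_mult[OF has_wirtinger_cnj[OF mw] Lw']]]]
    have "dzbar (dz P) w = dz (dzbar P) w" by (rule dzbar_dz_commute[OF d.open_U d.smooth_P w])
    also have "\<dots> = - (of_real (disc_S (m w)) * (cnj (deriv m w) * L w + cnj (m w) * dzbar L w)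
        + deriv m w * cnj (m w) * (cnj (deriv m w) * of_real (l w) + cnj (m w) * L' w))"
      using has_wirtinger_dz[OF has_wirtinger_cong[OF d.open_U w _ 4, of "dzbar P"]] d.core_zbar
      by (simp add: L'_def LL'[unfolded L'_def])
    finally have 5: "dzbar (dz P) w = - (of_real (disc_S (m w)) * (cnj (deriv m w) * L w + cnj (m w) * dzbar L w)
        + deriv m w * cnj (m w) * (cnj (deriv m w) * of_real (l w) + cnj (m w) * L' w))" .
    have "of_real (disc_S (m w)) * of_real (disc_D (m w)) * dzbar L w = 
      m w * (deriv m w * cnj (m w) * (cnj (deriv m w) * of_real (l w) + cnj (m w) * L' w)
      + (of_real (disc_S (m w)) - 1) * cnj (deriv m w) * L w)"
      using 3 unfolding 5 disc_S_complex disc_D_complex by algebra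
    then show ?thesis using SD[OF wU] by (simp add: K_def field_simps)
  qed
  have K: "dzbar L w = m w * K w" if w: "w \<in> ?B" for w
  proof (cases "w = w0")
    case True
    show ?thesis unfolding True
    proof (rule continuous_eq_if_frequently_eq[OF open_ball[of w0 R], of "dzbar L" "\<lambda>w. m w * K w" w0])
      show "continuous_on ?B (dzbar L)" "continuous_on ?B (\<lambda>w. m w * K w)"
        by (rule continuous_on_subset[OF _ BU], intro smooth_on_imp_continuous_on smooth_intros U sL sm sK)+
      show "\<forall>\<^sub>F q in at w0. q \<in> ?B \<longrightarrow> dzbar L q = m q * K q"
        unfolding eventually_at_filter using offK BV by (intro always_eventually) blast
    qed (use f in auto)
  qed (use offK BV w in auto)
  have bL: "\<forall>\<^sub>F z in at w0. cmod (L z) \<le> (2 * (cmod (u w0) + 1) * (C + cmod (deriv m w0 * l w0) + 1)) * cmod (z - w0) ^ n"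
  proof -
    have cont: "isCont h w0" if "smooth_on U h" for h :: "complex \<Rightarrow> complex"
      using smooth_on_imp_continuous_on[OF that] w0 U continuous_on_eq_continuous_at by blast
    have lim: "\<forall>\<^sub>F z in at w0. cmod (h z) < cmod (h w0) + 1" if "isCont h w0" for h :: "complex \<Rightarrow> complex"
      using order_tendstoD(2)[OF tendsto_norm[OF that[unfolded isCont_def]]] by simp
    have 1: "\<forall>\<^sub>F z in at w0. cmod (u z) < cmod (u w0) + 1"
      using f(2,4) holomorphic_on_imp_continuous_on continuous_on_eq_continuous_at[OF open_ball] centre_in_ball
      by (intro lim) blast
    have 2: "\<forall>\<^sub>F z in at w0. cmod (deriv m z * l z) < cmod (deriv m w0 * l w0) + 1"
      by (intro lim[of "\<lambda>z. deriv m z * of_real (l z)"] cont) (intro smooth_intros U sd slc sl)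
    have "isCont (\<lambda>z. complex_of_real (disc_S (m z)) * of_real (disc_D (m z))) w0"
      by (intro cont smooth_intros U sm)
    then have "((\<lambda>z. cmod (of_real (disc_S (m z)) * of_real (disc_D (m z)))) \<longlongrightarrow>
       cmod (of_real (disc_S (m w0)) * of_real (disc_D (m w0)))) (at w0)"
      unfolding isCont_def by (rule tendsto_norm)
    then have 3: "\<forall>\<^sub>F z in at w0. 1 / 2 < cmod (of_real (disc_S (m z)) * of_real (disc_D (m z)))"
      by (rule order_tendstoD(1)) (simp add: m0 disc_S_def disc_D_def)
    have 4: "\<forall>\<^sub>F z in at w0. z \<in> ?B" using eventually_at_in_open'[OF open_ball[of w0 R], of w0] f(2) by simp
    have 5: "\<forall>\<^sub>F z in at w0. z \<noteq> w0" by (simp add: eventually_at_filter)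
    show ?thesis using 1 2 3 4 5 bound
    proof eventually_elim
      case (elim z)
      then have zV: "z \<in> V" and zB: "z \<in> ?B" using BV by auto
      have zU: "z \<in> U" using zV by (simp add: V_def)
      have "of_real (disc_D (m z)) * of_real (disc_S (m z)) * d.a z = d.b z + (cnj (m z))\<^sup>2 * d.c z"
        unfolding d.b_def by simp
      then have "(of_real (disc_S (m z)) * of_real (disc_D (m z))) * L z = m z * (d.b z + (cnj (m z))\<^sup>2 * d.c z)"
        unfolding L_def d.dz_l[OF zV] by (simp add: algebra_simps)
      then have e: "cmod (of_real (disc_S (m z)) * of_real (disc_D (m z))) * cmod (L z) = cmod (m z) * cmod (d.b z + (cnj (m z))\<^sup>2 * d.c z)"
        by (metis norm_mult)
      have m1: "(cmod (m z))\<^sup>2 \<le> 1" using m_less[OF zU] by (simp add: power_le_one)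
      have "cmod (d.b z + (cnj (m z))\<^sup>2 * d.c z) \<le> cmod (d.b z) + (cmod (m z))\<^sup>2 * cmod (d.c z)"
        by (rule order_trans[OF norm_triangle_ineq]) (simp add: norm_mult norm_power)
      also have "\<dots> \<le> C + 1 * (cmod (deriv m w0 * l w0) + 1)"
        using elim m1 by (intro add_mono mult_mono) (auto simp: d.c_def mult.commute)
      finally have b: "cmod (d.b z + (cnj (m z))\<^sup>2 * d.c z) \<le> C + cmod (deriv m w0 * l w0) + 1" by simp
      have mm: "cmod (m z) \<le> cmod (z - w0) ^ n * (cmod (u w0) + 1)"
        unfolding f(5)[OF zB] norm_mult norm_power using elim(1) by (intro mult_left_mono) auto
      have "1 / 2 * cmod (L z) \<le> cmod (of_real (disc_S (m z)) * of_real (disc_D (m z))) * cmod (L z)"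
        using elim(3) by (intro mult_right_mono) auto
      also have "\<dots> \<le> (cmod (z - w0) ^ n * (cmod (u w0) + 1)) * (C + cmod (deriv m w0 * l w0) + 1)"
        unfolding e using mm b by (intro mult_mono) auto
      finally show ?case by (simp add: algebra_simps)
    qed
  qed
  have su: "smooth_on ?B u" by (rule smooth_on_holomorphic[OF open_ball f(4)])
  have "smooth_on ?B (\<lambda>w. u w * K w)" by (intro smooth_intros open_ball su smooth_on_subset[OF sK BU])
  then obtain q where q: "smooth_on ?B q" "\<And>z. z \<in> ?B \<Longrightarrow> L z = (z - w0) ^ n * q z"
    using smooth_divide_power[OF smooth_on_subset[OF sL BU] _ f(2) _ bL, of "\<lambda>w. u w * K w"] K f(5)
    by (auto simp: mult.assoc)
  define F1 where "F1 z = - of_real (disc_S (m z)) * (q z / u z)" for z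
  have sF1: "smooth_on ?B F1" unfolding F1_def[abs_def]
    using f(6) by (intro smooth_intros open_ball q su smooth_on_subset[OF sm BU]) auto
  have F1m: "F1 z * m z = - of_real (disc_S (m z)) * L z" if "z \<in> ?B" for z
    unfolding F1_def q(2)[OF that] f(5)[OF that] using f(6)[OF that] by simp
  have "dz P z = F1 z" if z: "z \<in> ?B - {w0}" for z
  proof -
    have zV: "z \<in> V" using z BV by blast
    have "dz P z * m z = F1 z * m z" using d.core_z[OF zV] F1m[of z] z by (simp add: L_def)
    then show ?thesis using zV by (simp add: V_def)
  qed
  moreover have "dzbar P z = F2 z" if z: "z \<in> ?B - {w0}" for z
    using d.core_zbar[of z] z BV unfolding F2_def L'_def by auto
  ultimately obtain Q where Q: "smooth_on ?B Q" "\<And>z. z \<in> ?B - {w0} \<Longrightarrow> Q z = P z"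
    "\<And>z. z \<in> ?B \<Longrightarrow> dz Q z = F1 z" "\<And>z. z \<in> ?B \<Longrightarrow> dzbar Q z = F2 z"
    using smooth_extension[OF f(2) smooth_on_subset[OF d.smooth_P BV] sF1 smooth_on_subset[OF sF2 BU]] by blast
  have Qd: "disc_data ?B m Q l"
  proof
    show "m holomorphic_on ?B" by (rule holomorphic_on_subset[OF hol BU])
    show "smooth_on ?B l" by (rule smooth_on_subset[OF sl BU])
    fix w assume w: "w \<in> ?B"
    show "cmod (m w) < 1" "0 < l w" using m_less l_pos BU w by auto
    show "dz Q w * m w = - disc_S (m w) * dz (\<lambda>q. of_real (l q)) w"
      using F1m[OF w] Q(3)[OF w] by (simp add: L_def)
    show "dzbar Q w = - disc_S (m w) * (cnj (deriv m w) * l w + cnj (m w) * dzbar (\<lambda>q. of_real (l q)) w)"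
      using Q(4)[OF w] by (simp add: F2_def L'_def)
  qed (use Q in auto)
  show ?thesis using that[OF f(2) BU _ Q(2) Qd] BV unfolding V_def by blast
qed

section \<open>Maps on the Riemann surface\<close>

lemma holomorphic_eventually_nonzero:
  assumes f: "f holomorphic_on ball w r" and b: "b \<in> ball w r" "f b \<noteq> 0"
  shows "\<forall>\<^sub>F q in at w. f q \<noteq> 0"
proof (cases "f w = 0")
  case True
  have r: "w \<in> ball w r" using b by (auto intro: le_less_trans[OF zero_le_dist])
  obtain e where e: "0 < e" "\<And>z. z \<in> ball w e - {w} \<Longrightarrow> f z \<noteq> 0"
    using isolated_zeros[OF f open_ball connected_ball r True b] by metis
  show ?thesis unfolding eventually_at
    by (rule exI[of _ e]) (use e in \<open>auto simp: dist_commute\<close>)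
next
  case False
  have r: "w \<in> ball w r" using b by (auto intro: le_less_trans[OF zero_le_dist])
  have "isCont f w"
    using holomorphic_on_imp_continuous_on[OF f] continuous_on_eq_continuous_at[OF open_ball, of w r f] r by blast
  then show ?thesis using False tendsto_imp_eventually_ne unfolding isCont_def by blast
qed

locale surface_atlas =
  fixes M :: "'a::t2_space set" and A :: "'a chart set"
  assumes surface: "riemann_surface M A"
begin

lemma M_eq: "(\<Union>c\<in>A. fst c) = M"
  and connected_M: "connected M"
  using surface by (auto simp: riemann_surface_def)

lemma chart_of: "p \<in> M \<Longrightarrow> \<exists>c\<in>A. p \<in> fst c"
  using M_eq by blast

context
  fixes c assumes c: "c \<in> A"
begin

lemma open_chart_image: "open (chart_image c)"
  and openin_chart: "openin (top_of_set M) (fst c)"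
  and homeo: "homeomorphism (fst c) (chart_image c) (snd c) (chart_inv c)"
  using surface c by (auto simp: riemann_surface_def)

lemma chart_subset: "fst c \<subseteq> M" using M_eq c by blast

lemma chart_inv_in: "w \<in> chart_image c \<Longrightarrow> chart_inv c w \<in> fst c"
  and chart_inv_in_M: "w \<in> chart_image c \<Longrightarrow> chart_inv c w \<in> M"
  and chart_right: "w \<in> chart_image c \<Longrightarrow> snd c (chart_inv c w) = w"
  and chart_left: "p \<in> fst c \<Longrightarrow> chart_inv c (snd c p) = p"
  and chart_in: "p \<in> fst c \<Longrightarrow> snd c p \<in> chart_image c"
  using homeo chart_subset unfolding homeomorphism_def by blast+

lemma in_chart_snd: "p \<in> fst c \<Longrightarrow> in_chart c f (snd c p) = f p"
  by (simp add: in_chart_def chart_left)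

lemma at_within_chart: "p \<in> fst c \<Longrightarrow> at p within M = at p within fst c"
proof -
  assume p: "p \<in> fst c"
  obtain S where "open S" "fst c = M \<inter> S" using openin_chart by (auto simp: openin_open)
  then show ?thesis using p by (intro at_within_nhd[of p S]) auto
qed

lemma tendsto_chart:
  assumes w: "w \<in> chart_image c" and lim: "(in_chart c f \<longlongrightarrow> v) (at w)"
  shows "(f \<longlongrightarrow> v) (at (chart_inv c w) within M)"
proof -
  let ?p = "chart_inv c w"
  have p: "?p \<in> fst c" by (rule chart_inv_in[OF w])
  have "(snd c \<longlongrightarrow> snd c ?p) (at ?p within fst c)"
    using homeomorphism_cont1[OF homeo] p by (simp add: continuous_on_def)
  moreover have "\<forall>\<^sub>F q in at ?p within fst c. snd c q \<noteq> w"
    unfolding eventually_at_filter using chart_left by (intro always_eventually) metis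
  ultimately have "filterlim (snd c) (at w) (at ?p within fst c)"
    by (simp add: filterlim_at chart_right[OF w])
  from filterlim_compose[OF lim this]
  have "((\<lambda>q. in_chart c f (snd c q)) \<longlongrightarrow> v) (at ?p within fst c)" .
  then show ?thesis unfolding at_within_chart[OF p]
    by (rule Lim_transform_eventually)
      (auto simp: eventually_at_filter in_chart_snd intro!: always_eventually)
qed

lemma at_within_nontrivial:
  assumes w: "w \<in> chart_image c"
  shows "at (chart_inv c w) within M \<noteq> bot"
proof
  assume bot: "at (chart_inv c w) within M = bot"
  have "(chart_inv c \<longlongrightarrow> chart_inv c w) (at w)"
    using homeomorphism_cont2[OF homeo] w continuous_on_eq_continuous_at[OF open_chart_image] by (auto simp: isCont_def)
  moreover have "\<forall>\<^sub>F q in at w. chart_inv c q \<in> M \<and> chart_inv c q \<noteq> chart_inv c w"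
  proof -
    have "\<forall>\<^sub>F q in at w. q \<in> chart_image c" by (rule eventually_at_in_open'[OF open_chart_image w])
    moreover have "\<forall>\<^sub>F q in at w. q \<noteq> w" by (simp add: eventually_at_filter)
    ultimately show ?thesis by eventually_elim (metis chart_inv_in_M chart_right w)
  qed
  ultimately have "filterlim (chart_inv c) (at (chart_inv c w) within M) (at w)"
    by (auto simp: filterlim_at elim: eventually_mono)
  then have "filtermap (chart_inv c) (at w) = bot" unfolding bot filterlim_def by (simp add: bot_unique)
  then show False by (simp add: filtermap_bot_iff)
qed

lemma Lim_chart:
  assumes "w \<in> chart_image c" "(in_chart c f \<longlongrightarrow> v) (at w)"
  shows "Lim (at (chart_inv c w) within M) f = v"
  using tendsto_Lim[OF at_within_nontrivial tendsto_chart] assms by blast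

lemma openin_chart_preimage:
  assumes "open S"
  shows "openin (top_of_set M) {p \<in> fst c. snd c p \<in> S}"
proof -
  have "openin (top_of_set (fst c)) (fst c \<inter> snd c -` S)"
    by (rule continuous_openin_preimage_gen[OF homeomorphism_cont1[OF homeo] assms])
  moreover have "fst c \<inter> snd c -` S = {p \<in> fst c. snd c p \<in> S}" by auto
  ultimately show ?thesis using openin_trans[OF _ openin_chart] by metis
qed

lemma open_chart_preimage:
  assumes "openin (top_of_set M) T"
  shows "open {w \<in> chart_image c. chart_inv c w \<in> T}"
proof -
  obtain S where S: "open S" "T = M \<inter> S" using assms by (auto simp: openin_open)
  have "open (chart_image c \<inter> chart_inv c -` S)"
    by (rule continuous_open_preimage[OF homeomorphism_cont2[OF homeo] open_chart_image S(1)])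
  moreover have "{w \<in> chart_image c. chart_inv c w \<in> T} = chart_image c \<inter> chart_inv c -` S"
    using S chart_inv_in_M by auto
  ultimately show ?thesis by simp
qed

end

lemma continuous_on_M:
  assumes "\<And>c. c \<in> A \<Longrightarrow> continuous_on (chart_image c) (in_chart c f)"
  shows "continuous_on M f"
  unfolding continuous_on_eq_continuous_within
proof
  fix p assume "p \<in> M"
  then obtain c where c: "c \<in> A" "p \<in> fst c" using chart_of by blast
  have "continuous_on (fst c) (\<lambda>q. in_chart c f (snd c q))"
    by (rule continuous_on_compose2[OF assms[OF c(1)] homeomorphism_cont1[OF homeo[OF c(1)]]])
      (use chart_in[OF c(1)] in auto)
  then have "continuous_on (fst c) f"
    by (rule continuous_on_eq) (rule in_chart_snd[OF c(1)])
  then show "continuous (at p within M) f"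
    using c by (simp add: at_within_chart continuous_on_eq_continuous_within)
qed

definition locally_constant_at :: "('a \<Rightarrow> complex) \<Rightarrow> 'a \<Rightarrow> bool" where
  "locally_constant_at f p \<longleftrightarrow> (\<exists>T. openin (top_of_set M) T \<and> p \<in> T \<and> f constant_on T)"

lemma deriv_zero_if_locally_constant:
  assumes c: "c \<in> A" and w: "w \<in> chart_image c" and lc: "locally_constant_at f (chart_inv c w)"
  shows "deriv (in_chart c f) w = 0"
proof -
  obtain T where T: "openin (top_of_set M) T" "chart_inv c w \<in> T" "f constant_on T"
    using lc by (auto simp: locally_constant_at_def)
  then obtain k where k: "\<And>p. p \<in> T \<Longrightarrow> f p = k" by (auto simp: constant_on_def)
  have "(in_chart c f has_field_derivative 0) (at w)"
    by (rule has_field_derivative_transform_within_open[OF DERIV_const open_chart_preimage[OF c T(1)]])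
      (use w T k in \<open>auto simp: in_chart_def\<close>)
  then show ?thesis by (rule DERIV_imp_deriv)
qed

lemma not_locally_constant_imp:
  assumes c: "c \<in> A" and w: "w \<in> chart_image c" and hol: "in_chart c f holomorphic_on chart_image c"
    and nlc: "\<not> locally_constant_at f (chart_inv c w)"
  shows "\<forall>\<^sub>F q in at w. deriv (in_chart c f) q \<noteq> 0" "\<forall>\<^sub>F q in at w. in_chart c f q \<noteq> 0"
proof -
  obtain r where r: "r > 0" "ball w r \<subseteq> chart_image c"
    using open_chart_image[OF c] w open_contains_ball by blast
  have hb: "in_chart c f holomorphic_on ball w r" by (rule holomorphic_on_subset[OF hol r(2)])
  have nc: "\<not> in_chart c f constant_on ball w r"
  proof
    assume "in_chart c f constant_on ball w r"
    then obtain k where k: "\<And>q. q \<in> ball w r \<Longrightarrow> in_chart c f q = k" by (auto simp: constant_on_def)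
    let ?T = "{p \<in> fst c. snd c p \<in> ball w r}"
    have "openin (top_of_set M) ?T" by (rule openin_chart_preimage[OF c open_ball])
    moreover have "chart_inv c w \<in> ?T" using chart_inv_in[OF c w] chart_right[OF c w] r by simp
    moreover have "f p = k" if "p \<in> ?T" for p
      using k[of "snd c p"] in_chart_snd[OF c, of p f] that by (metis (no_types, lifting) mem_Collect_eq)
    ultimately show False using nlc unfolding locally_constant_at_def constant_on_def by blast
  qed
  have "\<exists>b\<in>ball w r. deriv (in_chart c f) b \<noteq> 0"
  proof (rule ccontr)
    assume "\<not> (\<exists>b\<in>ball w r. deriv (in_chart c f) b \<noteq> 0)"
    then have "(in_chart c f has_field_derivative 0) (at q within ball w r)" if "q \<in> ball w r" for q
      using holomorphic_derivI[OF hb open_ball that] that by (metis has_field_derivative_at_within)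
    then have "\<exists>k. \<forall>x\<in>ball w r. in_chart c f x = k"
      by (intro has_field_derivative_zero_constant) auto
    then show False using nc by (auto simp: constant_on_def)
  qed
  then show "\<forall>\<^sub>F q in at w. deriv (in_chart c f) q \<noteq> 0"
    using holomorphic_eventually_nonzero[OF holomorphic_deriv[OF hb open_ball]] by blast
  have "\<exists>b\<in>ball w r. in_chart c f b \<noteq> 0" using nc by (auto simp: constant_on_def)
  then show "\<forall>\<^sub>F q in at w. in_chart c f q \<noteq> 0"
    using holomorphic_eventually_nonzero[OF hb] by blast
qed

lemma nowhere_locally_constant:
  assumes hol: "\<And>c. c \<in> A \<Longrightarrow> in_chart c f holomorphic_on chart_image c"
    and nc: "\<not> f constant_on M" and p: "p \<in> M"
  shows "\<not> locally_constant_at f p"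
proof
  assume lp: "locally_constant_at f p"
  let ?W = "{p \<in> M. locally_constant_at f p}"
  have oW: "openin (top_of_set M) ?W"
  proof (subst openin_subopen, intro ballI)
    fix q assume "q \<in> ?W"
    then obtain T where "openin (top_of_set M) T" "q \<in> T" "f constant_on T" by (auto simp: locally_constant_at_def)
    then show "\<exists>T. openin (top_of_set M) T \<and> q \<in> T \<and> T \<subseteq> ?W"
      using openin_subset[of "top_of_set M" T] by (intro exI[of _ T]) (auto simp: locally_constant_at_def)
  qed
  have oC: "openin (top_of_set M) (M - ?W)"
  proof (subst openin_subopen, intro ballI)
    fix q assume q: "q \<in> M - ?W"
    then obtain c where c: "c \<in> A" "q \<in> fst c" using chart_of by blast
    define w where "w = snd c q"
    have w: "w \<in> chart_image c" and qw: "chart_inv c w = q" using c chart_in chart_left by (auto simp: w_def)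
    have "\<forall>\<^sub>F z in at w. deriv (in_chart c f) z \<noteq> 0"
      by (rule not_locally_constant_imp(1)[OF c(1) w hol[OF c(1)]]) (use q qw in auto)
    then obtain S where S: "open S" "w \<in> S" "\<And>z. z \<in> S \<Longrightarrow> z \<noteq> w \<Longrightarrow> deriv (in_chart c f) z \<noteq> 0"
      by (auto simp: eventually_at_topological)
    let ?T = "{p \<in> fst c. snd c p \<in> S}"
    have "?T \<subseteq> M - ?W"
    proof
      fix p' assume p': "p' \<in> ?T"
      show "p' \<in> M - ?W"
      proof (cases "p' = q")
        case False
        then have "snd c p' \<noteq> w" using p' c chart_left by (metis (no_types, lifting) mem_Collect_eq qw)
        then have "deriv (in_chart c f) (snd c p') \<noteq> 0" using S p' by blast
        then have "\<not> locally_constant_at f (chart_inv c (snd c p'))"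
          using deriv_zero_if_locally_constant[OF c(1) chart_in[OF c(1)]] p' by blast
        then show ?thesis using p' chart_left[OF c(1)] chart_subset[OF c(1)] by auto
      qed (use q in simp)
    qed
    then show "\<exists>T. openin (top_of_set M) T \<and> q \<in> T \<and> T \<subseteq> M - ?W"
      using openin_chart_preimage[OF c(1) S(1)] c S w_def by blast
  qed
  have "closedin (top_of_set M) ?W" using oC by (auto simp: closedin_def)
  then have "?W = {} \<or> ?W = M"
    using connected_M[unfolded connected_clopen, rule_format, OF conjI[OF oW]] by blast
  then have W: "?W = M" using lp p by blast
  have "f a = f b" if "a \<in> M" "b \<in> M" for a b
  proof (rule connected_local_const[OF connected_M that], intro ballI)
    fix a assume "a \<in> M"
    then have "locally_constant_at f a" using W by blast
    then obtain T where T: "openin (top_of_set M) T" "a \<in> T" "f constant_on T"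
      unfolding locally_constant_at_def by blast
    then obtain S where S: "open S" "T = M \<inter> S" by (auto simp: openin_open)
    have "f a = f b" if "b \<in> S" "b \<in> M" for b using T S that by (auto simp: constant_on_def)
    then show "\<forall>\<^sub>F b in at a within M. f a = f b"
      unfolding eventually_at_topological using S T by blast
  qed
  then show False using nc p by (metis constant_on_def)
qed

lemma isolated_zeros_in_chart:
  assumes hol: "\<And>c. c \<in> A \<Longrightarrow> in_chart c f holomorphic_on chart_image c"
    and nc: "\<not> f constant_on M" and c: "c \<in> A" and w: "w \<in> chart_image c"
  shows "\<forall>\<^sub>F q in at w. deriv (in_chart c f) q \<noteq> 0" "\<forall>\<^sub>F q in at w. in_chart c f q \<noteq> 0"
  using not_locally_constant_imp[OF c w hol[OF c] nowhere_locally_constant[OF hol nc chart_inv_in_M[OF c w]]] by blast+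

end

lemma continuous_sphere_map_quotient:
  fixes a b :: "'a::t2_space \<Rightarrow> complex"
  assumes a: "continuous_on M a" and b: "continuous_on M b" and ab: "\<And>p. p \<in> M \<Longrightarrow> a p \<noteq> 0 \<or> b p \<noteq> 0"
    and f: "\<And>p. p \<in> M \<Longrightarrow> f p = (if b p = 0 then None else Some (a p / b p))"
  shows "continuous_sphere_map M f"
  unfolding continuous_sphere_map_def continuous_map_def
proof (intro conjI allI impI)
  show "f \<in> topspace (top_of_set M) \<rightarrow> topspace (Alexandroff_compactification euclidean)"
    by (auto simp: f)
  fix W assume W: "openin (Alexandroff_compactification (euclidean :: complex topology)) W"
  let ?N = "{p \<in> M. b p \<noteq> 0}"
  have oN: "openin (top_of_set M) ?N"
  proof -
    have "?N = M \<inter> b -` (- {0})" by auto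
    then show ?thesis using continuous_openin_preimage_gen[OF b, of "- {0}"] by (simp add: open_Compl)
  qed
  have cont: "continuous_on ?N (\<lambda>p. a p / b p)"
    by (intro continuous_intros continuous_on_subset[OF a] continuous_on_subset[OF b]) auto
  have "(\<exists>S. open S \<and> W = Some ` S) \<or> (\<exists>K. compact K \<and> W = insert None (Some ` (UNIV - K)))"
    using W by (auto simp: openin_Alexandroff_compactification)
  then show "openin (top_of_set M) {p \<in> topspace (top_of_set M). f p \<in> W}"
  proof (elim disjE exE conjE)
    fix S assume S: "open S" "W = Some ` S"
    have "f p \<in> W \<longleftrightarrow> b p \<noteq> 0 \<and> a p / b p \<in> S" if "p \<in> M" for p
      unfolding S(2) f[OF that] by auto
    then have "{p \<in> topspace (top_of_set M). f p \<in> W} = ?N \<inter> (\<lambda>p. a p / b p) -` S"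
      unfolding topspace_euclidean_subtopology by blast
    moreover have "openin (top_of_set M) (?N \<inter> (\<lambda>p. a p / b p) -` S)"
      by (rule openin_trans[OF continuous_openin_preimage_gen[OF cont S(1)] oN])
    ultimately show ?thesis by (simp only:)
  next
    fix K assume K: "compact K" "W = insert None (Some ` (UNIV - K))"
    obtain B where B: "\<And>y. y \<in> K \<Longrightarrow> cmod y \<le> B" using compact_imp_bounded[OF K(1)] by (auto simp: bounded_iff)
    let ?F = "{p \<in> M. cmod (a p) \<le> B * cmod (b p)}"
    have cF: "closedin (top_of_set M) ?F"
    proof -
      have "continuous_on M (\<lambda>p. cmod (a p) - B * cmod (b p))" by (intro continuous_intros a b)
      from continuous_closedin_preimage[OF this closed_atMost[of 0]]
      show ?thesis by (simp add: Int_def vimage_def)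
    qed
    have FN: "?F \<subseteq> ?N" using ab by force
    have "closedin (top_of_set ?F) (?F \<inter> (\<lambda>p. a p / b p) -` K)"
      by (rule continuous_closedin_preimage[OF continuous_on_subset[OF cont FN] compact_imp_closed[OF K(1)]])
    then have "closedin (top_of_set M) (?F \<inter> (\<lambda>p. a p / b p) -` K)" using closedin_trans[OF _ cF] by blast
    moreover have "?F \<inter> (\<lambda>p. a p / b p) -` K = {p \<in> M. b p \<noteq> 0 \<and> a p / b p \<in> K}"
    proof -
      have "cmod (a p) \<le> B * cmod (b p)" if "b p \<noteq> 0" "a p / b p \<in> K" for p
        using B[OF that(2)] that(1) by (simp add: norm_divide divide_le_eq)
      then show ?thesis using FN by auto
    qed
    ultimately have "closedin (top_of_set M) {p \<in> M. b p \<noteq> 0 \<and> a p / b p \<in> K}" by simp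
    moreover have "f p \<in> W \<longleftrightarrow> \<not> (b p \<noteq> 0 \<and> a p / b p \<in> K)" if "p \<in> M" for p
      unfolding K(2) f[OF that] by auto
    then have "{p \<in> topspace (top_of_set M). f p \<in> W} = M - {p \<in> M. b p \<noteq> 0 \<and> a p / b p \<in> K}"
      unfolding topspace_euclidean_subtopology by blast
    ultimately show ?thesis by (simp add: closedin_def)
  qed
qed

lemma in_chart_normal_field:
  "in_chart c (normal_field x \<eta>) = (\<lambda>w. (in_chart c x w $ 3) *\<^sub>R in_chart c \<eta> w)"
  by (simp add: in_chart_def normal_field_def fun_eq_iff)

context surface_atlas
begin

lemma chart_point:
  assumes "p \<in> M" obtains c w where "c \<in> A" "w \<in> chart_image c" "p = chart_inv c w"
  using chart_of[OF assms] chart_in chart_left by metis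

lemma sqrt_one_minus_curvature_cong:
  assumes "sqrt_one_minus_curvature A x f" "\<And>p. p \<in> M \<Longrightarrow> f p = f' p"
  shows "sqrt_one_minus_curvature A x f'"
  using assms chart_inv_in_M unfolding sqrt_one_minus_curvature_def Let_def in_chart_def comp_def by metis

lemma surface_if_disc_data:
  assumes data: "\<And>c. c \<in> A \<Longrightarrow> disc_data (chart_image c) (in_chart c m) (in_chart c P) (in_chart c l)"
    and sign: "\<And>c w. c \<in> A \<Longrightarrow> w \<in> chart_image c \<Longrightarrow>
      \<epsilon> * ((cmod (disc_data.b (in_chart c m) (in_chart c P) (in_chart c l) w))\<^sup>2
         - (cmod (disc_data.c (in_chart c m) (in_chart c l) w))\<^sup>2) > 0"
    and eps: "\<epsilon> = 1 \<or> \<epsilon> = -1"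
  defines "x \<equiv> \<lambda>p. hs_vec (P p) (l p * disc_S (m p))" and "\<eta> \<equiv> \<lambda>p. \<epsilon> *\<^sub>R disc_normal (m p)"
  shows "spacelike_surface M A x" "timelike_unit_normal M A x \<eta>" "structure_induced_by_neg_II A x \<eta>"
    "sqrt_one_minus_curvature A x (\<lambda>p. disc_S (m p) / disc_D (m p))"
proof -
  have x: "in_chart c x w = hs_vec (in_chart c P w) (in_chart c l w * disc_S (in_chart c m w))" for c w
    by (simp add: x_def in_chart_def)
  have \<eta>: "in_chart c \<eta> w = \<epsilon> *\<^sub>R disc_normal (in_chart c m w)" for c w
    by (simp add: \<eta>_def in_chart_def)
  have S: "disc_surface (chart_image c) (in_chart c x) (in_chart c \<eta>) (in_chart c m) \<epsilon>" if c: "c \<in> A" for c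
    by (rule disc_data.disc_surfaceI[OF data[OF c] x \<eta> eps sign[OF c]])
  have H: "half_space_surface (chart_image c) (in_chart c x) (in_chart c \<eta>)" if c: "c \<in> A" for c
    using S[OF c] by (rule disc_surface.axioms)
  show "spacelike_surface M A x"
    unfolding spacelike_surface_def smooth_map_def
  proof (intro conjI ballI allI impI)
    show "smooth_on (chart_image c) (in_chart c x)" if "c \<in> A" for c
      by (rule half_space_surface.smooth_x[OF H[OF that]])
    show "0 < induced_metric (in_chart c x) w v v" if "c \<in> A" "w \<in> chart_image c" "v \<noteq> 0" for c w v
      by (rule half_space_surface.h_pos[OF H[OF that(1)] that(2,3)])
    show "0 < x p $ 3" if "p \<in> M" for p
      using that half_space_surface.pos[OF H] by (elim chart_point) (simp add: in_chart_def)
  qed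
  show "timelike_unit_normal M A x \<eta>"
    unfolding timelike_unit_normal_def smooth_map_def
  proof (intro conjI ballI allI impI)
    show "smooth_on (chart_image c) (in_chart c \<eta>)" if "c \<in> A" for c
      by (rule half_space_surface.smooth_eta[OF H[OF that]])
    show "(\<eta> p $ 1)\<^sup>2 + (\<eta> p $ 2)\<^sup>2 - (\<eta> p $ 3)\<^sup>2 = - 1" if "p \<in> M" for p
      using that half_space_surface.unit[OF H] by (elim chart_point) (simp add: in_chart_def)
    show "dS_metric (in_chart c x w) (dderiv v (in_chart c x) w) (in_chart c (normal_field x \<eta>) w) = 0"
      if "c \<in> A" "w \<in> chart_image c" for c w v
      unfolding in_chart_normal_field by (rule half_space_surface.dS_metric_dx_N[OF H[OF that(1)] that(2)])
  qed
  have props: "\<exists>k<0. \<forall>u v. second_form (in_chart c x) (\<lambda>w. (in_chart c x w $ 3) *\<^sub>R in_chart c \<eta> w) w u v = k * Re (u * cnj v)"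
    "0 < det (vector [dderiv 1 (in_chart c x) w, dderiv \<i> (in_chart c x) w, (in_chart c x w $ 3) *\<^sub>R in_chart c \<eta> w] :: real^3^3)"
    "gauss_curvature (induced_metric (in_chart c x)) w = 1 - (disc_S (in_chart c m w) / disc_D (in_chart c m w))\<^sup>2"
    if c: "c \<in> A" and w: "w \<in> chart_image c" for c w
    by (rule disc_data.surface_properties[OF data[OF c] x \<eta> eps sign[OF c] w]; assumption)+
  show "structure_induced_by_neg_II A x \<eta>"
    unfolding structure_induced_by_neg_II_def Let_def in_chart_normal_field
  proof (intro ballI)
    fix c w assume c: "c \<in> A" and w: "w \<in> chart_image c"
    obtain k where k: "k < 0" "\<And>u v. second_form (in_chart c x) (\<lambda>w. (in_chart c x w $ 3) *\<^sub>R in_chart c \<eta> w) w u v = k * Re (u * cnj v)"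
      using props(1)[OF c w] by blast
    have "k * Re (v * cnj v) < 0" if "v \<noteq> 0" for v
      using that k(1) by (simp add: mult_neg_pos sum_power2_gt_zero_iff[unfolded power2_eq_square] complex_eq_iff)
    then show "(\<forall>v. v \<noteq> 0 \<longrightarrow> second_form (in_chart c x) (\<lambda>w. (in_chart c x w $ 3) *\<^sub>R in_chart c \<eta> w) w v v < 0) \<and>
      second_form (in_chart c x) (\<lambda>w. (in_chart c x w $ 3) *\<^sub>R in_chart c \<eta> w) w 1 1 =
      second_form (in_chart c x) (\<lambda>w. (in_chart c x w $ 3) *\<^sub>R in_chart c \<eta> w) w \<i> \<i> \<and>
      second_form (in_chart c x) (\<lambda>w. (in_chart c x w $ 3) *\<^sub>R in_chart c \<eta> w) w 1 \<i> = 0 \<and>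
      second_form (in_chart c x) (\<lambda>w. (in_chart c x w $ 3) *\<^sub>R in_chart c \<eta> w) w \<i> 1 = 0 \<and>
      0 < det (vector [dderiv 1 (in_chart c x) w, dderiv \<i> (in_chart c x) w, (in_chart c x w $ 3) *\<^sub>R in_chart c \<eta> w] :: real^3^3)"
      using props(2)[OF c w] by (simp add: k(2))
  qed
  show "sqrt_one_minus_curvature A x (\<lambda>p. disc_S (m p) / disc_D (m p))"
    unfolding sqrt_one_minus_curvature_def Let_def
  proof (intro ballI)
    fix c w assume c: "c \<in> A" and w: "w \<in> chart_image c"
    have "disc_S (in_chart c m w) / disc_D (in_chart c m w) \<ge> 0"
      using disc_S_pos disc_D_pos[OF disc_data.m_less[OF data[OF c] w]] by (simp add: less_imp_le)
    then have "1 - (disc_S (in_chart c m w) / disc_D (in_chart c m w))\<^sup>2 \<le> 1 \<and>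
      sqrt (1 - (1 - (disc_S (in_chart c m w) / disc_D (in_chart c m w))\<^sup>2)) = disc_S (in_chart c m w) / disc_D (in_chart c m w)"
      by (simp only: diff_diff_eq2 add_diff_cancel_left' real_sqrt_abs abs_of_nonneg) simp
    moreover have "in_chart c (\<lambda>p. disc_S (m p) / disc_D (m p)) w = disc_S (in_chart c m w) / disc_D (in_chart c m w)"
      by (simp add: in_chart_def)
    ultimately show "gauss_curvature (induced_metric (in_chart c x)) w \<le> 1 \<and>
      sqrt (1 - gauss_curvature (induced_metric (in_chart c x)) w) = in_chart c (\<lambda>p. disc_S (m p) / disc_D (m p)) w"
      unfolding props(3)[OF c w] by (simp only:)
  qed
qed

lemma disc_data_if_surface:
  assumes sp: "spacelike_surface M A x" and tn: "timelike_unit_normal M A x \<eta>"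
    and II: "structure_induced_by_neg_II A x \<eta>"
    and curv: "sqrt_one_minus_curvature A x (\<lambda>p. \<epsilon> * \<eta> p $ 3)"
    and eps: "\<epsilon> = 1 \<or> \<epsilon> = -1"
  obtains m P l where
    "\<And>c. c \<in> A \<Longrightarrow> disc_data (chart_image c) (in_chart c m) (in_chart c P) (in_chart c l)"
    "\<And>c w. c \<in> A \<Longrightarrow> w \<in> chart_image c \<Longrightarrow>
      \<epsilon> * ((cmod (disc_data.b (in_chart c m) (in_chart c P) (in_chart c l) w))\<^sup>2
         - (cmod (disc_data.c (in_chart c m) (in_chart c l) w))\<^sup>2) > 0"
    "\<And>p. x p = hs_vec (P p) (l p * disc_S (m p))" "\<And>p. p \<in> M \<Longrightarrow> \<eta> p = \<epsilon> *\<^sub>R disc_normal (m p)"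
proof -
  define e where "e p = \<epsilon> *\<^sub>R \<eta> p" for p
  define m where "m p = - cnj (Complex (e p $ 1) (e p $ 2)) / of_real (e p $ 3 + 1)" for p
  define P where "P p = Complex (x p $ 1) (x p $ 2)" for p
  define l where "l p = x p $ 3 / disc_S (m p)" for p
  have ee: "\<epsilon> * \<epsilon> = 1" using eps by auto
  have \<eta>e: "\<eta> p = \<epsilon> *\<^sub>R e p" for p by (simp add: e_def ee)
  have e3: "e p $ 3 \<ge> 0" if p: "p \<in> M" for p
  proof -
    obtain c w where cw: "c \<in> A" "w \<in> chart_image c" "p = chart_inv c w" using chart_point[OF p] .
    define K where "K = gauss_curvature (induced_metric (in_chart c x)) w"
    have "K \<le> 1 \<and> sqrt (1 - K) = \<epsilon> * \<eta> p $ 3"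
      using curv cw unfolding sqrt_one_minus_curvature_def Let_def in_chart_def comp_def K_def by blast
    then have "0 \<le> \<epsilon> * \<eta> p $ 3" by (metis diff_ge_0_iff_ge real_sqrt_ge_zero)
    then show ?thesis by (simp add: e_def)
  qed
  have eu: "(e p $ 1)\<^sup>2 + (e p $ 2)\<^sup>2 - (e p $ 3)\<^sup>2 = -1" if "p \<in> M" for p
  proof -
    have "(e p $ 1)\<^sup>2 + (e p $ 2)\<^sup>2 - (e p $ 3)\<^sup>2 = \<epsilon> * \<epsilon> * ((\<eta> p $ 1)\<^sup>2 + (\<eta> p $ 2)\<^sup>2 - (\<eta> p $ 3)\<^sup>2)"
      by (simp add: e_def power2_eq_square algebra_simps)
    then show ?thesis using tn that ee by (simp add: timelike_unit_normal_def)
  qed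
  have m1: "cmod (m p) < 1" and me: "disc_normal (m p) = e p" if "p \<in> M" for p
    using disc_normal_inverse[OF eu e3, OF that that] unfolding m_def by auto
  have S: "disc_surface (chart_image c) (in_chart c x) (in_chart c \<eta>) (in_chart c m) \<epsilon>" if c: "c \<in> A" for c
  proof
    show "open (chart_image c)" by (rule open_chart_image[OF c])
    show "smooth_on (chart_image c) (in_chart c x)" "smooth_on (chart_image c) (in_chart c \<eta>)"
      using sp tn c by (auto simp: spacelike_surface_def timelike_unit_normal_def smooth_map_def)
    show "\<epsilon> = 1 \<or> \<epsilon> = -1" by (rule eps)
    fix w assume w: "w \<in> chart_image c"
    have p: "chart_inv c w \<in> M" by (rule chart_inv_in_M[OF c w])
    show x3: "0 < in_chart c x w $ 3" using sp p by (simp add: spacelike_surface_def in_chart_def)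
    show "(in_chart c \<eta> w $ 1)\<^sup>2 + (in_chart c \<eta> w $ 2)\<^sup>2 - (in_chart c \<eta> w $ 3)\<^sup>2 = - 1"
      using tn p by (simp add: timelike_unit_normal_def in_chart_def)
    show "cmod (in_chart c m w) < 1" using m1[OF p] by (simp add: in_chart_def)
    show "in_chart c \<eta> w = \<epsilon> *\<^sub>R disc_normal (in_chart c m w)"
      using me[OF p] \<eta>e by (simp add: in_chart_def)
    show "lorentz (dderiv v (in_chart c x) w) (in_chart c \<eta> w) = 0" for v
    proof -
      have "dS_metric (in_chart c x w) (dderiv v (in_chart c x) w) (in_chart c (normal_field x \<eta>) w) = 0"
        using tn c w by (simp add: timelike_unit_normal_def)
      then show ?thesis using x3 by (simp add: in_chart_normal_field dS_metric_lorentz lorentz_simps)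
    qed
    show "0 < lorentz (dderiv v (in_chart c x) w) (dderiv v (in_chart c x) w)" if "v \<noteq> 0" for v
    proof -
      have "0 < induced_metric (in_chart c x) w v v"
        using sp c w that by (simp add: spacelike_surface_def)
      then show ?thesis using x3 by (simp add: induced_metric_def dS_metric_lorentz zero_less_divide_iff)
    qed
  qed
  have sm: "smooth_on (chart_image c) (in_chart c m)" if c: "c \<in> A" for c
  proof -
    have "in_chart c m = (\<lambda>w. - cnj (of_real (\<epsilon> * in_chart c \<eta> w $ 1) + \<i> * of_real (\<epsilon> * in_chart c \<eta> w $ 2)) / of_real (\<epsilon> * in_chart c \<eta> w $ 3 + 1))"
      by (simp add: m_def e_def in_chart_def fun_eq_iff Complex_eq)
    moreover have "complex_of_real (\<epsilon> * in_chart c \<eta> w $ 3 + 1) \<noteq> 0" if "w \<in> chart_image c" for w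
    proof -
      have "\<epsilon> * in_chart c \<eta> w $ 3 + 1 > 0"
        using e3[OF chart_inv_in_M[OF c that]] by (simp add: e_def in_chart_def)
      then show ?thesis unfolding of_real_eq_0_iff by linarith
    qed
    ultimately show ?thesis
      using disc_surface.axioms(1)[OF S[OF c], THEN half_space_surface.smooth_eta]
      by (auto intro!: smooth_intros open_chart_image c)
  qed
  have l_eq: "in_chart c l = (\<lambda>q. in_chart c x q $ 3 / disc_S (in_chart c m q))"
    and P_eq: "in_chart c P = (\<lambda>q. Complex (in_chart c x q $ 1) (in_chart c x q $ 2))" for c
    by (simp_all add: l_def P_def in_chart_def fun_eq_iff)
  have II': "second_form (in_chart c x) (\<lambda>w. (in_chart c x w $ 3) *\<^sub>R in_chart c \<eta> w) w 1 1 =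
      second_form (in_chart c x) (\<lambda>w. (in_chart c x w $ 3) *\<^sub>R in_chart c \<eta> w) w \<i> \<i>"
      "second_form (in_chart c x) (\<lambda>w. (in_chart c x w $ 3) *\<^sub>R in_chart c \<eta> w) w 1 \<i> = 0"
      "second_form (in_chart c x) (\<lambda>w. (in_chart c x w $ 3) *\<^sub>R in_chart c \<eta> w) w \<i> 1 = 0"
      "second_form (in_chart c x) (\<lambda>w. (in_chart c x w $ 3) *\<^sub>R in_chart c \<eta> w) w 1 1 < 0"
      "0 < det (vector [dderiv 1 (in_chart c x) w, dderiv \<i> (in_chart c x) w, (in_chart c x w $ 3) *\<^sub>R in_chart c \<eta> w] :: real^3^3)"
    if "c \<in> A" "w \<in> chart_image c" for c w
    using II that unfolding structure_induced_by_neg_II_def Let_def in_chart_normal_field by (auto dest!: bspec)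
  have K: "1 - gauss_curvature (induced_metric (in_chart c x)) w = (disc_S (in_chart c m w) / disc_D (in_chart c m w))\<^sup>2"
    if "c \<in> A" "w \<in> chart_image c" for c w
  proof -
    have p: "chart_inv c w \<in> M" using chart_inv_in_M that by blast
    define k where "k = gauss_curvature (induced_metric (in_chart c x)) w"
    have "k \<le> 1 \<and> sqrt (1 - k) = e (chart_inv c w) $ 3"
      using curv that unfolding sqrt_one_minus_curvature_def Let_def k_def by (simp add: e_def in_chart_def)
    moreover have "e (chart_inv c w) $ 3 = disc_S (in_chart c m w) / disc_D (in_chart c m w)"
      unfolding me[OF p, symmetric] by (simp add: disc_normal_def in_chart_def)
    ultimately show ?thesis unfolding k_def[symmetric] by (metis diff_ge_0_iff_ge real_sqrt_pow2)
  qed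
  note D = disc_surface.disc_data_if_neg_II[OF S sm II' K, folded l_eq P_eq]
  show ?thesis
  proof (rule that[of m P l])
    show "disc_data (chart_image c) (in_chart c m) (in_chart c P) (in_chart c l)" if "c \<in> A" for c
      using D(1)[OF that that that _ that _ that _ that _ that _ that _] by blast
    show "\<epsilon> * ((cmod (disc_data.b (in_chart c m) (in_chart c P) (in_chart c l) w))\<^sup>2
         - (cmod (disc_data.c (in_chart c m) (in_chart c l) w))\<^sup>2) > 0" if "c \<in> A" "w \<in> chart_image c" for c w
      using D(2)[OF that(1) that(1) that(1) _ that(1) _ that(1) _ that(1) _ that(1) _ that(1) _ that(2)] by blast
    show "x p = hs_vec (P p) (l p * disc_S (m p))" for p
      using disc_S_pos[of "m p"] by (simp add: P_def l_def hs_vec_eta)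
    show "\<eta> p = \<epsilon> *\<^sub>R disc_normal (m p)" if "p \<in> M" for p
      using me[OF that] \<eta>e by simp
  qed
qed

lemma dS_gauss_map_eq:
  assumes x3: "l p > 0" and m: "cmod (m p) < 1" and eps: "\<epsilon> = 1 \<or> \<epsilon> = -1"
    and x: "x p = hs_vec (P p) (l p * disc_S (m p))" and \<eta>: "\<eta> p = \<epsilon> *\<^sub>R disc_normal (m p)"
  shows "dS_gauss_map x \<eta> p = map_option (\<lambda>g. P p + of_real (l p * disc_S (m p)) * g) (normal_gauss_map \<eta> p)"
proof -
  have x3': "x p $ 3 > 0" using x3 disc_S_pos[of "m p"] by (simp add: x)
  have "(\<eta> p $ 1)\<^sup>2 + (\<eta> p $ 2)\<^sup>2 - (\<eta> p $ 3)\<^sup>2 = -1"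
    unfolding \<eta> using eps by (intro lorentz_disc_normal_scaled m) auto
  from final_point_formula[OF x3' this]
  show ?thesis unfolding dS_gauss_map_def normal_field_def normal_gauss_map_def by (simp add: x complex_surj)
qed

end

section \<open>The four implications\<close>

abbreviation (input) chart_val :: "'a chart \<Rightarrow> ('a \<Rightarrow> complex option) \<Rightarrow> complex \<Rightarrow> complex" where
  "chart_val c f \<equiv> finite_val \<circ> in_chart c f"

lemma holo_point_formula:
  fixes M g gz Gz :: complex and l :: real
  assumes "M \<noteq> 0" "g = inverse M" "gz \<noteq> 0" "Gz = of_real l * gz"
  shows "(1 + (cmod g)\<^sup>2) / (cnj g * gz) * Gz = of_real (l * disc_S M) / M"
    "(1 + (cmod g)\<^sup>2) / ((cmod g)\<^sup>2 * gz) * Gz = of_real (l * disc_S M)"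
proof -
  have n: "cnj M \<noteq> 0" using assms(1) by simp
  have 2: "(complex_of_real (cmod g))\<^sup>2 = inverse (M * cnj M)"
    unfolding of_real_power[symmetric] assms(2) norm_inverse power_inverse of_real_inverse complex_norm_square ..
  have 3: "(1 + (complex_of_real (cmod g))\<^sup>2) = of_real (disc_S M) * inverse (M * cnj M)"
    unfolding 2 disc_S_complex using assms(1) n by (simp add: field_simps)
  have 4: "cnj g = inverse (cnj M)" by (simp add: assms(2))
  show "(1 + (cmod g)\<^sup>2) / (cnj g * gz) * Gz = of_real (l * disc_S M) / M"
    unfolding of_real_add of_real_1 of_real_power 3 4 assms(4) using assms(1,3) n by (simp add: field_simps)
  show "(1 + (cmod g)\<^sup>2) / ((cmod g)\<^sup>2 * gz) * Gz = of_real (l * disc_S M)"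
    unfolding of_real_add of_real_1 of_real_power 3 unfolding 2 assms(4) using assms(1,3) n by simp
qed

lemma antiholo_point_formula:
  fixes M g gz Gz :: complex and l :: real
  assumes "M \<noteq> 0" "g = cnj M" "gz \<noteq> 0" "Gz = of_real l * ((cmod g)\<^sup>2 * gz)"
  shows "(1 + (cmod g)\<^sup>2) / (cnj g * gz) * Gz = of_real (l * disc_S M) * cnj M"
    "(1 + (cmod g)\<^sup>2) / ((cmod g)\<^sup>2 * gz) * Gz = of_real (l * disc_S M)"
proof -
  have n: "cnj M \<noteq> 0" using assms(1) by simp
  have 2: "(complex_of_real (cmod g))\<^sup>2 = M * cnj M"
    unfolding of_real_power[symmetric] assms(2) complex_mod_cnj complex_norm_square ..
  have 3: "(1 + (complex_of_real (cmod g))\<^sup>2) = of_real (disc_S M)"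
    unfolding 2 disc_S_complex ..
  show "(1 + (cmod g)\<^sup>2) / (cnj g * gz) * Gz = of_real (l * disc_S M) * cnj M"
    using assms n 3 2 by (simp add: field_simps)
  show "(1 + (cmod g)\<^sup>2) / ((cmod g)\<^sup>2 * gz) * Gz = of_real (l * disc_S M)"
    using assms n 3 2 by (simp add: field_simps)
qed

lemma holo_representationI:
  assumes "\<And>c w. c \<in> A \<Longrightarrow> w \<in> chart_image c \<Longrightarrow> in_chart c g w \<noteq> None \<Longrightarrow> dz (chart_val c g) w \<noteq> 0 \<Longrightarrow>
    \<exists>m l. m \<noteq> 0 \<and> chart_val c g w = inverse m \<and> dz (chart_val c G) w = of_real l * dz (chart_val c g) w \<and>
      in_chart c x w = hs_vec (chart_val c G w - of_real (l * disc_S m) / m) (l * disc_S m)"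
  shows "holo_representation A g G x"
  unfolding holo_representation_def Let_def
proof (intro ballI impI, goal_cases)
  case (1 c w)
  then obtain m and l :: real where "m \<noteq> 0" "chart_val c g w = inverse m"
    and r: "dz (chart_val c G) w = of_real l * dz (chart_val c g) w"
    and x: "in_chart c x w = hs_vec (chart_val c G w - of_real (l * disc_S m) / m) (l * disc_S m)"
    using assms by meson
  note F = holo_point_formula[OF this(1,2) conjunct2[OF 1(3)] r]
  show ?case unfolding F x by simp
qed

lemma antiholo_representationI:
  assumes "\<And>c w. c \<in> A \<Longrightarrow> w \<in> chart_image c \<Longrightarrow> chart_val c g w \<noteq> 0 \<Longrightarrow>
    \<exists>m l. m \<noteq> 0 \<and> chart_val c g w = cnj m \<and> dzbar (chart_val c g) w \<noteq> 0 \<and>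
      dzbar (chart_val c G) w = of_real l * ((cmod (chart_val c g w))\<^sup>2 * dzbar (chart_val c g) w) \<and>
      in_chart c x w = hs_vec (chart_val c G w - of_real (l * disc_S m) * cnj m) (l * disc_S m)"
  shows "antiholo_representation A g G x"
  unfolding antiholo_representation_def Let_def
proof (intro ballI impI, goal_cases)
  case (1 c w)
  then obtain m and l :: real where "m \<noteq> 0" "chart_val c g w = cnj m" "dzbar (chart_val c g) w \<noteq> 0"
    and r: "dzbar (chart_val c G) w = of_real l * ((cmod (chart_val c g w))\<^sup>2 * dzbar (chart_val c g) w)"
    and x: "in_chart c x w = hs_vec (chart_val c G w - of_real (l * disc_S m) * cnj m) (l * disc_S m)"
    using assms by meson
  note F = antiholo_point_formula[OF this(1,2,3) r]
  show ?case unfolding F x by simp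
qed

context surface_atlas
begin

lemma smooth_on_chart_lim:
  assumes "smooth_on U h" "open U" "w \<in> U"
  shows "((\<lambda>q. cmod (h q)) \<longlongrightarrow> cmod (h w)) (at w)"
  using smooth_on_imp_continuous_on[OF assms(1)] continuous_on_eq_continuous_at[OF assms(2)] assms(3)
  by (auto simp: isCont_def intro!: tendsto_norm)

lemma holo_forward:
  assumes hol: "holomorphic_sphere_map M A g" and nc: "\<not> g constant_on M" and sG: "smooth_sphere_map M A G"
    and gt: "\<And>p a. p \<in> M \<Longrightarrow> g p = Some a \<Longrightarrow> cmod a > 1" and cond: "holo_conditions M A g G"
  shows "\<exists>x \<eta>. holo_representation A g G x \<and>
           spacelike_surface M A x \<and> timelike_unit_normal M A x \<eta> \<and>
           (\<forall>p\<in>M. normal_gauss_map \<eta> p = g p) \<and> (\<forall>p\<in>M. dS_gauss_map x \<eta> p = G p) \<and>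
           sqrt_one_minus_curvature A x (\<lambda>p. stereographic_height (g p)) \<and>
           structure_induced_by_neg_II A x \<eta>"
proof -
  define m where "m p = recip_val (g p)" for p
  have g0: "g p \<noteq> Some 0" if "p \<in> M" for p using gt[OF that] by force
  have gm: "g p = (if m p = 0 then None else Some (inverse (m p)))" and fg: "finite_val (g p) = inverse (m p)"
    and m1: "cmod (m p) < 1" if "p \<in> M" for p
    using g0[OF that] gt[OF that] by (cases "g p"; auto simp: m_def recip_val_def finite_val_def norm_inverse inverse_less_1_iff)+
  obtain l :: "'a \<Rightarrow> real" where l: "smooth_map A l" "\<And>p. p \<in> M \<Longrightarrow> l p > 0"
    and rel: "\<And>c w. c \<in> A \<Longrightarrow> w \<in> chart_image c \<Longrightarrow> in_chart c g w \<noteq> None \<Longrightarrow> dz (chart_val c g) w \<noteq> 0 \<Longrightarrow>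
       dz (chart_val c G) w / dz (chart_val c g) w = complex_of_real (in_chart c l w)"
    using cond unfolding holo_conditions_def Let_def by blast
  have cond1: "in_chart c G w \<noteq> None"
    "(cmod ((chart_val c g) w))\<^sup>2 * cmod (dzbar (chart_val c G) w) > cmod (dz (chart_val c G) w)"
    "holo_pde_lhs (chart_val c g) (chart_val c G) w = 0"
    if "c \<in> A" "w \<in> chart_image c" "in_chart c g w \<noteq> None" for c w
    using cond that unfolding holo_conditions_def Let_def by blast+
  have cond2: "\<exists>a b. ((\<lambda>q. cmod (dzbar (chart_val c G) q)) \<longlongrightarrow> a) (at w) \<and>
                    ((\<lambda>q. cmod (dz (chart_val c G) q) / (cmod ((chart_val c g) q))\<^sup>2) \<longlongrightarrow> b) (at w) \<and> a > b"
    if "c \<in> A" "w \<in> chart_image c" "in_chart c g w = None" for c w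
    using cond that unfolding holo_conditions_def Let_def by blast
  have mg: "in_chart c m = recip_val \<circ> in_chart c g" for c
    by (simp add: in_chart_def m_def fun_eq_iff)
  have hm: "in_chart c m holomorphic_on chart_image c" if c: "c \<in> A" for c
  proof -
    have "{w \<in> chart_image c. in_chart c g w \<noteq> Some 0} = chart_image c"
      using g0 chart_inv_in_M[OF c] by (auto simp: in_chart_def)
    then show ?thesis using hol c unfolding holomorphic_sphere_map_def mg by metis
  qed
  have ncm: "\<not> m constant_on M"
    using nc gm unfolding constant_on_def by metis
  have iso: "\<forall>\<^sub>F q in at w. deriv (in_chart c m) q \<noteq> 0" "\<forall>\<^sub>F q in at w. in_chart c m q \<noteq> 0"
    if "c \<in> A" "w \<in> chart_image c" for c w
    by (rule isolated_zeros_in_chart[OF hm ncm that]; assumption)+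
  define P0 where "P0 p = finite_val (G p) - of_real (l p * disc_S (m p)) / m p" for p
  define P where "P p = (if m p = 0 then Lim (at p within M) P0 else P0 p)" for p
  have chart: "disc_data (chart_image c) (in_chart c m) (in_chart c P) (in_chart c l) \<and>
    (\<forall>w\<in>chart_image c. in_chart c m w = 0 \<longrightarrow> in_chart c G w = None) \<and>
    (\<forall>w\<in>chart_image c. 1 * ((cmod (disc_data.b (in_chart c m) (in_chart c P) (in_chart c l) w))\<^sup>2
         - (cmod (disc_data.c (in_chart c m) (in_chart c l) w))\<^sup>2) > 0) \<and>
    (\<forall>w\<in>chart_image c. in_chart c m w \<noteq> 0 \<longrightarrow>
        dz (chart_val c G) w = of_real (in_chart c l w) * dz (chart_val c g) w)" if c: "c \<in> A" for c
  proof -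
    define U where "U = chart_image c"
    define mc where "mc = in_chart c m"
    define lc where "lc = in_chart c l"
    define gc where "gc = finite_val \<circ> in_chart c g"
    define Gc where "Gc = finite_val \<circ> in_chart c G"
    define V where "V = {q \<in> U. mc q \<noteq> 0}"
    have U: "open U" unfolding U_def by (rule open_chart_image[OF c])
    have pM: "chart_inv c w \<in> M" if "w \<in> U" for w using chart_inv_in_M[OF c] that by (simp add: U_def)
    have hol_mc: "mc holomorphic_on U" using hm[OF c] by (simp add: mc_def U_def)
    have mc1: "cmod (mc w) < 1" if "w \<in> U" for w using m1[OF pM[OF that]] by (simp add: mc_def in_chart_def)
    have gc: "gc w = inverse (mc w)" if "w \<in> U" for w using fg[OF pM[OF that]] by (simp add: gc_def mc_def in_chart_def)
    have gNone: "in_chart c g w = None \<longleftrightarrow> mc w = 0" if "w \<in> U" for w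
      using gm[OF pM[OF that]] by (auto simp: mc_def in_chart_def)
    have slc: "smooth_on U lc" using l(1) c by (simp add: smooth_map_def U_def lc_def)
    have lpos: "lc w > 0" if "w \<in> U" for w using l(2)[OF pM[OF that]] by (simp add: lc_def in_chart_def)
    have oV: "open V" unfolding V_def by (rule open_nonzero_set[OF U hol_mc])
    have VU: "V \<subseteq> U" by (auto simp: V_def)
    have sGc: "smooth_on V Gc"
    proof -
      have "V \<subseteq> {w \<in> chart_image c. in_chart c G w \<noteq> None}"
        using cond1(1)[OF c] gNone by (auto simp: V_def U_def)
      moreover have "smooth_on {w \<in> chart_image c. in_chart c G w \<noteq> None} Gc"
        using sG c by (simp add: smooth_sphere_map_def Gc_def)
      ultimately show ?thesis by (metis smooth_on_subset)
    qed
    have isoc: "\<forall>\<^sub>F q in at w. deriv mc q \<noteq> 0" "\<forall>\<^sub>F q in at w. mc q \<noteq> 0" if "w \<in> U" for w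
      using iso[OF c] that by (auto simp: mc_def U_def)
    have P0c: "in_chart c P0 = (\<lambda>q. Gc q - of_real (lc q * disc_S (mc q)) / mc q)"
      by (simp add: in_chart_def P0_def Gc_def lc_def mc_def fun_eq_iff)
    have dV: "disc_data V mc (in_chart c P0) lc"
      unfolding P0c
    proof (rule holo_core[OF oV holomorphic_on_subset[OF hol_mc VU] mc1 _ isoc(1) smooth_on_subset[OF slc VU] lpos sGc gc])
      fix w assume w: "w \<in> V"
      then have w': "w \<in> chart_image c" "in_chart c g w \<noteq> None" using gNone by (auto simp: V_def U_def)
      show "dz Gc w / dz gc w = of_real (lc w)" if "dz gc w \<noteq> 0"
        using rel[OF c w'] that by (simp add: gc_def Gc_def lc_def)
      show "holo_pde_lhs gc Gc w = 0"
        using cond1(3)[OF c w'] unfolding gc_def Gc_def .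
    qed (auto simp: V_def)
    interpret dV: disc_data V mc "in_chart c P0" lc by (rule dV)
    have g'V: "gc q = inverse (mc q)" if "q \<in> V" "mc q \<noteq> 0" for q using gc that VU by auto
    have G'V: "Gc q = in_chart c P0 q + of_real (lc q * disc_S (mc q)) / mc q" if "q \<in> V" "mc q \<noteq> 0" for q
      by (simp add: P0c)
    have Pc_V: "in_chart c P q = in_chart c P0 q" if "mc q \<noteq> 0" for q
      using that by (simp add: in_chart_def P_def mc_def)
    have pole: "\<exists>R Q. R > 0 \<and> ball w R \<subseteq> U \<and> (\<forall>q\<in>ball w R - {w}. mc q \<noteq> 0) \<and>
        (\<forall>q\<in>ball w R. in_chart c P q = Q q) \<and> disc_data (ball w R) mc Q lc"
      if w: "w \<in> U" and mw: "mc w = 0" for w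
    proof -
      obtain a b where ab: "((\<lambda>q. cmod (dzbar Gc q)) \<longlongrightarrow> a) (at w)"
        using cond2[OF c] w mw gNone unfolding Gc_def U_def by blast
      have "\<forall>\<^sub>F q in at w. cmod (dzbar Gc q) < a + 1" by (rule order_tendstoD(2)[OF ab]) simp
      moreover have "\<forall>\<^sub>F q in at w. q \<in> U" by (rule eventually_at_in_open'[OF U w])
      ultimately have "\<forall>\<^sub>F q in at w. cmod (dV.b q) \<le> a + 1"
        using isoc(2)[OF w]
      proof eventually_elim
        case (elim q)
        then have q: "q \<in> V" by (simp add: V_def)
        show ?case using dV.holo_cmod_dzbar[OF q elim(3) g'V G'V] elim(1) by auto
      qed
      then obtain R Q where R: "R > 0" "ball w R \<subseteq> U" "\<And>q. q \<in> ball w R - {w} \<Longrightarrow> mc q \<noteq> 0"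
        "\<And>q. q \<in> ball w R - {w} \<Longrightarrow> Q q = in_chart c P0 q" "disc_data (ball w R) mc Q lc"
        using disc_data_pole[OF U hol_mc mc1 slc lpos w mw isoc(2)[OF w] dV[unfolded V_def]] by metis
      have "(Q \<longlongrightarrow> Q w) (at w)"
        using smooth_on_imp_continuous_on[OF disc_data.smooth_P[OF R(5)]] R(1)
          continuous_on_eq_continuous_at[OF open_ball[of w R], of Q] by (auto simp: isCont_def)
      then have "(in_chart c P0 \<longlongrightarrow> Q w) (at w)"
      proof (rule Lim_transform_eventually)
        have "\<forall>\<^sub>F q in at w. q \<in> ball w R" using eventually_at_in_open'[OF open_ball[of w R], of w] R(1) by simp
        moreover have "\<forall>\<^sub>F q in at w. q \<noteq> w" by (simp add: eventually_at_filter)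
        ultimately show "\<forall>\<^sub>F q in at w. Q q = in_chart c P0 q" by eventually_elim (use R(4) in blast)
      qed
      then have "Lim (at (chart_inv c w) within M) P0 = Q w"
        using Lim_chart[OF c] w by (simp add: U_def)
      then have "in_chart c P w = Q w" using mw by (simp add: in_chart_def P_def mc_def)
      then have "in_chart c P q = Q q" if "q \<in> ball w R" for q
        using Pc_V[of q] R(3,4)[of q] that by (cases "q = w") auto
      then show ?thesis using R by blast
    qed
    have data: "disc_data U mc (in_chart c P) lc"
    proof (rule disc_data_local[OF U])
      fix w assume w: "w \<in> U"
      show "\<exists>T. w \<in> T \<and> disc_data T mc (in_chart c P) lc"
      proof (cases "mc w = 0")
        case True
        then obtain R Q where "R > 0" "\<forall>q\<in>ball w R. in_chart c P q = Q q" "disc_data (ball w R) mc Q lc"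
          using pole[OF w] by blast
        then have "w \<in> ball w R \<and> disc_data (ball w R) mc (in_chart c P) lc"
          by (auto intro: disc_data_cong)
        then show ?thesis by blast
      next
        case False
        have "disc_data V mc (in_chart c P) lc" by (rule disc_data_cong[OF dV]) (simp add: Pc_V V_def)
        moreover have "w \<in> V" using False w by (simp add: V_def)
        ultimately show ?thesis by blast
      qed
    qed
    interpret d: disc_data U mc "in_chart c P" lc by (rule data)
    have G'U: "Gc q = in_chart c P q + of_real (lc q * disc_S (mc q)) / mc q" if "q \<in> U" "mc q \<noteq> 0" for q
      using that by (simp add: Pc_V P0c)
    have "in_chart c G w = None" if w: "w \<in> U" and mw: "mc w = 0" for w
    proof (rule ccontr)
      assume "in_chart c G w \<noteq> None"
      then obtain v where v: "G (chart_inv c w) = Some v" by (auto simp: in_chart_def)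
      have o: "openin (Alexandroff_compactification (euclidean :: complex topology)) (Some ` ball v 1)"
        by (auto simp: openin_Alexandroff_compactification)
      have "continuous_map (top_of_set M) (Alexandroff_compactification euclidean) G"
        using sG by (simp add: smooth_sphere_map_def continuous_sphere_map_def)
      from openin_continuous_map_preimage[OF this o]
      have "openin (top_of_set M) {p \<in> M. G p \<in> Some ` ball v 1}" by simp
      from open_chart_preimage[OF c this]
      have "open {q \<in> U. chart_inv c q \<in> {p \<in> M. G p \<in> Some ` ball v 1}}" by (simp add: U_def)
      then have "\<forall>\<^sub>F q in at w. q \<in> {q \<in> U. chart_inv c q \<in> {p \<in> M. G p \<in> Some ` ball v 1}}"
        by (rule eventually_at_in_open') (use w pM v in auto)
      then have b: "\<forall>\<^sub>F q in at w. cmod (Gc q) \<le> cmod v + 1"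
      proof eventually_elim
        case (elim q)
        then obtain y where "G (chart_inv c q) = Some y" "y \<in> ball v 1" by auto
        then show ?case using norm_triangle_ineq2[of y v]
          by (simp add: Gc_def in_chart_def finite_val_def dist_norm norm_minus_commute)
      qed
      have cont: "((\<lambda>q. cmod (h q)) \<longlongrightarrow> cmod (h w)) (at w)" if "smooth_on U h" for h :: "complex \<Rightarrow> complex"
        by (rule smooth_on_chart_lim[OF that U w])
      have lim1: "((\<lambda>q. cmod (of_real (lc q * disc_S (mc q)))) \<longlongrightarrow> cmod (complex_of_real (lc w * disc_S (mc w)))) (at w)"
        by (rule cont) (intro smooth_intros U slc d.smooth_m)
      have pos: "0 < cmod (complex_of_real (lc w * disc_S (mc w)))"
        using lpos[OF w] disc_S_pos[of "mc w"] by simp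
      have lim2: "((\<lambda>q. (cmod v + 1 + cmod (in_chart c P q)) * cmod (mc q)) \<longlongrightarrow> (cmod v + 1 + cmod (in_chart c P w)) * cmod (mc w)) (at w)"
        by (intro tendsto_intros cont d.smooth_P d.smooth_m)
      have "cmod (complex_of_real (lc w * disc_S (mc w))) \<le> (cmod v + 1 + cmod (in_chart c P w)) * cmod (mc w)"
      proof (rule tendsto_le[OF at_neq_bot lim2 lim1])
        show "\<forall>\<^sub>F q in at w. cmod (complex_of_real (lc q * disc_S (mc q))) \<le> (cmod v + 1 + cmod (in_chart c P q)) * cmod (mc q)"
          using b isoc(2)[OF w] eventually_at_in_open'[OF U w]
        proof eventually_elim
          case (elim q)
          have "complex_of_real (lc q * disc_S (mc q)) = (Gc q - in_chart c P q) * mc q"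
            using G'U[OF elim(3,2)] elim(2) by simp
          then have "cmod (complex_of_real (lc q * disc_S (mc q))) = cmod (Gc q - in_chart c P q) * cmod (mc q)"
            by (simp only: norm_mult)
          also have "\<dots> \<le> (cmod v + 1 + cmod (in_chart c P q)) * cmod (mc q)"
            using elim(1) norm_triangle_ineq4[of "Gc q" "in_chart c P q"] by (intro mult_right_mono) auto
          finally show ?case .
        qed
      qed
      then show False using pos mw by simp
    qed
    moreover have "cmod (d.b w) > cmod (d.c w)" if w: "w \<in> U" for w
    proof (cases "mc w = 0")
      case False
      have w': "w \<in> chart_image c" "in_chart c g w \<noteq> None" using gNone w False by (auto simp: U_def)
      have "cmod (gc w) > 0" using gc[OF w] False by simp
      then have "cmod (dz Gc w) / (cmod (gc w))\<^sup>2 < cmod (dzbar Gc w)"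
        using cond1(2)[OF c w', folded gc_def Gc_def] by (simp add: divide_less_eq mult.commute)
      then show ?thesis
        using d.holo_cmod_dzbar[OF w False gc G'U] d.holo_cmod_dz[OF w False gc G'U] by simp
    next
      case True
      obtain a b where ab: "((\<lambda>q. cmod (dzbar Gc q)) \<longlongrightarrow> a) (at w)"
        "((\<lambda>q. cmod (dz Gc q) / (cmod (gc q))\<^sup>2) \<longlongrightarrow> b) (at w)" "a > b"
        using cond2[OF c] w True gNone unfolding Gc_def gc_def U_def by blast
      have "((\<lambda>q. cmod (d.b q)) \<longlongrightarrow> cmod (d.b w)) (at w)" by (rule smooth_on_chart_lim[OF d.smooth_b U w])
      moreover have "((\<lambda>q. cmod (d.b q)) \<longlongrightarrow> a) (at w)"
      proof (rule Lim_transform_eventually[OF ab(1)])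
        show "\<forall>\<^sub>F q in at w. cmod (dzbar Gc q) = cmod (d.b q)"
          using isoc(2)[OF w] eventually_at_in_open'[OF U w]
          by eventually_elim (rule d.holo_cmod_dzbar[OF _ _ gc G'U])
      qed
      ultimately have "cmod (d.b w) = a" using tendsto_unique by (metis at_neq_bot)
      have "((\<lambda>q. cmod (d.c q)) \<longlongrightarrow> cmod (d.c w)) (at w)" by (rule smooth_on_chart_lim[OF d.smooth_c U w])
      moreover have "((\<lambda>q. cmod (d.c q)) \<longlongrightarrow> b) (at w)"
      proof (rule Lim_transform_eventually[OF ab(2)])
        show "\<forall>\<^sub>F q in at w. cmod (dz Gc q) / (cmod (gc q))\<^sup>2 = cmod (d.c q)"
          using isoc(2)[OF w] eventually_at_in_open'[OF U w]
          by eventually_elim (rule d.holo_cmod_dz[OF _ _ gc G'U])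
      qed
      ultimately have "cmod (d.c w) = b" using tendsto_unique by (metis at_neq_bot)
      then show ?thesis using ab(3) \<open>cmod (d.b w) = a\<close> by simp
    qed
    then have "1 * ((cmod (d.b w))\<^sup>2 - (cmod (d.c w))\<^sup>2) > 0" if "w \<in> U" for w
      using that power_strict_mono[of "cmod (d.c w)" "cmod (d.b w)" 2] by simp
    moreover have "dz Gc w = of_real (lc w) * dz gc w" if "w \<in> U" "mc w \<noteq> 0" for w
      by (rule d.holo_dz_relation[OF that gc G'U])
    ultimately show ?thesis
      using data unfolding U_def mc_def lc_def gc_def Gc_def by blast
  qed
  define x where "x p = hs_vec (P p) (l p * disc_S (m p))" for p
  define \<eta> where "\<eta> p = 1 *\<^sub>R disc_normal (m p)" for p
  have S: "spacelike_surface M A x" "timelike_unit_normal M A x \<eta>" "structure_induced_by_neg_II A x \<eta>"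
    "sqrt_one_minus_curvature A x (\<lambda>p. disc_S (m p) / disc_D (m p))"
    unfolding x_def[abs_def] \<eta>_def[abs_def]
    using surface_if_disc_data[of m P l 1] chart by blast+
  have ng: "normal_gauss_map \<eta> p = g p" if "p \<in> M" for p
    using gm[OF that] stereographic_disc_normal(1)[OF m1[OF that]] by (simp add: normal_gauss_map_def \<eta>_def)
  have GP: "G p = map_option (\<lambda>g. P p + of_real (l p * disc_S (m p)) * g) (g p)" if p: "p \<in> M" for p
  proof -
    obtain c w where cw: "c \<in> A" "w \<in> chart_image c" "p = chart_inv c w" using chart_point[OF p] .
    show ?thesis
    proof (cases "m p = 0")
      case True
      then have "G p = None" using chart[OF cw(1)] cw by (auto simp: in_chart_def)
      then show ?thesis using gm[OF p] True by simp
    next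
      case False
      then have "G p \<noteq> None" using cond1(1)[OF cw(1,2)] gm[OF p] cw(3) by (auto simp: in_chart_def)
      then show ?thesis using gm[OF p] False by (auto simp: P_def P0_def finite_val_def divide_inverse)
    qed
  qed
  have dG: "dS_gauss_map x \<eta> p = G p" if "p \<in> M" for p
    using dS_gauss_map_eq[of l p m 1 x P \<eta>] l(2)[OF that] m1[OF that] ng[OF that] GP[OF that]
    by (simp add: x_def \<eta>_def)
  have sq: "sqrt_one_minus_curvature A x (\<lambda>p. stereographic_height (g p))"
    by (rule sqrt_one_minus_curvature_cong[OF S(4)]) (simp add: gm stereographic_height_disc(1)[OF m1])
  have "holo_representation A g G x"
  proof (rule holo_representationI)
    fix c w assume c: "c \<in> A" and w: "w \<in> chart_image c" and h: "in_chart c g w \<noteq> None"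
    have p: "chart_inv c w \<in> M" by (rule chart_inv_in_M[OF c w])
    have mw: "in_chart c m w \<noteq> 0" using h gm[OF p] by (auto simp: in_chart_def)
    moreover have "chart_val c g w = inverse (in_chart c m w)" using fg[OF p] by (simp add: in_chart_def)
    moreover have "dz (chart_val c G) w = of_real (in_chart c l w) * dz (chart_val c g) w"
      using chart[OF c] w mw by blast
    moreover have "in_chart c x w = hs_vec (chart_val c G w - of_real (in_chart c l w * disc_S (in_chart c m w)) / in_chart c m w)
        (in_chart c l w * disc_S (in_chart c m w))"
      using mw by (simp add: in_chart_def x_def P_def P0_def)
    ultimately show "\<exists>m l. m \<noteq> 0 \<and> chart_val c g w = inverse m \<and> dz (chart_val c G) w = of_real l * dz (chart_val c g) w \<and>
      in_chart c x w = hs_vec (chart_val c G w - of_real (l * disc_S m) / m) (l * disc_S m)" by blast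
  qed
  then show ?thesis using S ng dG sq by blast
qed

end

lemma less_if_square_diff_neg: "-1 * (u\<^sup>2 - v\<^sup>2) > 0 \<Longrightarrow> v \<ge> 0 \<Longrightarrow> u < v" for u v :: real
  by (rule power_less_imp_less_base[of u 2 v]) auto

lemma less_if_square_diff_pos: "1 * (u\<^sup>2 - v\<^sup>2) > 0 \<Longrightarrow> u \<ge> 0 \<Longrightarrow> v < u" for u v :: real
  by (rule power_less_imp_less_base[of v 2 u]) auto

lemma stereographic_height_stereographic:
  fixes e :: "real^3"
  assumes e: "(e $ 1)\<^sup>2 + (e $ 2)\<^sup>2 - (e $ 3)\<^sup>2 = -1"
  shows "stereographic_height (stereographic e) = e $ 3"
proof (cases "e $ 3 = 1")
  case False
  let ?t = "e $ 3"
  have n: "1 - ?t \<noteq> 0" using False by simp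
  have sq: "(cmod (Complex (e $ 1) (e $ 2)))\<^sup>2 = (?t - 1) * (?t + 1)"
    using e unfolding cmod_power2 by (simp add: power2_eq_square algebra_simps)
  have "(cmod (Complex (e $ 1) (e $ 2) / of_real (1 - ?t)))\<^sup>2 = (?t - 1) * (?t + 1) / (1 - ?t)\<^sup>2"
    unfolding norm_divide norm_of_real power_divide sq power2_abs ..
  also have "\<dots> = - (?t + 1) / (1 - ?t)"
    using n by (simp add: power2_eq_square divide_eq_eq eq_divide_eq) (simp add: algebra_simps)?
  finally have c: "(cmod (Complex (e $ 1) (e $ 2) / of_real (1 - ?t)))\<^sup>2 = - (?t + 1) / (1 - ?t)" .
  have "1 + - (?t + 1) / (1 - ?t) = - 2 * ?t / (1 - ?t)" "- (?t + 1) / (1 - ?t) - 1 = - 2 / (1 - ?t)"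
    using n by (simp_all add: field_simps)
  then show ?thesis
    using False n unfolding stereographic_def stereographic_height_def by (simp only: if_False option.case c) simp
qed (simp add: stereographic_def stereographic_height_def)

context surface_atlas
begin

lemma holo_converse:
  assumes sp: "spacelike_surface M A x" and tn: "timelike_unit_normal M A x \<eta>"
    and II: "structure_induced_by_neg_II A x \<eta>" and g: "g = normal_gauss_map \<eta>" and G: "G = dS_gauss_map x \<eta>"
    and nc: "\<not> g constant_on M"
    and curv: "sqrt_one_minus_curvature A x (\<lambda>p. stereographic_height (g p))"
  shows "holomorphic_sphere_map M A g \<and> smooth_sphere_map M A G \<and>
          (\<forall>p\<in>M. \<forall>a. g p = Some a \<longrightarrow> cmod a > 1) \<and> holo_conditions M A g G \<and>
          holo_representation A g G x"
proof -
  have curv': "sqrt_one_minus_curvature A x (\<lambda>p. 1 * \<eta> p $ 3)"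
    by (rule sqrt_one_minus_curvature_cong[OF curv])
      (use tn in \<open>simp add: g normal_gauss_map_def stereographic_height_stereographic timelike_unit_normal_def\<close>)
  obtain m P l where data: "\<And>c. c \<in> A \<Longrightarrow> disc_data (chart_image c) (in_chart c m) (in_chart c P) (in_chart c l)"
    and sign: "\<And>c w. c \<in> A \<Longrightarrow> w \<in> chart_image c \<Longrightarrow>
      1 * ((cmod (disc_data.b (in_chart c m) (in_chart c P) (in_chart c l) w))\<^sup>2
         - (cmod (disc_data.c (in_chart c m) (in_chart c l) w))\<^sup>2) > 0"
    and x: "\<And>p. x p = hs_vec (P p) (l p * disc_S (m p))" and \<eta>: "\<And>p. p \<in> M \<Longrightarrow> \<eta> p = 1 *\<^sub>R disc_normal (m p)"
    using disc_data_if_surface[OF sp tn II curv'] by auto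
  have m1: "cmod (m p) < 1" and lpos: "l p > 0" if "p \<in> M" for p
    using chart_point[OF that] disc_data.m_less[OF data] disc_data.l_pos[OF data] by (metis comp_apply in_chart_def)+
  have gm: "g p = (if m p = 0 then None else Some (inverse (m p)))" if "p \<in> M" for p
    using stereographic_disc_normal(1)[OF m1[OF that]] \<eta>[OF that] by (simp add: g normal_gauss_map_def)
  have Gm: "G p = (if m p = 0 then None else Some (P p + of_real (l p * disc_S (m p)) / m p))" if "p \<in> M" for p
    using dS_gauss_map_eq[of l p m 1 x P \<eta>] lpos[OF that] m1[OF that] x \<eta>[OF that] gm[OF that]
    by (simp add: G g divide_inverse)
  have hm: "in_chart c m holomorphic_on chart_image c" if "c \<in> A" for c by (rule disc_data.hol[OF data[OF that]])
  have cm: "continuous_on M m" and cP: "continuous_on M P" and cl: "continuous_on M (\<lambda>p. complex_of_real (l p))"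
    and cl': "continuous_on M l"
  proof -
    show "continuous_on M m"
      by (rule continuous_on_M) (rule holomorphic_on_imp_continuous_on[OF hm])
    show "continuous_on M P"
      by (rule continuous_on_M) (rule smooth_on_imp_continuous_on[OF disc_data.smooth_P[OF data]])
    show l: "continuous_on M l"
      by (rule continuous_on_M) (rule smooth_on_imp_continuous_on[OF disc_data.smooth_l[OF data]])
    show "continuous_on M (\<lambda>p. complex_of_real (l p))" by (intro continuous_intros l)
  qed
  have ncm: "\<not> m constant_on M"
    using nc gm unfolding constant_on_def by metis
  have iso: "\<forall>\<^sub>F q in at w. deriv (in_chart c m) q \<noteq> 0" "\<forall>\<^sub>F q in at w. in_chart c m q \<noteq> 0"
    if "c \<in> A" "w \<in> chart_image c" for c w
    by (rule isolated_zeros_in_chart[OF hm ncm that]; assumption)+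
  have cg: "in_chart c g w = (if in_chart c m w = 0 then None else Some (inverse (in_chart c m w)))"
    and cG: "in_chart c G w = (if in_chart c m w = 0 then None else Some (in_chart c P w + of_real (in_chart c l w * disc_S (in_chart c m w)) / in_chart c m w))"
    if "c \<in> A" "w \<in> chart_image c" for c w
    using gm[OF chart_inv_in_M[OF that]] Gm[OF chart_inv_in_M[OF that]] by (simp_all add: in_chart_def)
  have fg: "(chart_val c g) w = inverse (in_chart c m w)"
    and rg: "(recip_val \<circ> in_chart c g) w = in_chart c m w" if "c \<in> A" "w \<in> chart_image c" for c w
    using cg[OF that] by (auto simp: finite_val_def recip_val_def)
  have fG: "(chart_val c G) w = in_chart c P w + of_real (in_chart c l w * disc_S (in_chart c m w)) / in_chart c m w"
    if "c \<in> A" "w \<in> chart_image c" "in_chart c m w \<noteq> 0" for c w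
    using cG[OF that(1,2)] that(3) by (auto simp: finite_val_def)
  have hg: "holomorphic_sphere_map M A g"
    unfolding holomorphic_sphere_map_def
  proof (intro conjI ballI)
    show "continuous_sphere_map M g"
      by (rule continuous_sphere_map_quotient[of _ "\<lambda>p. 1" m]) (auto simp: gm inverse_eq_divide intro: cm)
    fix c assume c: "c \<in> A"
    have "{w \<in> chart_image c. in_chart c g w \<noteq> None} = {w \<in> chart_image c. in_chart c m w \<noteq> 0}"
      using cg[OF c] by auto
    moreover have "(chart_val c g) holomorphic_on {w \<in> chart_image c. in_chart c m w \<noteq> 0}"
      by (rule holomorphic_transform[of "\<lambda>w. inverse (in_chart c m w)"])
        (use fg[OF c] in \<open>auto intro!: holomorphic_intros holomorphic_on_subset[OF hm[OF c]]\<close>)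
    ultimately show "(chart_val c g) holomorphic_on {w \<in> chart_image c. in_chart c g w \<noteq> None}" by simp
    show "(recip_val \<circ> in_chart c g) holomorphic_on {w \<in> chart_image c. in_chart c g w \<noteq> Some 0}"
      by (rule holomorphic_transform[of "in_chart c m"])
        (use rg[OF c] in \<open>auto intro!: holomorphic_on_subset[OF hm[OF c]]\<close>)
  qed
  have sG: "smooth_sphere_map M A G"
    unfolding smooth_sphere_map_def
  proof (intro conjI ballI)
    have "m p * P p + of_real (l p * disc_S (m p)) \<noteq> 0" if "p \<in> M" "m p = 0" for p
      using lpos[OF that(1)] disc_S_pos[of "m p"] that(2) by simp
    then show "continuous_sphere_map M G"
      by (intro continuous_sphere_map_quotient[of _ "\<lambda>p. m p * P p + of_real (l p * disc_S (m p))" m])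
        (auto simp: Gm disc_S_def add_divide_distrib intro!: continuous_intros cm cP cl' cl)
    fix c assume c: "c \<in> A"
    interpret d: disc_data "chart_image c" "in_chart c m" "in_chart c P" "in_chart c l" by (rule data[OF c])
    have oV: "open {w \<in> chart_image c. in_chart c m w \<noteq> 0}" by (rule open_nonzero_set[OF d.open_U d.hol])
    have "{w \<in> chart_image c. in_chart c G w \<noteq> None} = {w \<in> chart_image c. in_chart c m w \<noteq> 0}"
      using cG[OF c] by auto
    moreover have "smooth_on {w \<in> chart_image c. in_chart c m w \<noteq> 0} (chart_val c G)"
    proof (rule smooth_on_cong[OF oV])
      show "smooth_on {w \<in> chart_image c. in_chart c m w \<noteq> 0}
         (\<lambda>w. in_chart c P w + of_real (in_chart c l w * disc_S (in_chart c m w)) / in_chart c m w)"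
        by (intro smooth_intros oV smooth_on_subset[OF d.smooth_P] smooth_on_subset[OF d.smooth_l] smooth_on_subset[OF d.smooth_m]) auto
    qed (use fG[OF c] in auto)
    ultimately show "smooth_on {w \<in> chart_image c. in_chart c G w \<noteq> None} (chart_val c G)" by simp
    define k where "k w = in_chart c m w * in_chart c P w + of_real (in_chart c l w * disc_S (in_chart c m w))" for w
    have sk: "smooth_on (chart_image c) k"
      unfolding k_def[abs_def] by (intro smooth_intros d.open_U d.smooth_P d.smooth_l d.smooth_m)
    have k0: "k w \<noteq> 0" if "w \<in> chart_image c" "in_chart c m w = 0" for w
      using d.l_pos[OF that(1)] disc_S_pos[of "in_chart c m w"] that(2) by (simp add: k_def)
    have Gk: "in_chart c G w = (if in_chart c m w = 0 then None else Some (k w / in_chart c m w))" if "w \<in> chart_image c" for w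
      using cG[OF c that] by (simp add: k_def add_divide_distrib)
    have e: "{w \<in> chart_image c. in_chart c G w \<noteq> Some 0} = {w \<in> chart_image c. k w \<noteq> 0}"
      using Gk k0 by (auto split: if_splits)
    have ok: "open {w \<in> chart_image c. k w \<noteq> 0}"
    proof -
      have "{w \<in> chart_image c. k w \<noteq> 0} = chart_image c \<inter> k -` (- {0})" by auto
      then show ?thesis
        using continuous_open_preimage[OF smooth_on_imp_continuous_on[OF sk] d.open_U open_Compl[OF closed_singleton]] by simp
    qed
    show "smooth_on {w \<in> chart_image c. in_chart c G w \<noteq> Some 0} (recip_val \<circ> in_chart c G)"
      unfolding e
    proof (rule smooth_on_cong[OF ok])
      show "smooth_on {w \<in> chart_image c. k w \<noteq> 0} (\<lambda>w. in_chart c m w / k w)"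
        by (intro smooth_intros ok smooth_on_subset[OF d.smooth_m] smooth_on_subset[OF sk]) auto
      show "in_chart c m w / k w = (recip_val \<circ> in_chart c G) w" if "w \<in> {w \<in> chart_image c. k w \<noteq> 0}" for w
        using Gk[of w] that by (auto simp: recip_val_def)
    qed
  qed
  have gt: "cmod a > 1" if "p \<in> M" "g p = Some a" for p a
    using gm[OF that(1)] m1[OF that(1)] that(2) by (auto simp: norm_inverse one_less_inverse_iff split: if_splits)
  have ctx: "dz (chart_val c G) w = of_real (in_chart c l w) * dz (chart_val c g) w"
    "cmod (dzbar (chart_val c G) w) = cmod (disc_data.b (in_chart c m) (in_chart c P) (in_chart c l) w)"
    "cmod (dz (chart_val c G) w) / (cmod ((chart_val c g) w))\<^sup>2 = cmod (disc_data.c (in_chart c m) (in_chart c l) w)"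
    "holo_pde_lhs (chart_val c g) (chart_val c G) w = 0"
    if c: "c \<in> A" and w: "w \<in> chart_image c" and mw: "in_chart c m w \<noteq> 0" for c w
    by (rule disc_data.holo_dz_relation[OF data[OF c] w mw fg[OF c] fG[OF c]]
      disc_data.holo_cmod_dzbar[OF data[OF c] w mw fg[OF c] fG[OF c]]
      disc_data.holo_cmod_dz[OF data[OF c] w mw fg[OF c] fG[OF c]]
      disc_data.holo_pde[OF data[OF c] w mw fg[OF c] fG[OF c]]; assumption)+
  have bc: "cmod (disc_data.b (in_chart c m) (in_chart c P) (in_chart c l) w) > cmod (disc_data.c (in_chart c m) (in_chart c l) w)"
    if "c \<in> A" "w \<in> chart_image c" for c w
    by (rule less_if_square_diff_pos[OF sign[OF that]]) simp
  have "holo_conditions M A g G"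
    unfolding holo_conditions_def Let_def
  proof (intro conjI exI[of _ l] ballI impI)
    show "smooth_map A l" unfolding smooth_map_def using disc_data.smooth_l[OF data] by blast
    show "l p > 0" if "p \<in> M" for p by (rule lpos[OF that])
    fix c w assume c: "c \<in> A" and w: "w \<in> chart_image c"
    show "dz (chart_val c G) w / dz (chart_val c g) w = complex_of_real (in_chart c l w)"
      if "in_chart c g w \<noteq> None \<and> dz (chart_val c g) w \<noteq> 0"
      using that cg[OF c w] ctx(1)[OF c w] by (auto split: if_splits)
    {
      assume "in_chart c g w \<noteq> None"
      then have mw: "in_chart c m w \<noteq> 0" using cg[OF c w] by auto
      then show "in_chart c G w \<noteq> None" using cG[OF c w] by auto
      have "cmod ((chart_val c g) w) > 0" using fg[OF c w] mw by simp
      then show "cmod (dz (chart_val c G) w) < (cmod ((chart_val c g) w))\<^sup>2 * cmod (dzbar (chart_val c G) w)"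
        using bc[OF c w] unfolding ctx(2,3)[OF c w mw, symmetric] by (simp add: divide_less_eq mult.commute)
      show "holo_pde_lhs (chart_val c g) (chart_val c G) w = 0"
        by (rule ctx(4)[OF c w mw])
    }
    assume "in_chart c g w = None"
    interpret d: disc_data "chart_image c" "in_chart c m" "in_chart c P" "in_chart c l" by (rule data[OF c])
    have "((\<lambda>q. cmod (dzbar (chart_val c G) q)) \<longlongrightarrow> cmod (d.b w)) (at w)"
    proof (rule Lim_transform_eventually[OF smooth_on_chart_lim[OF d.smooth_b d.open_U w]])
      show "\<forall>\<^sub>F q in at w. cmod (d.b q) = cmod (dzbar (chart_val c G) q)"
        using iso(2)[OF c w] eventually_at_in_open'[OF d.open_U w]
        by eventually_elim (rule ctx(2)[OF c, symmetric])
    qed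
    moreover have "((\<lambda>q. cmod (dz (chart_val c G) q) / (cmod ((chart_val c g) q))\<^sup>2) \<longlongrightarrow> cmod (d.c w)) (at w)"
    proof (rule Lim_transform_eventually[OF smooth_on_chart_lim[OF d.smooth_c d.open_U w]])
      show "\<forall>\<^sub>F q in at w. cmod (d.c q) = cmod (dz (chart_val c G) q) / (cmod ((chart_val c g) q))\<^sup>2"
        using iso(2)[OF c w] eventually_at_in_open'[OF d.open_U w]
        by eventually_elim (rule ctx(3)[OF c, symmetric])
    qed
    ultimately show "\<exists>a b. ((\<lambda>q. cmod (dzbar (chart_val c G) q)) \<longlongrightarrow> a) (at w) \<and>
       ((\<lambda>q. cmod (dz (chart_val c G) q) / (cmod ((chart_val c g) q))\<^sup>2) \<longlongrightarrow> b) (at w) \<and> b < a"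
      using bc[OF c w] by blast
  qed
  moreover have "holo_representation A g G x"
  proof (rule holo_representationI)
    fix c w assume c: "c \<in> A" and w: "w \<in> chart_image c" and h: "in_chart c g w \<noteq> None"
    have mw: "in_chart c m w \<noteq> 0" using h cg[OF c w] by auto
    have "in_chart c x w = hs_vec (chart_val c G w - of_real (in_chart c l w * disc_S (in_chart c m w)) / in_chart c m w)
        (in_chart c l w * disc_S (in_chart c m w))"
      unfolding fG[OF c w mw] by (simp add: in_chart_def x)
    then show "\<exists>m l. m \<noteq> 0 \<and> chart_val c g w = inverse m \<and> dz (chart_val c G) w = of_real l * dz (chart_val c g) w \<and>
      in_chart c x w = hs_vec (chart_val c G w - of_real (l * disc_S m) / m) (l * disc_S m)"
      using mw fg[OF c w] ctx(1)[OF c w mw] by blast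
  qed
  ultimately show ?thesis using hg sG gt by blast
qed

lemma antiholo_forward:
  assumes hol: "antiholomorphic_sphere_map M A g" and wo: "without_holomorphic_points A g" and sG: "smooth_sphere_map M A G"
    and lt: "\<And>p. p \<in> M \<Longrightarrow> \<exists>a. g p = Some a \<and> cmod a < 1" and cond: "antiholo_conditions M A g G"
  shows "\<exists>x \<eta>. antiholo_representation A g G x \<and>
           spacelike_surface M A x \<and> timelike_unit_normal M A x \<eta> \<and>
           (\<forall>p\<in>M. normal_gauss_map \<eta> p = g p) \<and> (\<forall>p\<in>M. dS_gauss_map x \<eta> p = G p) \<and>
           sqrt_one_minus_curvature A x (\<lambda>p. - stereographic_height (g p)) \<and>
           structure_induced_by_neg_II A x \<eta>"
proof -
  define m where "m p = cnj (finite_val (g p))" for p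
  have gm: "g p = Some (cnj (m p))" and m1: "cmod (m p) < 1" if "p \<in> M" for p
    using lt[OF that] by (auto simp: m_def finite_val_def)
  have GN: "G p = Some (finite_val (G p))" if "p \<in> M" for p
    using cond that unfolding antiholo_conditions_def by (force simp: finite_val_def)
  obtain l :: "'a \<Rightarrow> real" where l: "smooth_map A l" "\<And>p. p \<in> M \<Longrightarrow> l p > 0"
    and rel: "\<And>c w. c \<in> A \<Longrightarrow> w \<in> chart_image c \<Longrightarrow> (chart_val c g) w \<noteq> 0 \<Longrightarrow>
       dzbar (chart_val c G) w / ((cmod ((chart_val c g) w))\<^sup>2 * dzbar (chart_val c g) w) = complex_of_real (in_chart c l w)"
    using cond unfolding antiholo_conditions_def Let_def by blast
  have cond1: "(cmod ((chart_val c g) w))\<^sup>2 * cmod (dz (chart_val c G) w) / cmod (dzbar (chart_val c G) w) < 1"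
    "antiholo_pde_lhs (chart_val c g) (chart_val c G) w = 0"
    if "c \<in> A" "w \<in> chart_image c" "(chart_val c g) w \<noteq> 0" for c w
    using cond that unfolding antiholo_conditions_def Let_def by blast+
  have cond2: "\<exists>a. ((\<lambda>q. (cmod ((chart_val c g) q))\<^sup>2 * cmod (dz (chart_val c G) q) / cmod (dzbar (chart_val c G) q)) \<longlongrightarrow> a) (at w) \<and> a < 1"
    if "c \<in> A" "w \<in> chart_image c" "(chart_val c g) w = 0" for c w
    using cond that unfolding antiholo_conditions_def Let_def by blast
  have fg: "(chart_val c g) w = cnj (in_chart c m w)" if "c \<in> A" "w \<in> chart_image c" for c w
    by (simp add: in_chart_def m_def)
  have hm: "in_chart c m holomorphic_on chart_image c" if c: "c \<in> A" for c
  proof -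
    have e: "{w \<in> chart_image c. in_chart c (map_option cnj \<circ> g) w \<noteq> None} = chart_image c"
      using gm[OF chart_inv_in_M[OF c]] by (auto simp: in_chart_def)
    have h: "(finite_val \<circ> in_chart c (map_option cnj \<circ> g)) holomorphic_on {w \<in> chart_image c. in_chart c (map_option cnj \<circ> g) w \<noteq> None}"
      using hol c unfolding antiholomorphic_sphere_map_def holomorphic_sphere_map_def by blast
    from h[unfolded e] show ?thesis
    proof (rule holomorphic_transform)
      show "(finite_val \<circ> in_chart c (map_option cnj \<circ> g)) w = in_chart c m w" if "w \<in> chart_image c" for w
        using gm[OF chart_inv_in_M[OF c that]] by (simp add: in_chart_def finite_val_def)
    qed
  qed
  define P where "P p = finite_val (G p) - of_real (l p * disc_S (m p)) * cnj (m p)" for p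
  have fG: "(chart_val c G) w = in_chart c P w + of_real (in_chart c l w * disc_S (in_chart c m w)) * cnj (in_chart c m w)" for c w
    by (simp add: in_chart_def P_def)
  have dm: "deriv (in_chart c m) w \<noteq> 0" if c: "c \<in> A" and w: "w \<in> chart_image c" for c w
  proof -
    have "has_wirtinger (chart_val c g) w (cnj 0) (cnj (deriv (in_chart c m) w))"
      by (rule has_wirtinger_cong[OF open_chart_image[OF c] w _ has_wirtinger_cnj[OF has_wirtinger_holomorphic[OF hm[OF c] open_chart_image[OF c] w]]])
        (rule fg[OF c, symmetric])
    then show ?thesis using wo c w has_wirtinger_dzbar unfolding without_holomorphic_points_def by fastforce
  qed
  have data: "disc_data (chart_image c) (in_chart c m) (in_chart c P) (in_chart c l)" if c: "c \<in> A" for c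
  proof -
    have "in_chart c P = (\<lambda>q. (chart_val c G) q - of_real (in_chart c l q * disc_S (in_chart c m q)) * cnj (in_chart c m q))"
      by (simp add: in_chart_def P_def fun_eq_iff)
    moreover have "disc_data (chart_image c) (in_chart c m) (\<lambda>q. (chart_val c G) q - of_real (in_chart c l q * disc_S (in_chart c m q)) * cnj (in_chart c m q)) (in_chart c l)"
    proof (rule antiholo_core[OF open_chart_image[OF c] hm[OF c] _ dm[OF c] _ _ _ fg[OF c] rel[OF c] cond1(2)[OF c]])
      show "cmod (in_chart c m w) < 1" "0 < in_chart c l w" if "w \<in> chart_image c" for w
        using m1 l(2) chart_inv_in_M[OF c that] by (auto simp: in_chart_def)
      show "smooth_on (chart_image c) (in_chart c l)" using l(1) c by (simp add: smooth_map_def)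
      have "{w \<in> chart_image c. in_chart c G w \<noteq> None} = chart_image c"
        using GN[OF chart_inv_in_M[OF c]] by (auto simp: in_chart_def)
      then show "smooth_on (chart_image c) (chart_val c G)"
        using sG c unfolding smooth_sphere_map_def by metis
    qed
    ultimately show ?thesis by simp
  qed
  have cmods: "(cmod ((chart_val c g) w))\<^sup>2 * cmod (dz (chart_val c G) w) / cmod (dzbar (chart_val c G) w) =
      cmod (disc_data.b (in_chart c m) (in_chart c P) (in_chart c l) w) / cmod (disc_data.c (in_chart c m) (in_chart c l) w)"
    if "c \<in> A" "w \<in> chart_image c" "in_chart c m w \<noteq> 0" for c w
    by (rule disc_data.antiholo_cmod[OF data[OF that(1)] that(2) fg[OF that(1)] fG that(3)])
  have sign: "-1 * ((cmod (disc_data.b (in_chart c m) (in_chart c P) (in_chart c l) w))\<^sup>2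
         - (cmod (disc_data.c (in_chart c m) (in_chart c l) w))\<^sup>2) > 0" if c: "c \<in> A" and w: "w \<in> chart_image c" for c w
  proof -
    interpret d: disc_data "chart_image c" "in_chart c m" "in_chart c P" "in_chart c l" by (rule data[OF c])
    have c0: "d.c q \<noteq> 0" if "q \<in> chart_image c" for q
      using dm[OF c that] d.l_pos[OF that] by (simp add: d.c_def)
    have "cmod (d.b w) / cmod (d.c w) < 1"
    proof (cases "in_chart c m w = 0")
      case False
      then show ?thesis using cond1(1)[OF c w] cmods[OF c w] fg[OF c w] by simp
    next
      case True
      then obtain a where a: "((\<lambda>q. (cmod ((chart_val c g) q))\<^sup>2 * cmod (dz (chart_val c G) q) / cmod (dzbar (chart_val c G) q)) \<longlongrightarrow> a) (at w)" "a < 1"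
        using cond2[OF c w] fg[OF c w] by auto
      have L1: "((\<lambda>q. cmod (d.b q) / cmod (d.c q)) \<longlongrightarrow> cmod (d.b w) / cmod (d.c w)) (at w)"
        using c0[OF w] by (intro tendsto_divide smooth_on_chart_lim[OF d.smooth_b d.open_U w] smooth_on_chart_lim[OF d.smooth_c d.open_U w]) simp
      have L2: "((\<lambda>q. cmod (d.b q) / cmod (d.c q)) \<longlongrightarrow> a) (at w)"
      proof (rule Lim_transform_eventually[OF a(1)])
        show "\<forall>\<^sub>F q in at w. (cmod ((chart_val c g) q))\<^sup>2 * cmod (dz (chart_val c G) q) / cmod (dzbar (chart_val c G) q) = cmod (d.b q) / cmod (d.c q)"
          using eventually_nonzero_if_deriv[OF holomorphic_derivI[OF d.hol d.open_U w] dm[OF c w]] eventually_at_in_open'[OF d.open_U w]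
          by eventually_elim (rule cmods[OF c])
      qed
      have "cmod (d.b w) / cmod (d.c w) = a" by (rule tendsto_unique[OF at_neq_bot L1 L2])
      then show ?thesis using a(2) by simp
    qed
    then have "cmod (d.b w) < cmod (d.c w)" using c0[OF w] by (simp add: divide_less_eq)
    then show ?thesis using power_strict_mono[of "cmod (d.b w)" "cmod (d.c w)" 2] by simp
  qed
  define x where "x p = hs_vec (P p) (l p * disc_S (m p))" for p
  define \<eta> where "\<eta> p = (-1) *\<^sub>R disc_normal (m p)" for p
  have S: "spacelike_surface M A x" "timelike_unit_normal M A x \<eta>" "structure_induced_by_neg_II A x \<eta>"
    "sqrt_one_minus_curvature A x (\<lambda>p. disc_S (m p) / disc_D (m p))"
    unfolding x_def[abs_def] \<eta>_def[abs_def]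
    using surface_if_disc_data[of m P l "-1"] data sign by blast+
  have ng: "normal_gauss_map \<eta> p = g p" if "p \<in> M" for p
    using gm[OF that] stereographic_disc_normal(2)[OF m1[OF that]] by (simp add: normal_gauss_map_def \<eta>_def)
  have dG: "dS_gauss_map x \<eta> p = G p" if "p \<in> M" for p
    using dS_gauss_map_eq[of l p m "-1" x P \<eta>] l(2)[OF that] m1[OF that] ng[OF that] gm[OF that] GN[OF that]
    by (simp add: x_def \<eta>_def P_def)
  have sq: "sqrt_one_minus_curvature A x (\<lambda>p. - stereographic_height (g p))"
    by (rule sqrt_one_minus_curvature_cong[OF S(4)]) (simp add: gm stereographic_height_disc(2)[OF m1])
  have "antiholo_representation A g G x"
  proof (rule antiholo_representationI)
    fix c w assume c: "c \<in> A" and w: "w \<in> chart_image c" and h: "chart_val c g w \<noteq> 0"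
    have "dzbar (chart_val c G) w = of_real (in_chart c l w) * ((cmod (chart_val c g w))\<^sup>2 * dzbar (chart_val c g) w)"
      by (rule disc_data.antiholo_dzbar_relation[OF data[OF c] w fg[OF c] fG])
    moreover have "in_chart c x w = hs_vec (chart_val c G w - of_real (in_chart c l w * disc_S (in_chart c m w)) * cnj (in_chart c m w))
        (in_chart c l w * disc_S (in_chart c m w))"
      by (simp add: in_chart_def x_def P_def)
    moreover have "dzbar (chart_val c g) w \<noteq> 0" using wo c w by (simp add: without_holomorphic_points_def)
    moreover have "in_chart c m w \<noteq> 0" using h fg[OF c w] by auto
    ultimately show "\<exists>m l. m \<noteq> 0 \<and> chart_val c g w = cnj m \<and> dzbar (chart_val c g) w \<noteq> 0 \<and>
      dzbar (chart_val c G) w = of_real l * ((cmod (chart_val c g w))\<^sup>2 * dzbar (chart_val c g) w) \<and>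
      in_chart c x w = hs_vec (chart_val c G w - of_real (l * disc_S m) * cnj m) (l * disc_S m)"
      using fg[OF c w] by blast
  qed
  then show ?thesis using S ng dG sq by blast
qed

lemma antiholo_converse:
  assumes sp: "spacelike_surface M A x" and tn: "timelike_unit_normal M A x \<eta>"
    and II: "structure_induced_by_neg_II A x \<eta>" and g: "g = normal_gauss_map \<eta>" and G: "G = dS_gauss_map x \<eta>"
    and curv: "sqrt_one_minus_curvature A x (\<lambda>p. - stereographic_height (g p))"
  shows "antiholomorphic_sphere_map M A g \<and> without_holomorphic_points A g \<and>
          smooth_sphere_map M A G \<and>
          (\<forall>p\<in>M. \<exists>a. g p = Some a \<and> cmod a < 1) \<and> antiholo_conditions M A g G \<and>
          antiholo_representation A g G x"
proof -
  have curv': "sqrt_one_minus_curvature A x (\<lambda>p. (-1) * \<eta> p $ 3)"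
    by (rule sqrt_one_minus_curvature_cong[OF curv])
      (use tn in \<open>simp add: g normal_gauss_map_def stereographic_height_stereographic timelike_unit_normal_def\<close>)
  obtain m P l where data: "\<And>c. c \<in> A \<Longrightarrow> disc_data (chart_image c) (in_chart c m) (in_chart c P) (in_chart c l)"
    and sign: "\<And>c w. c \<in> A \<Longrightarrow> w \<in> chart_image c \<Longrightarrow>
      -1 * ((cmod (disc_data.b (in_chart c m) (in_chart c P) (in_chart c l) w))\<^sup>2
         - (cmod (disc_data.c (in_chart c m) (in_chart c l) w))\<^sup>2) > 0"
    and x: "\<And>p. x p = hs_vec (P p) (l p * disc_S (m p))" and \<eta>: "\<And>p. p \<in> M \<Longrightarrow> \<eta> p = (-1) *\<^sub>R disc_normal (m p)"
    using disc_data_if_surface[OF sp tn II curv'] by auto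
  have m1: "cmod (m p) < 1" and lpos: "l p > 0" if "p \<in> M" for p
    using chart_point[OF that] disc_data.m_less[OF data] disc_data.l_pos[OF data] by (metis comp_apply in_chart_def)+
  have gm: "g p = Some (cnj (m p))" if "p \<in> M" for p
    using stereographic_disc_normal(2)[OF m1[OF that]] \<eta>[OF that] by (simp add: g normal_gauss_map_def)
  have Gm: "G p = Some (P p + of_real (l p * disc_S (m p)) * cnj (m p))" if "p \<in> M" for p
    using dS_gauss_map_eq[of l p m "-1" x P \<eta>] lpos[OF that] m1[OF that] x \<eta>[OF that] gm[OF that]
    by (simp add: G g)
  have hm: "in_chart c m holomorphic_on chart_image c" if "c \<in> A" for c by (rule disc_data.hol[OF data[OF that]])
  have cm: "continuous_on M m" by (rule continuous_on_M) (rule holomorphic_on_imp_continuous_on[OF hm])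
  have cP: "continuous_on M P" by (rule continuous_on_M) (rule smooth_on_imp_continuous_on[OF disc_data.smooth_P[OF data]])
  have cl: "continuous_on M l" by (rule continuous_on_M) (rule smooth_on_imp_continuous_on[OF disc_data.smooth_l[OF data]])
  have cg: "in_chart c g w = Some (cnj (in_chart c m w))"
    and cG: "in_chart c G w = Some (in_chart c P w + of_real (in_chart c l w * disc_S (in_chart c m w)) * cnj (in_chart c m w))"
    if "c \<in> A" "w \<in> chart_image c" for c w
    using gm[OF chart_inv_in_M[OF that]] Gm[OF chart_inv_in_M[OF that]] by (simp_all add: in_chart_def)
  have fg: "(chart_val c g) w = cnj (in_chart c m w)"
    and fG: "(chart_val c G) w = in_chart c P w + of_real (in_chart c l w * disc_S (in_chart c m w)) * cnj (in_chart c m w)"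
    if "c \<in> A" "w \<in> chart_image c" for c w
    using cg[OF that] cG[OF that] by (auto simp: finite_val_def)
  have bc: "cmod (disc_data.b (in_chart c m) (in_chart c P) (in_chart c l) w) < cmod (disc_data.c (in_chart c m) (in_chart c l) w)"
    if "c \<in> A" "w \<in> chart_image c" for c w
    by (rule less_if_square_diff_neg[OF sign[OF that]]) simp
  have c0: "cmod (disc_data.c (in_chart c m) (in_chart c l) w) > 0" if "c \<in> A" "w \<in> chart_image c" for c w
    using bc[OF that] by (rule le_less_trans[OF norm_ge_zero])
  have dm: "deriv (in_chart c m) w \<noteq> 0" if c: "c \<in> A" and w: "w \<in> chart_image c" for c w
    using c0[OF that] disc_data.c_def[OF data[OF c]] by auto
  have hg: "antiholomorphic_sphere_map M A g"
    unfolding antiholomorphic_sphere_map_def holomorphic_sphere_map_def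
  proof (intro conjI ballI)
    show "continuous_sphere_map M (map_option cnj \<circ> g)"
      by (rule continuous_sphere_map_quotient[of _ m "\<lambda>p. 1"]) (auto simp: gm intro: cm)
    fix c assume c: "c \<in> A"
    have e: "in_chart c (map_option cnj \<circ> g) w = Some (in_chart c m w)" if "w \<in> chart_image c" for w
      using cg[OF c that] by (simp add: in_chart_def)
    show "(finite_val \<circ> in_chart c (map_option cnj \<circ> g)) holomorphic_on {w \<in> chart_image c. in_chart c (map_option cnj \<circ> g) w \<noteq> None}"
      by (rule holomorphic_transform[of "in_chart c m"])
        (use e in \<open>auto simp: finite_val_def intro!: holomorphic_on_subset[OF hm[OF c]]\<close>)
    show "(recip_val \<circ> in_chart c (map_option cnj \<circ> g)) holomorphic_on {w \<in> chart_image c. in_chart c (map_option cnj \<circ> g) w \<noteq> Some 0}"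
      by (rule holomorphic_transform[of "\<lambda>w. inverse (in_chart c m w)"])
        (use e in \<open>auto simp: recip_val_def intro!: holomorphic_intros holomorphic_on_subset[OF hm[OF c]]\<close>)
  qed
  have gW: "has_wirtinger (chart_val c g) w 0 (cnj (deriv (in_chart c m) w))" if c: "c \<in> A" and w: "w \<in> chart_image c" for c w
    by (rule disc_data.antiholo_g[OF data[OF c] w fg[OF c] fG[OF c]])
  have wo: "without_holomorphic_points A g"
    unfolding without_holomorphic_points_def using dm has_wirtinger_dzbar[OF gW] by simp
  have sG: "smooth_sphere_map M A G"
    unfolding smooth_sphere_map_def
  proof (intro conjI ballI)
    show "continuous_sphere_map M G"
      by (rule continuous_sphere_map_quotient[of _ "\<lambda>p. P p + of_real (l p * disc_S (m p)) * cnj (m p)" "\<lambda>p. 1"])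
        (auto simp: Gm disc_S_def intro!: continuous_intros cm cP cl)
    fix c assume c: "c \<in> A"
    interpret d: disc_data "chart_image c" "in_chart c m" "in_chart c P" "in_chart c l" by (rule data[OF c])
    have s: "smooth_on (chart_image c) (chart_val c G)"
    proof (rule smooth_on_cong[OF d.open_U fG[OF c, symmetric]])
      show "smooth_on (chart_image c) (\<lambda>w. in_chart c P w + of_real (in_chart c l w * disc_S (in_chart c m w)) * cnj (in_chart c m w))"
        by (intro smooth_intros d.open_U d.smooth_P d.smooth_l d.smooth_m)
    qed
    show "smooth_on {w \<in> chart_image c. in_chart c G w \<noteq> None} (chart_val c G)"
      by (rule smooth_on_subset[OF s]) auto
    define k where "k = (chart_val c G)"
    have e: "{w \<in> chart_image c. in_chart c G w \<noteq> Some 0} = {w \<in> chart_image c. k w \<noteq> 0}"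
      using cG[OF c] by (auto simp: k_def finite_val_def)
    have ok: "open {w \<in> chart_image c. k w \<noteq> 0}"
    proof -
      have "{w \<in> chart_image c. k w \<noteq> 0} = chart_image c \<inter> k -` (- {0})" by auto
      then show ?thesis
        using continuous_open_preimage[OF smooth_on_imp_continuous_on[OF s] d.open_U open_Compl[OF closed_singleton]] by (simp add: k_def)
    qed
    show "smooth_on {w \<in> chart_image c. in_chart c G w \<noteq> Some 0} (recip_val \<circ> in_chart c G)"
      unfolding e
    proof (rule smooth_on_cong[OF ok])
      show "smooth_on {w \<in> chart_image c. k w \<noteq> 0} (\<lambda>w. inverse (k w))"
        by (intro smooth_intros ok smooth_on_subset[OF s[folded k_def]]) auto
      show "inverse (k w) = (recip_val \<circ> in_chart c G) w" if "w \<in> {w \<in> chart_image c. k w \<noteq> 0}" for w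
        using cG[OF c, of w] that by (auto simp: recip_val_def finite_val_def k_def)
    qed
  qed
  have lt: "\<exists>a. g p = Some a \<and> cmod a < 1" if "p \<in> M" for p
    using gm[OF that] m1[OF that] by simp
  have ctx: "dzbar (chart_val c G) w = of_real (in_chart c l w) * ((cmod ((chart_val c g) w))\<^sup>2 * dzbar (chart_val c g) w)"
    "in_chart c m w \<noteq> 0 \<Longrightarrow> (cmod ((chart_val c g) w))\<^sup>2 * cmod (dz (chart_val c G) w) / cmod (dzbar (chart_val c G) w) =
      cmod (disc_data.b (in_chart c m) (in_chart c P) (in_chart c l) w) / cmod (disc_data.c (in_chart c m) (in_chart c l) w)"
    "in_chart c m w \<noteq> 0 \<Longrightarrow> antiholo_pde_lhs (chart_val c g) (chart_val c G) w = 0"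
    if c: "c \<in> A" and w: "w \<in> chart_image c" for c w
    by (rule disc_data.antiholo_dzbar_relation[OF data[OF c] w fg[OF c] fG[OF c]]
      disc_data.antiholo_cmod[OF data[OF c] w fg[OF c] fG[OF c]]
      disc_data.antiholo_pde[OF data[OF c] w fg[OF c] fG[OF c]]; assumption)+
  have "antiholo_conditions M A g G"
    unfolding antiholo_conditions_def Let_def
  proof (intro conjI exI[of _ l] ballI impI)
    show "smooth_map A l" unfolding smooth_map_def using disc_data.smooth_l[OF data] by blast
    show "l p > 0" if "p \<in> M" for p by (rule lpos[OF that])
    show "G p \<noteq> None" if "p \<in> M" for p using Gm[OF that] by simp
    fix c w assume c: "c \<in> A" and w: "w \<in> chart_image c"
    {
      assume h: "(chart_val c g) w \<noteq> 0"
      have mw: "in_chart c m w \<noteq> 0" using h fg[OF c w] by auto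
      have "dzbar (chart_val c g) w \<noteq> 0" using wo c w by (simp add: without_holomorphic_points_def)
      then show "dzbar (chart_val c G) w / ((cmod ((chart_val c g) w))\<^sup>2 * dzbar (chart_val c g) w) = complex_of_real (in_chart c l w)"
        unfolding ctx(1)[OF c w] using h by simp
      show "(cmod ((chart_val c g) w))\<^sup>2 * cmod (dz (chart_val c G) w) / cmod (dzbar (chart_val c G) w) < 1"
        unfolding ctx(2)[OF c w mw] using bc[OF c w] c0[OF c w] by (simp add: divide_less_eq)
      show "antiholo_pde_lhs (chart_val c g) (chart_val c G) w = 0"
        by (rule ctx(3)[OF c w mw])
    }
    interpret d: disc_data "chart_image c" "in_chart c m" "in_chart c P" "in_chart c l" by (rule data[OF c])
    have "((\<lambda>q. cmod (d.b q) / cmod (d.c q)) \<longlongrightarrow> cmod (d.b w) / cmod (d.c w)) (at w)"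
      using c0[OF c w] by (intro tendsto_divide smooth_on_chart_lim[OF d.smooth_b d.open_U w] smooth_on_chart_lim[OF d.smooth_c d.open_U w]) simp
    then have "((\<lambda>q. (cmod ((chart_val c g) q))\<^sup>2 * cmod (dz (chart_val c G) q) / cmod (dzbar (chart_val c G) q)) \<longlongrightarrow> cmod (d.b w) / cmod (d.c w)) (at w)"
    proof (rule Lim_transform_eventually)
      show "\<forall>\<^sub>F q in at w. cmod (d.b q) / cmod (d.c q) = (cmod ((chart_val c g) q))\<^sup>2 * cmod (dz (chart_val c G) q) / cmod (dzbar (chart_val c G) q)"
        using eventually_nonzero_if_deriv[OF holomorphic_derivI[OF d.hol d.open_U w] dm[OF c w]] eventually_at_in_open'[OF d.open_U w]
        by eventually_elim (rule ctx(2)[OF c, symmetric])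
    qed
    moreover have "cmod (d.b w) / cmod (d.c w) < 1" using bc[OF c w] c0[OF c w] by (simp add: divide_less_eq)
    ultimately show "\<exists>a. ((\<lambda>q. (cmod ((chart_val c g) q))\<^sup>2 * cmod (dz (chart_val c G) q) / cmod (dzbar (chart_val c G) q)) \<longlongrightarrow> a) (at w) \<and> a < 1"
      by blast
  qed
  moreover have "antiholo_representation A g G x"
  proof (rule antiholo_representationI)
    fix c w assume c: "c \<in> A" and w: "w \<in> chart_image c" and h: "chart_val c g w \<noteq> 0"
    have "in_chart c x w = hs_vec (chart_val c G w - of_real (in_chart c l w * disc_S (in_chart c m w)) * cnj (in_chart c m w))
        (in_chart c l w * disc_S (in_chart c m w))"
      unfolding fG[OF c w] by (simp add: in_chart_def x)
    moreover have "dzbar (chart_val c g) w \<noteq> 0" using wo c w by (simp add: without_holomorphic_points_def)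
    moreover have "in_chart c m w \<noteq> 0" using h fg[OF c w] by auto
    ultimately show "\<exists>m l. m \<noteq> 0 \<and> chart_val c g w = cnj m \<and> dzbar (chart_val c g) w \<noteq> 0 \<and>
      dzbar (chart_val c G) w = of_real l * ((cmod (chart_val c g w))\<^sup>2 * dzbar (chart_val c g) w) \<and>
      in_chart c x w = hs_vec (chart_val c G w - of_real (l * disc_S m) * cnj m) (l * disc_S m)"
      using fg[OF c w] ctx(1)[OF c w] by blast
  qed
  ultimately show ?thesis using hg wo sG lt by blast
qed

end

theorem theorem5p1:
  fixes M :: "'a::t2_space set" and A :: "'a chart set"
  assumes "riemann_surface M A" and "simply_connected M"
  shows
    "(\<forall>g G. holomorphic_sphere_map M A g \<and> \<not> g constant_on M \<and> smooth_sphere_map M A G \<and>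
        (\<forall>p\<in>M. \<forall>a. g p = Some a \<longrightarrow> cmod a > 1) \<and> holo_conditions M A g G \<longrightarrow>
        (\<exists>x \<eta>. holo_representation A g G x \<and>
           spacelike_surface M A x \<and> timelike_unit_normal M A x \<eta> \<and>
           (\<forall>p\<in>M. normal_gauss_map \<eta> p = g p) \<and> (\<forall>p\<in>M. dS_gauss_map x \<eta> p = G p) \<and>
           sqrt_one_minus_curvature A x (\<lambda>p. stereographic_height (g p)) \<and>
           structure_induced_by_neg_II A x \<eta>)) \<and>
     (\<forall>x \<eta> g G. spacelike_surface M A x \<and> timelike_unit_normal M A x \<eta> \<and>
        structure_induced_by_neg_II A x \<eta> \<and>
        g = normal_gauss_map \<eta> \<and> G = dS_gauss_map x \<eta> \<and> \<not> g constant_on M \<and>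
        sqrt_one_minus_curvature A x (\<lambda>p. stereographic_height (g p)) \<longrightarrow>
          holomorphic_sphere_map M A g \<and> smooth_sphere_map M A G \<and>
          (\<forall>p\<in>M. \<forall>a. g p = Some a \<longrightarrow> cmod a > 1) \<and> holo_conditions M A g G \<and>
          holo_representation A g G x) \<and>
     (\<forall>g G. antiholomorphic_sphere_map M A g \<and> \<not> g constant_on M \<and>
        without_holomorphic_points A g \<and> smooth_sphere_map M A G \<and>
        (\<forall>p\<in>M. \<exists>a. g p = Some a \<and> cmod a < 1) \<and> antiholo_conditions M A g G \<longrightarrow>
        (\<exists>x \<eta>. antiholo_representation A g G x \<and>
           spacelike_surface M A x \<and> timelike_unit_normal M A x \<eta> \<and>
           (\<forall>p\<in>M. normal_gauss_map \<eta> p = g p) \<and> (\<forall>p\<in>M. dS_gauss_map x \<eta> p = G p) \<and>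
           sqrt_one_minus_curvature A x (\<lambda>p. - stereographic_height (g p)) \<and>
           structure_induced_by_neg_II A x \<eta>)) \<and>
     (\<forall>x \<eta> g G. spacelike_surface M A x \<and> timelike_unit_normal M A x \<eta> \<and>
        structure_induced_by_neg_II A x \<eta> \<and>
        g = normal_gauss_map \<eta> \<and> G = dS_gauss_map x \<eta> \<and>
        sqrt_one_minus_curvature A x (\<lambda>p. - stereographic_height (g p)) \<longrightarrow>
          antiholomorphic_sphere_map M A g \<and> without_holomorphic_points A g \<and>
          smooth_sphere_map M A G \<and>
          (\<forall>p\<in>M. \<exists>a. g p = Some a \<and> cmod a < 1) \<and> antiholo_conditions M A g G \<and>
          antiholo_representation A g G x)"
proof -
  interpret surface_atlas M A by unfold_locales (rule assms(1))
  show ?thesis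
  proof (rule conjI[OF _ conjI[OF _ conjI]]; intro allI impI, elim conjE)
  qed (rule holo_forward holo_converse antiholo_forward antiholo_converse; blast)+
qed

end
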